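(* There exist absolute constants $\alpha>0$ and $\beta>0$ such that the following holds. Let $G$ be a 4-connected planar triangulation with $n\ge 2$ vertices that has at most $\alpha\, n/\log_2 n$ separating 4-cycles. Then $G$ has at least $\beta n^2$ Hamiltonian cycles.
   Context: A planar triangulation is a plane graph in which every face (including the infinite face) is bounded by a 3-cycle. A $k$-cycle is a cycle of length $k$. A cycle $C$ in a connected graph $G$ is separating if $G-V(C)$ is disconnected. *)

theory Defs
  imports "HOL-Analysis.Analysis" "Graph_Theory.Graph_Theory"
begin

section \<open>Plane graphs\<close>

text \<open>
  A plane graph is given by a finite set \<open>V\<close> of points of the plane and a finite set \<open>E\<close> of
  edges, each edge being the point set of an arc.  Loops are impossible, since an arc has two
  distinct end points; the last clause of \<open>plane_graph\<close> excludes parallel edges.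
\<close>

definition joins :: "complex set \<Rightarrow> complex \<Rightarrow> complex \<Rightarrow> bool" where
  "joins e u v \<longleftrightarrow> (\<exists>g. arc g \<and> path_image g = e \<and> pathstart g = u \<and> pathfinish g = v)"

definition plane_graph :: "complex set \<Rightarrow> complex set set \<Rightarrow> bool" where
  "plane_graph V E \<longleftrightarrow>
     finite V \<and> finite E \<and>
     (\<forall>e\<in>E. \<exists>u\<in>V. \<exists>v\<in>V. joins e u v \<and> e \<inter> V = {u, v}) \<and>
     (\<forall>e\<in>E. \<forall>e'\<in>E. e \<noteq> e' \<longrightarrow> e \<inter> e' \<subseteq> V) \<and>
     (\<forall>e\<in>E. \<forall>e'\<in>E. \<forall>u v. joins e u v \<and> joins e' u v \<longrightarrow> e = e')"

definition faces :: "complex set \<Rightarrow> complex set set \<Rightarrow> complex set set" where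
  "faces V E = components (- (V \<union> \<Union>E))"

text \<open>
  The abstract graph of a plane graph.  Undirected graphs are symmetric digraphs, as in
  \<^theory>\<open>Graph_Theory.Digraph\<close>.
\<close>

definition underlying_graph :: "complex set \<Rightarrow> complex set set \<Rightarrow> complex pair_pre_digraph" where
  "underlying_graph V E =
     \<lparr> pverts = V, parcs = {(u, v). u \<in> V \<and> v \<in> V \<and> (\<exists>e\<in>E. joins e u v)} \<rparr>"

lemma joins_commute: "joins e u v \<longleftrightarrow> joins e v u"
proof -
  have "joins e b a" if "joins e a b" for a b
    using that unfolding joins_def
    by (metis arc_reversepath path_image_reversepath pathfinish_reversepath pathstart_reversepath)
  then show ?thesis by blast
qed

lemma joins_neq: "joins e u v \<Longrightarrow> u \<noteq> v"
  using arc_distinct_ends by (metis joins_def)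

lemma pair_graph_underlying_graph:
  assumes "plane_graph V E"
  shows "pair_graph (underlying_graph V E)"
proof
  show "finite (parcs (underlying_graph V E))"
    by (rule finite_subset[of _ "V \<times> V"])
       (use assms in \<open>auto simp: underlying_graph_def plane_graph_def\<close>)
qed (use assms joins_commute joins_neq in
      \<open>auto simp: underlying_graph_def plane_graph_def symmetric_def sym_def\<close>)


section \<open>Cycles and connectivity\<close>

text \<open>
  A cycle, as a subgraph of an undirected graph \<open>G\<close>, is represented by its set \<open>C\<close> of undirected
  edges, so that the different starting points and orientations of a closed walk are identified.
  Its vertex set is \<open>\<Union>C\<close> and its length is \<open>card C\<close>.  The bound on the length of \<open>p\<close> excludes
  walks going back and forth along a single edge.
\<close>

definition cycles :: "'a pair_pre_digraph \<Rightarrow> 'a set set set" where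
  "cycles G = {(\<lambda>(u, v). {u, v}) ` set p | p. pre_digraph.cycle (with_proj G) p \<and> 3 \<le> length p}"

definition k_cycles :: "nat \<Rightarrow> 'a pair_pre_digraph \<Rightarrow> 'a set set set" where
  "k_cycles k G = {C \<in> cycles G. card C = k}"

definition hamiltonian_cycles :: "'a pair_pre_digraph \<Rightarrow> 'a set set set" where
  "hamiltonian_cycles G = {C \<in> cycles G. \<Union>C = pverts G}"

definition delete_vertices :: "'a pair_pre_digraph \<Rightarrow> 'a set \<Rightarrow> ('a, 'a \<times> 'a) pre_digraph" where
  "delete_vertices G S = with_proj G \<restriction> (pverts G - S)"

text \<open>
  The predicate \<open>Digraph_Component.connected\<close> is false for the graph without vertices, which is not
  regarded as disconnected here.
\<close>

definition separating :: "'a pair_pre_digraph \<Rightarrow> 'a set set \<Rightarrow> bool" where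
  "separating G C \<longleftrightarrow>
     pverts G - \<Union>C \<noteq> {} \<and> \<not> Digraph_Component.connected (delete_vertices G (\<Union>C))"

definition k_connected :: "nat \<Rightarrow> 'a pair_pre_digraph \<Rightarrow> bool" where
  "k_connected k G \<longleftrightarrow> k < card (pverts G) \<and>
     (\<forall>S \<subseteq> pverts G. card S < k \<longrightarrow> Digraph_Component.connected (delete_vertices G S))"


section \<open>Planar triangulations\<close>

text \<open>The point set of a cycle \<open>C\<close> of the underlying graph in the drawing.\<close>

definition drawn :: "complex set set \<Rightarrow> complex set set \<Rightarrow> complex set" where
  "drawn E C = \<Union>{e \<in> E. \<exists>u v. {u, v} \<in> C \<and> joins e u v}"

definition planar_triangulation :: "complex set \<Rightarrow> complex set set \<Rightarrow> bool" where
  "planar_triangulation V E \<longleftrightarrow> plane_graph V E \<and>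
     (\<forall>F \<in> faces V E. \<exists>C \<in> k_cycles 3 (underlying_graph V E). frontier F = drawn E C)"

end

theory Submission
  imports Defs
begin

text \<open>
  Choose a set \<open>S\<close> of order \<open>sqrt n\<close> of vertices of degree between 5 and 12 that lie on no separating 4-cycle and are
  pairwise not in conflict, and at each \<open>s\<close> in \<open>S\<close> an edge. Flipping any of the chosen edges yields a triangulation without
  separating triangles. For a family of such triangulations that is closed under flips, Whitney's argument gives a
  Hamiltonian cycle without flippable edges, that is, one of the original triangulation that avoids all chosen edges. A fixed
  Hamiltonian cycle uses two edges at each \<open>s\<close> and therefore avoids at most a fraction \<open>(5/6) ^ card S\<close> of all choices, so there
  are at least \<open>(6/5) ^ card S\<close> Hamiltonian cycles. To find \<open>S\<close>,
  call a degree above \<open>40 * sqrt n\<close> high: at least half of all vertices are candidates, with at most one neighbour of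
  high degree, and each conflicts with only \<open>O(sqrt n)\<close> others.

  A plane triangulation enters only through its set of facial vertex triples: every edge lies in two faces, every even
  set of edges is the boundary of a set of faces, and only the empty set and the set of all faces have empty boundary.
\<close>

section \<open>Edges of paths and cycles\<close>

text \<open>The obstacle is that a triangulation without its chosen edges is no longer triangulated:
  every missing edge leaves a quadrilateral, whereas Whitney's induction, which strips off the fan
  of faces at a boundary vertex, needs triangles. A triangulation is therefore kept together with a
  set of optional diagonals, and before a fan is removed, flips turn the diagonals so that the new
  boundary consists of edges that really exist. The hypotheses of such an induction must not depend
  on the current position of the diagonals, so chords give way to a flip-invariant relation.
  Topology enters only modulo 2: a disc is any set of faces whose boundary is a cycle. The threshold
  near sqrt n balances two effects. Below it, a vertex causes O(sqrt n) conflicts; above it, there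
  are only O(sqrt n) vertices, so the common neighbours of pairs of them make up a small fraction of
  all vertices. Freedom from conflict keeps every flipped triangulation free of separating
  triangles. A set of order sqrt n suffices because exponential growth in its size dominates every
  power of n.\<close>

fun path_edges :: "'v list \<Rightarrow> 'v set set" where
  "path_edges (x # y # r) = insert {x, y} (path_edges (y # r))"
| "path_edges _ = {}"

definition cycle_edges :: "'v list \<Rightarrow> 'v set set" where
  "cycle_edges c = path_edges (c @ [hd c])"

lemma path_edges_Cons: "p \<noteq> [] \<Longrightarrow> path_edges (x # p) = insert {x, hd p} (path_edges p)"
  by (cases p) auto

lemma path_edges_append:
  "p \<noteq> [] \<Longrightarrow> q \<noteq> [] \<Longrightarrow> path_edges (p @ q) = path_edges p \<union> path_edges q \<union> {{last p, hd q}}"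
  by (induction p rule: path_edges.induct) (auto simp: path_edges_Cons)

lemma path_edges_glue: "path_edges (p @ x # q) = path_edges (p @ [x]) \<union> path_edges (x # q)"
  by (induction p rule: path_edges.induct) (auto simp: path_edges_Cons)

lemma path_edges_rev [simp]: "path_edges (rev p) = path_edges p"
proof (induction p rule: path_edges.induct)
  case (1 x y r)
  then show ?case using path_edges_glue[of "rev r" y "[x]"] by (auto simp: insert_commute)
qed auto

lemma path_edges_subset: "e \<in> path_edges p \<Longrightarrow> e \<subseteq> set p"
  by (induction p rule: path_edges.induct) auto

lemma finite_path_edges [simp, intro]: "finite (path_edges p)"
  by (induction p rule: path_edges.induct) auto

lemma card_path_edges: "distinct p \<Longrightarrow> e \<in> path_edges p \<Longrightarrow> card e = 2"
  by (induction p rule: path_edges.induct) auto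

lemma path_edges_nth: "path_edges p = {{p ! i, p ! Suc i} | i. Suc i < length p}"
proof (induction p rule: path_edges.induct)
  case (1 x y r)
  have "{{(x#y#r) ! i, (x#y#r) ! Suc i} | i. Suc i < length (x#y#r)} =
     insert {x, y} {{(y#r) ! i, (y#r) ! Suc i} | i. Suc i < length (y#r)}"
    (is "?L = ?R")
  proof
    show "?L \<subseteq> ?R"
    proof
      fix e assume "e \<in> ?L"
      then obtain i where i: "e = {(x#y#r) ! i, (x#y#r) ! Suc i}" "Suc i < length (x#y#r)" by blast
      show "e \<in> ?R" using i by (cases i) auto
    qed
    show "?R \<subseteq> ?L" by (force intro: exI[of _ "Suc _"])
  qed
  then show ?case using 1 by simp
qed auto

lemma path_edges_split: "{x, y} \<in> path_edges p \<Longrightarrow>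
   (\<exists>a b. p = a @ x # y # b) \<or> (\<exists>a b. p = a @ y # x # b)"
proof (induction p rule: path_edges.induct)
  case (1 u v r)
  show ?case
  proof (cases "{x, y} = {u, v}")
    case True
    then have "x = u \<and> y = v \<or> x = v \<and> y = u" by (auto simp: doubleton_eq_iff)
    then show ?thesis by (metis append_Nil)
  next
    case False
    then have "{x, y} \<in> path_edges (v # r)" using 1(2) by auto
    from 1(1)[OF this] show ?thesis by (metis append_Cons)
  qed
qed auto

lemma path_edges_mem: "{x, y} \<in> path_edges (a @ x # y # b)"
  by (simp add: path_edges_glue[of a x "y # b"])

lemma path_edges_infix: "path_edges q \<subseteq> path_edges (a @ q @ b)"
proof (cases "q = []")
  case False
  show ?thesis
  proof (cases "a = []")
    case True
    show ?thesis using False by (cases "b = []") (auto simp: True path_edges_append)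
  next
    case False': False
    then show ?thesis using False by (cases "b = []") (auto simp: path_edges_append)
  qed
qed auto

lemma cycle_edges_Cons: "cycle_edges (x # p) = path_edges (x # p @ [x])"
  by (simp add: cycle_edges_def)

lemma cycle_edges_eq: "c \<noteq> [] \<Longrightarrow> cycle_edges c = path_edges c \<union> {{last c, hd c}}"
  by (simp add: cycle_edges_def path_edges_append)

lemma cycle_edges_commute: "cycle_edges (p @ q) = cycle_edges (q @ p)"
proof (cases "p = [] \<or> q = []")
  case False
  then show ?thesis by (auto simp: cycle_edges_eq path_edges_append)
qed auto

lemma cycle_edges_rev [simp]: "cycle_edges (rev c) = cycle_edges c"
proof (cases "c = []")
  case False
  then show ?thesis by (simp add: cycle_edges_eq hd_rev last_rev insert_commute)
qed auto

lemma cycle_edges_append: "p \<noteq> [] \<Longrightarrow> q \<noteq> [] \<Longrightarrow>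
   cycle_edges (p @ q) = path_edges p \<union> path_edges q \<union> {{last p, hd q}, {last q, hd p}}"
  by (auto simp: cycle_edges_eq path_edges_append)

text \<open>Both arcs are written from \<open>x\<close> to \<open>y\<close>, hence the reversal of
  \<open>b\<close>; discs are later cut along a third path of this kind.\<close>

lemma cycle_edges_theta: "cycle_edges (x # a @ y # b) = path_edges (x # a @ [y]) \<union> path_edges (x # rev b @ [y])"
proof -
  have "cycle_edges (x # a @ y # b) = path_edges ((x # a) @ y # (b @ [x]))"
    by (simp add: cycle_edges_def)
  also have "\<dots> = path_edges (x # a @ [y]) \<union> path_edges (y # b @ [x])"
    by (subst path_edges_glue) simp
  also have "path_edges (y # b @ [x]) = path_edges (rev (y # b @ [x]))" by (rule path_edges_rev[symmetric])
  finally show ?thesis by simp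
qed

lemma cycle_edges_subset: "e \<in> cycle_edges c \<Longrightarrow> e \<subseteq> set c"
  using path_edges_subset[of e "c @ [hd c]"] by (cases c) (auto simp: cycle_edges_def)

lemma finite_cycle_edges [simp, intro]: "finite (cycle_edges c)"
  by (simp add: cycle_edges_def)

lemma card_cycle_edge:
  assumes "distinct c" "2 \<le> length c" "e \<in> cycle_edges c"
  shows "card e = 2"
proof -
  have ne: "c \<noteq> []" using assms by auto
  have "last c \<noteq> hd c" using assms by (cases c) (auto split: if_splits)
  then show ?thesis using assms ne by (auto simp: cycle_edges_eq card_path_edges)
qed

lemma cycle_vertex_edge: "v \<in> set c \<Longrightarrow> \<exists>e\<in>cycle_edges c. v \<in> e"
proof -
  assume "v \<in> set c"
  then obtain a b where "c = a @ v # b" by (meson split_list)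
  then have "cycle_edges c = cycle_edges (v # b @ a)" by (simp add: cycle_edges_commute[of a "v # b"])
  then show ?thesis by (cases "b @ a") (auto simp: cycle_edges_def)
qed

lemma Union_cycle_edges: "\<Union>(cycle_edges c) = set c"
  using cycle_edges_subset cycle_vertex_edge by fastforce

text \<open>With only two vertices the closing edge would repeat the path edge, and parity of
  degrees would fail; this is where the length bound enters.\<close>

lemma closing_edge_notin:
  assumes "distinct c" "3 \<le> length c"
  shows "{last c, hd c} \<notin> path_edges c"
proof
  assume e: "{last c, hd c} \<in> path_edges c"
  obtain x y r where c: "c = x # y # r" "r \<noteq> []" using assms
    by (cases c rule: path_edges.cases) force+
  have "{last r, x} \<in> insert {x, y} (path_edges (y # r))" using e c by simp
  moreover have "{last r, x} \<noteq> {x, y}" using assms c by (auto simp: doubleton_eq_iff)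
  ultimately have "x \<in> set (y # r)" using path_edges_subset[of "{last r, x}" "y # r"] by auto
  then show False using assms c by simp
qed

section \<open>Even edge sets\<close>

definition degree_in :: "'v set set \<Rightarrow> 'v \<Rightarrow> nat" where
  "degree_in Z v = card {e \<in> Z. v \<in> e}"

text \<open>The elements of the cycle space over the two-element field, with \<open>sym_diff\<close>
  as addition.\<close>

definition even_set :: "'v set set \<Rightarrow> bool" where
  "even_set Z \<longleftrightarrow> (\<forall>v. even (degree_in Z v))"

lemma even_card_sym_diff:
  assumes "finite A" "finite B"
  shows "even (card (sym_diff A B)) \<longleftrightarrow> (even (card A) \<longleftrightarrow> even (card B))"
proof -
  have 1: "card A = card (A - B) + card (A \<inter> B)"
    by (metis assms(1) card_Diff_subset_Int card_mono finite_Int inf_le1 le_add_diff_inverse2)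
  have 2: "card B = card (B - A) + card (A \<inter> B)"
    by (metis assms(2) card_Diff_subset_Int card_mono finite_Int inf_le1 inf_commute le_add_diff_inverse2)
  have 3: "card (sym_diff A B) = card (A - B) + card (B - A)"
    by (rule card_Un_disjoint) (use assms in auto)
  show ?thesis unfolding 1 2 3 by auto
qed

lemma even_degree_sym_diff:
  assumes "finite A" "finite B"
  shows "even (degree_in (sym_diff A B) v) \<longleftrightarrow> (even (degree_in A v) \<longleftrightarrow> even (degree_in B v))"
proof -
  have "{e \<in> sym_diff A B. v \<in> e} = sym_diff {e \<in> A. v \<in> e} {e \<in> B. v \<in> e}" by auto
  then show ?thesis unfolding degree_in_def using even_card_sym_diff[of "{e \<in> A. v \<in> e}" "{e \<in> B. v \<in> e}"] assms by simp
qed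

lemma even_set_sym_diff: "finite A \<Longrightarrow> finite B \<Longrightarrow> even_set A \<Longrightarrow> even_set B \<Longrightarrow> even_set (sym_diff A B)"
  unfolding even_set_def by (simp add: even_degree_sym_diff)

lemma degree_in_empty [simp]: "degree_in {} v = 0"
  by (simp add: degree_in_def)

lemma even_set_empty [simp]: "even_set {}"
  by (simp add: even_set_def)

lemma degree_in_insert: "finite Z \<Longrightarrow> e \<notin> Z \<Longrightarrow> degree_in (insert e Z) v = degree_in Z v + (if v \<in> e then 1 else 0)"
proof -
  assume "finite Z" "e \<notin> Z"
  moreover have "{d \<in> insert e Z. v \<in> d} = (if v \<in> e then insert e {d \<in> Z. v \<in> d} else {d \<in> Z. v \<in> d})" by auto
  ultimately show ?thesis by (simp add: degree_in_def)
qed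

text \<open>The exclusive or also covers a path with one vertex, whose ends coincide and whose edge
  set is empty.\<close>

lemma odd_degree_path:
  "distinct p \<Longrightarrow> p \<noteq> [] \<Longrightarrow> odd (degree_in (path_edges p) v) \<longleftrightarrow> (v = hd p) \<noteq> (v = last p)"
proof (induction p rule: path_edges.induct)
  case (1 x y r)
  have "{x, y} \<notin> path_edges (y # r)" using 1(2) by (auto dest: path_edges_subset)
  then show ?case using 1 by (auto simp: degree_in_insert split: if_splits)
qed auto

lemma even_set_cycle:
  assumes "distinct c" "3 \<le> length c"
  shows "even_set (cycle_edges c)"
proof -
  have ne: "c \<noteq> []" using assms by auto
  have lh: "last c \<noteq> hd c" using assms by (cases c) (auto split: if_splits)
  show ?thesis unfolding even_set_def
  proof
    fix v
    have "cycle_edges c = insert {last c, hd c} (path_edges c)" using ne by (simp add: cycle_edges_eq)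
    then show "even (degree_in (cycle_edges c) v)"
      using odd_degree_path[OF assms(1) ne, of v] closing_edge_notin[OF assms] lh
      by (auto simp: degree_in_insert)
  qed
qed

section \<open>Triangulated spheres\<close>

definition edges_of :: "'v set set \<Rightarrow> 'v set set" where
  "edges_of T = {e. card e = 2 \<and> (\<exists>f\<in>T. e \<subseteq> f)}"

text \<open>The boundary map modulo 2: in a \<open>surface\<close> an edge lies in exactly two
  faces, so lying in one face of \<open>X\<close> means lying in an odd number of them.\<close>

definition bd :: "'v set set \<Rightarrow> 'v set set" where
  "bd X = {e. card e = 2 \<and> (\<exists>!f. f \<in> X \<and> e \<subseteq> f)}"

lemma bd_subset_edges: "bd X \<subseteq> edges_of X"
  by (auto simp: bd_def edges_of_def)

lemma edges_of_mono: "X \<subseteq> Y \<Longrightarrow> edges_of X \<subseteq> edges_of Y"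
  by (auto simp: edges_of_def)

lemma bd_empty [simp]: "bd {} = {}"
  by (auto simp: bd_def)

lemma edges_ofI: "f \<in> X \<Longrightarrow> {u, v} \<subseteq> f \<Longrightarrow> u \<noteq> v \<Longrightarrow> {u, v} \<in> edges_of X"
  by (auto simp: edges_of_def)

lemma edge_doubleton: "e \<in> edges_of X \<Longrightarrow> \<exists>u v. e = {u, v} \<and> u \<noteq> v"
  by (auto simp: edges_of_def card_2_iff)

lemma edge_subset_Union: "e \<in> edges_of X \<Longrightarrow> e \<subseteq> \<Union>X"
  by (auto simp: edges_of_def)

lemma doubletons_in_triple:
  assumes "card e = 2" "e \<subseteq> {a, b, c}" shows "e = {a, b} \<or> e = {a, c} \<or> e = {b, c}"
proof -
  obtain x y where "e = {x, y}" "x \<noteq> y" using assms by (auto simp: card_2_iff)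
  then show ?thesis using assms by auto
qed

text \<open>A closed surface up to pinch points: several fans of faces may still meet in one vertex.
  The axioms of \<open>tri_sphere\<close> exclude this, see \<open>link_connected\<close>.\<close>

locale surface =
  fixes T :: "'v set set"
  assumes finite_T [simp, intro]: "finite T"
    and card_face: "f \<in> T \<Longrightarrow> card f = 3"
    and two_faces: "f \<in> T \<Longrightarrow> e \<subseteq> f \<Longrightarrow> card e = 2 \<Longrightarrow> \<exists>g. g \<noteq> f \<and> {h \<in> T. e \<subseteq> h} = {f, g}"
begin

lemma finite_face: "f \<in> T \<Longrightarrow> finite f"
  using card_face by (metis card.infinite zero_neq_numeral)

lemma finite_sub [intro]: "X \<subseteq> T \<Longrightarrow> finite X"
  using finite_subset by blast

lemma finite_Union [intro]: "X \<subseteq> T \<Longrightarrow> finite (\<Union>X)"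
  using finite_face finite_sub by blast

lemma finite_edges [simp, intro]: "finite (edges_of T)"
  by (rule finite_subset[of _ "Pow (\<Union>T)"]) (auto simp: edges_of_def)

lemma edge_faces:
  assumes "e \<in> edges_of T"
  obtains f g where "f \<in> T" "g \<in> T" "f \<noteq> g" "{h \<in> T. e \<subseteq> h} = {f, g}"
proof -
  obtain f where f: "f \<in> T" "e \<subseteq> f" "card e = 2" using assms by (auto simp: edges_of_def)
  obtain g where g: "g \<noteq> f" "{h \<in> T. e \<subseteq> h} = {f, g}" using two_faces[OF f] by blast
  have "g \<in> T" using g by blast
  then show thesis using that[of f g] f g by simp
qed

lemma third_face_eq:
  assumes "e \<in> edges_of T" "f \<in> T" "g \<in> T" "h \<in> T" "e \<subseteq> f" "e \<subseteq> g" "e \<subseteq> h" "f \<noteq> g" "g \<noteq> h"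
  shows "h = f"
proof -
  obtain a b where "{h \<in> T. e \<subseteq> h} = {a, b}" using edge_faces[OF assms(1)] by metis
  then have "f \<in> {a, b}" "g \<in> {a, b}" "h \<in> {a, b}" using assms by blast+
  then show ?thesis using assms by auto
qed

lemma faces_of_edge: "e \<in> edges_of T \<Longrightarrow> f \<in> T \<Longrightarrow> g \<in> T \<Longrightarrow> e \<subseteq> f \<Longrightarrow> e \<subseteq> g \<Longrightarrow> f \<noteq> g \<Longrightarrow>
    {h \<in> T. e \<subseteq> h} = {f, g}"
  using third_face_eq by blast

lemma other_face:
  assumes "f \<in> T" "e \<subseteq> f" "card e = 2"
  obtains g where "g \<in> T" "e \<subseteq> g" "g \<noteq> f" "{h \<in> T. e \<subseteq> h} = {f, g}"
proof -
  obtain g where g: "g \<noteq> f" "{h \<in> T. e \<subseteq> h} = {f, g}" using two_faces[OF assms] by blast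
  then have "g \<in> {h \<in> T. e \<subseteq> h}" by simp
  then have "g \<in> T" "e \<subseteq> g" by blast+
  then show thesis using that[of g] g by metis
qed

lemma in_bd_iff:
  assumes "e \<in> edges_of T" "{h \<in> T. e \<subseteq> h} = {f, g}" "f \<noteq> g" "X \<subseteq> T"
  shows "e \<in> bd X \<longleftrightarrow> (f \<in> X) \<noteq> (g \<in> X)"
proof -
  have 1: "h \<in> X \<and> e \<subseteq> h \<longleftrightarrow> h \<in> X \<and> (h = f \<or> h = g)" for h using assms(2,4) by blast
  have 2: "card e = 2" using assms by (simp add: edges_of_def)
  show ?thesis unfolding bd_def mem_Collect_eq 1
    by (cases "f \<in> X"; cases "g \<in> X") (use 2 assms(3) in auto)
qed

lemma bd_sub_edges: "X \<subseteq> T \<Longrightarrow> bd X \<subseteq> edges_of T"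
  using bd_subset_edges edges_of_mono by blast

lemma bd_sym_diff:
  assumes "X \<subseteq> T" "Y \<subseteq> T"
  shows "bd (sym_diff X Y) = sym_diff (bd X) (bd Y)"
proof (rule set_eqI)
  fix e
  show "e \<in> bd (sym_diff X Y) \<longleftrightarrow> e \<in> sym_diff (bd X) (bd Y)"
  proof (cases "e \<in> edges_of T")
    case True
    then obtain f g where fg: "{h \<in> T. e \<subseteq> h} = {f, g}" "f \<noteq> g" by (metis edge_faces)
    have "sym_diff X Y \<subseteq> T" using assms by blast
    then show ?thesis using in_bd_iff[OF True fg] assms by auto
  next
    case False
    have "sym_diff X Y \<subseteq> T" using assms by blast
    then show ?thesis using False bd_sub_edges assms by blast
  qed
qed

lemma bd_Diff:
  assumes "X \<subseteq> Y" "Y \<subseteq> T"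
  shows "bd (Y - X) = sym_diff (bd Y) (bd X)"
proof -
  have "Y - X = sym_diff Y X" using assms by blast
  then show ?thesis using bd_sym_diff[of Y X] assms by auto
qed

lemma bd_disjoint_Un:
  assumes "X \<subseteq> T" "Y \<subseteq> T" "X \<inter> Y = {}"
  shows "bd (X \<union> Y) = sym_diff (bd X) (bd Y)"
proof -
  have "X \<union> Y = sym_diff X Y" using assms by blast
  then show ?thesis using bd_sym_diff[of X Y] assms by auto
qed

lemma bd_T [simp]: "bd T = {}"
proof -
  have "e \<notin> bd T" for e
  proof
    assume a: "e \<in> bd T"
    then have e: "e \<in> edges_of T" using bd_subset_edges by blast
    then obtain f g where fg: "{h \<in> T. e \<subseteq> h} = {f, g}" "f \<noteq> g" "f \<in> T" "g \<in> T" by (metis edge_faces)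
    show False using in_bd_iff[OF e fg(1,2)] a fg by auto
  qed
  then show ?thesis by blast
qed

lemma bd_compl: "X \<subseteq> T \<Longrightarrow> bd (T - X) = bd X"
  by (subst bd_Diff) auto

lemma face_sets:
  assumes "f \<in> T"
  obtains a b c where "f = {a, b, c}" "a \<noteq> b" "a \<noteq> c" "b \<noteq> c"
  using card_face[OF assms] by (auto simp: card_3_iff)

lemma face_third:
  assumes "f \<in> T" "{a, b} \<subseteq> f" "a \<noteq> b"
  obtains c where "f = {a, b, c}" "c \<noteq> a" "c \<noteq> b"
proof -
  obtain x y z where "f = {x, y, z}" "x \<noteq> y" "x \<noteq> z" "y \<noteq> z" using face_sets[OF assms(1)] by metis
  then consider "f = {a, b, x}" "x \<noteq> a" "x \<noteq> b" | "f = {a, b, y}" "y \<noteq> a" "y \<noteq> b" | "f = {a, b, z}" "z \<noteq> a" "z \<noteq> b"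
    using assms by auto
  then show thesis using that by cases
qed

lemma face_distinct: "{a, b, c} \<in> T \<Longrightarrow> a \<noteq> b \<and> a \<noteq> c \<and> b \<noteq> c"
  using card_face[of "{a, b, c}"] by (auto simp: card_insert_if split: if_splits)

lemma edges_face: "{a, b, c} \<in> T \<Longrightarrow> {a, b} \<in> edges_of T \<and> {a, c} \<in> edges_of T \<and> {b, c} \<in> edges_of T"
  using face_distinct by (auto intro!: edges_ofI)

lemma bd_face:
  assumes "{a, b, c} \<in> T"
  shows "bd {{a, b, c}} = {{a, b}, {a, c}, {b, c}}"
proof -
  have d: "a \<noteq> b" "a \<noteq> c" "b \<noteq> c" using face_distinct[OF assms] by auto
  show ?thesis
  proof
    show "bd {{a, b, c}} \<subseteq> {{a, b}, {a, c}, {b, c}}"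
    proof
      fix e assume "e \<in> bd {{a, b, c}}"
      then have "card e = 2" "e \<subseteq> {a, b, c}" by (auto simp: bd_def)
      then show "e \<in> {{a, b}, {a, c}, {b, c}}" using doubletons_in_triple[of e a b c] by simp
    qed
    show "{{a, b}, {a, c}, {b, c}} \<subseteq> bd {{a, b, c}}"
      using d unfolding bd_def by auto
  qed
qed

lemma bd_two_faces:
  assumes "{a, b, u} \<in> T" "{a, b, v} \<in> T" "u \<noteq> v"
  shows "bd {{a, b, u}, {a, b, v}} = {{a, u}, {b, u}, {a, v}, {b, v}}"
proof -
  note d = face_distinct[OF assms(1)] face_distinct[OF assms(2)]
  have "{{a, b, u}, {a, b, v}} = {{a, b, u}} \<union> {{a, b, v}}" by auto
  moreover have "{{a, b, u}} \<inter> {{a, b, v}} = {}" using d assms(3) by auto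
  ultimately have "bd {{a, b, u}, {a, b, v}} = sym_diff (bd {{a, b, u}}) (bd {{a, b, v}})"
    using bd_disjoint_Un[of "{{a, b, u}}" "{{a, b, v}}"] assms by auto
  also have "\<dots> = sym_diff {{a, b}, {a, u}, {b, u}} {{a, b}, {a, v}, {b, v}}"
    using bd_face[OF assms(1)] bd_face[OF assms(2)] by simp
  finally show ?thesis using d assms(3) by (auto simp: doubleton_eq_iff)
qed

lemma finite_bd [simp]: "X \<subseteq> T \<Longrightarrow> finite (bd X)"
  using bd_sub_edges finite_edges finite_subset by metis

lemma even_set_bd: 
  assumes "X \<subseteq> T" shows "even_set (bd X)"
proof -
  have "finite X" using assms by blast
  then show ?thesis using assms
  proof (induction X rule: finite_induct)
    case (insert f X)
    obtain a b c where f: "f = {a, b, c}" "a \<noteq> b" "a \<noteq> c" "b \<noteq> c" using face_sets[of f] insert by auto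
    have "cycle_edges [a, b, c] = {{a, b}, {a, c}, {b, c}}" by (auto simp: cycle_edges_def insert_commute)
    then have bf: "bd {f} = cycle_edges [a, b, c]" using bd_face[of a b c] f insert by auto
    have ev: "even_set (bd {f})" unfolding bf by (rule even_set_cycle) (use f in auto)
    have "insert f X = {f} \<union> X" by simp
    then have "bd (insert f X) = sym_diff (bd {f}) (bd X)"
      using bd_disjoint_Un[of "{f}" X] insert by auto
    moreover have "finite (bd X)" "finite (bd {f})" 
      using insert by (auto intro!: finite_bd)
    moreover have "even_set (bd X)" using insert by auto
    ultimately show ?case using ev even_set_sym_diff[of "bd {f}" "bd X"] by simp
  qed simp
qed

end

text \<open>Modulo 2, the first axiom says that the first homology vanishes, the second that the
  surface is connected. Together they give every cycle exactly two sides, a combinatorial form of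
  the Jordan curve theorem.\<close>

locale tri_sphere = surface +
  assumes even_set_bounds: "Z \<subseteq> edges_of T \<Longrightarrow> even_set Z \<Longrightarrow> \<exists>X\<subseteq>T. bd X = Z"
    and bd_eq_empty: "X \<subseteq> T \<Longrightarrow> bd X = {} \<Longrightarrow> X = {} \<or> X = T"
begin

text \<open>No vertex separates the graph. Every edge has an end other than \<open>v\<close>, and
  each face at the edge meets the component \<open>U\<close> of \<open>a\<close> off
  \<open>v\<close> exactly when that end is in \<open>U\<close>. So the faces meeting
  \<open>U\<close> have empty boundary and are all faces.\<close>

lemma reach_avoiding:
  assumes "T \<noteq> {}" "a \<noteq> v" "{a, v} \<in> edges_of T" "b \<noteq> v" "b \<in> \<Union>T"
  shows "(a, b) \<in> {(x, y). {x, y} \<in> edges_of T \<and> x \<noteq> v \<and> y \<noteq> v}\<^sup>*" (is "_ \<in> ?R\<^sup>*")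
proof -
  define U where "U = {x. (a, x) \<in> ?R\<^sup>*}"
  define X where "X = {f \<in> T. f \<inter> U \<noteq> {}}"
  have closed: "y \<in> U" if "f \<in> T" "x \<in> f" "x \<in> U" "y \<in> f" "y \<noteq> v" "x \<noteq> v" for f x y
  proof (cases "x = y")
    case False
    then have "(x, y) \<in> ?R" using that by (auto intro: edges_ofI)
    then show ?thesis using that unfolding U_def by (auto intro: rtrancl_into_rtrancl)
  qed (use that in auto)
  have vU: "v \<notin> U"
  proof
    assume "v \<in> U"
    then have "(a, v) \<in> ?R\<^sup>*" by (simp add: U_def)
    then show False using assms(2) by (cases rule: rtranclE) auto
  qed
  have XT: "X \<subseteq> T" by (auto simp: X_def)
  have "bd X = {}"
  proof -
    have "e \<notin> bd X" if e: "e \<in> edges_of T" for e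
    proof -
      obtain f g where fg: "{h \<in> T. e \<subseteq> h} = {f, g}" "f \<noteq> g" "f \<in> T" "g \<in> T" using edge_faces[OF e] by metis
      obtain x y where xy: "e = {x, y}" "x \<noteq> y" using edge_doubleton[OF e] by blast
      obtain z where z: "z \<in> e" "z \<noteq> v" using xy by auto
      have sub: "e \<subseteq> f" "e \<subseteq> g" using fg by blast+
      have "h \<in> X \<longleftrightarrow> z \<in> U" if "h \<in> T" "e \<subseteq> h" for h
        unfolding X_def using closed[of h] z that vU by blast
      from this[OF fg(3) sub(1)] this[OF fg(4) sub(2)] show ?thesis using in_bd_iff[OF e fg(1,2) XT] by simp
    qed
    then show ?thesis using bd_sub_edges[OF XT] by blast
  qed
  moreover have "X \<noteq> {}"
  proof -
    obtain f where "f \<in> T" "{a, v} \<subseteq> f" using assms by (auto simp: edges_of_def)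
    then have "f \<in> X" by (auto simp: X_def U_def)
    then show ?thesis by blast
  qed
  ultimately have "X = T" using bd_eq_empty XT by blast
  then obtain f where "f \<in> X" "b \<in> f" using assms by auto
  then have "b \<in> U" using closed[of f] assms vU unfolding X_def by blast
  then show ?thesis by (simp add: U_def)
qed

end

text \<open>A walk of least length repeats no vertex, since the part between two visits could be cut
  out.\<close>

lemma rtrancl_distinct_path:
  assumes "(a, b) \<in> R\<^sup>*"
  obtains p where "distinct p" "p \<noteq> []" "hd p = a" "last p = b" "\<And>i. Suc i < length p \<Longrightarrow> (p ! i, p ! Suc i) \<in> R"
proof -
  let ?P = "\<lambda>p. p \<noteq> [] \<and> hd p = a \<and> last p = b \<and> (\<forall>i. Suc i < length p \<longrightarrow> (p ! i, p ! Suc i) \<in> R)"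
  have "\<exists>p. ?P p" using assms
  proof (induction rule: rtrancl_induct)
    case base
    show ?case by (rule exI[of _ "[a]"]) simp
  next
    case (step y z)
    then obtain p where p: "p \<noteq> []" "hd p = a" "last p = y" "\<forall>i. Suc i < length p \<longrightarrow> (p ! i, p ! Suc i) \<in> R" by blast
    have "((p @ [z]) ! i, (p @ [z]) ! Suc i) \<in> R" if "Suc i < length (p @ [z])" for i
    proof (cases "Suc i < length p")
      case True
      then show ?thesis using p by (simp add: nth_append)
    next
      case False
      then have "i = length p - 1" "i < length p" using that p by auto
      then show ?thesis using p step(2) by (auto simp: nth_append last_conv_nth)
    qed
    then show ?case using p by (intro exI[of _ "p @ [z]"]) auto
  qed
  then obtain p where p: "?P p" "\<And>q. ?P q \<Longrightarrow> length p \<le> length q"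
    using ex_has_least_nat[of ?P _ length] by metis
  have "distinct p"
  proof (rule ccontr)
    assume "\<not> distinct p"
    then obtain x xs ys zs where d: "p = xs @ [x] @ ys @ [x] @ zs" using not_distinct_decomp by blast
    have R: "(p ! i, p ! Suc i) \<in> R" if "Suc i < length p" for i using p that by blast
    have "?P (xs @ [x] @ zs)"
    proof (intro conjI allI impI)
      show "hd (xs @ [x] @ zs) = a" using p d by (cases xs) auto
      show "last (xs @ [x] @ zs) = b" using p d by (cases zs) auto
      fix i assume i: "Suc i < length (xs @ [x] @ zs)"
      consider "Suc i \<le> length xs" | "length xs \<le> i" by linarith
      then show "((xs @ [x] @ zs) ! i, (xs @ [x] @ zs) ! Suc i) \<in> R"
      proof cases
        case 1
        then show ?thesis using R[of i] d by (auto simp: nth_append nth_Cons split: if_splits nat.splits)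
      next
        case 2
        \<comment> \<open>Behind the cut, positions are shifted by the length of \<open>ys\<close>
          plus one.\<close>
        define j where "j = i + length ys + 1"
        have "Suc j < length p" using i d j_def by simp
        moreover have "p ! (k + length ys + 1) = (xs @ [x] @ zs) ! k" if "length xs \<le> k" for k
        proof -
          have "p = (xs @ [x] @ ys) @ [x] @ zs" using d by simp
          then have "p ! (k + length ys + 1) = ([x] @ zs) ! (k - length xs)"
            using nth_append_right[of "xs @ [x] @ ys" "k + length ys + 1" "[x] @ zs"] that by simp
          then show ?thesis using nth_append_right[of xs k "[x] @ zs"] that by simp
        qed
        from this[of i] this[of "Suc i"] have "p ! j = (xs @ [x] @ zs) ! i" "p ! Suc j = (xs @ [x] @ zs) ! Suc i"
          using 2 by (simp_all add: j_def)
        ultimately show ?thesis using R[of j] by metis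
      qed
    qed simp
    then have "length p \<le> length (xs @ [x] @ zs)" using p(2) by blast
    then show False using d by simp
  qed
  then show thesis using that p(1) by blast
qed

section \<open>Vertex links, interior vertices, and discs cut along a path\<close>

context tri_sphere
begin

text \<open>Excludes pinch points. If a face at \<open>v\<close> were missed, a path off
  \<open>v\<close> from a face in \<open>A\<close> to the missed face would close up through
  \<open>v\<close> to a cycle, and a side of this cycle, cut down to \<open>A\<close>, has odd
  degree at \<open>v\<close>.\<close>

lemma link_connected:
  assumes AT: "A \<subseteq> {f \<in> T. v \<in> f}" and ne: "A \<noteq> {}"
    and cl: "\<And>f g w. f \<in> A \<Longrightarrow> g \<in> T \<Longrightarrow> {v, w} \<subseteq> f \<Longrightarrow> {v, w} \<subseteq> g \<Longrightarrow> w \<noteq> v \<Longrightarrow> g \<in> A"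
  shows "A = {f \<in> T. v \<in> f}"
proof (rule ccontr)
  assume "A \<noteq> {f \<in> T. v \<in> f}"
  then obtain g where g: "g \<in> T" "v \<in> g" "g \<notin> A" using AT by blast
  obtain f where f: "f \<in> A" using ne by blast
  have fT: "f \<in> T" "v \<in> f" using f AT by auto
  have "\<exists>w. w \<in> h \<and> w \<noteq> v" if "h \<in> T" for h
    using card_face[OF that] by (metis card_1_singleton_iff card.empty is_singletonI' is_singleton_altdef numeral_eq_one_iff semiring_norm(86) zero_neq_numeral)
  then obtain a b where ab: "a \<in> f" "a \<noteq> v" "b \<in> g" "b \<noteq> v" using fT g by meson
  have av: "{a, v} \<in> edges_of T" "{b, v} \<in> edges_of T" using ab fT g by (auto intro: edges_ofI)
  have "(a, b) \<in> {(x, y). {x, y} \<in> edges_of T \<and> x \<noteq> v \<and> y \<noteq> v}\<^sup>*"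
    by (rule reach_avoiding) (use ab av fT g in auto)
  then obtain p where p: "distinct p" "p \<noteq> []" "hd p = a" "last p = b"
    "\<And>i. Suc i < length p \<Longrightarrow> (p ! i, p ! Suc i) \<in> {(x, y). {x, y} \<in> edges_of T \<and> x \<noteq> v \<and> y \<noteq> v}"
    by (rule rtrancl_distinct_path) blast
  have anb: "a \<noteq> b"
  proof
    assume "a = b"
    then have "g \<in> A" using cl[of f g a] f g ab fT by auto
    then show False using g by simp
  qed
  have len: "2 \<le> length p" using p anb by (cases p rule: path_edges.cases) auto
  have pe: "path_edges p \<subseteq> edges_of T" using p(5) by (auto simp: path_edges_nth)
  have vp: "v \<notin> set p"
  proof
    assume "v \<in> set p"
    then obtain i where i: "i < length p" "p ! i = v" by (auto simp: in_set_conv_nth)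
    show False
    proof (cases "Suc i < length p")
      case True then show ?thesis using p(5)[of i] i by auto
    next
      case False
      then have "i = length p - 1" using i by auto
      then show ?thesis using i p ab by (auto simp: last_conv_nth)
    qed
  qed
  define Z where "Z = cycle_edges (v # p)"
  have Zeq: "Z = path_edges p \<union> {{a, v}, {b, v}}"
    using p by (auto simp: Z_def cycle_edges_eq path_edges_Cons insert_commute)
  have "even_set Z" unfolding Z_def by (rule even_set_cycle) (use p vp len in auto)
  moreover have "Z \<subseteq> edges_of T" using Zeq pe av by auto
  ultimately obtain X where X: "X \<subseteq> T" "bd X = Z" using even_set_bounds by blast
  define Y where "Y = X \<inter> A"
  have YT: "Y \<subseteq> T" using X Y_def by auto
  have vp': "\<And>e. e \<in> path_edges p \<Longrightarrow> v \<notin> e" using vp path_edges_subset by blast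
  \<comment> \<open>Around \<open>v\<close>, the faces in \<open>A\<close> form closed fans, so the boundary of \<open>X\<close> meets an even number of their spokes; but only \<open>{a, v}\<close> is one.\<close>
  have eq: "{e \<in> bd Y. v \<in> e} = {{a, v}}"
  proof (rule set_eqI)
    fix e
    show "e \<in> {e \<in> bd Y. v \<in> e} \<longleftrightarrow> e \<in> {{a, v}}"
    proof (cases "e \<in> edges_of T \<and> v \<in> e")
      case True
      then have e: "e \<in> edges_of T" "v \<in> e" by auto
      obtain h k where hk: "{h \<in> T. e \<subseteq> h} = {h, k}" "h \<noteq> k" "h \<in> T" "k \<in> T" using edge_faces[OF e(1)] by metis
      obtain w where w: "e = {v, w}" "w \<noteq> v" using edge_doubleton[OF e(1)] e(2) by auto
      have hkA: "h \<in> A \<longleftrightarrow> k \<in> A" using cl[of h k w] cl[of k h w] hk w by blast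
      have eZ: "e \<in> Z \<longleftrightarrow> e = {a, v} \<or> e = {b, v}" unfolding Zeq using vp' e by auto
      have 1: "e \<in> bd Y \<longleftrightarrow> e \<in> Z \<and> h \<in> A"
        using in_bd_iff[OF e(1) hk(1,2) YT] in_bd_iff[OF e(1) hk(1,2) X(1)] hkA X Y_def by auto
      have 2: "h \<in> A" if "e = {a, v}"
      proof -
        have "f \<in> {h \<in> T. e \<subseteq> h}" using fT ab that by auto
        then have "f = h \<or> f = k" using hk by blast
        then show ?thesis using f hkA by blast
      qed
      have 3: "h \<notin> A" if "e = {b, v}"
      proof -
        have "g \<in> {h \<in> T. e \<subseteq> h}" using g ab that by auto
        then have "g = h \<or> g = k" using hk by blast
        then show ?thesis using g hkA by blast
      qed
      show ?thesis using 1 2 3 eZ e by blast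
    next
      case False
      then show ?thesis using bd_sub_edges[OF YT] av by auto
    qed
  qed
  have "even (card {e \<in> bd Y. v \<in> e})" using even_set_bd[OF YT] by (simp add: even_set_def degree_in_def)
  then show False unfolding eq by simp
qed

text \<open>No spoke at \<open>v\<close> is a boundary edge, so the faces of \<open>S\<close> at
  \<open>v\<close> are closed under passing across spokes.\<close>

lemma faces_at_interior_vertex:
  assumes "S \<subseteq> T" "v \<notin> \<Union>(bd S)" "f \<in> S" "v \<in> f" "g \<in> T" "v \<in> g"
  shows "g \<in> S"
proof -
  have "{f \<in> S. v \<in> f} = {f \<in> T. v \<in> f}"
  proof (rule link_connected)
    show "{f \<in> S. v \<in> f} \<noteq> {}" using assms by blast
    fix f g w assume a: "f \<in> {f \<in> S. v \<in> f}" "g \<in> T" "{v, w} \<subseteq> f" "{v, w} \<subseteq> g" "w \<noteq> v"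
    have e: "{v, w} \<in> edges_of T" using a by (auto intro!: edges_ofI)
    obtain h k where hk: "{h \<in> T. {v, w} \<subseteq> h} = {h, k}" "h \<noteq> k" using edge_faces[OF e] by metis
    have "{v, w} \<notin> bd S" using assms by auto
    then have "h \<in> S \<longleftrightarrow> k \<in> S" using in_bd_iff[OF e hk assms(1)] by simp
    moreover have "f \<in> {h, k}" "g \<in> {h, k}" using hk(1) a assms(1) by blast+
    ultimately show "g \<in> {f \<in> S. v \<in> f}" using a by auto
  qed (use assms in auto)
  then show ?thesis using assms by blast
qed

lemma boundary_vertex_face_outside:
  assumes "S \<subseteq> T" "v \<in> \<Union>(bd S)"
  obtains f where "f \<in> T" "f \<notin> S" "v \<in> f"
proof -
  obtain e where e: "e \<in> bd S" "v \<in> e" using assms by blast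
  have eT: "e \<in> edges_of T" using e bd_sub_edges assms by blast
  obtain h k where hk: "{h \<in> T. e \<subseteq> h} = {h, k}" "h \<noteq> k" using edge_faces[OF eT] by metis
  then have "(h \<in> S) \<noteq> (k \<in> S)" using in_bd_iff[OF eT hk assms(1)] e by simp
  moreover have "h \<in> T" "k \<in> T" "e \<subseteq> h" "e \<subseteq> k" using hk by blast+
  ultimately show thesis using that e by blast
qed

text \<open>A boundary vertex of \<open>S\<close> sees a face outside \<open>S\<close> and hence
  cannot be interior to \<open>R\<close>. After a cut this tells which part a boundary vertex
  avoids.\<close>

lemma vertex_not_in_part:
  assumes "S \<subseteq> T" "R \<subseteq> S" "v \<in> \<Union>(bd S)" "v \<notin> \<Union>(bd R)"
  shows "v \<notin> \<Union>R"
proof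
  assume "v \<in> \<Union>R"
  then obtain f where f: "f \<in> R" "v \<in> f" by blast
  obtain g where g: "g \<in> T" "g \<notin> S" "v \<in> g" using boundary_vertex_face_outside[OF assms(1,3)] by metis
  have "g \<in> R" by (rule faces_at_interior_vertex[OF _ assms(4) f g(1,3)]) (use assms in auto)
  then show False using g assms by auto
qed

text \<open>The theta-graph lemma modulo 2. A side \<open>X\<close> of the cycle formed by
  \<open>a\<close> and \<open>p\<close> is intersected with \<open>S\<close>. Off
  \<open>bd S\<close> the boundary of the intersection is the path through \<open>p\<close>; on
  \<open>bd S\<close> it is a set \<open>W\<close> with odd degree exactly at \<open>x\<close> and
  \<open>y\<close>, and such a set is one of the two arcs.\<close>

lemma theta_split:
  assumes S: "S \<subseteq> T" and bdS: "bd S = cycle_edges (x # a @ y # b)"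
    and dist: "distinct (x # a @ y # b)" "distinct (x # p @ [y])" "set p \<inter> set (x # a @ y # b) = {}"
    and pe: "path_edges (x # p @ [y]) \<subseteq> edges_of S" and nb: "path_edges (x # p @ [y]) \<inter> bd S = {}"
  obtains S1 S2 where "S = S1 \<union> S2" "S1 \<inter> S2 = {}" "bd S1 = cycle_edges (x # a @ y # rev p)"
    "bd S2 = cycle_edges (x # p @ y # b)" "S1 \<noteq> {}" "S2 \<noteq> {}"
proof -
  let ?A = "path_edges (x # a @ [y])" and ?B = "path_edges (x # rev b @ [y])" and ?P = "path_edges (x # p @ [y])"
  have bdAB: "bd S = ?A \<union> ?B" unfolding bdS by (rule cycle_edges_theta)
  have Z1: "cycle_edges (x # a @ y # rev p) = ?A \<union> ?P" using cycle_edges_theta[of x a y "rev p"] by simp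
  have Z2: "cycle_edges (x # p @ y # b) = ?P \<union> ?B" by (rule cycle_edges_theta)
  have AP: "?A \<inter> ?P = {}" "?B \<inter> ?P = {}" using nb bdAB by auto
  have len: "3 \<le> length (x # a @ y # rev p)"
  proof (cases "a = [] \<and> p = []")
    case True
    then show ?thesis using AP(1) by simp
  qed (cases a; cases p; auto)
  have "even_set (?A \<union> ?P)" unfolding Z1[symmetric]
    by (rule even_set_cycle) (use dist len in auto)
  moreover have "?A \<union> ?P \<subseteq> edges_of T"
    using pe bdAB bd_sub_edges[OF S] edges_of_mono[OF S] by blast
  ultimately obtain X where X: "X \<subseteq> T" "bd X = ?A \<union> ?P" using even_set_bounds by blast
  define Y where "Y = X \<inter> S"
  have YT: "Y \<subseteq> T" using X Y_def by auto
  have bdY: "bd Y - bd S = ?P"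
  proof (rule set_eqI)
    fix e
    show "e \<in> bd Y - bd S \<longleftrightarrow> e \<in> ?P"
    proof (cases "e \<in> edges_of T")
      case True
      then obtain h k where hk: "{h \<in> T. e \<subseteq> h} = {h, k}" "h \<noteq> k" by (metis edge_faces)
      show ?thesis
      proof (cases "e \<in> bd S")
        case True
        then show ?thesis using nb by auto
      next
        case False
        then have hkS: "h \<in> S \<longleftrightarrow> k \<in> S" using in_bd_iff[OF True hk S] by simp
        have eS: "e \<in> edges_of S \<longleftrightarrow> h \<in> S"
        proof -
          have "card e = 2" using True by (simp add: edges_of_def)
          then have "e \<in> edges_of S \<longleftrightarrow> (\<exists>f\<in>S. e \<subseteq> f)" by (simp add: edges_of_def)
          also have "\<dots> \<longleftrightarrow> (\<exists>f\<in>S. f \<in> {f \<in> T. e \<subseteq> f})" using S by blast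
          also have "\<dots> \<longleftrightarrow> h \<in> S \<or> k \<in> S" unfolding hk(1) by blast
          finally show ?thesis using hkS by simp
        qed
        show ?thesis
        proof -
          have 1: "e \<in> bd Y \<longleftrightarrow> h \<in> S \<and> e \<in> bd X"
            using in_bd_iff[OF True hk YT] in_bd_iff[OF True hk X(1)] hkS unfolding Y_def by auto
          have 2: "e \<in> bd X \<longleftrightarrow> e \<in> ?P" using X bdAB False by auto
          have 3: "e \<in> ?P \<Longrightarrow> e \<in> edges_of S" using pe by auto
          show ?thesis using 1 2 3 False eS by auto
        qed
      qed
    next
      case False
      then show ?thesis using bd_sub_edges[OF YT] pe edges_of_mono[OF S] by auto
    qed
  qed
  define W where "W = bd Y \<inter> bd S"
  have bdYW: "bd Y = ?P \<union> W" "?P \<inter> W = {}" using bdY nb by (auto simp: W_def)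
  have WAB: "W \<subseteq> ?A \<union> ?B" using W_def bdAB by auto
  have degW: "odd (degree_in W v) \<longleftrightarrow> v = x \<or> v = y" for v
  proof -
    have "W = sym_diff (bd Y) ?P" using bdYW by auto
    then have "even (degree_in W v) \<longleftrightarrow> (even (degree_in (bd Y) v) \<longleftrightarrow> even (degree_in ?P v))"
      using even_degree_sym_diff[of "bd Y" ?P v] YT by simp
    moreover have "even (degree_in (bd Y) v)" using even_set_bd[OF YT] by (simp add: even_set_def)
    moreover have "odd (degree_in ?P v) \<longleftrightarrow> (v = x) \<noteq> (v = y)"
      using odd_degree_path[of "x # p @ [y]" v] dist by simp
    ultimately show ?thesis using dist by auto
  qed
  \<comment> \<open>With both arcs equal to the single edge \<open>{x, y}\<close>, the boundary of
    \<open>S\<close> would have odd degree at \<open>x\<close>.\<close>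
  have len2: "3 \<le> length (x # a @ y # b)" if "a = []" "b = []"
    using that bdS dist S
  proof -
    have "bd S = {{x, y}}" using that bdS by (auto simp: cycle_edges_def)
    moreover have "even_set (bd S)" by (rule even_set_bd[OF S])
    ultimately have "even (degree_in {{x, y}} x)" by (simp add: even_set_def)
    moreover have "{e. e = {x, y} \<and> x \<in> e} = {{x, y}}" by auto
    ultimately show ?thesis by (simp add: degree_in_def)
  qed
  \<comment> \<open>A set of boundary edges that has even degree at the inner vertices of an arc contains all or none of the edges of that arc.\<close>
  have all_or_none: "path_edges q \<subseteq> W \<or> path_edges q \<inter> W = {}"
    if q: "path_edges q \<subseteq> bd S" "distinct q" "\<And>v. v \<in> set (tl (butlast q)) \<Longrightarrow> even (degree_in W v) \<and> {e \<in> bd S. v \<in> e} = {e \<in> path_edges q. v \<in> e}" for q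
    using q
  proof (induction q rule: path_edges.induct)
    case (1 u v r)
    show ?case
    proof (cases r)
      case Nil
      then show ?thesis by auto
    next
      case (Cons w s)
      have v: "v \<in> set (tl (butlast (u # v # r)))" using Cons by simp
      have ev: "even (degree_in W v)" and vE: "{e \<in> bd S. v \<in> e} = {e \<in> path_edges (u # v # r). v \<in> e}"
        using 1(4)[OF v] by auto
      have "{e \<in> path_edges (u # v # r). v \<in> e} = {{u, v}, {v, w}}"
        using 1(3) Cons by (auto dest!: path_edges_subset)
      moreover have "{e \<in> W. v \<in> e} = {e \<in> bd S. v \<in> e} \<inter> W" by (auto simp: W_def)
      ultimately have eW: "{e \<in> W. v \<in> e} = {{u, v}, {v, w}} \<inter> W" using vE by simp
      have ne: "{u, v} \<noteq> {v, w}" using 1(3) Cons by (auto simp: doubleton_eq_iff)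
      have iff: "{u, v} \<in> W \<longleftrightarrow> {v, w} \<in> W"
      proof (rule ccontr)
        assume "({u, v} \<in> W) \<noteq> ({v, w} \<in> W)"
        then have "\<exists>e. {e \<in> W. v \<in> e} = {e}" unfolding eW using ne by blast
        then obtain d where d: "{e \<in> W. v \<in> e} = {d}" by blast
        have "degree_in W v = 1" unfolding degree_in_def d by simp
        then show False using ev by simp
      qed
      have "path_edges (v # r) \<subseteq> W \<or> path_edges (v # r) \<inter> W = {}"
      proof (rule 1(1))
        show "path_edges (v # r) \<subseteq> bd S" "distinct (v # r)" using 1 by auto
        fix t assume t: "t \<in> set (tl (butlast (v # r)))"
        then have "t \<in> set (tl (butlast (u # v # r)))" using Cons by (auto split: if_splits)
        then have *: "even (degree_in W t)" "{e \<in> bd S. t \<in> e} = {e \<in> path_edges (u # v # r). t \<in> e}" using 1(4) by blast+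
        have "t \<in> set r" using t Cons by (auto split: if_splits dest: in_set_butlastD)
        then have "t \<noteq> u" "t \<noteq> v" using 1(3) by auto
        then have "{e \<in> path_edges (u # v # r). t \<in> e} = {e \<in> path_edges (v # r). t \<in> e}" by auto
        then show "even (degree_in W t) \<and> {e \<in> bd S. t \<in> e} = {e \<in> path_edges (v # r). t \<in> e}" using * by simp
      qed
      then show ?thesis using iff Cons by auto
    qed
  qed auto
  have vAB: "{e \<in> bd S. v \<in> e} = {e \<in> ?A. v \<in> e}" if "v \<in> set a" for v
  proof -
    have "e \<notin> ?B" if "v \<in> e" for e
      using that \<open>v \<in> set a\<close> dist(1) path_edges_subset[of e "x # rev b @ [y]"] by auto
    then show ?thesis using bdAB by auto
  qed
  have vBA: "{e \<in> bd S. v \<in> e} = {e \<in> ?B. v \<in> e}" if "v \<in> set b" for v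
  proof -
    have "e \<notin> ?A" if "v \<in> e" for e
      using that \<open>v \<in> set b\<close> dist(1) path_edges_subset[of e "x # a @ [y]"] by auto
    then show ?thesis using bdAB by auto
  qed
  have tb: "set (tl (butlast (x # q @ [y]))) = set q" for q :: "'a list" by (simp add: butlast_append)
  have cA: "?A \<subseteq> W \<or> ?A \<inter> W = {}"
  proof (rule all_or_none)
    fix v assume "v \<in> set (tl (butlast (x # a @ [y])))"
    then have va: "v \<in> set a" by (simp only: tb)
    then have "v \<noteq> x" "v \<noteq> y" using dist(1) by auto
    then show "even (degree_in W v) \<and> {e \<in> bd S. v \<in> e} = {e \<in> ?A. v \<in> e}" using vAB[OF va] degW[of v] by auto
  qed (use bdAB dist in auto)
  have cB: "?B \<subseteq> W \<or> ?B \<inter> W = {}"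
  proof (rule all_or_none)
    fix v assume "v \<in> set (tl (butlast (x # rev b @ [y])))"
    then have va: "v \<in> set b" by (simp only: tb set_rev)
    then have "v \<noteq> x" "v \<noteq> y" using dist(1) by auto
    then show "even (degree_in W v) \<and> {e \<in> bd S. v \<in> e} = {e \<in> ?B. v \<in> e}" using vBA[OF va] degW[of v] by auto
  qed (use bdAB dist in auto)
  \<comment> \<open>Odd degree at \<open>x\<close> excludes that \<open>W\<close> is empty, and also
    that it is all of \<open>bd S\<close>, which is even.\<close>
  have W: "W = ?A \<or> W = ?B"
  proof -
    have "W = (?A \<inter> W) \<union> (?B \<inter> W)" using WAB by blast
    then have "W = {} \<or> W = ?A \<or> W = ?B \<or> W = ?A \<union> ?B" using cA cB by blast
    moreover have "W \<noteq> {}" using degW[of x] by auto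
    moreover have "W = ?A \<or> W = ?B" if "W = ?A \<union> ?B"
    proof -
      have "even_set (bd S)" by (rule even_set_bd[OF S])
      then have "even (degree_in W x)" using that bdAB by (simp add: even_set_def)
      then show ?thesis using degW[of x] by simp
    qed
    ultimately show ?thesis by blast
  qed
  \<comment> \<open>A common edge joins the only common vertices \<open>x\<close> and
    \<open>y\<close>, so it would be the whole of both arcs.\<close>
  have ABd: "?A \<inter> ?B = {}"
  proof -
    have False if "e \<in> ?A" "e \<in> ?B" for e
    proof -
      have "e \<subseteq> {x, y}" using that dist(1) path_edges_subset[of e "x # a @ [y]"] path_edges_subset[of e "x # rev b @ [y]"] by auto
      moreover have "card e = 2" using that dist by (auto intro: card_path_edges[of "x # a @ [y]"])
      ultimately have e: "e = {x, y}" by (metis card_2_iff doubleton_eq_iff insert_subset singletonD subset_insert_iff subset_singletonD doubletons_in_triple insert_absorb2 insertCI insertE)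
      have "a = []"
      proof (cases a)
        case (Cons z q)
        have "{x, y} \<notin> path_edges (z # q @ [y])" using dist by (auto dest!: path_edges_subset simp: Cons)
        moreover have "{x, y} \<noteq> {x, z}" using dist Cons by (auto simp: doubleton_eq_iff)
        ultimately show ?thesis using that Cons e by simp
      qed
      moreover have "b = []"
      proof (cases "rev b")
        case (Cons z q)
        then have "set b = set (z # q)" by (metis set_rev)
        then have "{x, y} \<notin> path_edges (z # q @ [y])" using dist by (auto dest!: path_edges_subset)
        moreover have "{x, y} \<noteq> {x, z}" using dist \<open>set b = _\<close> by (auto simp: doubleton_eq_iff)
        ultimately show ?thesis using that Cons e by simp
      qed simp
      ultimately show False using len2 by simp
    qed
    then show ?thesis by blast
  qed
  have bdSY: "bd (S - Y) = sym_diff (bd S) (bd Y)" by (rule bd_Diff) (use S Y_def in auto)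
  have Pne: "?P \<noteq> {}" by (cases p) auto
  \<comment> \<open>\<open>X\<close> may be either side of its cycle; which arc \<open>W\<close> is
    decides the roles of \<open>Y\<close> and \<open>S - Y\<close>.\<close>
  show thesis
  proof (cases "W = ?A")
    case True
    have 1: "bd Y = cycle_edges (x # a @ y # rev p)" unfolding Z1 bdYW True by auto
    have 2: "bd (S - Y) = cycle_edges (x # p @ y # b)" unfolding bdSY bdYW True bdAB Z2 using AP ABd by auto
    have "bd Y \<noteq> {}" "bd (S - Y) \<noteq> {}" using 1 2 Pne Z1 Z2 by auto
    then have "Y \<noteq> {}" "S - Y \<noteq> {}" by (metis bd_empty)+
    then show ?thesis using that[of Y "S - Y"] 1 2 Y_def by auto
  next
    case False
    then have True: "W = ?B" using W by simp
    have 1: "bd Y = cycle_edges (x # p @ y # b)" unfolding Z2 bdYW True by auto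
    have 2: "bd (S - Y) = cycle_edges (x # a @ y # rev p)" unfolding bdSY bdYW True bdAB Z1 using AP ABd by auto
    have "bd Y \<noteq> {}" "bd (S - Y) \<noteq> {}" using 1 2 Pne Z1 Z2 by auto
    then have "Y \<noteq> {}" "S - Y \<noteq> {}" by (metis bd_empty)+
    then show ?thesis using that[of "S - Y" Y] 1 2 Y_def by auto
  qed
qed

end

section \<open>Families of triangulations closed under flips\<close>

definition flip :: "'v set set \<Rightarrow> 'v \<Rightarrow> 'v \<Rightarrow> 'v \<Rightarrow> 'v \<Rightarrow> 'v set set" where
  "flip S a b u v = S - {{a, b, u}, {a, b, v}} \<union> {{u, v, a}, {u, v, b}}"

definition quad :: "'v set set \<Rightarrow> 'v set set \<Rightarrow> 'v \<Rightarrow> 'v \<Rightarrow> 'v \<Rightarrow> 'v \<Rightarrow> bool" where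
  "quad S D a b u v \<longleftrightarrow> {a, b} \<in> D \<and> {a, b, u} \<in> S \<and> {a, b, v} \<in> S \<and> u \<noteq> v"

text \<open>Two vertices of a disc \<open>S\<close> are linked if they are adjacent in \<open>S\<close>, possibly after one flip inside \<open>S\<close>;
  unlike adjacency, this relation does not change under flips inside \<open>S\<close>.\<close>

definition linked :: "'v set set \<Rightarrow> 'v set set \<Rightarrow> 'v \<Rightarrow> 'v \<Rightarrow> bool" where
  "linked D S u v \<longleftrightarrow> u \<noteq> v \<and> ((\<exists>f\<in>S. u \<in> f \<and> v \<in> f) \<or> (\<exists>a b. quad S D a b u v))"

text \<open>Corresponds to having no chords. Neighbours on a boundary arc share a face and are
  always linked, so only pairs with something in between count.\<close>

definition link_free :: "'v set set \<Rightarrow> 'v set set \<Rightarrow> 'v list \<Rightarrow> bool" where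
  "link_free D S Q \<longleftrightarrow> (\<forall>A x B y C. Q = A @ x # B @ y # C \<longrightarrow> B \<noteq> [] \<longrightarrow> \<not> linked D S x y)"

lemma quad_commute: "quad S D a b u v \<longleftrightarrow> quad S D a b v u" "quad S D a b u v \<longleftrightarrow> quad S D b a u v"
  by (auto simp: quad_def insert_commute)

lemma quad_mono: "quad S D a b u v \<Longrightarrow> S \<subseteq> S' \<Longrightarrow> quad S' D a b u v"
  by (auto simp: quad_def)

lemma linked_commute: "linked D S u v \<longleftrightarrow> linked D S v u"
  unfolding linked_def quad_commute(1)[of S D _ _ u v] by auto

lemma linked_mono: "linked D S u v \<Longrightarrow> S \<subseteq> S' \<Longrightarrow> linked D S' u v"
  unfolding linked_def by (meson quad_mono subsetD)

lemma linked_face: "f \<in> S \<Longrightarrow> u \<in> f \<Longrightarrow> v \<in> f \<Longrightarrow> u \<noteq> v \<Longrightarrow> linked D S u v"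
  by (auto simp: linked_def)

lemma link_free_mono: "link_free D S Q \<Longrightarrow> R \<subseteq> S \<Longrightarrow> link_free D R Q"
proof -
  assume lf: "link_free D S Q" and R: "R \<subseteq> S"
  show ?thesis unfolding link_free_def
  proof (intro allI impI notI)
    fix A x B y C assume "Q = A @ x # B @ y # C" "B \<noteq> []" "linked D R x y"
    then show False using lf linked_mono[OF _ R] unfolding link_free_def by metis
  qed
qed

lemma link_free_infix: "link_free D S (A @ Q @ B) \<Longrightarrow> link_free D S Q"
  unfolding link_free_def
proof (intro allI impI)
  fix A' x B' y C
  assume *: "\<forall>A' x B' y C. A @ Q @ B = A' @ x # B' @ y # C \<longrightarrow> B' \<noteq> [] \<longrightarrow> \<not> linked D S x y"
    and Q: "Q = A' @ x # B' @ y # C" and "B' \<noteq> []"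
  have "A @ Q @ B = (A @ A') @ x # B' @ y # (C @ B)" using Q by simp
  then show "\<not> linked D S x y" using * \<open>B' \<noteq> []\<close> by blast
qed

lemma link_free_prefix: "link_free D S (Q @ B) \<Longrightarrow> link_free D S Q"
  using link_free_infix[of D S "[]"] by simp

lemma link_free_suffix: "link_free D S (A @ Q) \<Longrightarrow> link_free D S Q"
  using link_free_infix[of D S A Q "[]"] by simp

lemma link_free_rev [simp]: "link_free D S (rev Q) \<longleftrightarrow> link_free D S Q"
proof -
  have "link_free D S (rev Q)" if a: "link_free D S Q" for Q
    unfolding link_free_def
  proof (intro allI impI)
    fix A x B y C assume "rev Q = A @ x # B @ y # C" "B \<noteq> []"
    then have "Q = rev (A @ x # B @ y # C)" by (metis rev_rev_ident)
    then have "Q = rev C @ y # rev B @ x # rev A" by simp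
    then show "\<not> linked D S x y" using a \<open>B \<noteq> []\<close> unfolding link_free_def linked_commute[of D S x y] by (metis rev_is_Nil_conv)
  qed
  from this[of Q] this[of "rev Q"] show ?thesis by auto
qed

lemma link_free_short: "length Q \<le> 2 \<Longrightarrow> link_free D S Q"
  unfolding link_free_def by (intro allI impI) (case_tac B; simp)

lemma link_freeD: "link_free D S (A @ x # B @ y # C) \<Longrightarrow> B \<noteq> [] \<Longrightarrow> \<not> linked D S x y"
  unfolding link_free_def by blast

lemma flip_mono: "S \<subseteq> T \<Longrightarrow> flip S a b u v \<subseteq> flip T a b u v"
  unfolding flip_def by blast

lemma Union_flip:
  assumes "quad S D a b u v" shows "\<Union>(flip S a b u v) = \<Union>S"
proof -
  have q: "{a, b, u} \<in> S" "{a, b, v} \<in> S" using assms by (auto simp: quad_def)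
  show ?thesis
  proof
    show "\<Union>(flip S a b u v) \<subseteq> \<Union>S" using q unfolding flip_def by blast
    show "\<Union>S \<subseteq> \<Union>(flip S a b u v)"
    proof
      fix x assume "x \<in> \<Union>S"
      then obtain f where f: "f \<in> S" "x \<in> f" by blast
      show "x \<in> \<Union>(flip S a b u v)"
      proof (cases "f \<in> {{a, b, u}, {a, b, v}}")
        case True
        then have "x \<in> {u, v, a} \<union> {u, v, b}" using f by auto
        then show ?thesis unfolding flip_def by blast
      next
        case False
        then show ?thesis using f unfolding flip_def by blast
      qed
    qed
  qed
qed

text \<open>A state \<open>(T, D)\<close> is a triangulation \<open>T\<close> with a set \<open>D\<close> of edges that can be flipped and need not belong
  to the graph \<open>H\<close>; all other edges of \<open>T\<close> do.\<close>

locale flip_family =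
  fixes St :: "('v set set \<times> 'v set set) set" and H :: "'v set set"
  assumes sphere: "(T, D) \<in> St \<Longrightarrow> tri_sphere T"
    and triangle_face: "(T, D) \<in> St \<Longrightarrow> {a, b} \<in> edges_of T \<Longrightarrow> {b, c} \<in> edges_of T \<Longrightarrow> {a, c} \<in> edges_of T \<Longrightarrow> {a, b, c} \<in> T"
    and diagonals: "(T, D) \<in> St \<Longrightarrow> D \<subseteq> edges_of T"
    and one_diagonal: "(T, D) \<in> St \<Longrightarrow> d \<in> D \<Longrightarrow> d' \<in> D \<Longrightarrow> f \<in> T \<Longrightarrow> d \<subseteq> f \<Longrightarrow> d' \<subseteq> f \<Longrightarrow> d = d'"
    and non_diagonals: "(T, D) \<in> St \<Longrightarrow> edges_of T - D \<subseteq> H"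
    and opposite_nonedge: "(T, D) \<in> St \<Longrightarrow> quad T D a b u v \<Longrightarrow> {u, v} \<notin> edges_of T"
    and flip_closed: "(T, D) \<in> St \<Longrightarrow> quad T D a b u v \<Longrightarrow> (flip T a b u v, insert {u, v} (D - {{a, b}})) \<in> St"
begin

section \<open>Invariance of links and boundaries under flips\<close>

lemma is_surface: "(T, D) \<in> St \<Longrightarrow> surface T"
  using sphere tri_sphere.axioms(1) by blast

lemma quad_distinct:
  assumes "(T, D) \<in> St" "quad T D a b u v"
  shows "a \<noteq> b" "a \<noteq> u" "a \<noteq> v" "b \<noteq> u" "b \<noteq> v" "u \<noteq> v"
proof -
  interpret surface T by (rule is_surface[OF assms(1)])
  show "a \<noteq> b" "a \<noteq> u" "a \<noteq> v" "b \<noteq> u" "b \<noteq> v" "u \<noteq> v"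
    using assms(2) face_distinct unfolding quad_def by blast+
qed

lemma quad_faces:
  assumes "(T, D) \<in> St" "quad T D a b u v" "f \<in> T" "{a, b} \<subseteq> f"
  shows "f = {a, b, u} \<or> f = {a, b, v}"
proof -
  interpret surface T by (rule is_surface[OF assms(1)])
  note d = quad_distinct[OF assms(1,2)]
  have "{a, b} \<in> edges_of T" using assms d by (auto intro: edges_ofI)
  moreover have "{a, b, u} \<noteq> {a, b, v}" using d by auto
  ultimately have "{h \<in> T. {a, b} \<subseteq> h} = {{a, b, u}, {a, b, v}}"
    using assms faces_of_edge[of "{a, b}" "{a, b, u}" "{a, b, v}"] by (auto simp: quad_def)
  then show ?thesis using assms(3,4) by blast
qed

lemma flip_new_faces:
  assumes "(T, D) \<in> St" "quad T D a b u v"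
  shows "{u, v, a} \<notin> T" "{u, v, b} \<notin> T"
  using opposite_nonedge[OF assms] quad_distinct(6)[OF assms] edges_ofI[of _ T u v] by blast+

text \<open>Flips are reversible, so an invariance under flips needs a proof in one direction
  only.\<close>

lemma flip_back:
  assumes st: "(T, D) \<in> St" and q: "quad S D a b u v" and S: "S \<subseteq> T"
  shows "quad (flip S a b u v) (insert {u, v} (D - {{a, b}})) u v a b"
    "flip (flip S a b u v) u v a b = S"
    "insert {a, b} (insert {u, v} (D - {{a, b}}) - {{u, v}}) = D"
proof -
  have qT: "quad T D a b u v" using q S by (rule quad_mono)
  note d = quad_distinct[OF st qT] and n = flip_new_faces[OF st qT]
  show "quad (flip S a b u v) (insert {u, v} (D - {{a, b}})) u v a b" using d by (auto simp: quad_def flip_def)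
  have "{u, v, a} \<notin> S" "{u, v, b} \<notin> S" "{a, b, u} \<in> S" "{a, b, v} \<in> S" using n S q by (auto simp: quad_def)
  moreover have "{u, v, a} \<noteq> {a, b, u}" "{u, v, a} \<noteq> {a, b, v}" "{u, v, b} \<noteq> {a, b, u}" "{u, v, b} \<noteq> {a, b, v}"
    using d by auto
  ultimately show "flip (flip S a b u v) u v a b = S" unfolding flip_def by blast
  have "{u, v} \<notin> D" using opposite_nonedge[OF st qT] diagonals[OF st] by blast
  then show "insert {a, b} (insert {u, v} (D - {{a, b}}) - {{u, v}}) = D" using q by (auto simp: quad_def)
qed

text \<open>A face contains at most one diagonal, so the two faces of any other quadrilateral are
  untouched by the flip.\<close>

lemma quad_flip:
  assumes st: "(T, D) \<in> St" and q: "quad S D a b u v" and S: "S \<subseteq> T" and c: "quad S D c d x y" "{c, d} \<noteq> {a, b}"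
  shows "quad (S - {{a, b, u}, {a, b, v}}) (insert {u, v} (D - {{a, b}})) c d x y"
proof -
  have *: "f \<notin> {{a, b, u}, {a, b, v}}" if "f \<in> S" "{c, d} \<subseteq> f" for f
    using one_diagonal[OF st, of "{c, d}" "{a, b}" f] that c q S unfolding quad_def by auto
  show ?thesis using c *[of "{c, d, x}"] *[of "{c, d, y}"] unfolding quad_def by auto
qed

text \<open>The four vertices of the flipped quadrilateral are pairwise linked before and after, and
  all other witnesses of links avoid its two faces. The converse comes from flipping back.\<close>

lemma linked_flip1:
  assumes st: "(T, D) \<in> St" and q: "quad S D a b u v" and S: "S \<subseteq> T" and l: "linked D S x y"
  shows "linked (insert {u, v} (D - {{a, b}})) (flip S a b u v) x y" (is "linked ?D ?S x y")
proof -
  have qT: "quad T D a b u v" using q S by (rule quad_mono)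
  have xy: "x \<noteq> y" using l by (simp add: linked_def)
  note q' = flip_back(1)[OF st q S]
  have l1: "linked ?D ?S s t" if "s \<in> {u, v, a}" "t \<in> {u, v, a}" "s \<noteq> t" for s t
    by (rule linked_face[of "{u, v, a}"]) (use that in \<open>auto simp: flip_def\<close>)
  have l2: "linked ?D ?S s t" if "s \<in> {u, v, b}" "t \<in> {u, v, b}" "s \<noteq> t" for s t
    by (rule linked_face[of "{u, v, b}"]) (use that in \<open>auto simp: flip_def\<close>)
  have l3: "linked ?D ?S a b" using q' quad_distinct(1)[OF st qT] unfolding linked_def by blast
  have l4: "linked ?D ?S b a" using l3 by (simp only: linked_commute[of _ _ b a])
  consider f where "f \<in> S" "x \<in> f" "y \<in> f" | c d where "quad S D c d x y" using l unfolding linked_def by blast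
  then show ?thesis
  proof cases
    case (1 f)
    show ?thesis
    proof (cases "f \<in> {{a, b, u}, {a, b, v}}")
      case True
      then show ?thesis using 1 xy l1[of x y] l2[of x y] l3 l4 by auto
    next
      case False
      then have "f \<in> flip S a b u v" using 1 by (simp add: flip_def)
      then show ?thesis using linked_face[of f "flip S a b u v" x y ?D] 1 xy by simp
    qed
  next
    case (2 c d)
    show ?thesis
    proof (cases "{c, d} = {a, b}")
      case True
      then have "{a, b, x} \<in> T" "{a, b, y} \<in> T" using 2 S by (auto simp: quad_def insert_commute doubleton_eq_iff)
      then have "{a, b, x} \<in> {{a, b, u}, {a, b, v}}" "{a, b, y} \<in> {{a, b, u}, {a, b, v}}"
        using quad_faces[OF st qT] by auto
      moreover have "x \<notin> {a, b}" "y \<notin> {a, b}" 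
        using quad_distinct[OF st quad_mono[OF 2 S]] True by auto
      ultimately have "x \<in> {u, v}" "y \<in> {u, v}" by auto
      then show ?thesis using l1[of x y] xy by auto
    next
      case False
      have "quad ?S ?D c d x y" by (rule quad_mono[OF quad_flip[OF st q S 2 False]]) (auto simp: flip_def)
      then show ?thesis using xy by (auto simp: linked_def)
    qed
  qed
qed

text \<open>The last clause records that a quadrilateral cut by the boundary of \<open>S\<close> is
  never flipped: an optional edge on the boundary keeps its face in \<open>S\<close>. Strips rely on
  this when they repair missing boundary edges.\<close>

definition flip_equiv where
  "flip_equiv T D S T' D' S' \<longleftrightarrow> (T', D') \<in> St \<and> S' \<subseteq> T' \<and> card T' = card T \<and> card S' = card S \<and> bd S' = bd S \<and>
     \<Union>S' = \<Union>S \<and> linked D' S' = linked D S \<and>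
     (\<forall>e f. e \<in> bd S' \<longrightarrow> e \<in> D' \<longrightarrow> f \<in> S' \<longrightarrow> e \<subseteq> f \<longrightarrow> e \<in> D \<and> f \<in> S)"

lemma flip_equiv_refl: "(T, D) \<in> St \<Longrightarrow> S \<subseteq> T \<Longrightarrow> flip_equiv T D S T D S"
  by (simp add: flip_equiv_def)

lemma flip_equiv_trans: "flip_equiv T D S T' D' S' \<Longrightarrow> flip_equiv T' D' S' T'' D'' S'' \<Longrightarrow> flip_equiv T D S T'' D'' S''"
proof -
  assume 1: "flip_equiv T D S T' D' S'" and 2: "flip_equiv T' D' S' T'' D'' S''"
  have "e \<in> D \<and> f \<in> S" if e: "e \<in> bd S''" "e \<in> D''" "f \<in> S''" "e \<subseteq> f" for e f
  proof -
    have "e \<in> D'" "f \<in> S'" "e \<in> bd S'" using 2 e unfolding flip_equiv_def by simp_all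
    then show ?thesis using 1 e(4) unfolding flip_equiv_def by simp
  qed
  then show ?thesis using 1 2 unfolding flip_equiv_def by simp
qed

text \<open>The old and the new pair of faces have the same quadrilateral as boundary, so
  \<open>bd S\<close> does not change.\<close>

lemma flip_equiv_flip:
  assumes st: "(T, D) \<in> St" and S: "S \<subseteq> T" and q: "quad S D a b u v"
  shows "flip_equiv T D S (flip T a b u v) (insert {u, v} (D - {{a, b}})) (flip S a b u v)"
proof -
  let ?T = "flip T a b u v" and ?D = "insert {u, v} (D - {{a, b}})" and ?S = "flip S a b u v"
  have qT: "quad T D a b u v" using q S by (rule quad_mono)
  note d = quad_distinct[OF st qT] and n = flip_new_faces[OF st qT]
  have st': "(?T, ?D) \<in> St" by (rule flip_closed[OF st qT])
  interpret A: surface T by (rule is_surface[OF st])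
  interpret B: surface ?T by (rule is_surface[OF st'])
  have S': "?S \<subseteq> ?T" using S by (rule flip_mono)
  let ?O = "{{a, b, u}, {a, b, v}}" and ?N = "{{u, v, a}, {u, v, b}}"
  have cards: "card (flip R a b u v) = card R" if "R \<subseteq> T" "quad R D a b u v" for R
  proof -
    have "{a, b, u} \<noteq> {a, b, v}" using d by auto
    then have O: "?O \<subseteq> R" "card ?O = 2" using that by (auto simp: quad_def)
    have N: "?N \<inter> R = {}" using n that by auto
    have "{u, v, a} \<noteq> {u, v, b}" using d by auto
    then have N2: "card ?N = 2" by simp
    have fin: "finite R" using that by blast
    have "card (flip R a b u v) = card (R - ?O) + card ?N"
      unfolding flip_def by (rule card_Un_disjoint) (use N fin in auto)
    also have "card (R - ?O) = card R - 2" using card_Diff_subset[of ?O R] O by simp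
    finally show ?thesis using N2 card_mono[OF fin O(1)] O(2) by simp
  qed
  let ?R = "S - ?O"
  have bdq: "bd ?O = {{a, u}, {b, u}, {a, v}, {b, v}}"
    by (rule A.bd_two_faces) (use qT in \<open>auto simp: quad_def\<close>)
  have "bd ?N = {{u, a}, {v, a}, {u, b}, {v, b}}"
    by (rule B.bd_two_faces) (use d in \<open>auto simp: flip_def\<close>)
  then have bdn: "bd ?N = {{a, u}, {b, u}, {a, v}, {b, v}}" by (auto simp: insert_commute)
  have 1: "bd S = sym_diff (bd ?R) (bd ?O)"
  proof -
    have "?R \<union> ?O = S" using q by (auto simp: quad_def)
    moreover have "?R \<subseteq> T" "?O \<subseteq> T" "?R \<inter> ?O = {}" using S qT by (auto simp: quad_def)
    ultimately show ?thesis using A.bd_disjoint_Un[of ?R ?O] by simp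
  qed
  have 2: "bd ?S = sym_diff (bd ?R) (bd ?N)"
  proof -
    have "?R \<subseteq> ?T" "?N \<subseteq> ?T" using S unfolding flip_def by blast+
    moreover have "?R \<inter> ?N = {}" using n S by auto
    ultimately show ?thesis using B.bd_disjoint_Un[of ?R ?N] unfolding flip_def by blast
  qed
  have bdS: "bd ?S = bd S" unfolding 1 2 bdq bdn by simp
  have lk: "linked ?D ?S = linked D S"
  proof (intro ext iffI)
    fix x y assume "linked ?D ?S x y"
    from linked_flip1[OF st' flip_back(1)[OF st q S] S' this]
    show "linked D S x y" unfolding flip_back(2,3)[OF st q S] .
  qed (rule linked_flip1[OF st q S])
  have "e \<in> D \<and> f \<in> S" if e: "e \<in> bd ?S" "e \<in> ?D" "f \<in> ?S" "e \<subseteq> f" for e f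
  proof -
    have "e \<in> edges_of T" using e(1) A.bd_sub_edges[OF S] bdS by auto
    then have ne: "e \<noteq> {u, v}" using opposite_nonedge[OF st qT] by auto
    have "f \<notin> ?N"
    proof
      assume "f \<in> ?N"
      then have "{u, v} \<subseteq> f" by auto
      then have "e = {u, v}" using one_diagonal[OF st', of e "{u, v}" f] e S' by auto
      then show False using ne by simp
    qed
    then show ?thesis using e ne by (auto simp: flip_def)
  qed
  then show ?thesis unfolding flip_equiv_def
    using st' S' cards[OF S q] cards[OF order.refl qT] bdS Union_flip[OF q] lk by blast
qed

text \<open>Diagonals inside \<open>S\<close> opposite to a vertex of \<open>Q\<close> are turned so
  that they end in \<open>Q\<close>. For \<open>Q = {w}\<close> this makes every edge opposite to
  \<open>w\<close> in a face of \<open>S\<close> an edge of \<open>H\<close> or of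
  \<open>bd S\<close>, so it may serve as new boundary once \<open>w\<close> is removed.\<close>

definition normal where
  "normal D S Q \<longleftrightarrow> (\<forall>a b u v. quad S D a b u v \<longrightarrow> u \<in> Q \<longrightarrow> a \<in> Q \<or> b \<in> Q)"

lemma quad_flip_back:
  assumes st: "(T, D) \<in> St" and q: "quad S D a b u v" and S: "S \<subseteq> T"
    and c: "quad (flip S a b u v) (insert {u, v} (D - {{a, b}})) c d x y" "{c, d} \<noteq> {u, v}"
  shows "quad S D c d x y" "{c, d} \<noteq> {a, b}"
proof -
  have qT: "quad T D a b u v" using q S by (rule quad_mono)
  have st': "(flip T a b u v, insert {u, v} (D - {{a, b}})) \<in> St" by (rule flip_closed[OF st qT])
  have S': "flip S a b u v \<subseteq> flip T a b u v" using S by (rule flip_mono)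
  from quad_flip[OF st' flip_back(1)[OF st q S] S' c]
  have "quad (flip S a b u v - {{u, v, a}, {u, v, b}}) D c d x y" unfolding flip_back(3)[OF st q S] .
  then show "quad S D c d x y" by (rule quad_mono) (auto simp: flip_def)
  show "{c, d} \<noteq> {a, b}" using c by (auto simp: quad_def)
qed

text \<open>Each bad diagonal is flipped; the new one ends in \<open>u\<close>, a vertex of
  \<open>Q\<close>, and the other quadrilaterals are unaffected, so the number of bad diagonals
  drops.\<close>

lemma exists_normal:
  assumes "(T, D) \<in> St" "S \<subseteq> T"
  obtains T' D' S' where "flip_equiv T D S T' D' S'" "normal D' S' Q"
proof -
  define bad where "bad = (\<lambda>S D. {d \<in> D. \<exists>a b u v. d = {a, b} \<and> quad S D a b u v \<and> u \<in> Q \<and> a \<notin> Q \<and> b \<notin> Q})"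
  have "\<exists>T' D' S'. flip_equiv T D S T' D' S' \<and> normal D' S' Q" if "(T, D) \<in> St" "S \<subseteq> T" "card (bad S D) = n" for n T D S
    using that
  proof (induction n arbitrary: T D S rule: less_induct)
    case (less n)
    have finD: "finite D"
      using diagonals[OF less(2)] is_surface[OF less(2)] surface.finite_edges finite_subset by metis
    show ?case
    proof (cases "normal D S Q")
      case True
      then show ?thesis using flip_equiv_refl[OF less(2,3)] by blast
    next
      case False
      then obtain a b u v where q: "quad S D a b u v" "u \<in> Q" "a \<notin> Q" "b \<notin> Q" unfolding normal_def by blast
      let ?T = "flip T a b u v" and ?D = "insert {u, v} (D - {{a, b}})" and ?S = "flip S a b u v"
      have fe: "flip_equiv T D S ?T ?D ?S" by (rule flip_equiv_flip[OF less(2,3) q(1)])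
      have st': "(?T, ?D) \<in> St" "?S \<subseteq> ?T" using fe by (auto simp: flip_equiv_def)
      have "bad ?S ?D \<subseteq> bad S D - {{a, b}}"
      proof
        fix d assume "d \<in> bad ?S ?D"
        then obtain c e x y where c: "d = {c, e}" "quad ?S ?D c e x y" "x \<in> Q" "c \<notin> Q" "e \<notin> Q"
          unfolding bad_def by blast
        have ne: "{c, e} \<noteq> {u, v}" using c q by (auto simp: doubleton_eq_iff)
        note b = quad_flip_back[OF less(2) q(1) less(3) c(2) ne]
        have "{c, e} \<in> D" using b(1) by (simp add: quad_def)
        then show "d \<in> bad S D - {{a, b}}" using b c unfolding bad_def by blast
      qed
      moreover have "{a, b} \<in> bad S D" using q unfolding bad_def by (auto simp: quad_def)
      moreover have "finite (bad S D)" using finD by (auto simp: bad_def)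
      ultimately have "card (bad ?S ?D) < n" using less(4) by (metis Diff_subset psubsetI psubset_card_mono subset_Diff_insert subset_trans insertI1 Diff_iff subsetD)
      from less(1)[OF this st' refl] show ?thesis using flip_equiv_trans[OF fe] by blast
    qed
  qed
  from this[OF assms refl] show thesis using that by blast
qed

end

section \<open>Fans\<close>

lemma consecutive_split:
  assumes d: "distinct (X @ b # Y @ c # Z)" and e: "{b, c} \<in> path_edges (X @ b # Y @ c # Z)"
  shows "Y = []"
proof -
  from path_edges_split[OF e] obtain a1 a2 where
    "X @ b # Y @ c # Z = a1 @ b # c # a2 \<or> X @ b # Y @ c # Z = a1 @ c # b # a2" by blast
  then show ?thesis
  proof
    assume eq: "X @ b # Y @ c # Z = a1 @ b # c # a2"
    have "b \<notin> set X" "b \<notin> set (Y @ c # Z)" using d by auto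
    then have "Y @ c # Z = c # a2" using eq by (metis append_Cons_eq_iff)
    then show ?thesis using d by (cases Y) auto
  next
    assume eq: "X @ b # Y @ c # Z = a1 @ c # b # a2"
    then have d': "distinct (a1 @ c # b # a2)" using d by simp
    then have "c \<notin> set a1" "c \<notin> set (b # a2)" by auto
    moreover have "(X @ b # Y) @ c # Z = a1 @ c # (b # a2)" using eq by simp
    moreover have "c \<notin> set (X @ b # Y)" "c \<notin> set Z" using d by auto
    ultimately have "a1 = X @ b # Y" by (metis append_Cons_eq_iff)
    then show ?thesis using d' by auto
  qed
qed

lemma (in surface) bd_fan:
  "distinct (w # B) \<Longrightarrow> 2 \<le> length B \<Longrightarrow> insert w ` path_edges B \<subseteq> T \<Longrightarrow>
    bd (insert w ` path_edges B) = path_edges B \<union> {{w, hd B}, {w, last B}}"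
proof (induction B rule: path_edges.induct)
  case (1 x y r)
  have f: "{w, x, y} \<in> T" using 1 by auto
  show ?case
  proof (cases "r = []")
    case True
    then show ?thesis using bd_face[OF f] by auto
  next
    case False
    let ?F = "insert w ` path_edges (y # r)"
    have IH: "bd ?F = path_edges (y # r) \<union> {{w, y}, {w, last r}}" using 1 False by (cases r) auto
    have nF: "{w, x, y} \<notin> ?F"
    proof
      assume "{w, x, y} \<in> ?F"
      then obtain e where e: "e \<in> path_edges (y # r)" "{w, x, y} = insert w e" by auto
      have "x \<in> insert w e" using e(2) by blast
      then show False using 1(2) path_edges_subset[OF e(1)] by auto
    qed
    have FT: "?F \<subseteq> T" using 1 by auto
    have "insert w ` path_edges (x # y # r) = {{w, x, y}} \<union> ?F" by auto
    then have "bd (insert w ` path_edges (x # y # r)) = sym_diff (bd {{w, x, y}}) (bd ?F)"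
      using bd_disjoint_Un[of "{{w, x, y}}" ?F] f nF FT by auto
    also have "\<dots> = sym_diff {{w, x}, {w, y}, {x, y}} (path_edges (y # r) \<union> {{w, y}, {w, last r}})"
      using bd_face[OF f] IH by simp
    also have "\<dots> = path_edges (x # y # r) \<union> {{w, x}, {w, last r}}"
    proof -
      have "{w, x} \<notin> path_edges (y # r)" "{x, y} \<notin> path_edges (y # r)" "{w, y} \<notin> path_edges (y # r)"
        using 1(2) path_edges_subset by fastforce+
      moreover have "last r \<in> set r" using False by simp
      then have "last r \<noteq> y" "last r \<noteq> x" "last r \<noteq> w" using 1(2) by auto
      moreover have "{w, last r} \<notin> path_edges (y # r)" using 1(2) path_edges_subset by fastforce
      moreover have "x \<noteq> y" "x \<noteq> w" "y \<noteq> w" using 1(2) by auto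
      ultimately show ?thesis by (auto simp: doubleton_eq_iff)
    qed
    finally show ?thesis using False by simp
  qed
qed auto

lemma edges_of_flip: "edges_of S - {{a, b}} \<subseteq> edges_of (flip S a b u v)"
proof
  fix e assume e: "e \<in> edges_of S - {{a, b}}"
  then obtain f where f: "f \<in> S" "e \<subseteq> f" "card e = 2" by (auto simp: edges_of_def)
  show "e \<in> edges_of (flip S a b u v)"
  proof (cases "f \<in> {{a, b, u}, {a, b, v}}")
    case False
    then have "f \<in> flip S a b u v" using f by (simp add: flip_def)
    then show ?thesis using f by (auto simp: edges_of_def)
  next
    case True
    then have "e \<subseteq> {a, b, u} \<or> e \<subseteq> {a, b, v}" using f by auto
    then have "e = {a, b} \<or> e = {a, u} \<or> e = {b, u} \<or> e = {a, v} \<or> e = {b, v}"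
      using f(3) doubletons_in_triple by metis
    then have "e \<subseteq> {u, v, a} \<or> e \<subseteq> {u, v, b}" using e by auto
    then show ?thesis using f by (auto simp: edges_of_def flip_def)
  qed
qed

context flip_family
begin

text \<open>If \<open>x\<close> and \<open>y\<close> are adjacent, a triangle of edges is a face. If
  they are opposite vertices of a quadrilateral, it is flipped first; the resulting face is not one
  of the two new ones, which do not contain \<open>w\<close>, so it was there before.\<close>

lemma linked_triangle:
  assumes st: "(T, D) \<in> St" and R: "R \<subseteq> T" and w: "w \<notin> \<Union>R"
    and l: "linked D R x y" and e: "{w, x} \<in> edges_of T" "{w, y} \<in> edges_of T"
  shows "{w, x, y} \<in> T"
proof -
  have xy: "x \<noteq> y" using l by (simp add: linked_def)
  consider f where "f \<in> R" "x \<in> f" "y \<in> f" | c d where "quad R D c d x y" using l unfolding linked_def by blast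
  then show ?thesis
  proof cases
    case (1 f)
    then have "{x, y} \<in> edges_of T" using R xy by (auto intro!: edges_ofI)
    then show ?thesis using triangle_face[OF st e(1) _ e(2)] by blast
  next
    case (2 c d)
    have q: "quad T D c d x y" using 2 R by (rule quad_mono)
    let ?T = "flip T c d x y"
    have st': "(?T, insert {x, y} (D - {{c, d}})) \<in> St" by (rule flip_closed[OF st q])
    have wn: "w \<notin> {c, d, x}" "w \<notin> {c, d, y}" using 2 w unfolding quad_def by blast+
    then have "{w, x} \<noteq> {c, d}" "{w, y} \<noteq> {c, d}" by auto
    then have "{w, x} \<in> edges_of ?T" "{w, y} \<in> edges_of ?T"
      using e edges_of_flip[of T c d x y] by auto
    moreover have "{x, y} \<in> edges_of ?T" using xy by (intro edges_ofI[of "{x, y, c}"]) (auto simp: flip_def)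
    ultimately have "{w, x, y} \<in> ?T" using triangle_face[OF st'] by blast
    moreover have "{w, x, y} \<noteq> {x, y, c}" "{w, x, y} \<noteq> {x, y, d}" using wn by auto
    ultimately show ?thesis by (auto simp: flip_def)
  qed
qed

text \<open>Describes what is left when all faces at \<open>w\<close> are removed: a disc whose
  boundary runs along \<open>R\<close> and the link path \<open>M\<close>. Normality makes the link
  edges real unless they already lie on \<open>bd S\<close>, and \<open>linked_triangle\<close>
  shows that the link path has no links, except possibly between its two ends, where the triangle
  with \<open>w\<close> may lie outside \<open>S\<close>.\<close>

lemma fan_at_boundary_vertex:
  assumes st: "(T, D) \<in> St" and S: "S \<subseteq> T" and bdS: "bd S = cycle_edges (w # R)"
    and dist: "distinct (w # R)" and len: "2 \<le> length R"
    and nl: "\<And>A r B. R = A @ r # B \<Longrightarrow> A \<noteq> [] \<Longrightarrow> B \<noteq> [] \<Longrightarrow> \<not> linked D S w r"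
    and nm: "normal D S {w}"
  obtains M where "distinct (w # R @ M)" "insert w ` path_edges (last R # M @ [hd R]) = {f \<in> S. w \<in> f}"
    "path_edges (last R # M @ [hd R]) \<subseteq> H \<union> bd S"
    "3 \<le> length (R @ M) \<Longrightarrow> bd (S - {f \<in> S. w \<in> f}) = cycle_edges (R @ M)"
    "\<And>X b Y c Z. last R # M @ [hd R] = X @ b # Y @ c # Z \<Longrightarrow> Y \<noteq> [] \<Longrightarrow> linked D (S - {f \<in> S. w \<in> f}) b c \<Longrightarrow> X = [] \<and> Z = []"
proof -
  interpret tri_sphere T by (rule sphere[OF st])
  define y where "y = last R"
  define A where "A = hd R"
  have Rne: "R \<noteq> []" using len by auto
  have yR: "y \<in> set R" "A \<in> set R" using Rne by (auto simp: y_def A_def)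
  have wyA: "w \<noteq> y" "w \<noteq> A" using yR dist by auto
  have yA: "y \<noteq> A" unfolding y_def A_def using len dist by (cases R) (auto split: if_splits)
  have bd_eq: "bd S = path_edges R \<union> {{w, A}, {w, y}}"
    using Rne unfolding bdS A_def y_def by (auto simp: cycle_edges_eq path_edges_Cons insert_commute)
  have bdw: "e = {w, y} \<or> e = {w, A}" if "e \<in> bd S" "w \<in> e" for e
    using that bd_eq path_edges_subset[of e R] dist by auto
  have uniq: "f = g" if "e \<in> bd S" "f \<in> S" "g \<in> S" "e \<subseteq> f" "e \<subseteq> g" for e f g
    using that unfolding bd_def by blast
  have interior: "g \<in> S" if "{w, x} \<subseteq> f" "f \<in> S" "x \<noteq> w" "x \<noteq> y" "x \<noteq> A" "g \<in> T" "{w, x} \<subseteq> g" for x f g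
  proof -
    have e: "{w, x} \<in> edges_of T" using that S by (auto intro!: edges_ofI)
    have nb: "{w, x} \<notin> bd S" using bdw[of "{w, x}"] that by (auto simp: doubleton_eq_iff)
    obtain h k where hk: "{h \<in> T. {w, x} \<subseteq> h} = {h, k}" "h \<noteq> k" using edge_faces[OF e] by metis
    have "h \<in> S \<longleftrightarrow> k \<in> S" using in_bd_iff[OF e hk S] nb by simp
    moreover have "f \<in> {h, k}" "g \<in> {h, k}" using hk(1) that S by blast+
    ultimately show ?thesis using that by auto
  qed
  \<comment> \<open>Partial fans at \<open>w\<close> that begin at the boundary spoke to
    \<open>y\<close>; a longest one will be the whole fan.\<close>
  define P where "P = (\<lambda>B. B \<noteq> [] \<and> distinct B \<and> hd B = y \<and> w \<notin> set B \<and> insert w ` path_edges B \<subseteq> S)"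
  have Pw: "set B \<subseteq> insert y (\<Union>S)" if "P B" for B
  proof
    fix x assume "x \<in> set B"
    then obtain X Z where B: "B = X @ x # Z" by (meson split_list)
    show "x \<in> insert y (\<Union>S)"
    proof (cases "X = []")
      case True then show ?thesis using that B by (simp add: P_def)
    next
      case False
      then have "{last X, x} \<in> path_edges B" unfolding B by (simp add: path_edges_append)
      then have "insert w {last X, x} \<in> S" using that by (auto simp: P_def)
      then show ?thesis by auto
    qed
  qed
  have finS: "finite (insert y (\<Union>S))" using finite_Union[OF S] by simp
  have bound: "length B < Suc (card (insert y (\<Union>S)))" if "P B" for B
  proof -
    have "length B = card (set B)" using that by (simp add: P_def distinct_card)
    also have "\<dots> \<le> card (insert y (\<Union>S))" by (rule card_mono[OF finS Pw[OF that]])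
    finally show ?thesis by simp
  qed
  have "P [y]" using wyA by (simp add: P_def)
  then obtain B where B: "P B" "\<And>C. P C \<Longrightarrow> length C \<le> length B"
    using ex_has_greatest_nat[of P "[y]" length "Suc (card (insert y (\<Union>S)))"] bound by blast
  have Bp: "B \<noteq> []" "distinct B" "hd B = y" "w \<notin> set B" "insert w ` path_edges B \<subseteq> S" using B(1) by (auto simp: P_def)
  have extend: False if "insert w {last B, z} \<in> S" "z \<notin> set B" "z \<noteq> w" for z
  proof -
    have "P (B @ [z])" unfolding P_def using that Bp by (auto simp: path_edges_append)
    from B(2)[OF this] show False by simp
  qed
  have Sy: "\<exists>f\<in>S. e \<subseteq> f" if "e \<in> bd S" for e using that unfolding bd_def by blast
  have fS: "\<exists>z. f = {w, x, z} \<and> z \<noteq> w \<and> z \<noteq> x" if "f \<in> S" "{w, x} \<subseteq> f" "x \<noteq> w" for f x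
    using face_third[of f w x] that S by (metis subsetD)
  have consec: "insert w {s, t} \<in> S" if "B = X @ s # t # Z" for X s t Z
    using Bp(5) path_edges_mem[of s t X Z] that by auto
  have notend: "s \<noteq> y" if "B = X @ s # Z" "X \<noteq> []" for X s Z using that Bp by (cases X) auto
  \<comment> \<open>A longest fan can only stop at \<open>A\<close>: at any other last vertex
    \<open>t\<close> different from \<open>y\<close> the spoke \<open>{w, t}\<close> is no boundary
    edge, so a further face of \<open>S\<close> lies across it, and at \<open>y\<close> the boundary
    spoke supplies a first face.\<close>
  have lastA: "last B = A"
  proof (rule ccontr)
    assume nA: "last B \<noteq> A"
    define t where "t = last B"
    show False
    proof (cases "butlast B = []")
      case True
      then have By: "B = [y]" using Bp True by (cases B) (auto split: if_splits)
      obtain f where f: "f \<in> S" "{w, y} \<subseteq> f" using Sy[of "{w, y}"] bd_eq by blast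
      obtain z where z: "f = {w, y, z}" "z \<noteq> w" "z \<noteq> y" using fS[OF f] wyA by metis
      show False using extend[of z] z f By by simp
    next
      case False
      define p where "p = last (butlast B)"
      define X where "X = butlast (butlast B)"
      have BX: "B = X @ p # [t]" unfolding p_def t_def X_def using False Bp(1)
        by (metis append_butlast_last_id append_assoc append_Cons append_Nil)
      have pt: "p \<noteq> t" "t \<noteq> w" "p \<noteq> w" using Bp BX by auto
      have ty: "t \<noteq> y" by (rule notend[of "X @ [p]" t "[]"]) (use BX in auto)
      have fpt: "{w, p, t} \<in> S" using consec[OF BX] by simp
      have tA: "t \<noteq> A" using nA by (simp add: t_def)
      have fT: "{w, p, t} \<in> T" using fpt S by auto
      have c2: "card {w, t} = 2" using pt by simp
      have sub: "{w, t} \<subseteq> {w, p, t}" by auto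
      obtain g where g: "g \<in> T" "{w, t} \<subseteq> g" "g \<noteq> {w, p, t}" using other_face[OF fT sub c2] by metis
      have gS: "g \<in> S" by (rule interior[OF sub fpt pt(2) ty tA g(1,2)])
      obtain z where z: "g = {w, t, z}" "z \<noteq> w" "z \<noteq> t" using fS[OF gS g(2)] pt by metis
      have zp: "z \<noteq> p" using g(3) z by auto
      \<comment> \<open>If \<open>z\<close> were already on the fan, the spoke \<open>{w, z}\<close>
        would lie in too many faces: in two of \<open>S\<close> if it is the boundary spoke at
        \<open>y\<close>, in three otherwise.\<close>
      have "z \<notin> set B"
      proof
        assume "z \<in> set B"
        then have "z \<in> set X" using z zp BX by auto
        then obtain X1 X2 where X12: "X = X1 @ z # X2" by (meson split_list)
        obtain s Z' where sZ: "X2 @ [p, t] = s # Z'" "s \<noteq> t" using Bp(2) BX X12 by (cases X2) auto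
        have B2: "B = X1 @ z # s # Z'" using BX X12 sZ by simp
        have f1: "insert w {z, s} \<in> S" by (rule consec[OF B2])
        have zt: "insert w {z, t} \<in> S" using gS z by (simp add: insert_commute)
        have "s \<noteq> w" "s \<noteq> z" "s \<noteq> t" using sZ(2) Bp(2,4) B2 by auto
        then have "s \<notin> insert w {z, t}" by simp
        then have ne1: "insert w {z, s} \<noteq> insert w {z, t}" by blast
        show False
        proof (cases "X1 = []")
          case True
          then have "z = y" using Bp(3) B2 by simp
          then show False using uniq[of "{w, y}" "insert w {z, s}" "insert w {z, t}"] bd_eq f1 zt ne1 by auto
        next
          case False
          then obtain X1' r where X1': "X1 = X1' @ [r]" by (metis append_butlast_last_id)
          have f2: "insert w {r, z} \<in> S" by (rule consec[of X1' r z "s # Z'"]) (use B2 X1' in simp)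
          have "t \<notin> set X" using Bp(2) BX by auto
          then have rs: "r \<noteq> s" "r \<noteq> t" "r \<noteq> w" using Bp(2,4) X12 X1' B2 by auto
          have ne2: "insert w {z, s} \<noteq> insert w {r, z}" "insert w {r, z} \<noteq> insert w {z, t}"
            using rs Bp(4) B2 pt Bp(2) X1' by auto
          have "{w, z} \<in> edges_of T" using g z by (auto intro!: edges_ofI)
          from third_face_eq[OF this, of "insert w {z, s}" "insert w {r, z}" "insert w {z, t}"]
          show False using f1 f2 zt S ne1 ne2 by auto
        qed
      qed
      moreover have "insert w {last B, z} \<in> S" using gS z by (simp add: t_def)
      ultimately show False using extend z by blast
    qed
  qed
  have len2: "2 \<le> length B" using Bp(1,3) lastA yA by (cases B rule: path_edges.cases) auto
  define M where "M = butlast (tl B)"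
  have BM: "B = y # M @ [A]"
  proof -
    have "B = y # tl B" using Bp(1,3) by (cases B) auto
    moreover have "tl B \<noteq> []" using len2 by (cases B) auto
    ultimately show ?thesis unfolding M_def using lastA by (metis append_butlast_last_id last_ConsR)
  qed
  let ?F = "insert w ` path_edges B"
  have F_at: "g \<in> ?F" if x: "x \<in> set B" and g: "g \<in> S" "{w, x} \<subseteq> g" for x g
  proof -
    obtain X Z where XZ: "B = X @ x # Z" using x by (meson split_list)
    have xw: "x \<noteq> w" using x Bp by auto
    show ?thesis
    proof (cases "X = [] \<or> Z = []")
      case True
      have "\<exists>s. {x, s} \<in> path_edges B"
      proof (cases "X = []")
        case True
        then obtain s Z' where "Z = s # Z'" using XZ len2 by (cases Z) auto
        then show ?thesis using XZ True by auto
      next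
        case False
        then have "{last X, x} \<in> path_edges B" using XZ by (simp add: path_edges_append)
        then show ?thesis by (metis insert_commute)
      qed
      then obtain s where s: "{x, s} \<in> path_edges B" by blast
      have sS: "insert w {x, s} \<in> S" using s Bp by auto
      have "x = y \<or> x = A" using True XZ Bp lastA by auto
      then have "{w, x} \<in> bd S" using bd_eq by auto
      then have "g = insert w {x, s}" using uniq[of "{w, x}" g "insert w {x, s}"] g sS by auto
      then show ?thesis using s by auto
    next
      case False
      then obtain X' r where X': "X = X' @ [r]" by (metis append_butlast_last_id)
      obtain s Z' where Z': "Z = s # Z'" using False by (cases Z) auto
      have e1: "{r, x} \<in> path_edges B" using path_edges_mem[of r x X' Z] XZ X' by simp
      have e2: "{x, s} \<in> path_edges B" using path_edges_mem[of x s X Z'] XZ Z' by simp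
      have rs: "r \<noteq> s" "r \<noteq> x" "s \<noteq> x" "r \<noteq> w" "s \<noteq> w" using Bp(2,4) XZ X' Z' by auto
      have e: "{w, x} \<in> edges_of T" using g S xw by (auto intro!: edges_ofI)
      have fs: "insert w {r, x} \<in> T" "insert w {x, s} \<in> T" using e1 e2 Bp(5) S by auto
      have ne: "insert w {r, x} \<noteq> insert w {x, s}" using rs xw by auto
      have "{h \<in> T. {w, x} \<subseteq> h} = {insert w {r, x}, insert w {x, s}}"
        by (rule faces_of_edge[OF e fs _ _ ne]) auto
      moreover have "g \<in> {h \<in> T. {w, x} \<subseteq> h}" using g S by auto
      ultimately have "g = insert w {r, x} \<or> g = insert w {x, s}" by simp
      then show ?thesis using e1 e2 by blast
    qed
  qed
  have F_in: "\<exists>x s. f = insert w {x, s} \<and> x \<in> set B \<and> s \<in> set B" if f: "f \<in> ?F" for f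
  proof -
    obtain e where e: "e \<in> path_edges B" "f = insert w e" using f by auto
    have "card e = 2" using e Bp by (auto intro: card_path_edges)
    then obtain x s where "e = {x, s}" by (auto simp: card_2_iff)
    then show ?thesis using e path_edges_subset[OF e(1)] by auto
  qed
  \<comment> \<open>The fan and the faces at \<open>w\<close> outside \<open>S\<close> are jointly
    closed under passing across spokes, since only the spokes to \<open>y\<close> and
    \<open>A\<close> lead out of \<open>S\<close>. So the fan misses no face of \<open>S\<close> at
    \<open>w\<close>.\<close>
  have F_T: "?F \<union> {f \<in> T - S. w \<in> f} = {f \<in> T. w \<in> f}"
  proof (rule link_connected)
    show "?F \<union> {f \<in> T - S. w \<in> f} \<subseteq> {f \<in> T. w \<in> f}" using Bp S by auto
    have "path_edges B \<noteq> {}" unfolding BM by (cases M) auto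
    then show "?F \<union> {f \<in> T - S. w \<in> f} \<noteq> {}" by blast
    fix f g x assume a: "f \<in> ?F \<union> {f \<in> T - S. w \<in> f}" "g \<in> T" "{w, x} \<subseteq> f" "{w, x} \<subseteq> g" "x \<noteq> w"
    show "g \<in> ?F \<union> {f \<in> T - S. w \<in> f}"
    proof (cases "g \<in> S")
      case False
      then show ?thesis using a by auto
    next
      case gS: True
      have "x \<in> set B"
      proof (cases "f \<in> ?F")
        case True
        then show ?thesis using F_in[OF True] a by auto
      next
        case False
        then have fn: "f \<notin> S" "f \<in> T" using a by auto
        have "x = y \<or> x = A"
        proof (rule ccontr)
          assume "\<not> (x = y \<or> x = A)"
          then have "f \<in> S" using interior[OF a(4) gS a(5) _ _ fn(2) a(3)] by blast
          then show False using fn by simp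
        qed
        then show ?thesis unfolding BM by auto
      qed
      then show ?thesis using F_at gS a by blast
    qed
  qed
  have Feq: "?F = {f \<in> S. w \<in> f}"
  proof
    show "?F \<subseteq> {f \<in> S. w \<in> f}" using Bp by auto
    show "{f \<in> S. w \<in> f} \<subseteq> ?F" using F_T S by blast
  qed
  \<comment> \<open>A link vertex shares a face with \<open>w\<close>, while the inner vertices of
    \<open>R\<close> are not linked to \<open>w\<close>.\<close>
  have MR: "m \<notin> set R" if m: "m \<in> set M" for m
  proof
    assume "m \<in> set R"
    then obtain R1 R2 where R12: "R = R1 @ m # R2" by (meson split_list)
    have "m \<noteq> y" "m \<noteq> A" using m Bp(2) BM by auto
    then have "R1 \<noteq> []" "R2 \<noteq> []" using R12 unfolding y_def A_def by auto
    then have "\<not> linked D S w m" using nl R12 by blast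
    moreover have "linked D S w m"
    proof -
      obtain X Z where XZ: "M = X @ m # Z" using m by (meson split_list)
      have "\<exists>s. {m, s} \<in> path_edges B"
        unfolding BM XZ using path_edges_mem[of m "hd (Z @ [A])" "y # X" "tl (Z @ [A])"]
        by (cases Z) auto
      then obtain s where "{m, s} \<in> path_edges B" by blast
      then have "insert w {m, s} \<in> S" using Bp by auto
      moreover have "m \<noteq> w" using m BM Bp by auto
      ultimately show ?thesis by (auto intro: linked_face)
    qed
    ultimately show False by simp
  qed
  have d1: "distinct (w # R @ M)" using dist MR Bp(2,4) BM by auto
  \<comment> \<open>An optional edge off the boundary has both its faces in \<open>S\<close>; with
    \<open>w\<close> as one of its opposite vertices it would violate normality.\<close>
  have real: "path_edges B \<subseteq> H \<union> bd S"
  proof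
    fix e assume e: "e \<in> path_edges B"
    have ce: "card e = 2" using e Bp by (auto intro: card_path_edges)
    have fS: "insert w e \<in> S" using e Bp by auto
    then have fT: "insert w e \<in> T" using S by auto
    have eT: "e \<in> edges_of T" using ce fT by (auto simp: edges_of_def)
    have we: "w \<notin> e" using path_edges_subset[OF e] Bp by auto
    show "e \<in> H \<union> bd S"
    proof (rule ccontr)
      assume n: "e \<notin> H \<union> bd S"
      then have eD: "e \<in> D" using non_diagonals[OF st] eT by auto
      obtain g where g: "g \<in> T" "e \<subseteq> g" "g \<noteq> insert w e" "{h \<in> T. e \<subseteq> h} = {insert w e, g}"
        using other_face[OF fT _ ce] by blast
      have gS: "g \<in> S" using in_bd_iff[OF eT g(4) _ S] g(3) n fS by auto
      obtain p q where pq: "e = {p, q}" "p \<noteq> q" using ce by (auto simp: card_2_iff)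
      obtain z where z: "g = {p, q, z}" using face_third[OF g(1), of p q] g(2) pq by auto
      have "quad S D p q w z" unfolding quad_def using eD pq fS gS z g(3) by (auto simp: insert_commute)
      then have "p \<in> {w} \<or> q \<in> {w}" using nm unfolding normal_def by blast
      then show False using we pq by auto
    qed
  qed
  have bdF: "bd ?F = path_edges B \<union> {{w, y}, {w, A}}"
    using bd_fan[of w B] Bp len2 S lastA by auto
  have bdSF: "bd (S - ?F) = sym_diff (bd S) (bd ?F)" by (rule bd_Diff) (use Bp S in auto)
  have bdR: "bd (S - ?F) = cycle_edges (R @ M)" if l3: "3 \<le> length (R @ M)"
  proof -
    have dj: "path_edges R \<inter> path_edges B = {}"
    proof (cases "M = []")
      case True
      then have "path_edges B = {{last R, hd R}}" unfolding BM y_def A_def by simp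
      then show ?thesis using closing_edge_notin[of R] dist l3 True by simp
    next
      case False
      have "\<not> e \<subseteq> set R" if "e \<in> path_edges B" for e
      proof -
        have "path_edges B = insert {y, hd M} (path_edges M \<union> {{last M, A}})"
          unfolding BM using False by (simp add: path_edges_Cons path_edges_append)
        then consider "e = {y, hd M}" | "e \<in> path_edges M" | "e = {last M, A}" using \<open>e \<in> path_edges B\<close> by blast
        then have "e \<inter> set M \<noteq> {}"
        proof cases
          case 2
          have "card e = 2" using that Bp by (auto intro: card_path_edges)
          then have "e \<noteq> {}" by auto
          then show ?thesis using path_edges_subset[OF 2] by auto
        qed (use False in auto)
        then show ?thesis using MR by auto
      qed
      then show ?thesis using path_edges_subset by blast
    qed
    have n1: "{w, y} \<notin> path_edges R" "{w, A} \<notin> path_edges R" using dist path_edges_subset[of _ R] by auto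
    have n2: "{w, y} \<notin> path_edges B" "{w, A} \<notin> path_edges B" using Bp path_edges_subset[of _ B] by auto
    have "bd (S - ?F) = path_edges R \<union> path_edges B"
      unfolding bdSF bdF bd_eq using dj n1 n2 by auto
    also have "\<dots> = cycle_edges (R @ M)"
    proof (cases "M = []")
      case True
      then show ?thesis unfolding BM using Rne by (auto simp: cycle_edges_eq y_def A_def)
    next
      case False
      then show ?thesis unfolding BM using Rne
        by (auto simp: cycle_edges_append y_def A_def path_edges_Cons path_edges_append)
    qed
    finally show ?thesis .
  qed
  \<comment> \<open>Linked vertices of the link path span a face with \<open>w\<close>. Unless they
    are the two ends, one of them lies on an interior spoke, so this face belongs to the fan and the
    two are consecutive.\<close>
  have lf: "X = [] \<and> Z = []" if XZ: "B = X @ b # Y @ c # Z" and Y: "Y \<noteq> []" and l: "linked D (S - ?F) b c" for X b Y c Z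
  proof (rule ccontr)
    assume n: "\<not> (X = [] \<and> Z = [])"
    have bB: "b \<in> set B" "c \<in> set B" using XZ by auto
    have ew: "{w, x} \<in> edges_of T" if "x \<in> set B" for x
    proof -
      obtain X Z where XZ: "B = X @ x # Z" using \<open>x \<in> set B\<close> by (meson split_list)
      have "\<exists>s. {x, s} \<in> path_edges B"
      proof (cases "X = []")
        case True
        then obtain s Z' where "Z = s # Z'" using XZ len2 by (cases Z) auto
        then show ?thesis using XZ True by auto
      next
        case False
        then have "{last X, x} \<in> path_edges B" using XZ by (simp add: path_edges_append)
        then show ?thesis by (metis insert_commute)
      qed
      then obtain s where "insert w {x, s} \<in> T" using Bp S by blast
      then show ?thesis using that Bp(4) by (intro edges_ofI[of "insert w {x, s}"]) auto
    qed
    have f: "{w, b, c} \<in> T"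
      by (rule linked_triangle[OF st _ _ l]) (use S Feq bB ew in auto)
    have "\<exists>x. x \<in> {b, c} \<and> x \<noteq> y \<and> x \<noteq> A"
    proof (cases "X = []")
      case False
      then have "b \<noteq> y" using notend[OF XZ] by simp
      moreover have "A \<in> set (c # Z)" using XZ lastA last_in_set[of "c # Z"] by auto
      then have "b \<noteq> A" using Bp(2) XZ by auto
      ultimately show ?thesis by blast
    next
      case True
      then have "Z \<noteq> []" using n by simp
      then have "c \<noteq> A" using Bp(2) XZ lastA by auto
      moreover have "c \<noteq> y" using notend[of "X @ b # Y" c Z] XZ by simp
      ultimately show ?thesis by blast
    qed
    then obtain x where x: "x \<in> {b, c}" "x \<noteq> y" "x \<noteq> A" by blast
    have xB: "x \<in> set B" using x bB by auto
    obtain s f' where f': "f' \<in> S" "{w, x} \<subseteq> f'"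
    proof -
      have "\<exists>f'\<in>S. {w, x} \<subseteq> f'"
      proof -
        obtain e where e: "e \<in> path_edges B" "x \<in> e"
        proof -
          obtain X Z where XZ: "B = X @ x # Z" using xB by (meson split_list)
          have "X \<noteq> []" using x(2) XZ Bp(3) by (cases X) auto
          then have "{last X, x} \<in> path_edges B" using XZ by (simp add: path_edges_append)
          then show thesis using that by blast
        qed
        then have "insert w e \<in> S" using Bp by auto
        then show ?thesis using e by blast
      qed
      then show thesis using that by blast
    qed
    have "{w, b, c} \<in> S"
      by (rule interior[OF f'(2,1) _ x(2,3) f]) (use x xB Bp in auto)
    then have "{w, b, c} \<in> ?F" using Feq by auto
    then obtain e where e: "e \<in> path_edges B" "{w, b, c} = insert w e" by blast
    have "w \<notin> e" using path_edges_subset[OF e(1)] Bp by auto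
    moreover have "b \<noteq> w" "c \<noteq> w" using bB Bp by auto
    ultimately have "e = {b, c}" using e(2) by auto
    then have bc: "{b, c} \<in> path_edges B" using e by simp
    then show False using consecutive_split[of X b Y c Z] Bp(2) XZ Y by simp
  qed
  show thesis
    by (rule that[of M]) (use d1 Feq real bdR lf BM in \<open>auto simp: y_def A_def\<close>)
qed

end

section \<open>Spanning paths in pockets and strips\<close>

definition is_path :: "'v list \<Rightarrow> 'v \<Rightarrow> 'v \<Rightarrow> 'v set set \<Rightarrow> bool" where
  "is_path p a b E \<longleftrightarrow> p \<noteq> [] \<and> distinct p \<and> hd p = a \<and> last p = b \<and> path_edges p \<subseteq> E"

lemma is_path_mono: "is_path p a b E \<Longrightarrow> E \<subseteq> E' \<Longrightarrow> is_path p a b E'"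
  by (auto simp: is_path_def)

lemma is_path_rev: "is_path p a b E \<Longrightarrow> is_path (rev p) b a E"
  by (auto simp: is_path_def hd_rev last_rev)

lemma is_path_ends: "is_path p a b E \<Longrightarrow> a \<in> set p \<and> b \<in> set p"
  by (auto simp: is_path_def)

lemma is_path_append: "is_path p a b E \<Longrightarrow> is_path q c d E \<Longrightarrow> {b, c} \<in> E \<Longrightarrow> set p \<inter> set q = {} \<Longrightarrow>
    is_path (p @ q) a d E"
  by (auto simp: is_path_def path_edges_append)

lemma is_path_glue:
  assumes "is_path p a b E" "is_path q b c E" "set p \<inter> set q = {b}"
  shows "is_path (p @ tl q) a c E" "set (p @ tl q) = set p \<union> set q"
proof -
  obtain q' where q: "q = b # q'" using assms(2) by (cases q) (auto simp: is_path_def)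
  have bp: "b \<in> set p" using assms(1) by (auto simp: is_path_def)
  have d: "set p \<inter> set q' = {}" using assms q by (auto simp: is_path_def)
  have "is_path (p @ q') a c E"
  proof (cases q')
    case Nil
    then show ?thesis using assms q by (simp add: is_path_def)
  next
    case (Cons z r)
    then have "is_path q' z c E" "{b, z} \<in> E" using assms(2) q by (auto simp: is_path_def)
    then show ?thesis using is_path_append[OF assms(1) _ _ d] by blast
  qed
  then show "is_path (p @ tl q) a c E" using q by simp
  show "set (p @ tl q) = set p \<union> set q" using q bp by auto
qed

text \<open>A recursive call permits all edges of a smaller boundary; those with an end off the
  resulting path drop out again.\<close>

lemma is_path_restrict:
  assumes "is_path p a b (H \<union> B)" "\<And>e. e \<in> B \<Longrightarrow> e \<subseteq> set p \<Longrightarrow> e \<in> C"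
  shows "is_path p a b (H \<union> C)"
proof -
  have "path_edges p \<subseteq> H \<union> C" using assms path_edges_subset[of _ p] unfolding is_path_def by blast
  then show ?thesis using assms(1) by (simp add: is_path_def)
qed

lemma replace_edge:
  assumes p: "is_path p a b (insert {x, y} E)" and e: "{x, y} \<in> path_edges p" and r: "is_path r x y E"
    and d: "set r \<inter> set p = {x, y}"
  obtains p' where "is_path p' a b E" "set p' = set p \<union> set r"
proof -
  have *: "\<exists>p'. is_path p' a b E \<and> set p' = set p \<union> set r"
    if p: "p = A @ x # y # B" "is_path p a b (insert {x, y} E)" "is_path r x y E" "set r \<inter> set p = {x, y}" for A B x y r
  proof -
    have dp: "distinct (A @ x # y # B)" using p by (simp add: is_path_def)
    have "x \<in> set r" "y \<in> set r" using p by (auto simp: is_path_def)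
    have r': "r \<noteq> []" "distinct r" "hd r = x" "last r = y" "path_edges r \<subseteq> E" using p(3) by (auto simp: is_path_def)
    have dr: "set r \<inter> set A = {}" "set r \<inter> set B = {}" using p(4) dp unfolding p(1) by auto
    have "is_path (A @ r @ B) a b E" unfolding is_path_def
    proof (intro conjI)
      show "distinct (A @ r @ B)" using dp dr r' by auto
      show "hd (A @ r @ B) = a" using p(1,2) r' by (cases A) (auto simp: is_path_def)
      show "last (A @ r @ B) = b" using p(1,2) r' by (cases B) (auto simp: is_path_def)
      have pp: "path_edges p \<subseteq> insert {x, y} E" using p(2) by (simp add: is_path_def)
      have 1: "path_edges (A @ [x]) \<subseteq> E"
      proof
        fix e assume e: "e \<in> path_edges (A @ [x])"
        have "e \<in> path_edges p" using path_edges_infix[of "A @ [x]" "[]" "y # B"] e p(1) by auto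
        moreover have "e \<noteq> {x, y}" using path_edges_subset[OF e] dp by auto
        ultimately show "e \<in> E" using pp by auto
      qed
      have 2: "path_edges (y # B) \<subseteq> E"
      proof
        fix e assume e: "e \<in> path_edges (y # B)"
        have "e \<in> path_edges p" using path_edges_infix[of "y # B" "A @ [x]" "[]"] e p(1) by auto
        moreover have "e \<noteq> {x, y}" using path_edges_subset[OF e] dp by auto
        ultimately show "e \<in> E" using pp by auto
      qed
      have 3: "path_edges (A @ r) \<subseteq> E" using 1 r' by (cases "A = []") (auto simp: path_edges_append)
      show "path_edges (A @ r @ B) \<subseteq> E"
        using 2 3 r' by (cases "B = []") (auto simp: path_edges_append[of "A @ r" B, simplified] path_edges_Cons)
    qed (use r' in auto)
    then show ?thesis using p(1) \<open>x \<in> set r\<close> \<open>y \<in> set r\<close> by (intro exI[of _ "A @ r @ B"]) auto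
  qed
  from path_edges_split[OF e] consider A B where "p = A @ x # y # B" | A B where "p = A @ y # x # B" by blast
  then have "\<exists>p'. is_path p' a b E \<and> set p' = set p \<union> set r"
  proof cases
    case 1
    then show ?thesis using *[OF _ p r d] by blast
  next
    case 2
    have "{y, x} = {x, y}" by auto
    then show ?thesis using *[OF 2, of "rev r"] p is_path_rev[OF r] d by simp
  qed
  then show thesis using that by blast
qed

section \<open>Discs cut along a chord\<close>

context tri_sphere
begin

text \<open>The case of \<open>theta_split\<close> without inner vertices on the path; as both arcs
  do have inner vertices, the chord is no boundary edge.\<close>

lemma chord_split:
  assumes S: "S \<subseteq> T" and bdS: "bd S = cycle_edges (x # a @ y # b)" and dist: "distinct (x # a @ y # b)"
    and e: "{x, y} \<in> edges_of S" and ne: "a \<noteq> []" "b \<noteq> []"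
  obtains S1 S2 where "S = S1 \<union> S2" "S1 \<inter> S2 = {}" "bd S1 = cycle_edges (x # a @ [y])"
    "bd S2 = cycle_edges (x # y # b)" "S1 \<noteq> {}" "S2 \<noteq> {}"
proof -
  have "{x, y} \<notin> path_edges (x # a @ [y])" using consecutive_split[of "[]" x a y "[]"] dist ne by auto
  moreover have "{x, y} \<notin> path_edges (x # rev b @ [y])" using consecutive_split[of "[]" x "rev b" y "[]"] dist ne by auto
  ultimately have "{x, y} \<notin> bd S" unfolding bdS cycle_edges_theta by simp
  then show thesis using theta_split[OF S bdS dist, of "[]"] dist e that by auto
qed

text \<open>A vertex interior to one part has all its faces there and so does not occur in the
  other.\<close>

lemma common_vertices:
  assumes "S1 \<subseteq> T" "S2 \<subseteq> T" "S1 \<inter> S2 = {}"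
  shows "\<Union>S1 \<inter> \<Union>S2 \<subseteq> \<Union>(bd S1) \<inter> \<Union>(bd S2)"
proof
  fix v assume v: "v \<in> \<Union>S1 \<inter> \<Union>S2"
  then obtain f g where fg: "f \<in> S1" "v \<in> f" "g \<in> S2" "v \<in> g" by blast
  have "v \<in> \<Union>(bd S1)"
  proof (rule ccontr)
    assume "v \<notin> \<Union>(bd S1)"
    then have "g \<in> S1" using faces_at_interior_vertex[OF assms(1) _ fg(1,2) _ fg(4)] fg assms by blast
    then show False using fg assms by blast
  qed
  moreover have "v \<in> \<Union>(bd S2)"
  proof (rule ccontr)
    assume "v \<notin> \<Union>(bd S2)"
    then have "f \<in> S2" using faces_at_interior_vertex[OF assms(2) _ fg(3,4) _ fg(2)] fg assms by blast
    then show False using fg assms by blast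
  qed
  ultimately show "v \<in> \<Union>(bd S1) \<inter> \<Union>(bd S2)" by blast
qed

end

lemma boundary_edge_face:
  assumes "e \<in> bd S" obtains f where "f \<in> S" "e \<subseteq> f"
  using assms unfolding bd_def by blast

lemma Union_bd_subset: "\<Union>(bd S) \<subseteq> \<Union>S"
  unfolding bd_def by blast

section \<open>Spanning paths that leave out one or two boundary vertices\<close>

context flip_family
begin

lemma link_free_equiv: "flip_equiv T D S T' D' S' \<Longrightarrow> link_free D' S' Q \<longleftrightarrow> link_free D S Q"
  by (simp add: flip_equiv_def link_free_def)

lemma flip_equivD:
  assumes "flip_equiv T D S T' D' S'"
  shows "(T', D') \<in> St" "S' \<subseteq> T'" "card T' = card T" "card S' = card S" "bd S' = bd S" "\<Union>S' = \<Union>S"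
    "linked D' S' = linked D S" "e \<in> bd S' \<Longrightarrow> e \<in> D' \<Longrightarrow> f \<in> S' \<Longrightarrow> e \<subseteq> f \<Longrightarrow> f \<in> S"
  using assms unfolding flip_equiv_def by simp_all

text \<open>At most one flip inside \<open>S\<close> turns a link into an edge. Both faces it
  creates contain \<open>u\<close>, so every vertex that shared a face with a set \<open>X\<close>
  containing \<open>u\<close> still does.\<close>

lemma linked_make_edge:
  assumes st: "(T, D) \<in> St" and S: "S \<subseteq> T" and l: "linked D S u v"
  obtains T' D' S' where "flip_equiv T D S T' D' S'" "{u, v} \<in> edges_of S'"
    "\<And>X x f. u \<in> X \<Longrightarrow> f \<in> S \<Longrightarrow> x \<in> f \<Longrightarrow> f \<inter> X \<noteq> {} \<Longrightarrow> \<exists>f'\<in>S'. x \<in> f' \<and> f' \<inter> X \<noteq> {}"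
proof -
  have uv: "u \<noteq> v" using l by (simp add: linked_def)
  consider f where "f \<in> S" "u \<in> f" "v \<in> f" | a b where "quad S D a b u v" using l unfolding linked_def by blast
  then show thesis
  proof cases
    case (1 f)
    then have "{u, v} \<in> edges_of S" using uv by (auto intro: edges_ofI)
    then show ?thesis using that[OF flip_equiv_refl[OF st S]] by blast
  next
    case (2 a b)
    have "{u, v} \<in> edges_of (flip S a b u v)" using uv by (intro edges_ofI[of "{u, v, a}"]) (auto simp: flip_def)
    moreover have "\<exists>f'\<in>flip S a b u v. x \<in> f' \<and> f' \<inter> X \<noteq> {}" if "u \<in> X" "f \<in> S" "x \<in> f" "f \<inter> X \<noteq> {}" for X x f
    proof (cases "f \<in> {{a, b, u}, {a, b, v}}")
      case True
      then have "x \<in> {u, v, a} \<or> x \<in> {u, v, b}" using that by auto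
      moreover have "{u, v, a} \<in> flip S a b u v" "{u, v, b} \<in> flip S a b u v" by (auto simp: flip_def)
      moreover have "{u, v, a} \<inter> X \<noteq> {}" "{u, v, b} \<inter> X \<noteq> {}" using that by auto
      ultimately show ?thesis by metis
    next
      case False
      then have "f \<in> flip S a b u v" using that by (simp add: flip_def)
      then show ?thesis using that by blast
    qed
    ultimately show ?thesis by (rule that[OF flip_equiv_flip[OF st S 2]])
  qed
qed

text \<open>A version of Whitney's lemma on Hamiltonian cycles of triangulations without separating triangles, in which
  chords are replaced by links. The boundary of the disc consists of three arcs without links; \<open>P\<close> may be empty.\<close>

definition two_paths :: "nat \<Rightarrow> bool" where
  "two_paths n \<longleftrightarrow> (\<forall>T D S Q1 Q2 P. (T, D) \<in> St \<longrightarrow> S \<subseteq> T \<longrightarrow> card S = n \<longrightarrow> Suc n < card T \<longrightarrow>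
     distinct (Q1 @ Q2 @ P) \<longrightarrow> 3 \<le> length (Q1 @ Q2 @ P) \<longrightarrow> bd S = cycle_edges (Q1 @ Q2 @ P) \<longrightarrow>
     Q1 \<noteq> [] \<longrightarrow> Q2 \<noteq> [] \<longrightarrow> link_free D S Q1 \<longrightarrow> link_free D S Q2 \<longrightarrow> link_free D S (last Q2 # P @ [hd Q1]) \<longrightarrow>
     \<not> (length Q1 = 1 \<and> length Q2 = 1) \<longrightarrow>
     (\<exists>p1 p2. is_path p1 (hd Q1) (last Q1) (H \<union> bd S) \<and> is_path p2 (hd Q2) (last Q2) (H \<union> bd S) \<and>
        set p1 \<inter> set p2 = {} \<and> set p1 \<union> set p2 = \<Union>S))"

lemma two_pathsD:
  assumes "two_paths (card S)" "(T, D) \<in> St" "S \<subseteq> T" "Suc (card S) < card T"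
     "distinct (Q1 @ Q2 @ P)" "3 \<le> length (Q1 @ Q2 @ P)" "bd S = cycle_edges (Q1 @ Q2 @ P)"
     "Q1 \<noteq> []" "Q2 \<noteq> []" "link_free D S Q1" "link_free D S Q2" "link_free D S (last Q2 # P @ [hd Q1])"
     "\<not> (length Q1 = 1 \<and> length Q2 = 1)"
  obtains p1 p2 where "is_path p1 (hd Q1) (last Q1) (H \<union> bd S)" "is_path p2 (hd Q2) (last Q2) (H \<union> bd S)"
        "set p1 \<inter> set p2 = {}" "set p1 \<union> set p2 = \<Union>S"
proof -
  have "\<exists>p1 p2. is_path p1 (hd Q1) (last Q1) (H \<union> bd S) \<and> is_path p2 (hd Q2) (last Q2) (H \<union> bd S) \<and>
        set p1 \<inter> set p2 = {} \<and> set p1 \<union> set p2 = \<Union>S"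
    by (rule assms(1)[unfolded two_paths_def, rule_format, of T D S Q1 Q2 P]) (use assms(2-) in simp_all)
  then obtain p1 p2 where "is_path p1 (hd Q1) (last Q1) (H \<union> bd S)" "is_path p2 (hd Q2) (last Q2) (H \<union> bd S)"
        "set p1 \<inter> set p2 = {}" "set p1 \<union> set p2 = \<Union>S" by metis
  then show thesis by (rule that)
qed

text \<open>The face alone already has the boundary of \<open>S\<close>, so the rest of
  \<open>S\<close> has empty boundary; it misses a face and is therefore empty.\<close>

lemma remove_triangle_empty:
  assumes st: "(T, D) \<in> St" and S: "S \<subseteq> T" and f: "{a, b, c} \<in> S" and b: "bd S = cycle_edges [a, b, c]"
  shows "S = {{a, b, c}}"
proof -
  interpret tri_sphere T by (rule sphere[OF st])
  have fT: "{a, b, c} \<in> T" using f S by auto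
  have "bd {{a, b, c}} = bd S" unfolding bd_face[OF fT] b by (auto simp: cycle_edges_def)
  then have "bd (S - {{a, b, c}}) = {}" using bd_Diff[of "{{a, b, c}}" S] f S by auto
  then have "S - {{a, b, c}} = {} \<or> S - {{a, b, c}} = T"
    using bd_eq_empty[of "S - {{a, b, c}}"] S by blast
  then show ?thesis using f fT by auto
qed

text \<open>The boundary triangle is a face on one side or the other. The bound on
  \<open>card S\<close> excludes that \<open>S\<close> is everything except this face.\<close>

lemma triangle_disc:
  assumes st: "(T, D) \<in> St" and S: "S \<subseteq> T" and b: "bd S = cycle_edges [x, y, z]" and c: "Suc (card S) < card T"
  shows "S = {{x, y, z}}"
proof -
  interpret tri_sphere T by (rule sphere[OF st])
  have "bd S = {{x, y}, {y, z}, {x, z}}" unfolding b by (auto simp: cycle_edges_def)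
  then have "{x, y} \<in> edges_of T" "{y, z} \<in> edges_of T" "{x, z} \<in> edges_of T" using bd_sub_edges[OF S] by auto
  then have f: "{x, y, z} \<in> T" using triangle_face[OF st] by blast
  show ?thesis
  proof (cases "{x, y, z} \<in> S")
    case True
    then show ?thesis by (rule remove_triangle_empty[OF st S _ b])
  next
    case False
    have "bd {{x, y, z}} = bd S" unfolding bd_face[OF f] b by (auto simp: cycle_edges_def)
    then have "bd (S \<union> {{x, y, z}}) = {}" using bd_disjoint_Un[of S "{{x, y, z}}"] False S f by auto
    then have "S \<union> {{x, y, z}} = T" using bd_eq_empty[of "S \<union> {{x, y, z}}"] S f by auto
    then have "card T \<le> card S + 1" by (metis card_Un_le card.empty card_insert_disjoint empty_iff finite.emptyI One_nat_def)
    then show ?thesis using c by simp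
  qed
qed

text \<open>The apex \<open>w\<close> is removed with its fan. In the rest, \<open>two_paths\<close>
  yields a path with the ends of \<open>q0 # rev Ps\<close> and one with the ends of
  \<open>rev M @ [y]\<close>, and a link edge of \<open>w\<close> joins them to a single path from
  the first to the last vertex of \<open>Qs\<close>.\<close>

lemma cone_path:
  assumes IH: "\<And>m. m < card S \<Longrightarrow> two_paths m"
    and st: "(T, D) \<in> St" and S: "S \<subseteq> T" and cS: "Suc (card S) < card T"
    and bdS: "bd S = cycle_edges (Qs @ w # Ps)" and dist: "distinct (Qs @ w # Ps)"
    and len: "3 \<le> length (Qs @ w # Ps)" and Qne: "Qs \<noteq> []"
    and lQ: "link_free D S Qs" and lP: "link_free D S (w # Ps @ [hd Qs])"
    and nl: "\<And>A r B. Qs = A @ r # B \<Longrightarrow> A \<noteq> [] \<Longrightarrow> B \<noteq> [] \<Longrightarrow> \<not> linked D S w r"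
  obtains p where "is_path p (hd Qs) (last Qs) (H \<union> bd S)" "set p = \<Union>S - {w}"
proof -
  obtain T' D' S' where eq: "flip_equiv T D S T' D' S'" and nm: "normal D' S' {w}"
    by (rule exists_normal[OF st S])
  note e = flip_equivD[OF eq]
  interpret tri_sphere T' by (rule sphere[OF e(1)])
  define R where "R = Ps @ Qs"
  have bdR: "bd S' = cycle_edges (w # R)" unfolding e(5) bdS R_def using cycle_edges_commute[of Qs "w # Ps"] by simp
  have dR: "distinct (w # R)" using dist by (auto simp: R_def)
  have lR: "2 \<le> length R" using len by (simp add: R_def)
  obtain y where y: "last Qs = y" by blast
  obtain q0 Qt where Qs: "Qs = q0 # Qt" using Qne by (cases Qs) auto
  have yR: "last R = y" using Qne y by (simp add: R_def)
  have Qt: "Qt \<noteq> []"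
  proof
    assume "Qt = []"
    then have Q1: "Qs = [y]" using Qs y by simp
    then have P: "Ps \<noteq> []" using len by auto
    have "{y, w} \<in> bd S" unfolding bdS using Q1 by (simp add: cycle_edges_Cons)
    then obtain f where "f \<in> S" "{y, w} \<subseteq> f" by (rule boundary_edge_face)
    then have "linked D S w y" using dist Q1 by (auto intro: linked_face)
    then show False using link_freeD[of D S "[]" w Ps y "[]"] lP P Q1 by simp
  qed
  define I where "I = butlast Qt"
  have QI: "Qs = q0 # I @ [y]" using Qs Qt y I_def by (metis append_butlast_last_id last_ConsR)
  have nlR: "\<not> linked D' S' w r" if AB: "R = A @ r # B" "A \<noteq> []" "B \<noteq> []" for A r B
  proof -
    have "Ps @ Qs = A @ r # B" using AB R_def by simp
    then obtain us where us: "Ps = A @ us \<and> us @ Qs = r # B \<or> Ps @ us = A \<and> Qs = us @ r # B"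
      by (auto simp: append_eq_append_conv2)
    then have "\<not> linked D S w r"
    proof
      assume u: "Ps = A @ us \<and> us @ Qs = r # B"
      show ?thesis
      proof (cases us)
        case Nil
        then have "r = hd Qs" "Ps = A" using u Qs by auto
        then show ?thesis using link_freeD[of D S "[]" w A r "[]"] lP AB by simp
      next
        case (Cons r' us')
        then have "w # Ps @ [hd Qs] = [] @ w # A @ r # (us' @ [hd Qs])" using u by simp
        then show ?thesis using link_freeD[of D S "[]" w A r] lP AB by metis
      qed
    next
      assume u: "Ps @ us = A \<and> Qs = us @ r # B"
      show ?thesis
      proof (cases us)
        case Nil
        then have "r = hd Qs" "Ps = A" using u by auto
        then show ?thesis using link_freeD[of D S "[]" w A r "[]"] lP AB by simp
      next
        case (Cons a list)
        then show ?thesis using nl[of us r B] u AB by simp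
      qed
    qed
    then show ?thesis using e(7) by simp
  qed
  obtain M where M: "distinct (w # R @ M)" "insert w ` path_edges (last R # M @ [hd R]) = {f \<in> S'. w \<in> f}"
    "path_edges (last R # M @ [hd R]) \<subseteq> H \<union> bd S'"
    "3 \<le> length (R @ M) \<Longrightarrow> bd (S' - {f \<in> S'. w \<in> f}) = cycle_edges (R @ M)"
    "\<And>X b Y c Z. last R # M @ [hd R] = X @ b # Y @ c # Z \<Longrightarrow> Y \<noteq> [] \<Longrightarrow> linked D' (S' - {f \<in> S'. w \<in> f}) b c \<Longrightarrow> X = [] \<and> Z = []"
    by (rule fan_at_boundary_vertex[OF e(1,2) bdR dR lR nlR nm]) blast+
  let ?S0 = "S' - {f \<in> S'. w \<in> f}"
  define A where "A = hd R"
  have fin: "finite S'" using e(2) by blast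
  have ne: "{f \<in> S'. w \<in> f} \<noteq> {}" using M(2) by (cases M) auto
  have "?S0 \<subset> S'" using ne by blast
  then have c0: "card ?S0 < card S" using psubset_card_mono[OF fin] e(4) by simp
  show thesis
  proof (cases "3 \<le> length (R @ M)")
    \<comment> \<open>The remainder has too short a boundary to be a disc: \<open>S\<close> is the
      single triangle on \<open>w\<close> and the two vertices of \<open>Qs\<close>.\<close>
    case False
    then have M0: "M = []" and R2: "length R = 2" using lR by (cases M; simp)+
    then have P0: "Ps = []" "I = []" using QI by (auto simp: R_def)
    then have Qs2: "Qs = [q0, y]" "R = [q0, y]" using QI by (auto simp: R_def)
    have "{w, q0, y} \<in> S'" using M(2) M0 Qs2 by (auto simp: insert_commute)
    then have "S' = {{w, q0, y}}" using remove_triangle_empty[OF e(1,2)] bdR Qs2 by blast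
    then have "\<Union>S = {w, q0, y}" using e(6) by auto
    moreover have "{q0, y} \<in> bd S" unfolding bdS Qs2 by (simp add: cycle_edges_Cons)
    moreover have "w \<noteq> q0" "w \<noteq> y" "q0 \<noteq> y" using dR Qs2 by auto
    ultimately show ?thesis by (intro that[of "[q0, y]"]) (auto simp: is_path_def Qs2)
  next
    case True
    note bd0 = M(4)[OF True]
    \<comment> \<open>The boundary is traversed backwards, so that the arc along \<open>Ps\<close>
      is followed immediately by the link path, and the inner vertices of \<open>Qs\<close> form the
      third arc.\<close>
    let ?Q1 = "q0 # rev Ps" and ?Q2 = "rev M @ [y]" and ?P = "rev I"
    have cyc: "cycle_edges (R @ M) = cycle_edges (?Q1 @ ?Q2 @ ?P)"
    proof -
      have "cycle_edges (R @ M) = cycle_edges (rev (R @ M))" by (simp only: cycle_edges_rev)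
      also have "rev (R @ M) = (rev M @ [y] @ rev I) @ (q0 # rev Ps)" by (simp add: R_def QI)
      also have "cycle_edges \<dots> = cycle_edges ((q0 # rev Ps) @ (rev M @ [y] @ rev I))" by (rule cycle_edges_commute)
      finally show ?thesis by simp
    qed
    have S0S: "?S0 \<subseteq> S'" by auto
    have lf: "link_free D' ?S0 Q" if "link_free D S Q" for Q
      using link_free_mono[OF _ S0S] link_free_equiv[OF eq] that by blast
    have l1: "link_free D' ?S0 ?Q1"
    proof -
      have "link_free D S (Ps @ [q0])" using lP link_free_suffix[of D S "[w]"] Qs by simp
      then have "link_free D S (rev (Ps @ [q0]))" by (simp only: link_free_rev)
      then show ?thesis using lf by simp
    qed
    have l2: "link_free D' ?S0 ?Q2"
    proof -
      have "link_free D' ?S0 (y # M)" unfolding link_free_def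
      proof (intro allI impI notI)
        fix X b Y c Z assume a: "y # M = X @ b # Y @ c # Z" "Y \<noteq> []" "linked D' ?S0 b c"
        then have "last R # M @ [hd R] = X @ b # Y @ c # (Z @ [hd R])" using yR by simp
        from M(5)[OF this a(2,3)] show False by simp
      qed
      then have "link_free D' ?S0 (rev (y # M))" by (simp only: link_free_rev)
      then show ?thesis by simp
    qed
    have l3: "link_free D' ?S0 (last ?Q2 # ?P @ [hd ?Q1])"
    proof -
      have "link_free D' ?S0 (rev Qs)" using lf[OF lQ] by (simp only: link_free_rev)
      then show ?thesis by (simp add: QI)
    qed
    \<comment> \<open>If both arcs were single vertices, the fan would consist of the face on
      \<open>w\<close>, \<open>q0\<close> and \<open>y\<close>, which would link the ends of
      \<open>Qs\<close>.\<close>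
    have nb: "\<not> (length ?Q1 = 1 \<and> length ?Q2 = 1)"
    proof
      assume "length ?Q1 = 1 \<and> length ?Q2 = 1"
      then have "Ps = []" "M = []" by auto
      then have I: "I \<noteq> []" "hd R = q0" using True by (auto simp: R_def QI)
      have "insert w {y, q0} \<in> S'" using M(2) \<open>M = []\<close> yR I by auto
      moreover have "q0 \<noteq> y" using dist QI by simp
      ultimately have "linked D' S' q0 y" by (auto intro: linked_face)
      then show False using link_freeD[of D S "[]" q0 I y "[]"] lQ QI I e(7) by simp
    qed
    have dd: "distinct (?Q1 @ ?Q2 @ ?P)" using M(1) by (auto simp: R_def QI)
    have ll: "3 \<le> length (?Q1 @ ?Q2 @ ?P)" using True by (simp add: R_def QI)
    obtain p1 p2 where p: "is_path p1 (hd ?Q1) (last ?Q1) (H \<union> bd ?S0)" "is_path p2 (hd ?Q2) (last ?Q2) (H \<union> bd ?S0)"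
        "set p1 \<inter> set p2 = {}" "set p1 \<union> set p2 = \<Union>?S0"
    proof (rule two_pathsD[OF IH[OF c0] e(1) _ _ dd ll _ _ _ l1 l2 l3 nb])
      show "?S0 \<subseteq> T'" using e(2) by auto
      show "Suc (card ?S0) < card T'" using c0 cS e(3) by simp
      show "bd ?S0 = cycle_edges (?Q1 @ ?Q2 @ ?P)" using bd0 cyc by simp
    qed auto
    have A1: "last ?Q1 = A" unfolding A_def R_def Qs by (cases Ps) auto
    have join: "{A, hd ?Q2} \<in> path_edges (last R # M @ [hd R])"
    proof (cases M rule: rev_cases)
      case Nil
      then show ?thesis using yR by (simp add: A_def insert_commute)
    next
      case (snoc M' m)
      then show ?thesis using path_edges_mem[of m "hd R" "last R # M'" "[]"] by (simp add: A_def insert_commute)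
    qed
    \<comment> \<open>The smaller boundary consists of old boundary edges and of link edges, which
      normality has made real.\<close>
    have bd0s: "bd ?S0 \<subseteq> H \<union> bd S"
    proof -
      have "cycle_edges (R @ M) \<subseteq> path_edges R \<union> path_edges (last R # M @ [hd R])"
      proof (cases "M = []")
        case True
        then show ?thesis using lR by (cases R) (auto simp: cycle_edges_eq)
      next
        case False
        then show ?thesis using lR cycle_edges_append[of R M] by (cases R) (auto simp: path_edges_Cons path_edges_append)
      qed
      moreover have "path_edges R \<subseteq> bd S'" unfolding bdR cycle_edges_Cons using path_edges_infix[of R "[w]" "[w]"] by simp
      ultimately show ?thesis using bd0 M(3) e(5) by blast
    qed
    have E: "H \<union> bd ?S0 \<subseteq> H \<union> bd S" using bd0s by auto
    have "is_path (p1 @ p2) (hd ?Q1) (last ?Q2) (H \<union> bd S)"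
      by (rule is_path_append[OF is_path_mono[OF p(1) E] is_path_mono[OF p(2) E]])
         (use A1 join M(3) e(5) p(3) in auto)
    moreover have "set (p1 @ p2) = \<Union>S - {w}"
    proof -
      have "\<Union>?S0 = \<Union>S' - {w}"
      proof
        show "\<Union>?S0 \<subseteq> \<Union>S' - {w}" by auto
        show "\<Union>S' - {w} \<subseteq> \<Union>?S0"
        proof
          fix x assume x: "x \<in> \<Union>S' - {w}"
          show "x \<in> \<Union>?S0"
          proof (cases "x \<in> set (R @ M)")
            case True
            then have "x \<in> \<Union>(bd ?S0)" unfolding bd0 Union_cycle_edges .
            then show ?thesis using Union_bd_subset[of ?S0] by blast
          next
            case False
            obtain f where f: "f \<in> S'" "x \<in> f" using x by blast
            have "w \<notin> f"
            proof
              assume "w \<in> f"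
              then have "f \<in> insert w ` path_edges (last R # M @ [hd R])" using M(2) f by blast
              then obtain d where d: "d \<in> path_edges (last R # M @ [hd R])" "f = insert w d" by blast
              have "x \<in> d" using d f x by auto
              then have "x \<in> set (last R # M @ [hd R])" using path_edges_subset[OF d(1)] by blast
              moreover have "last R \<in> set R" "hd R \<in> set R" using lR by (cases R; auto)+
              ultimately show False using False by auto
            qed
            then show ?thesis using f by blast
          qed
        qed
      qed
      then show ?thesis using p(4) e(6) by simp
    qed
    ultimately show ?thesis using that[of "p1 @ p2"] QI by simp
  qed
qed

text \<open>First \<open>m\<close> goes with its fan, then \<open>n\<close> serves as apex of
  \<open>cone_path\<close> in what remains, with the boundary traversed backwards. The conditions on
  \<open>m\<close> and \<open>n\<close> express that no link cuts the pocket further.\<close>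

lemma pocket_path:
  assumes IH: "\<And>m. m < card S \<Longrightarrow> two_paths m"
    and st: "(T, D) \<in> St" and S: "S \<subseteq> T" and cS: "Suc (card S) < card T"
    and bdS: "bd S = cycle_edges (Q @ [m, n])" and dist: "distinct (Q @ [m, n])" and Qne: "Q \<noteq> []"
    and lQ: "link_free D S Q"
    and lm: "\<And>q. q \<in> set Q \<Longrightarrow> linked D S q m \<Longrightarrow> q = last Q"
    and ln: "\<And>q. q \<in> set Q \<Longrightarrow> linked D S q n \<Longrightarrow> q = hd Q"
  obtains p where "is_path p (hd Q) (last Q) (H \<union> bd S)" "set p = \<Union>S - {m, n}"
proof (cases "tl Q = []")
  case True
  then obtain q where Q: "Q = [q]" using Qne by (cases Q) auto
  have "S = {{q, m, n}}" using triangle_disc[OF st S _ cS, of q m n] bdS Q by simp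
  then have "\<Union>S - {m, n} = {q}" using dist Q by auto
  then show ?thesis by (intro that[of "[q]"]) (auto simp: is_path_def Q)
next
  case False
  have hl: "hd Q \<noteq> last Q" using False dist by (cases Q) (auto split: if_splits)
  obtain T' D' S' where eq: "flip_equiv T D S T' D' S'" and nm: "normal D' S' {m}"
    by (rule exists_normal[OF st S])
  note e = flip_equivD[OF eq]
  interpret tri_sphere T' by (rule sphere[OF e(1)])
  let ?R = "n # Q"
  have bdR: "bd S' = cycle_edges (m # ?R)" unfolding e(5) bdS using cycle_edges_commute[of Q "[m, n]"] by simp
  have dR: "distinct (m # ?R)" using dist by auto
  have lR: "2 \<le> length ?R" using Qne by (cases Q) auto
  have lastR: "last ?R = last Q" using Qne by simp
  have nlR: "\<not> linked D' S' m r" if AB: "?R = A @ r # B" "A \<noteq> []" "B \<noteq> []" for A r B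
  proof
    assume "linked D' S' m r"
    then have "linked D S r m" using e(7) linked_commute by metis
    moreover obtain A' where A': "A = n # A'" "Q = A' @ r # B" using AB by (cases A) auto
    ultimately have "r = last Q" using lm[of r] by auto
    then show False using A' AB dist by auto
  qed
  obtain M where M: "distinct (m # ?R @ M)" "insert m ` path_edges (last ?R # M @ [hd ?R]) = {f \<in> S'. m \<in> f}"
    "path_edges (last ?R # M @ [hd ?R]) \<subseteq> H \<union> bd S'"
    "3 \<le> length (?R @ M) \<Longrightarrow> bd (S' - {f \<in> S'. m \<in> f}) = cycle_edges (?R @ M)"
    "\<And>X b Y c Z. last ?R # M @ [hd ?R] = X @ b # Y @ c # Z \<Longrightarrow> Y \<noteq> [] \<Longrightarrow> linked D' (S' - {f \<in> S'. m \<in> f}) b c \<Longrightarrow> X = [] \<and> Z = []"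
    by (rule fan_at_boundary_vertex[OF e(1,2) bdR dR lR nlR nm]) blast+
  let ?S0 = "S' - {f \<in> S'. m \<in> f}"
  have fin: "finite S'" using e(2) by blast
  have ne: "{f \<in> S'. m \<in> f} \<noteq> {}" using M(2) by (cases M) auto
  have "?S0 \<subset> S'" using ne by blast
  then have c0: "card ?S0 < card S" using psubset_card_mono[OF fin] e(4) by simp
  have len3: "3 \<le> length (?R @ M)" using False Qne by (cases Q; cases "tl Q") auto
  note bd0 = M(4)[OF len3]
  have S0S: "?S0 \<subseteq> S'" by auto
  have lf: "link_free D' ?S0 Q" using link_free_mono[OF _ S0S] link_free_equiv[OF eq] lQ by blast
  have lkS: "linked D S a b" if "linked D' ?S0 a b" for a b using linked_mono[OF that S0S] e(7) by simp
  have "is_path p a b (H \<union> bd S)" if "is_path p a b (H \<union> bd ?S0)" for p a b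
  proof -
    have "bd ?S0 \<subseteq> path_edges ?R \<union> path_edges (last ?R # M @ [hd ?R])"
    proof (cases "M = []")
      case True
      then show ?thesis unfolding bd0 by (auto simp: cycle_edges_eq)
    next
      case False
      then show ?thesis using bd0 cycle_edges_append[of ?R M] by (auto simp: path_edges_Cons path_edges_append)
    qed
    moreover have "path_edges ?R \<subseteq> bd S'" unfolding bdR cycle_edges_Cons using path_edges_infix[of ?R "[m]" "[m]"] by simp
    ultimately have "bd ?S0 \<subseteq> H \<union> bd S" using M(3) e(5) by blast
    then show ?thesis using is_path_mono[OF that] by blast
  qed
  note lift = this
  have cyc: "cycle_edges (?R @ M) = cycle_edges (rev Q @ n # rev M)"
  proof -
    have "cycle_edges (?R @ M) = cycle_edges (rev (?R @ M))" by (simp only: cycle_edges_rev)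
    also have "rev (?R @ M) = rev M @ (rev Q @ [n])" by simp
    also have "cycle_edges \<dots> = cycle_edges ((rev Q @ [n]) @ rev M)" by (rule cycle_edges_commute)
    finally show ?thesis by simp
  qed
  obtain p where p: "is_path p (hd (rev Q)) (last (rev Q)) (H \<union> bd ?S0)" "set p = \<Union>?S0 - {n}"
  proof (rule cone_path[of ?S0 T' D' "rev Q" n "rev M"])
    show "two_paths k" if "k < card ?S0" for k using IH that c0 by simp
    show "?S0 \<subseteq> T'" using e(2) by auto
    show "Suc (card ?S0) < card T'" using c0 cS e(3) by simp
    show "bd ?S0 = cycle_edges (rev Q @ n # rev M)" using bd0 cyc by simp
    show "distinct (rev Q @ n # rev M)" using M(1) by auto
    show "3 \<le> length (rev Q @ n # rev M)" using len3 by simp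
    show "link_free D' ?S0 (rev Q)" using lf by simp
    \<comment> \<open>The only link that the fan at \<open>m\<close> permits is the one between
      \<open>last Q\<close> and \<open>n\<close>; it is excluded because \<open>n\<close> is linked
      to \<open>hd Q\<close> alone.\<close>
    have "link_free D' ?S0 (last Q # M @ [n])" unfolding link_free_def
    proof (intro allI impI notI)
      fix X b Y c Z assume a: "last Q # M @ [n] = X @ b # Y @ c # Z" "Y \<noteq> []" "linked D' ?S0 b c"
      have "last ?R # M @ [hd ?R] = X @ b # Y @ c # Z" using a(1) lastR by simp
      from M(5)[OF this a(2,3)] have "X = [] \<and> Z = []" .
      then have "b = last Q" "c = n" using a(1) by auto
      then have "last Q = hd Q" using ln[of "last Q"] lkS[OF a(3)] Qne by simp
      then show False using hl by simp
    qed
    then have "link_free D' ?S0 (rev (last Q # M @ [n]))" by (simp only: link_free_rev)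
    then show "link_free D' ?S0 (n # rev M @ [hd (rev Q)])" using Qne by (simp add: hd_rev)
    fix A r B assume AB: "rev Q = A @ r # B" "A \<noteq> []" "B \<noteq> []"
    then have Qr: "Q = rev B @ r # rev A" using rev_swap[of Q "A @ r # B"] by simp
    show "\<not> linked D' ?S0 n r"
    proof
      assume "linked D' ?S0 n r"
      then have "linked D S r n" using lkS linked_commute by metis
      then have "r = hd Q" using ln[of r] Qr by auto
      moreover have "hd Q \<in> set (rev B)" using Qr AB(3) hd_in_set[of "rev B"] by simp
      moreover have "distinct Q" using dist by simp
      ultimately show False unfolding Qr by simp
    qed
  qed (use e(1) Qne in auto)
  have P1: "is_path (rev p) (hd Q) (last Q) (H \<union> bd S)"
    using lift[OF is_path_rev[OF p(1)]] Qne by (simp add: hd_rev last_rev)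
  have P2: "set (rev p) = \<Union>S - {m, n}"
  proof -
    have "\<Union>?S0 = \<Union>S' - {m}"
    proof
      show "\<Union>?S0 \<subseteq> \<Union>S' - {m}" by auto
      show "\<Union>S' - {m} \<subseteq> \<Union>?S0"
      proof
        fix x assume x: "x \<in> \<Union>S' - {m}"
        show "x \<in> \<Union>?S0"
        proof (cases "x \<in> set (?R @ M)")
          case True
          then have "x \<in> \<Union>(bd ?S0)" unfolding bd0 Union_cycle_edges .
          then show ?thesis using Union_bd_subset[of ?S0] by blast
        next
          case False
          obtain f where f: "f \<in> S'" "x \<in> f" using x by blast
          have "m \<notin> f"
          proof
            assume "m \<in> f"
            then have "f \<in> insert m ` path_edges (last ?R # M @ [hd ?R])" using M(2) f by blast
            then obtain d where d: "d \<in> path_edges (last ?R # M @ [hd ?R])" "f = insert m d" by blast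
            have "x \<in> d" using d f x by auto
            then have "x \<in> set (last ?R # M @ [hd ?R])" using path_edges_subset[OF d(1)] by blast
            then show False using False Qne by (auto split: if_splits)
          qed
          then show ?thesis using f by blast
        qed
      qed
    qed
    then show ?thesis using p(2) e(6) by auto
  qed
  show ?thesis by (rule that[OF P1 P2])
qed

text \<open>Used when a path beyond the pocket runs along the optional edge \<open>{m, n}\<close>.
  With the face on \<open>m\<close>, \<open>n\<close>, \<open>z\<close> cut off, the rest is a disc
  with the arcs \<open>m\<close>, \<open>z\<close>, \<open>n\<close> and \<open>Q\<close>; the path
  that \<open>two_paths\<close> finds from \<open>m\<close> to \<open>n\<close> is the detour that
  replaces the edge.\<close>

lemma pocket_two_paths:
  assumes IH: "\<And>m. m < card S \<Longrightarrow> two_paths m"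
    and st: "(T, D) \<in> St" and S: "S \<subseteq> T" and cS: "Suc (card S) < card T"
    and bdS: "bd S = cycle_edges (Q @ [m, n])" and dist: "distinct (Q @ [m, n])" and Qne: "Q \<noteq> []"
    and lQ: "link_free D S Q"
    and f: "{m, n, z} \<in> S" "z \<notin> set Q" and mnD: "{m, n} \<in> D"
  obtains p1 p2 where "is_path p1 (hd Q) (last Q) (H \<union> path_edges Q)" "is_path p2 m n (H \<union> path_edges Q)"
    "set p1 \<inter> set p2 = {}" "set p1 \<union> set p2 = \<Union>S"
proof -
  interpret tri_sphere T by (rule sphere[OF st])
  have fT: "{m, n, z} \<in> T" using f S by auto
  have d: "m \<noteq> n" "m \<noteq> z" "n \<noteq> z" using face_distinct[OF fT] by auto
  let ?S0 = "S - {{m, n, z}}"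
  have mn: "{m, n} \<in> bd S" unfolding bdS using Qne by (auto simp: cycle_edges_append)
  have bdS0: "bd ?S0 = cycle_edges ([m, z, n] @ Q)"
  proof -
    have "bd ?S0 = sym_diff (bd S) (bd {{m, n, z}})" by (rule bd_Diff) (use f S in auto)
    also have "\<dots> = sym_diff (bd S) {{m, n}, {m, z}, {n, z}}" by (simp only: bd_face[OF fT])
    also have "\<dots> = bd S - {{m, n}} \<union> {{m, z}, {n, z}}"
    proof -
      have "{m, z} \<notin> bd S" "{n, z} \<notin> bd S"
        unfolding bdS using cycle_edges_subset[of _ "Q @ [m, n]"] f(2) d by auto
      moreover have "{m, n} \<noteq> {m, z}" "{m, n} \<noteq> {n, z}" using d by (auto simp: doubleton_eq_iff)
      ultimately show ?thesis using mn by auto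
    qed
    also have "\<dots> = cycle_edges ([m, z, n] @ Q)"
    proof -
      have "bd S = path_edges Q \<union> {{m, n}, {last Q, m}, {n, hd Q}}"
        unfolding bdS using Qne by (auto simp: cycle_edges_append)
      moreover have "{m, n} \<notin> path_edges Q" using path_edges_subset[of "{m, n}" Q] dist by auto
      moreover have "last Q \<in> set Q" "hd Q \<in> set Q" using Qne by auto
      then have "{m, n} \<noteq> {last Q, m}" "{m, n} \<noteq> {n, hd Q}" using dist by (auto simp: doubleton_eq_iff)
      moreover have "cycle_edges ([m, z, n] @ Q) = path_edges [m, z, n] \<union> path_edges Q \<union> {{last [m, z, n], hd Q}, {last Q, hd [m, z, n]}}"
        by (rule cycle_edges_append) (use Qne in auto)
      ultimately show ?thesis by (auto simp: insert_commute)
    qed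
    finally show ?thesis .
  qed
  have S0S: "?S0 \<subseteq> S" by auto
  have c0: "card ?S0 < card S" using psubset_card_mono[of S ?S0] f S by auto
  \<comment> \<open>A link between \<open>m\<close> and \<open>n\<close> would need a second face of
    \<open>S\<close> at the boundary edge \<open>{m, n}\<close>, or a quadrilateral with
    \<open>m\<close> and \<open>n\<close> as opposite vertices, which are never adjacent.\<close>
  have l1: "link_free D ?S0 [m, z, n]" unfolding link_free_def
  proof (intro allI impI notI)
    fix A x B y C assume a: "[m, z, n] = A @ x # B @ y # C" "B \<noteq> []" "linked D ?S0 x y"
    then have "x = m \<and> y = n" by (auto simp: Cons_eq_append_conv append_eq_Cons_conv)
    then have l: "linked D ?S0 m n" using a by simp
    then consider g where "g \<in> ?S0" "m \<in> g" "n \<in> g" | a b where "quad ?S0 D a b m n" unfolding linked_def by blast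
    then show False
    proof cases
      case (1 g)
      have "g \<in> S" "{m, n} \<subseteq> g" "g \<noteq> {m, n, z}" using 1 by auto
      then show False using mn f(1) unfolding bd_def by blast
    next
      case (2 a b)
      then have "quad T D a b m n" by (rule quad_mono) (use S in auto)
      then have "{m, n} \<notin> edges_of T" by (rule opposite_nonedge[OF st])
      then show False using edges_face[OF fT] by simp
    qed
  qed
  have dd: "distinct ([m, z, n] @ Q @ [])" using dist f(2) d by auto
  have ll: "3 \<le> length ([m, z, n] @ Q @ [])" by simp
  obtain p1 p2 where p: "is_path p1 (hd [m, z, n]) (last [m, z, n]) (H \<union> bd ?S0)" "is_path p2 (hd Q) (last Q) (H \<union> bd ?S0)"
        "set p1 \<inter> set p2 = {}" "set p1 \<union> set p2 = \<Union>?S0"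
  proof (rule two_pathsD[OF IH[OF c0] st _ _ dd ll _ _ _ l1 link_free_mono[OF lQ S0S]])
    show "link_free D ?S0 (last Q # [] @ [hd [m, z, n]])" by (rule link_free_short) simp
  qed (use S c0 cS bdS0 Qne in auto)
  have U: "\<Union>?S0 = \<Union>S"
  proof -
    have "{m, z, n} \<subseteq> \<Union>?S0" using Union_bd_subset[of ?S0] unfolding bdS0 Union_cycle_edges by auto
    moreover have "\<Union>S = \<Union>?S0 \<union> {m, n, z}" using f(1) by auto
    ultimately show ?thesis by blast
  qed
  have "hd Q \<in> set p2" "last Q \<in> set p2" "m \<in> set p1" "n \<in> set p1"
    using is_path_ends[OF p(1)] is_path_ends[OF p(2)] by auto
  have bdE: "bd ?S0 = path_edges Q \<union> {{m, z}, {z, n}, {last Q, m}, {n, hd Q}}"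
    unfolding bdS0 using Qne cycle_edges_append[of "[m, z, n]" Q] by auto
  \<comment> \<open>The face contains the diagonal \<open>{m, n}\<close> and hence no other
    one.\<close>
  have zH: "{m, z} \<in> H" "{z, n} \<in> H"
  proof -
    have "e \<in> H" if "e \<in> edges_of T" "e \<subseteq> {m, n, z}" "e \<noteq> {m, n}" for e
      using one_diagonal[OF st mnD _ fT _ that(2)] non_diagonals[OF st] that by auto
    moreover have "{m, z} \<noteq> {m, n}" "{z, n} \<noteq> {m, n}" using d by (auto simp: doubleton_eq_iff)
    ultimately show "{m, z} \<in> H" "{z, n} \<in> H" using edges_face[OF fT] by (auto simp: insert_commute)
  qed
  have "is_path p1 m n (H \<union> (path_edges Q \<union> {{m, z}, {z, n}}))"
  proof (rule is_path_restrict)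
    show "is_path p1 m n (H \<union> bd ?S0)" using p(1) by simp
    fix e assume e: "e \<in> bd ?S0" "e \<subseteq> set p1"
    have "e \<noteq> {last Q, m}" "e \<noteq> {n, hd Q}" using e(2) p(3) \<open>hd Q \<in> set p2\<close> \<open>last Q \<in> set p2\<close> by auto
    then have "e \<in> path_edges Q \<union> {{m, z}, {z, n}}" using e(1) bdE by auto
    then show "e \<in> path_edges Q \<union> {{m, z}, {z, n}}" by simp
  qed
  then have p1: "is_path p1 m n (H \<union> path_edges Q)" by (rule is_path_mono) (use zH in auto)
  have p2: "is_path p2 (hd Q) (last Q) (H \<union> path_edges Q)"
  proof (rule is_path_restrict[OF p(2)])
    fix e assume e: "e \<in> bd ?S0" "e \<subseteq> set p2"
    have "m \<notin> e" "n \<notin> e" using e(2) p(3) \<open>m \<in> set p1\<close> \<open>n \<in> set p1\<close> by auto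
    then show "e \<in> path_edges Q" using e(1) bdE by auto
  qed
  show thesis by (rule that[OF p2 p1]) (use p U in auto)
qed

end

context flip_family
begin

text \<open>A strip between two boundary arcs \<open>Q\<close> and \<open>N\<close> all of whose vertices in \<open>N\<close> see \<open>Q\<close>. The path \<open>p2\<close> beyond the
  strip may use edges of \<open>N\<close> that are missing in \<open>H\<close>; they are replaced by detours into the strip.\<close>

lemma strip_paths:
  assumes IH: "\<And>m. m < K \<Longrightarrow> two_paths m"
  shows "(T, D) \<in> St \<Longrightarrow> S \<subseteq> T \<Longrightarrow> Suc (card S) < card T \<Longrightarrow> card S \<le> K \<Longrightarrow> bd S = cycle_edges (Q @ N) \<Longrightarrow>
    distinct (Q @ N) \<Longrightarrow> 3 \<le> length (Q @ N) \<Longrightarrow> Q \<noteq> [] \<Longrightarrow> N \<noteq> [] \<Longrightarrow> link_free D S Q \<Longrightarrow>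
    (\<And>n. n \<in> set N \<Longrightarrow> \<exists>f\<in>S. n \<in> f \<and> f \<inter> set Q \<noteq> {}) \<Longrightarrow> H \<union> path_edges Q \<subseteq> E \<Longrightarrow>
    (\<And>e f. e \<in> path_edges N \<Longrightarrow> e \<notin> E \<Longrightarrow> f \<in> S \<Longrightarrow> e \<subseteq> f \<Longrightarrow> f \<inter> set Q = {}) \<Longrightarrow>
    is_path p2 a b (E \<union> path_edges N) \<Longrightarrow> set p2 \<inter> \<Union>S = set N \<Longrightarrow>
    \<exists>p1 p2'. is_path p1 (hd Q) (last Q) E \<and> is_path p2' a b E \<and> set p1 \<inter> set p2' = {} \<and>
      set p1 \<union> set p2' = \<Union>S \<union> set p2 \<and> set p2 \<subseteq> set p2'"
proof (induction "card S" arbitrary: T D S Q N E p2 rule: less_induct)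
  case less
  note st = less(2) and S = less(3) and cS = less(4) and cK = less(5) and bdS = less(6) and dist = less(7)
    and len = less(8) and Qne = less(9) and Nne = less(10) and lQ = less(11) and adj = less(12) and HE = less(13)
    and Z = less(14) and p2 = less(15) and p2S = less(16)
  show ?case
  \<comment> \<open>A link between the two arcs that leaves vertices on both sides is turned into a
    chord and cuts the strip in two shorter strips.\<close>
  proof (cases "\<exists>Qa q Qb Na n Nb. Q = Qa @ q # Qb \<and> N = Na @ n # Nb \<and> linked D S q n \<and> Qb @ Na \<noteq> [] \<and> Nb @ Qa \<noteq> []")
    case True
    then obtain Qa q Qb Na n Nb where Q: "Q = Qa @ q # Qb" and N: "N = Na @ n # Nb" and l: "linked D S q n"
      and ne: "Qb @ Na \<noteq> []" "Nb @ Qa \<noteq> []" by blast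
    obtain T' D' S' where eq: "flip_equiv T D S T' D' S'" and qn: "{q, n} \<in> edges_of S'"
      and adj': "\<And>X x f. q \<in> X \<Longrightarrow> f \<in> S \<Longrightarrow> x \<in> f \<Longrightarrow> f \<inter> X \<noteq> {} \<Longrightarrow> \<exists>f'\<in>S'. x \<in> f' \<and> f' \<inter> X \<noteq> {}"
      by (rule linked_make_edge[OF st S l]) blast
    note e = flip_equivD[OF eq]
    interpret tri_sphere T' by (rule sphere[OF e(1)])
    have cyc: "cycle_edges (Q @ N) = cycle_edges (q # (Qb @ Na) @ n # (Nb @ Qa))"
      unfolding Q N using cycle_edges_commute[of Qa "q # Qb @ Na @ n # Nb"] by simp
    have dist': "distinct (q # (Qb @ Na) @ n # (Nb @ Qa))" using dist unfolding Q N by auto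
    obtain S1 S2 where sp: "S' = S1 \<union> S2" "S1 \<inter> S2 = {}" "bd S1 = cycle_edges (q # (Qb @ Na) @ [n])"
      "bd S2 = cycle_edges (q # n # (Nb @ Qa))" "S1 \<noteq> {}" "S2 \<noteq> {}"
      using chord_split[OF e(2) _ dist' qn ne] e(5) bdS cyc by metis
    have b1: "bd S1 = cycle_edges ((q # Qb) @ (Na @ [n]))" using sp(3) by simp
    have b2: "bd S2 = cycle_edges ((Qa @ [q]) @ (n # Nb))"
      using sp(4) cycle_edges_commute[of Qa "q # n # Nb"] by simp
    have s12: "S1 \<subseteq> S'" "S2 \<subseteq> S'" "S1 \<subseteq> T'" "S2 \<subseteq> T'" using sp(1) e(2) by auto
    have fin: "finite S'" using e(2) by blast
    have "S1 \<subset> S'" "S2 \<subset> S'" using sp by auto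
    then have c12: "card S1 < card S" "card S2 < card S" using psubset_card_mono[OF fin] e(4) by auto
    have V: "set (Q @ N) = \<Union>(bd S')" unfolding e(5) bdS Union_cycle_edges by simp
    have V1: "\<Union>(bd S1) = set (q # Qb @ Na @ [n])" unfolding b1 Union_cycle_edges by simp
    have V2: "\<Union>(bd S2) = set (Qa @ q # n # Nb)" unfolding b2 Union_cycle_edges by simp
    have n1: "v \<notin> \<Union>S1" if "v \<in> set Qa \<union> set Nb" for v
      by (rule vertex_not_in_part[OF e(2) s12(1)]) (use that V V1 dist' Q N in auto)
    have n2: "v \<notin> \<Union>S2" if "v \<in> set Qb \<union> set Na" for v
      by (rule vertex_not_in_part[OF e(2) s12(2)]) (use that V V2 dist' Q N in auto)
    have common: "\<Union>S1 \<inter> \<Union>S2 \<subseteq> {q, n}"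
    proof -
      have "set (q # Qb @ Na @ [n]) \<inter> set (Qa @ q # n # Nb) \<subseteq> {q, n}" using dist' by auto
      then show ?thesis using common_vertices[OF s12(3,4) sp(2)] unfolding V1 V2 by blast
    qed
    have lf: "link_free D' S' Q" using lQ link_free_equiv[OF eq] by simp
    have in1: "set (q # Qb @ Na @ [n]) \<subseteq> \<Union>S1" using V1 Union_bd_subset[of S1] by simp
    have in2: "set (Qa @ q # n # Nb) \<subseteq> \<Union>S2" using V2 Union_bd_subset[of S2] by simp
    have qn1: "\<exists>f\<in>S1. {q, n} \<subseteq> f"
    proof -
      have "{q, n} \<in> bd S1" unfolding b1 by (subst cycle_edges_append) auto
      then show ?thesis by (meson boundary_edge_face)
    qed
    have qn2: "\<exists>f\<in>S2. {q, n} \<subseteq> f"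
    proof -
      have "{q, n} \<in> bd S2" unfolding b2 by (subst cycle_edges_append) auto
      then show ?thesis by (meson boundary_edge_face)
    qed
    have a1: "\<exists>f\<in>S1. m \<in> f \<and> f \<inter> set (q # Qb) \<noteq> {}" if m: "m \<in> set (Na @ [n])" for m
    proof (cases "m = n")
      case True
      then show ?thesis using qn1 by auto
    next
      case False
      then have mN: "m \<in> set N" "m \<in> set Na" using m N by auto
      obtain f0 where "f0 \<in> S" "m \<in> f0" "f0 \<inter> set Q \<noteq> {}" using adj[OF mN(1)] by blast
      then obtain f where f: "f \<in> S'" "m \<in> f" "f \<inter> set Q \<noteq> {}" using adj'[of "set Q" f0 m] Q by auto
      have "f \<in> S1" using f n2[of m] mN sp(1) by auto
      moreover have "f \<inter> set (q # Qb) \<noteq> {}" 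
      proof -
        obtain q' where q': "q' \<in> f" "q' \<in> set Q" using f(3) by blast
        then have "q' \<notin> set Qa" using n1[of q'] \<open>f \<in> S1\<close> q'(1) by blast
        then show ?thesis using q' Q by auto
      qed
      ultimately show ?thesis using f by blast
    qed
    have a2: "\<exists>f\<in>S2. m \<in> f \<and> f \<inter> set (Qa @ [q]) \<noteq> {}" if m: "m \<in> set (n # Nb)" for m
    proof (cases "m = n")
      case True
      then show ?thesis using qn2 by auto
    next
      case False
      then have mN: "m \<in> set N" "m \<in> set Nb" using m N by auto
      obtain f0 where "f0 \<in> S" "m \<in> f0" "f0 \<inter> set Q \<noteq> {}" using adj[OF mN(1)] by blast
      then obtain f where f: "f \<in> S'" "m \<in> f" "f \<inter> set Q \<noteq> {}" using adj'[of "set Q" f0 m] Q by auto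
      have "f \<in> S2" using f n1[of m] mN sp(1) by auto
      moreover have "f \<inter> set (Qa @ [q]) \<noteq> {}" 
      proof -
        obtain q' where q': "q' \<in> f" "q' \<in> set Q" using f(3) by blast
        then have "q' \<notin> set Qb" using n2[of q'] \<open>f \<in> S2\<close> q'(1) by blast
        then show ?thesis using q' Q by auto
      qed
      ultimately show ?thesis using f by blast
    qed
    have pN: "path_edges (Na @ [n]) \<subseteq> path_edges N" "path_edges (n # Nb) \<subseteq> path_edges N"
      unfolding N using path_edges_glue[of Na n Nb] by auto
    have pQ: "path_edges (Qa @ [q]) \<subseteq> path_edges Q" "path_edges (q # Qb) \<subseteq> path_edges Q"
      unfolding Q using path_edges_glue[of Qa q Qb] by auto
    have pNe: "path_edges N = path_edges (Na @ [n]) \<union> path_edges (n # Nb)" unfolding N by (rule path_edges_glue)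
    \<comment> \<open>An edge of \<open>N\<close> outside \<open>E\<close> is an optional boundary
      edge; its face in the strip was not touched by the flips.\<close>
    have Z': "f \<inter> set Q = {}" if ef: "e \<in> path_edges N" "e \<notin> E" "f \<in> S'" "e \<subseteq> f" for e f
    proof -
      have "e \<in> cycle_edges (Q @ N)" using ef(1) Qne Nne by (simp add: cycle_edges_append)
      then have ebd: "e \<in> bd S'" using e(5) bdS by simp
      then have "e \<in> edges_of T'" using bd_sub_edges[OF e(2)] by blast
      then have "e \<in> D'" using non_diagonals[OF e(1)] HE ef(2) by blast
      then have "f \<in> S" using e(8) ebd ef by blast
      then show ?thesis using Z ef by blast
    qed
    \<comment> \<open>While the first part is treated, the outer path may keep using the edges of
      \<open>N\<close> that belong to the second part.\<close>
    let ?E1 = "E \<union> path_edges (n # Nb)"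
    have "\<exists>p1 p2'. is_path p1 (hd (q # Qb)) (last (q # Qb)) ?E1 \<and> is_path p2' a b ?E1 \<and> set p1 \<inter> set p2' = {} \<and>
      set p1 \<union> set p2' = \<Union>S1 \<union> set p2 \<and> set p2 \<subseteq> set p2'"
    proof (rule less(1)[OF c12(1) e(1) s12(3), of "q # Qb" "Na @ [n]"])
      show "Suc (card S1) < card T'" using c12 cS e(3) by simp
      show "card S1 \<le> K" using c12 cK by simp
      show "bd S1 = cycle_edges ((q # Qb) @ Na @ [n])" using b1 by simp
      show "distinct ((q # Qb) @ Na @ [n])" using dist' by auto
      show "3 \<le> length ((q # Qb) @ Na @ [n])" using ne by (cases Qb; cases Na; simp)
      have "link_free D' S' (q # Qb)" using lf Q link_free_suffix by metis
      then show "link_free D' S1 (q # Qb)" using link_free_mono[OF _ s12(1)] by blast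
      show "H \<union> path_edges (q # Qb) \<subseteq> ?E1" using HE pQ by auto
      show "f \<inter> set (q # Qb) = {}" if "e \<in> path_edges (Na @ [n])" "e \<notin> ?E1" "f \<in> S1" "e \<subseteq> f" for e f
      proof -
        have "f \<inter> set Q = {}" by (rule Z'[of e f]) (use that pN s12 in auto)
        then show ?thesis unfolding Q by auto
      qed
      show "is_path p2 a b (?E1 \<union> path_edges (Na @ [n]))" by (rule is_path_mono[OF p2]) (use pNe in auto)
      show "set p2 \<inter> \<Union>S1 = set (Na @ [n])"
      proof
        show "set p2 \<inter> \<Union>S1 \<subseteq> set (Na @ [n])"
        proof
          fix v assume v: "v \<in> set p2 \<inter> \<Union>S1"
          then have "v \<in> set N" using p2S e(6) s12(1) by blast
          moreover have "v \<notin> set Nb" using n1[of v] v by blast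
          ultimately show "v \<in> set (Na @ [n])" using N by auto
        qed
        show "set (Na @ [n]) \<subseteq> set p2 \<inter> \<Union>S1" using p2S N in1 by auto
      qed
    qed (use a1 in auto)
    then obtain p1a p2a where pa: "is_path p1a q (last (q # Qb)) ?E1" "is_path p2a a b ?E1" "set p1a \<inter> set p2a = {}"
      "set p1a \<union> set p2a = \<Union>S1 \<union> set p2" "set p2 \<subseteq> set p2a" by auto
    have np2: "n \<in> set p2" using p2S N by auto
    have p1aS: "set p1a \<subseteq> \<Union>S1" using pa by blast
    have "\<exists>p1 p2'. is_path p1 (hd (Qa @ [q])) (last (Qa @ [q])) E \<and> is_path p2' a b E \<and> set p1 \<inter> set p2' = {} \<and>
      set p1 \<union> set p2' = \<Union>S2 \<union> set p2a \<and> set p2a \<subseteq> set p2'"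
    proof (rule less(1)[OF c12(2) e(1) s12(4), of "Qa @ [q]" "n # Nb"])
      show "Suc (card S2) < card T'" using c12 cS e(3) by simp
      show "card S2 \<le> K" using c12 cK by simp
      show "bd S2 = cycle_edges ((Qa @ [q]) @ n # Nb)" using b2 by simp
      show "distinct ((Qa @ [q]) @ n # Nb)" using dist' by auto
      show "3 \<le> length ((Qa @ [q]) @ n # Nb)" using ne by (cases Qa; cases Nb; simp)
      have "link_free D' S' ((Qa @ [q]) @ Qb)" using lf Q by simp
      then have "link_free D' S' (Qa @ [q])" by (rule link_free_prefix)
      then show "link_free D' S2 (Qa @ [q])" using link_free_mono[OF _ s12(2)] by blast
      show "H \<union> path_edges (Qa @ [q]) \<subseteq> E" using HE pQ by auto
      show "f \<inter> set (Qa @ [q]) = {}" if "e \<in> path_edges (n # Nb)" "e \<notin> E" "f \<in> S2" "e \<subseteq> f" for e f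
      proof -
        have "f \<inter> set Q = {}" by (rule Z'[of e f]) (use that pN s12 in auto)
        then show ?thesis unfolding Q by auto
      qed
      show "is_path p2a a b (E \<union> path_edges (n # Nb))" by (rule pa)
      show "set p2a \<inter> \<Union>S2 = set (n # Nb)"
      proof
        show "set p2a \<inter> \<Union>S2 \<subseteq> set (n # Nb)"
        proof
          fix v assume v: "v \<in> set p2a \<inter> \<Union>S2"
          have qa: "q \<in> set p1a" using pa(1) by (auto simp: is_path_def)
          consider "v \<in> \<Union>S1" | "v \<in> set p2" using v pa(4) by blast
          then show "v \<in> set (n # Nb)"
          proof cases
            case 1
            then have "v \<in> {q, n}" using common v by blast
            then show ?thesis using v qa pa(3) by auto
          next
            case 2
            then have "v \<in> set N" using p2S e(6) s12(2) v by blast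
            moreover have "v \<notin> set Na" using n2[of v] v by blast
            ultimately show ?thesis using N by auto
          qed
        qed
        show "set (n # Nb) \<subseteq> set p2a \<inter> \<Union>S2" using p2S N in2 pa(5) by auto
      qed
    qed (use a2 in auto)
    then obtain p1b p2b where pb: "is_path p1b (hd (Qa @ [q])) q E" "is_path p2b a b E" "set p1b \<inter> set p2b = {}"
      "set p1b \<union> set p2b = \<Union>S2 \<union> set p2a" "set p2a \<subseteq> set p2b" by auto
    have p1bS: "set p1b \<subseteq> \<Union>S2" using pb by blast
    have qs: "q \<in> set p1a" "q \<in> set p1b" using is_path_ends[OF pa(1)] is_path_ends[OF pb(1)] by auto
    have nn: "n \<notin> set p1a" "n \<notin> set p1b" using np2 pa(3,5) pb(3,5) by auto
    \<comment> \<open>The vertices of \<open>n # Nb\<close> lie on the outer path, so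
      \<open>p1a\<close> uses none of the additionally permitted edges.\<close>
    have p1aE: "is_path p1a q (last (q # Qb)) E"
    proof -
      have "is_path p1a q (last (q # Qb)) (E \<union> {})"
      proof (rule is_path_restrict[OF pa(1)])
        fix e assume ee: "e \<in> path_edges (n # Nb)" "e \<subseteq> set p1a"
        have "set (n # Nb) \<subseteq> set p2a" using p2S N pa(5) by auto
        then have "e \<subseteq> set p2a" using path_edges_subset[OF ee(1)] by blast
        moreover have "e \<noteq> {}" using ee(1) card_path_edges[of "n # Nb" e] dist' by auto
        ultimately show "e \<in> {}" using ee(2) pa(3) by blast
      qed
      then show ?thesis by simp
    qed
    have int: "set p1b \<inter> set p1a = {q}" using p1aS p1bS common qs nn by blast
    note g = is_path_glue[OF pb(1) p1aE int]
    have "hd (Qa @ [q]) = hd Q" "last (q # Qb) = last Q" unfolding Q by (cases Qa; simp)+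
    then have 1: "is_path (p1b @ tl p1a) (hd Q) (last Q) E" using g(1) by simp
    have 2: "set (p1b @ tl p1a) \<inter> set p2b = {}"
    proof -
      have "v \<notin> set p2b" if v: "v \<in> set p1a" for v
      proof
        assume a: "v \<in> set p2b"
        then have "v \<in> \<Union>S2" using pb(4) v pa(3) by blast
        then have "v \<in> {q, n}" using common p1aS v by blast
        then show False using v nn qs a pb(3) by auto
      qed
      then show ?thesis using g(2) pb(3) by blast
    qed
    have "set (p1b @ tl p1a) \<union> set p2b = set p1a \<union> (\<Union>S2 \<union> set p2a)" using g(2) pb(4) by blast
    also have "\<dots> = \<Union>S2 \<union> (\<Union>S1 \<union> set p2)" using pa(4) by blast
    also have "\<dots> = \<Union>S \<union> set p2" using sp(1) e(6) by auto
    finally have 3: "set (p1b @ tl p1a) \<union> set p2b = \<Union>S \<union> set p2" .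
    show ?thesis using 1 2 3 pb(2,5) pa(5) by blast
  next
    case False
    then have nolink: "\<not> linked D S q n" if "Q = Qa @ q # Qb" "N = Na @ n # Nb" "Qb @ Na \<noteq> []" "Nb @ Qa \<noteq> []"
      for Qa q Qb Na n Nb using that by blast
    interpret tri_sphere T by (rule sphere[OF st])
    have IHc: "two_paths m" if "m < card S" for m using IH that cK by simp
    have bdE: "bd S = path_edges Q \<union> path_edges N \<union> {{last Q, hd N}, {last N, hd Q}}"
      unfolding bdS using Qne Nne by (rule cycle_edges_append)
    \<comment> \<open>A path that misses all of \<open>N\<close> can use no boundary edges except
      those of \<open>Q\<close>.\<close>
    have avoid: "is_path p (hd Q) (last Q) E" if p: "is_path p (hd Q) (last Q) (H \<union> bd S)" "set p = \<Union>S - set N" for p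
    proof -
      have "is_path p (hd Q) (last Q) (H \<union> path_edges Q)"
      proof (rule is_path_restrict[OF p(1)])
        fix e assume ee: "e \<in> bd S" "e \<subseteq> set p"
        have ne: "e \<inter> set N = {}" using ee p(2) by auto
        have "e \<notin> path_edges N"
        proof
          assume eN: "e \<in> path_edges N"
          have "card e = 2" using card_path_edges[OF _ eN] dist by auto
          then have "e \<noteq> {}" by auto
          then show False using path_edges_subset[OF eN] ne by blast
        qed
        moreover have "hd N \<in> set N" "last N \<in> set N" using Nne by auto
        ultimately show "e \<in> path_edges Q" using ee(1) bdE ne by auto
      qed
      then show ?thesis by (rule is_path_mono[OF _ HE])
    qed
    \<comment> \<open>An inner vertex of \<open>N\<close> shares a face with some vertex of
      \<open>Q\<close>, and this link would leave vertices of \<open>N\<close> on both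
      sides.\<close>
    have short: "length N \<le> 2"
    proof (rule ccontr)
      assume "\<not> length N \<le> 2"
      then obtain n0 m N' where N: "N = n0 # m # N'" "N' \<noteq> []" by (cases N rule: path_edges.cases) force+
      obtain f where f: "f \<in> S" "m \<in> f" "f \<inter> set Q \<noteq> {}" using adj[of m] N by auto
      then obtain q where q: "q \<in> f" "q \<in> set Q" by blast
      then obtain Qa Qb where Q: "Q = Qa @ q # Qb" by (meson split_list)
      have "q \<noteq> m" using q dist N by auto
      then have "linked D S q m" using f q by (auto intro: linked_face)
      then show False using nolink[OF Q, of "[n0]" m N'] N by simp
    qed
    consider n where "N = [n]" | m n where "N = [m, n]"
      using short Nne by (cases N rule: path_edges.cases) auto
    then show ?thesis
    proof cases
      case (1 n)
      obtain p where p: "is_path p (hd Q) (last Q) (H \<union> bd S)" "set p = \<Union>S - {n}"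
      proof (rule cone_path[OF IHc st S cS, of Q n "[]"])
        show "link_free D S (n # [] @ [hd Q])" by (rule link_free_short) simp
        show "\<not> linked D S n r" if "Q = A @ r # B" "A \<noteq> []" "B \<noteq> []" for A r B
          using nolink[OF that(1), of "[]" n "[]"] that 1 linked_commute by (metis append_Nil append_is_Nil_conv)
      qed (use bdS dist len Qne lQ 1 in auto)
      have "is_path p (hd Q) (last Q) E" using avoid[OF p(1)] p(2) 1 by simp
      moreover have "is_path p2 a b E" using p2 1 by simp
      moreover have "set p \<inter> set p2 = {}" using p(2) p2S 1 by auto
      moreover have "set p \<union> set p2 = \<Union>S \<union> set p2" using p(2) p2S 1 by auto
      ultimately show ?thesis by blast
    next
      case (2 m n)
      have lm: "q = last Q" if q: "q \<in> set Q" "linked D S q m" for q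
      proof (rule ccontr)
        assume "q \<noteq> last Q"
        moreover obtain Qa Qb where Q: "Q = Qa @ q # Qb" using q by (meson split_list)
        ultimately have "Qb \<noteq> []" by auto
        then show False using nolink[OF Q, of "[]" m "[n]"] 2 q by simp
      qed
      have ln: "q = hd Q" if q: "q \<in> set Q" "linked D S q n" for q
      proof (rule ccontr)
        assume "q \<noteq> hd Q"
        moreover obtain Qa Qb where Q: "Q = Qa @ q # Qb" using q by (meson split_list)
        ultimately have "Qa \<noteq> []" by auto
        then show False using nolink[OF Q, of "[m]" n "[]"] 2 q by simp
      qed
      have mn: "{m, n} \<in> bd S" using bdE 2 by simp
      have b2: "bd S = cycle_edges (Q @ [m, n])" using bdS 2 by simp
      have d2: "distinct (Q @ [m, n])" using dist 2 by simp
      show ?thesis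
      \<comment> \<open>Only if the outer path runs along a missing edge does the pocket have to
        supply a detour; otherwise it is covered by the path along \<open>Q\<close> alone.\<close>
      proof (cases "{m, n} \<in> path_edges p2 \<and> {m, n} \<notin> E")
        case True
        obtain f where f: "f \<in> S" "{m, n} \<subseteq> f" using boundary_edge_face[OF mn] by blast
        have mne: "m \<noteq> n" using d2 by auto
        obtain z where z: "f = {m, n, z}" using face_third[of f m n] f S mne by blast
        have "f \<inter> set Q = {}" using Z[of "{m, n}" f] True f 2 by simp
        then have zQ: "z \<notin> set Q" using z by auto
        have "{m, n} \<in> D" using mn bd_sub_edges[OF S] non_diagonals[OF st] HE True by blast
        then obtain p1 r where pr: "is_path p1 (hd Q) (last Q) (H \<union> path_edges Q)" "is_path r m n (H \<union> path_edges Q)"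
          "set p1 \<inter> set r = {}" "set p1 \<union> set r = \<Union>S"
          using pocket_two_paths[OF IHc st S cS b2 d2 Qne lQ _ zQ] f z by metis
        have mnr: "m \<in> set r" "n \<in> set r" using pr(2) by (auto simp: is_path_def)
        have "set r \<inter> set p2 = {m, n}" using pr(4) p2S 2 mnr by auto
        moreover have "is_path p2 a b (insert {m, n} E)" using p2 2 by simp
        moreover have "is_path r m n E" by (rule is_path_mono[OF pr(2) HE])
        ultimately obtain p' where p': "is_path p' a b E" "set p' = set p2 \<union> set r"
          using replace_edge[of p2 a b m n E r] True by blast
        have "set p1 \<inter> set p2 = {}"
        proof -
          have "set p1 \<inter> set p2 \<subseteq> {m, n}" using pr(4) p2S 2 by auto
          then show ?thesis using mnr pr(3) by blast
        qed
        then have "set p1 \<inter> set p' = {}" using p'(2) pr(3) by auto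
        moreover have "set p1 \<union> set p' = \<Union>S \<union> set p2" using p'(2) pr(4) by auto
        moreover have "is_path p1 (hd Q) (last Q) E" by (rule is_path_mono[OF pr(1) HE])
        ultimately show ?thesis using p' by blast
      next
        case False
        obtain p where p: "is_path p (hd Q) (last Q) (H \<union> bd S)" "set p = \<Union>S - {m, n}"
          using pocket_path[OF IHc st S cS b2 d2 Qne lQ lm ln] by blast
        have "is_path p (hd Q) (last Q) E" using avoid[OF p(1)] p(2) 2 by simp
        moreover have "is_path p2 a b E" using p2 False 2 by (auto simp: is_path_def)
        moreover have "set p \<inter> set p2 = {}" using p(2) p2S 2 by auto
        moreover have "set p \<union> set p2 = \<Union>S \<union> set p2" using p(2) p2S 2 by auto
        ultimately show ?thesis by blast
      qed
    qed
  qed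
qed

end

section \<open>A shortest path through the neighbours of a boundary arc\<close>

lemma (in surface) even_card_bd_Int:
  assumes "X \<subseteq> T" "\<And>f. f \<in> X \<Longrightarrow> even (card (bd {f} \<inter> E))"
  shows "even (card (bd X \<inter> E))"
proof -
  have "finite X" using assms by blast
  then show ?thesis using assms
  proof (induction X rule: finite_induct)
    case (insert f X)
    have "insert f X = {f} \<union> X" by simp
    then have "bd (insert f X) = sym_diff (bd {f}) (bd X)"
      using bd_disjoint_Un[of "{f}" X] insert by auto
    then have "bd (insert f X) \<inter> E = sym_diff (bd {f} \<inter> E) (bd X \<inter> E)" by auto
    moreover have "finite (bd {f} \<inter> E)" "finite (bd X \<inter> E)" using insert by (auto intro!: finite_Int)
    moreover have "even (card (bd X \<inter> E))" "even (card (bd {f} \<inter> E))" using insert by auto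
    ultimately show ?case by (simp add: even_card_sym_diff)
  qed simp
qed

text \<open>The spokes from the boundary arc \<open>Q\<close> to a component of its neighbours \<open>L\<close> come in pairs within each face,
  so an even number of them lies on the boundary.\<close>

lemma (in surface) neighbours_connected:
  assumes S: "S \<subseteq> T" and bdS: "bd S = cycle_edges (Q @ c # B @ [x])" and dist: "distinct (Q @ c # B @ [x])" and Qne: "Q \<noteq> []"
  defines "L \<equiv> {v \<in> \<Union>S - set Q. \<exists>f\<in>S. v \<in> f \<and> f \<inter> set Q \<noteq> {}}"
  shows "(c, x) \<in> {(u, v). {u, v} \<in> edges_of S \<and> u \<in> L \<and> v \<in> L}\<^sup>*" (is "_ \<in> ?R\<^sup>*")
proof (rule ccontr)
  assume n: "(c, x) \<notin> ?R\<^sup>*"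
  define U where "U = {u. (c, u) \<in> ?R\<^sup>*}"
  have cU: "c \<in> U" "x \<notin> U" using n by (auto simp: U_def)
  have UQ: "u \<notin> set Q" if "u \<in> U" for u
  proof -
    have "(c, u) \<in> ?R\<^sup>*" using that by (simp add: U_def)
    then show ?thesis using dist by (cases rule: rtranclE) (auto simp: L_def)
  qed
  have bdE: "bd S = path_edges Q \<union> path_edges (c # B @ [x]) \<union> {{last Q, c}, {x, hd Q}}"
    unfolding bdS using cycle_edges_append[OF Qne, of "c # B @ [x]"] by simp
  have cL: "c \<in> L"
  proof -
    have "{last Q, c} \<in> bd S" using bdE by simp
    then obtain f where f: "f \<in> S" "{last Q, c} \<subseteq> f" by (rule boundary_edge_face)
    moreover have "last Q \<in> set Q" using Qne by simp
    moreover have "c \<notin> set Q" using dist by auto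
    ultimately show ?thesis unfolding L_def by blast
  qed
  have UL: "u \<in> L" if "u \<in> U" for u
  proof -
    have "(c, u) \<in> ?R\<^sup>*" using that by (simp add: U_def)
    then show ?thesis using cL by (cases rule: rtranclE) auto
  qed
  define E where "E = {e. \<exists>q\<in>set Q. \<exists>u\<in>U. e = {q, u}}"
  have "even (card (bd S \<inter> E))"
  proof (rule even_card_bd_Int[OF S])
    fix f assume f: "f \<in> S"
    then have fT: "f \<in> T" using S by auto
    show "even (card (bd {f} \<inter> E))"
    proof (cases "f \<inter> set Q \<noteq> {} \<and> f \<inter> U \<noteq> {}")
      case False
      then have "bd {f} \<inter> E = {}" unfolding E_def bd_def by blast
      then show ?thesis by simp
    next
      case True
      then obtain q u where qu: "q \<in> f" "q \<in> set Q" "u \<in> f" "u \<in> U" by blast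
      have qnu: "q \<noteq> u" using qu UQ by auto
      obtain w where w: "f = {q, u, w}" "w \<noteq> q" "w \<noteq> u" using face_third[OF fT, of q u] qu qnu by auto
      have bf: "bd {f} = {{q, u}, {q, w}, {u, w}}" using bd_face[of q u w] fT w by simp
      show ?thesis
      proof (cases "w \<in> set Q")
        case True
        have "{q, u} \<in> E" unfolding E_def using qu by blast
        moreover have "{w, u} \<in> E" unfolding E_def using qu True by blast
        moreover have "{q, w} \<notin> E"
        proof
          assume "{q, w} \<in> E"
          then obtain u' where "u' \<in> {q, w}" "u' \<in> U" unfolding E_def by blast
          then show False using UQ qu(2) True by auto
        qed
        moreover have "{w, u} = {u, w}" by auto
        ultimately have "bd {f} \<inter> E = {{q, u}, {u, w}}" unfolding bf by auto
        moreover have "{q, u} \<noteq> {u, w}" using w by (auto simp: doubleton_eq_iff)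
        ultimately show ?thesis by simp
      next
        case False
        moreover have "w \<in> f" using w by simp
        ultimately have "w \<in> L" using f qu(1,2) unfolding L_def by blast
        moreover have "{u, w} \<in> edges_of S" using f w by (auto intro: edges_ofI)
        ultimately have "(u, w) \<in> ?R" using UL qu by auto
        then have "w \<in> U" using qu(4) unfolding U_def by (auto intro: rtrancl_into_rtrancl)
        then have "{q, w} \<in> E" unfolding E_def using qu by blast
        moreover have "{q, u} \<in> E" unfolding E_def using qu by blast
        moreover have "{u, w} \<notin> E"
        proof
          assume "{u, w} \<in> E"
          then obtain q' where "q' \<in> {u, w}" "q' \<in> set Q" unfolding E_def by blast
          then show False using UQ qu(4) False by auto
        qed
        ultimately have "bd {f} \<inter> E = {{q, u}, {q, w}}" unfolding bf by auto
        moreover have "{q, u} \<noteq> {q, w}" using w by (auto simp: doubleton_eq_iff)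
        ultimately show ?thesis by simp
      qed
    qed
  qed
  \<comment> \<open>The boundary cycle leaves \<open>Q\<close> only along \<open>{last Q, c}\<close>
    and \<open>{x, hd Q}\<close>, and \<open>x\<close> is not in \<open>U\<close>; a single spoke
    contradicts parity.\<close>
  moreover have "bd S \<inter> E = {{last Q, c}}"
  proof
    show "{{last Q, c}} \<subseteq> bd S \<inter> E" using bdE cU Qne last_in_set unfolding E_def by blast
    show "bd S \<inter> E \<subseteq> {{last Q, c}}"
    proof
      fix e assume e: "e \<in> bd S \<inter> E"
      then obtain q u where qu: "e = {q, u}" "q \<in> set Q" "u \<in> U" unfolding E_def by blast
      have "e \<notin> path_edges Q" using path_edges_subset[of e Q] qu UQ by auto
      moreover have "e \<notin> path_edges (c # B @ [x])" using path_edges_subset[of e "c # B @ [x]"] qu dist by auto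
      moreover have "e \<noteq> {x, hd Q}"
      proof
        assume "e = {x, hd Q}"
        then have "u = x \<or> u = hd Q" using qu by auto
        then show False using qu(3) UQ[of u] cU(2) Qne hd_in_set[of Q] by auto
      qed
      ultimately show "e \<in> {{last Q, c}}" using e bdE by auto
    qed
  qed
  ultimately show False by simp
qed

context flip_family
begin

text \<open>Cuts off a strip \<open>S2\<close> along \<open>Q\<close>. The dividing path is shortest
  among all flip-equivalent normal states, so a link between two of its vertices in the rest
  \<open>S1\<close> would give a shortcut, possibly after one more flip. Normality with respect to
  \<open>Q\<close> ensures that an optional edge of the dividing path has no vertex of
  \<open>Q\<close> in its face in the strip.\<close>

lemma shortest_inner_path:
  assumes st: "(T, D) \<in> St" and S: "S \<subseteq> T" and bdS: "bd S = cycle_edges (Q @ c # B @ [x])"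
    and dist: "distinct (Q @ c # B @ [x])" and Qne: "Q \<noteq> []" and Bne: "B \<noteq> []"
    and nl: "\<And>b q. b \<in> set B \<Longrightarrow> q \<in> set Q \<Longrightarrow> \<not> linked D S b q"
  obtains T' D' S' N S1 S2 where "flip_equiv T D S T' D' S'" "S' = S1 \<union> S2" "S1 \<inter> S2 = {}"
    "bd S1 = cycle_edges (c # B @ x # rev N)" "bd S2 = cycle_edges (Q @ c # N @ [x])" "S1 \<noteq> {}" "S2 \<noteq> {}"
    "distinct (Q @ c # B @ x # N)" "link_free D' S1 (c # N @ [x])"
    "\<And>n. n \<in> set (c # N @ [x]) \<Longrightarrow> \<exists>f\<in>S2. n \<in> f \<and> f \<inter> set Q \<noteq> {}"
    "\<And>e f. e \<in> path_edges (c # N @ [x]) \<Longrightarrow> e \<notin> H \<Longrightarrow> f \<in> S2 \<Longrightarrow> e \<subseteq> f \<Longrightarrow> f \<inter> set Q = {}"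
proof -
  define L where "L = (\<lambda>S. {v \<in> \<Union>S - set Q. \<exists>f\<in>S. v \<in> f \<and> f \<inter> set Q \<noteq> {}})"
  \<comment> \<open>The triangulation varies together with the path, since a flip may create the
    edge needed for a shortcut.\<close>
  define good where "good = (\<lambda>T' D' S' N. flip_equiv T D S T' D' S' \<and> normal D' S' (set Q) \<and>
    distinct (c # N @ [x]) \<and> set (c # N @ [x]) \<subseteq> L S' \<and> path_edges (c # N @ [x]) \<subseteq> edges_of S')"
  have shape: "\<exists>N. p = c # N @ [x]" if p: "distinct p" "p \<noteq> []" "hd p = c" "last p = x" for p
  proof -
    have cx: "c \<noteq> x" using dist by auto
    obtain p' where p': "p = c # p'" using p by (cases p) auto
    have "p' \<noteq> []" using p' p cx by auto
    then have "p' = butlast p' @ [x]" using p p' append_butlast_last_id[of p'] by simp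
    then show ?thesis using p' by metis
  qed
  have "\<exists>n T' D' S' N. good T' D' S' N \<and> length N = n"
  proof -
    obtain T' D' S' where eq: "flip_equiv T D S T' D' S'" and nm: "normal D' S' (set Q)"
      by (rule exists_normal[OF st S])
    note e = flip_equivD[OF eq]
    interpret surface T' by (rule is_surface[OF e(1)])
    have bd': "bd S' = cycle_edges (Q @ c # B @ [x])" using e(5) bdS by simp
    have R: "(c, x) \<in> {(u, v). {u, v} \<in> edges_of S' \<and> u \<in> L S' \<and> v \<in> L S'}\<^sup>*"
      using neighbours_connected[OF e(2) bd' dist Qne] unfolding L_def .
    obtain p where p: "distinct p" "p \<noteq> []" "hd p = c" "last p = x"
      "\<And>i. Suc i < length p \<Longrightarrow> (p ! i, p ! Suc i) \<in> {(u, v). {u, v} \<in> edges_of S' \<and> u \<in> L S' \<and> v \<in> L S'}"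
      by (rule rtrancl_distinct_path[OF R]) blast
    obtain N where N: "p = c # N @ [x]" using shape p by blast
    have "set p \<subseteq> L S'"
    proof
      fix v assume "v \<in> set p"
      then obtain i where i: "i < length p" "v = p ! i" by (metis in_set_conv_nth)
      show "v \<in> L S'"
      proof (cases "Suc i < length p")
        case True then show ?thesis using p(5)[of i] i by auto
      next
        case False
        then have "Suc (i - 1) < length p" "Suc (i - 1) = i" using i N by auto
        then show ?thesis using p(5)[of "i - 1"] i by auto
      qed
    qed
    moreover have "path_edges p \<subseteq> edges_of S'" using p(5) by (auto simp: path_edges_nth)
    ultimately have "good T' D' S' N" unfolding good_def using eq nm p(1) N by simp
    then show ?thesis by blast
  qed
  then obtain n where n: "\<exists>T' D' S' N. good T' D' S' N \<and> length N = n"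
    and least: "\<And>m. m < n \<Longrightarrow> \<not> (\<exists>T' D' S' N. good T' D' S' N \<and> length N = m)"
    using exists_least_iff[of "\<lambda>n. \<exists>T' D' S' N. good T' D' S' N \<and> length N = n"] by blast
  then obtain T' D' S' N where g: "good T' D' S' N" "length N = n" by blast
  have eq: "flip_equiv T D S T' D' S'" and nm: "normal D' S' (set Q)" and dN: "distinct (c # N @ [x])"
    and NL: "set (c # N @ [x]) \<subseteq> L S'" and Ne: "path_edges (c # N @ [x]) \<subseteq> edges_of S'"
    using g(1) unfolding good_def by auto
  note e = flip_equivD[OF eq]
  interpret tri_sphere T' by (rule sphere[OF e(1)])
  have bd': "bd S' = cycle_edges (c # B @ x # Q)"
    using e(5) bdS cycle_edges_commute[of Q "c # B @ [x]"] by simp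
  have NQ: "v \<notin> set Q" if "v \<in> set N" for v using that NL by (auto simp: L_def)
  \<comment> \<open>Every vertex of the path is linked to \<open>Q\<close>, but those of
    \<open>B\<close> are not.\<close>
  have NB: "v \<notin> set B" if "v \<in> set N" for v
  proof
    assume vB: "v \<in> set B"
    have "v \<in> L S'" using NL that by auto
    then obtain f q where f: "f \<in> S'" "v \<in> f" "q \<in> f" "q \<in> set Q" unfolding L_def by blast
    then have "v \<noteq> q" using NQ that by auto
    then have "linked D' S' v q" using f by (auto intro: linked_face)
    then show False using nl[OF vB f(4)] e(7) by simp
  qed
  have dall: "distinct (Q @ c # B @ x # N)" using dist dN NQ NB by auto
  have nb: "path_edges (c # N @ [x]) \<inter> bd S' = {}"
  proof -
    have False if ee: "d \<in> path_edges (c # N @ [x])" "d \<in> bd S'" for d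
    proof -
      have "d \<subseteq> set (c # B @ x # Q)" using cycle_edges_subset ee(2) bd' by blast
      then have "d \<inter> set N = {}" using dall by auto
      moreover have "set (c # N @ [x]) \<subseteq> {c, x} \<union> set N" by auto
      ultimately have "d \<subseteq> {c, x}" using path_edges_subset[OF ee(1)] by blast
      moreover have "card d = 2" by (rule card_path_edges[OF dN ee(1)])
      moreover have "card {c, x} = 2" using dist by auto
      ultimately have d: "d = {c, x}" by (intro card_subset_eq) auto
      have "d \<in> path_edges (c # B @ [x]) \<union> path_edges (c # rev Q @ [x])" using ee(2) bd' cycle_edges_theta by metis
      then show False using consecutive_split[of "[]" c B x "[]"] consecutive_split[of "[]" c "rev Q" x "[]"] dist d Qne Bne by auto
    qed
    then show ?thesis by blast
  qed
  have d1: "distinct (c # B @ x # Q)" using dist by auto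
  have d2: "set N \<inter> set (c # B @ x # Q) = {}" using dall by auto
  obtain S1 S2 where sp: "S' = S1 \<union> S2" "S1 \<inter> S2 = {}" "bd S1 = cycle_edges (c # B @ x # rev N)"
    "bd S2 = cycle_edges (c # N @ x # Q)" "S1 \<noteq> {}" "S2 \<noteq> {}"
    by (rule theta_split[OF e(2) bd' d1 dN d2 Ne nb])
  have bd2: "bd S2 = cycle_edges (Q @ c # N @ [x])"
    using sp(4) cycle_edges_commute[of Q "c # N @ [x]"] by simp
  have S1S: "S1 \<subseteq> S'" using sp by auto
  have S1Q: "q \<notin> \<Union>S1" if "q \<in> set Q" for q
  proof (rule vertex_not_in_part[OF e(2) S1S])
    show "q \<in> \<Union>(bd S')" unfolding bd' Union_cycle_edges using that by simp
    show "q \<notin> \<Union>(bd S1)" unfolding sp(3) Union_cycle_edges using that dall by auto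
  qed
  have adj: "\<exists>f\<in>S2. m \<in> f \<and> f \<inter> set Q \<noteq> {}" if "m \<in> set (c # N @ [x])" for m
  proof -
    have "m \<in> L S'" using NL that by blast
    then obtain f where f: "f \<in> S'" "m \<in> f" "f \<inter> set Q \<noteq> {}" by (auto simp: L_def)
    have "f \<notin> S1" using f(3) S1Q by blast
    then show ?thesis using f sp(1) by blast
  qed
  \<comment> \<open>An optional edge of the dividing path is interior to the disc; a vertex of
    \<open>Q\<close> opposite to it would violate normality, since the edge itself avoids
    \<open>Q\<close>.\<close>
  have Z: "f \<inter> set Q = {}" if ef: "d \<in> path_edges (c # N @ [x])" "d \<notin> H" "f \<in> S2" "d \<subseteq> f" for d f
  proof (rule ccontr)
    assume "f \<inter> set Q \<noteq> {}"
    then obtain q where q: "q \<in> f" "q \<in> set Q" by blast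
    have dT: "d \<in> edges_of T'" using ef(1) Ne edges_of_mono[OF e(2)] by blast
    then have dD: "d \<in> D'" using non_diagonals[OF e(1)] ef(2) by blast
    have cd: "card d = 2" using dT by (simp add: edges_of_def)
    have fS: "f \<in> S'" "f \<in> T'" using ef(3) sp(1) e(2) by auto
    have dQ: "d \<inter> set Q = {}" using path_edges_subset[OF ef(1)] dall by auto
    obtain h where h: "h \<in> T'" "d \<subseteq> h" "h \<noteq> f" "{k \<in> T'. d \<subseteq> k} = {f, h}" by (rule other_face[OF fS(2) ef(4) cd])
    have "d \<notin> bd S'" using nb ef(1) by blast
    then have hS: "h \<in> S'" using in_bd_iff[OF dT h(4) _ e(2)] h(3) fS by auto
    obtain p r where pr: "d = {p, r}" "p \<noteq> r" using cd by (auto simp: card_2_iff)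
    obtain z where z: "h = {p, r, z}" using face_third[OF h(1), of p r] h(2) pr by auto
    obtain z' where z': "f = {p, r, z'}" using face_third[OF fS(2), of p r] ef(4) pr by auto
    have "z' = q" using q z' dQ pr by auto
    then have "quad S' D' p r q z" unfolding quad_def using dD pr fS hS z z' h(3) by auto
    then have "p \<in> set Q \<or> r \<in> set Q" using nm q(2) unfolding normal_def by blast
    then show False using dQ pr by auto
  qed
  have lf: "link_free D' S1 (c # N @ [x])" unfolding link_free_def
  proof (intro allI impI notI)
    fix A u M v C assume a: "c # N @ [x] = A @ u # M @ v # C" "M \<noteq> []" "linked D' S1 u v"
    let ?p = "A @ u # v # C"
    have duv: "distinct ?p" "?p \<noteq> []" using dN unfolding a(1) by auto
    have "hd ?p = hd (A @ u # M @ v # C)" by (cases A) auto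
    then have h: "hd ?p = c" using a(1) by (metis list.sel(1))
    have "last ?p = last (A @ u # M @ v # C)" by simp
    then have l: "last ?p = x" using a(1) by (metis last.simps last_snoc snoc_eq_iff_butlast)
    obtain N' where N': "?p = c # N' @ [x]" using shape[OF duv h l] by blast
    have "length (A @ u # v # C) < length (A @ u # M @ v # C)" using a(2) by simp
    then have len: "length N' < n" using N' a(1) g(2) by (metis (no_types) add_less_cancel_right length_Cons length_append not_less_eq Suc_less_eq)
    have sub: "set ?p \<subseteq> set (c # N @ [x])" unfolding a(1) by auto
    have pe: "path_edges ?p \<subseteq> path_edges (c # N @ [x]) \<union> {{u, v}}"
    proof -
      have "path_edges ?p = path_edges (A @ [u]) \<union> {{u, v}} \<union> path_edges (v # C)"
        by (subst path_edges_glue) auto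
      moreover have "path_edges (A @ [u]) \<subseteq> path_edges (c # N @ [x])"
        unfolding a(1) using path_edges_infix[of "A @ [u]" "[]" "M @ v # C"] by simp
      moreover have "path_edges (v # C) \<subseteq> path_edges (c # N @ [x])"
        unfolding a(1) using path_edges_infix[of "v # C" "A @ u # M" "[]"] by simp
      ultimately show ?thesis by blast
    qed
    have contra: False if "good T'' D'' S'' N'" for T'' D'' S'' using least[OF len] that by blast
    have uv: "u \<noteq> v" using a(3) by (simp add: linked_def)
    from a(3) consider f where "f \<in> S1" "u \<in> f" "v \<in> f" | p r where "quad S1 D' p r u v" unfolding linked_def by blast
    then show False
    proof cases
      case (1 f)
      then have "{u, v} \<in> edges_of S'" using S1S uv by (auto intro!: edges_ofI)
      then have "good T' D' S' N'" unfolding good_def N'[symmetric] using eq nm duv(1) sub NL pe Ne by blast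
      then show False by (rule contra)
    next
      case (2 p r)
      have q: "quad S' D' p r u v" using 2 S1S by (rule quad_mono)
      let ?T = "flip T' p r u v" and ?D = "insert {u, v} (D' - {{p, r}})" and ?S = "flip S' p r u v"
      have f1: "flip_equiv T D S ?T ?D ?S"
        by (rule flip_equiv_trans[OF eq flip_equiv_flip[OF e(1,2) q]])
      \<comment> \<open>The quadrilateral lies in \<open>S1\<close> and thus away from
        \<open>Q\<close>, so the flip disturbs neither normality nor the faces that meet
        \<open>Q\<close>.\<close>
      have qQ: "{p, r, u} \<inter> set Q = {}" "{p, r, v} \<inter> set Q = {}" using 2 S1Q unfolding quad_def by blast+
      have f2: "normal ?D ?S (set Q)" unfolding normal_def
      proof (intro allI impI)
        fix i j k m assume ij: "quad ?S ?D i j k m" "k \<in> set Q"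
        show "i \<in> set Q \<or> j \<in> set Q"
        proof (cases "{i, j} = {u, v}")
          case False
          then show ?thesis using quad_flip_back(1)[OF e(1) q e(2) ij(1)] nm ij(2) unfolding normal_def by blast
        next
          case True
          have st2: "(?T, ?D) \<in> St" using f1 by (simp add: flip_equiv_def)
          have "quad ?T ?D u v p r" using flip_back(1)[OF e(1) quad_mono[OF q e(2)] order.refl] .
          moreover have "{i, j, k} \<in> ?T" using ij(1) flip_mono[OF e(2)] unfolding quad_def by blast
          ultimately have "{i, j, k} = {u, v, p} \<or> {i, j, k} = {u, v, r}"
            using quad_faces[OF st2, of u v p r "{i, j, k}"] True by blast
          then have "k \<in> {u, v, p} \<union> {u, v, r}" by blast
          then show ?thesis using qQ ij(2) by auto
        qed
      qed
      have f3: "set (c # N @ [x]) \<subseteq> L ?S"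
      proof
        fix m assume "m \<in> set (c # N @ [x])"
        then have m: "m \<in> L S'" using NL by blast
        then obtain f where f: "f \<in> S'" "m \<in> f" "f \<inter> set Q \<noteq> {}" by (auto simp: L_def)
        have "f \<in> ?S" using f qQ unfolding flip_def by blast
        then show "m \<in> L ?S" using f m unfolding L_def by blast
      qed
      \<comment> \<open>Both faces at \<open>{p, r}\<close> lie in \<open>S1\<close>, so it is no
        boundary edge of \<open>S1\<close> and the flip destroys no edge of the dividing
        path.\<close>
      have pr: "{p, r} \<notin> path_edges (c # N @ [x])"
      proof
        assume "{p, r} \<in> path_edges (c # N @ [x])"
        moreover have "cycle_edges (c # B @ x # rev N) = path_edges (c # B @ [x]) \<union> path_edges (c # rev (rev N) @ [x])"
          by (rule cycle_edges_theta)
        ultimately have "{p, r} \<in> bd S1" unfolding sp(3) by simp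
        moreover have "{p, r, u} \<in> S1" "{p, r, v} \<in> S1" using 2 by (auto simp: quad_def)
        moreover have "{p, r, u} \<noteq> {p, r, v}" using quad_distinct[OF e(1) quad_mono[OF q e(2)]] by auto
        ultimately show False unfolding bd_def by blast
      qed
      have f4: "path_edges ?p \<subseteq> edges_of ?S"
      proof -
        have "{u, v} \<in> edges_of ?S" using uv by (intro edges_ofI[of "{u, v, p}"]) (auto simp: flip_def)
        moreover have "path_edges (c # N @ [x]) \<subseteq> edges_of ?S" using pr Ne edges_of_flip[of S' p r u v] by blast
        ultimately show ?thesis using pe by blast
      qed
      have "good ?T ?D ?S N'" unfolding good_def N'[symmetric] using f1 f2 duv(1) sub f3 f4 by blast
      then show False by (rule contra)
    qed
  qed
  show thesis by (rule that[OF eq sp(1,2,3) bd2 sp(5,6) dall lf adj Z])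
qed

end

section \<open>Disjoint paths covering a disc\<close>

lemma cycle_edges_chord:
  "cycle_edges (x # a @ y # b) = path_edges (x # a @ [y]) \<union> path_edges (y # b @ [x])"
  "cycle_edges (x # a @ [y]) = insert {x, y} (path_edges (x # a @ [y]))"
  "cycle_edges (x # y # b) = insert {x, y} (path_edges (y # b @ [x]))"
proof -
  show "cycle_edges (x # a @ y # b) = path_edges (x # a @ [y]) \<union> path_edges (y # b @ [x])"
    unfolding cycle_edges_Cons using path_edges_glue[of "x # a" y "b @ [x]"] by simp
  show "cycle_edges (x # a @ [y]) = insert {x, y} (path_edges (x # a @ [y]))"
    by (simp add: cycle_edges_eq insert_commute)
qed (simp add: cycle_edges_Cons)

context flip_family
begin

text \<open>The case in which only the two ends of \<open>Q2 @ P\<close> are linked to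
  \<open>Q\<close>. A shortest inner path separates a strip along \<open>Q\<close> from the rest
  \<open>S1\<close>. Two paths in \<open>S1\<close>, joined by the last edge of the inner path, form
  an outer path for \<open>strip_paths\<close>, which adds the path along \<open>Q\<close> and
  repairs missing edges. That the last vertex of \<open>Q2 @ P\<close> lies on \<open>p2\<close>
  matters when this disc is glued to another one.\<close>

lemma core_paths:
  assumes IH: "\<And>m. m < card S \<Longrightarrow> two_paths m"
    and st: "(T, D) \<in> St" and S: "S \<subseteq> T" and cS: "Suc (card S) < card T"
    and bdS: "bd S = cycle_edges (Q @ Q2 @ P)" and dist: "distinct (Q @ Q2 @ P)" and Qne: "Q \<noteq> []" and Q2: "2 \<le> length Q2"
    and lQ: "link_free D S Q" and lQ2: "link_free D S Q2" and lP: "link_free D S (last Q2 # P)"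
    and nl: "\<And>r q. r \<in> set (butlast (tl (Q2 @ P))) \<Longrightarrow> q \<in> set Q \<Longrightarrow> \<not> linked D S r q"
  obtains p1 p2 where "is_path p1 (hd Q) (last Q) (H \<union> bd S)" "is_path p2 (hd Q2) (last Q2) (H \<union> bd S)"
    "set p1 \<inter> set p2 = {}" "set p1 \<union> set p2 = \<Union>S" "last (Q2 @ P) \<in> set p2"
proof -
  define c where "c = hd Q2"
  define G where "G = butlast (tl Q2)"
  define R where "R = last Q2 # P"
  have Q2G: "Q2 = c # G @ [last Q2]"
  proof -
    have "Q2 \<noteq> []" "tl Q2 \<noteq> []" using Q2 by (cases Q2; auto)+
    then show ?thesis unfolding c_def G_def by (metis append_butlast_last_id last_tl list.collapse)
  qed
  have QR: "Q2 @ P = c # G @ R" unfolding R_def by (subst Q2G) simp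
  define x where "x = last R"
  define B where "B = G @ butlast R"
  have GR: "G @ R = B @ [x]" unfolding B_def x_def R_def by simp
  have lastx: "last (Q2 @ P) = x" unfolding QR GR by simp
  have bd1: "bd S = cycle_edges (Q @ c # B @ [x])" using bdS QR GR by simp
  have d1: "distinct (Q @ c # B @ [x])" using dist QR GR by simp
  have nlB: "\<not> linked D S r q" if "r \<in> set B" "q \<in> set Q" for r q
    using nl that unfolding QR GR by simp
  let ?E = "H \<union> bd S"
  have "Q2 @ P \<noteq> []" using Q2 by auto
  then have QS: "path_edges Q \<subseteq> bd S" unfolding bdS using cycle_edges_append[OF Qne, of "Q2 @ P"] by auto
  show thesis
  proof (cases "B = []")
    case True
    have cyc: "bd S = cycle_edges (Q @ [c, x])" using bd1 True by simp
    have bdE: "bd S = path_edges Q \<union> {{c, x}, {last Q, c}, {x, hd Q}}" unfolding cyc using Qne by (auto simp: cycle_edges_append)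
    have lx: "last Q2 = x" "Q2 = [c, x]"
      using GR True Q2G unfolding R_def B_def by auto
    have "\<exists>p1 p2'. is_path p1 (hd Q) (last Q) ?E \<and> is_path p2' c x ?E \<and> set p1 \<inter> set p2' = {} \<and>
      set p1 \<union> set p2' = \<Union>S \<union> set [c, x] \<and> set [c, x] \<subseteq> set p2'"
    proof (rule strip_paths[OF IH st S cS order.refl cyc])
      show "distinct (Q @ [c, x])" using d1 True by simp
      show "3 \<le> length (Q @ [c, x])" using Qne by (cases Q) auto
      show "H \<union> path_edges Q \<subseteq> ?E" using QS by auto
      have e: "{last Q, c} \<in> bd S" "{x, hd Q} \<in> bd S" "{c, x} \<in> bd S" using bdE by auto
      show "\<exists>f\<in>S. n \<in> f \<and> f \<inter> set Q \<noteq> {}" if n: "n \<in> set [c, x]" for n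
      proof -
        obtain f where f: "f \<in> S" "{last Q, c} \<subseteq> f" by (rule boundary_edge_face[OF e(1)])
        obtain g where g: "g \<in> S" "{x, hd Q} \<subseteq> g" by (rule boundary_edge_face[OF e(2)])
        have "c \<in> f \<and> f \<inter> set Q \<noteq> {}" using f(2) last_in_set[OF Qne] by auto
        moreover have "x \<in> g \<and> g \<inter> set Q \<noteq> {}" using g(2) hd_in_set[OF Qne] by auto
        moreover have "n = c \<or> n = x" using n by auto
        ultimately show ?thesis using f(1) g(1) by metis
      qed
      show "f \<inter> set Q = {}" if "e' \<in> path_edges [c, x]" "e' \<notin> ?E" for e' f using that e by simp
      show "is_path [c, x] c x (?E \<union> path_edges [c, x])" using d1 by (auto simp: is_path_def)
      have "{c, x} \<subseteq> \<Union>S" using order.trans[OF Union_upper[OF e(3)] Union_bd_subset] .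
      then show "set [c, x] \<inter> \<Union>S = set [c, x]" by auto
    qed (use Qne lQ in auto)
    then obtain p1 p2 where p: "is_path p1 (hd Q) (last Q) ?E" "is_path p2 c x ?E" "set p1 \<inter> set p2 = {}"
      "set p1 \<union> set p2 = \<Union>S \<union> set [c, x]" "set [c, x] \<subseteq> set p2" by blast
    have "{c, x} \<in> bd S" using bdE by auto
    then have "{c, x} \<subseteq> \<Union>S" using order.trans[OF Union_upper Union_bd_subset] by metis
    then have "\<Union>S \<union> set [c, x] = \<Union>S" by auto
    then show ?thesis by (intro that[of p1 p2]) (use p lx(1) lastx c_def in simp_all)
  next
    case False
    obtain T' D' S' N S1 S2 where eq: "flip_equiv T D S T' D' S'" and sp: "S' = S1 \<union> S2" "S1 \<inter> S2 = {}"
      and b1: "bd S1 = cycle_edges (c # B @ x # rev N)" and b2: "bd S2 = cycle_edges (Q @ c # N @ [x])"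
      and ne: "S1 \<noteq> {}" "S2 \<noteq> {}" and dN: "distinct (Q @ c # B @ x # N)" and lN: "link_free D' S1 (c # N @ [x])"
      and adj: "\<And>n. n \<in> set (c # N @ [x]) \<Longrightarrow> \<exists>f\<in>S2. n \<in> f \<and> f \<inter> set Q \<noteq> {}"
      and Z: "\<And>e f. e \<in> path_edges (c # N @ [x]) \<Longrightarrow> e \<notin> H \<Longrightarrow> f \<in> S2 \<Longrightarrow> e \<subseteq> f \<Longrightarrow> f \<inter> set Q = {}"
      by (rule shortest_inner_path[OF st S bd1 d1 Qne False nlB]) blast+
    note e = flip_equivD[OF eq]
    interpret tri_sphere T' by (rule sphere[OF e(1)])
    have s12: "S1 \<subseteq> S'" "S2 \<subseteq> S'" "S1 \<subseteq> T'" "S2 \<subseteq> T'" using sp(1) e(2) by auto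
    have fin: "finite S'" using e(2) by blast
    have "S1 \<subset> S'" "S2 \<subset> S'" using sp ne by auto
    then have c12: "card S1 < card S" "card S2 < card S" using psubset_card_mono[OF fin] e(4) by auto
    \<comment> \<open>Seen from \<open>S1\<close>, the roles change: the inner path becomes an arc
      of its own, and the inner vertices of \<open>Q2\<close> form the third arc.\<close>
    let ?Q1 = "c # N" and ?Q2 = "rev R" and ?P = "rev G"
    have lf1: "link_free D' S1 X" if "link_free D S X" for X
      using link_free_mono[OF _ s12(1)] link_free_equiv[OF eq] that by blast
    have lf2: "link_free D' S2 X" if "link_free D S X" for X
      using link_free_mono[OF _ s12(2)] link_free_equiv[OF eq] that by blast
    have cyc1: "bd S1 = cycle_edges (?Q1 @ ?Q2 @ ?P)"
    proof -
      have "bd S1 = cycle_edges (rev (c # B @ x # rev N))" unfolding b1 by (simp only: cycle_edges_rev)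
      also have "rev (c # B @ x # rev N) = N @ rev (B @ [x]) @ [c]" by simp
      also have "\<dots> = (N @ rev R @ rev G) @ [c]" unfolding GR[symmetric] by simp
      also have "cycle_edges \<dots> = cycle_edges ([c] @ (N @ rev R @ rev G))" by (rule cycle_edges_commute)
      finally show ?thesis by simp
    qed
    have dd: "distinct (?Q1 @ ?Q2 @ ?P)"
    proof -
      have "set R \<union> set G = set (B @ [x])" using GR by (metis set_append Un_commute)
      moreover have "distinct (G @ R)" using GR dN by simp
      ultimately show ?thesis using dN by auto
    qed
    have ll: "3 \<le> length (?Q1 @ ?Q2 @ ?P)"
    proof -
      have "length (G @ R) = length B + 1" unfolding GR by simp
      then show ?thesis using False by (cases B) auto
    qed
    have l1: "link_free D' S1 ?Q1" using lN link_free_prefix[of D' S1 "c # N" "[x]"] by simp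
    have l2: "link_free D' S1 ?Q2" using lf1[OF lP] unfolding R_def[symmetric] by (simp only: link_free_rev)
    have l3: "link_free D' S1 (last ?Q2 # ?P @ [hd ?Q1])"
    proof -
      have "link_free D' S1 (rev Q2)" using lf1[OF lQ2] by (simp only: link_free_rev)
      moreover have "rev Q2 = last ?Q2 # ?P @ [hd ?Q1]" by (subst Q2G) (simp add: R_def)
      ultimately show ?thesis by simp
    qed
    have pb1: "bd S1 = path_edges (c # B @ [x]) \<union> path_edges (c # N @ [x])"
      unfolding b1 cycle_edges_theta by simp
    \<comment> \<open>Otherwise \<open>{c, x}\<close> would be an edge joining the two ends of
      \<open>Q2\<close>, although \<open>Q2\<close> is free of links.\<close>
    have nb: "\<not> (length ?Q1 = 1 \<and> length ?Q2 = 1)"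
    proof
      assume "length ?Q1 = 1 \<and> length ?Q2 = 1"
      then have N0: "N = []" "P = []" by (auto simp: R_def)
      then have Gne: "G \<noteq> []" using False unfolding B_def R_def by simp
      have "{c, x} \<in> bd S1" using pb1 N0 by simp
      then obtain f where "f \<in> S1" "{c, x} \<subseteq> f" by (rule boundary_edge_face)
      moreover have "c \<noteq> x" using d1 by auto
      ultimately have "linked D' S' c x" using s12(1) by (auto intro: linked_face)
      then have "linked D S c x" using e(7) by simp
      moreover have "last Q2 = x" using N0 by (simp add: x_def R_def)
      ultimately show False using link_freeD[of D S "[]" c G x "[]"] lQ2 Q2G Gne by simp
    qed
    obtain a b where ab: "is_path a (hd ?Q1) (last ?Q1) (H \<union> bd S1)" "is_path b (hd ?Q2) (last ?Q2) (H \<union> bd S1)"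
        "set a \<inter> set b = {}" "set a \<union> set b = \<Union>S1"
    proof (rule two_pathsD[OF IH[OF c12(1)] e(1) s12(3) _ dd ll cyc1 _ _ l1 l2 l3 nb])
      show "Suc (card S1) < card T'" using c12 cS e(3) by simp
    qed (auto simp: R_def)
    have hl: "hd ?Q2 = x" "last ?Q2 = last Q2" by (auto simp: x_def R_def hd_rev)
    have E1: "H \<union> bd S1 \<subseteq> ?E \<union> path_edges (c # N @ [x])"
    proof -
      have "path_edges (c # B @ [x]) \<subseteq> bd S" unfolding bd1 using cycle_edges_append[OF Qne, of "c # B @ [x]"] by auto
      then show ?thesis using pb1 by blast
    qed
    have join: "{last ?Q1, x} \<in> path_edges (c # N @ [x])"
      using path_edges_append[of "c # N" "[x]"] by simp
    have p2: "is_path (a @ b) c (last Q2) (?E \<union> path_edges (c # N @ [x]))"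
      by (rule is_path_append[OF is_path_mono[of a _ "last ?Q1", OF _ E1] is_path_mono[of b x, OF _ E1]])
         (use ab hl join in auto)
    have V1: "\<Union>(bd S1) = set (c # B @ x # N)" unfolding b1 Union_cycle_edges by auto
    have V2: "\<Union>(bd S2) = set (Q @ c # N @ [x])" unfolding b2 Union_cycle_edges ..
    have int: "set (a @ b) \<inter> \<Union>S2 = set (c # N @ [x])"
    proof
      have "set (c # B @ x # N) \<inter> set (Q @ c # N @ [x]) \<subseteq> set (c # N @ [x])" using dN by auto
      then have "\<Union>S1 \<inter> \<Union>S2 \<subseteq> set (c # N @ [x])" using common_vertices[OF s12(3,4) sp(2)] V1 V2 by blast
      then show "set (a @ b) \<inter> \<Union>S2 \<subseteq> set (c # N @ [x])" using ab(4) by auto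
      have "set (c # N @ [x]) \<subseteq> \<Union>S1" using Union_bd_subset[of S1] V1 by auto
      moreover have "set (c # N @ [x]) \<subseteq> \<Union>S2" using Union_bd_subset[of S2] V2 by auto
      ultimately show "set (c # N @ [x]) \<subseteq> set (a @ b) \<inter> \<Union>S2" using ab(4) by auto
    qed
    have "\<exists>p1 p2'. is_path p1 (hd Q) (last Q) ?E \<and> is_path p2' c (last Q2) ?E \<and> set p1 \<inter> set p2' = {} \<and>
      set p1 \<union> set p2' = \<Union>S2 \<union> set (a @ b) \<and> set (a @ b) \<subseteq> set p2'"
    proof (rule strip_paths[OF IH e(1) s12(4) _ _ b2 _ _ Qne _ lf2[OF lQ] adj _ _ p2 int])
      show "Suc (card S2) < card T'" using c12 cS e(3) by simp
      show "card S2 \<le> card S" using c12 by simp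
      show "distinct (Q @ c # N @ [x])" using dN by auto
      show "H \<union> path_edges Q \<subseteq> ?E" using QS by auto
      show "f \<inter> set Q = {}" if "d \<in> path_edges (c # N @ [x])" "d \<notin> ?E" "f \<in> S2" "d \<subseteq> f" for d f
        using Z that by blast
      show "3 \<le> length (Q @ c # N @ [x])" using Qne by (cases Q) auto
    qed auto
    then obtain p1 p2 where p: "is_path p1 (hd Q) (last Q) ?E" "is_path p2 c (last Q2) ?E" "set p1 \<inter> set p2 = {}"
      "set p1 \<union> set p2 = \<Union>S2 \<union> set (a @ b)" "set (a @ b) \<subseteq> set p2" by blast
    have "\<Union>S2 \<union> set (a @ b) = \<Union>S" using ab(4) sp(1) e(6) by auto
    moreover have "x \<in> set p2" using int p(5) by auto
    ultimately show ?thesis by (intro that[of p1 p2]) (use p lastx c_def in auto)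
  qed
qed

text \<open>Links from \<open>P\<close> to \<open>Q1\<close> are still possible. The disc is cut
  along the link from the first vertex \<open>x\<close> of \<open>P\<close> that is linked to
  \<open>Q1\<close> to the first such vertex \<open>y\<close> of \<open>Q1\<close>. The choice of
  \<open>x\<close> makes one part a case for \<open>core_paths\<close>, that of \<open>y\<close>
  makes the other a cone with apex \<open>x\<close>; the paths are glued at
  \<open>y\<close>.\<close>

lemma unlinked_arcs_paths:
  assumes IH: "\<And>m. m < card S \<Longrightarrow> two_paths m"
    and st: "(T, D) \<in> St" and S: "S \<subseteq> T" and cS: "Suc (card S) < card T"
    and bdS: "bd S = cycle_edges (Q1 @ Q2 @ P)" and dist: "distinct (Q1 @ Q2 @ P)" and Qne: "Q1 \<noteq> []" and Q2: "2 \<le> length Q2"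
    and lQ: "link_free D S Q1" and lQ2: "link_free D S Q2" and lP: "link_free D S (last Q2 # P @ [hd Q1])"
    and nl: "\<And>A q B C r F. Q1 = A @ q # B \<Longrightarrow> Q2 = C @ r # F \<Longrightarrow> linked D S q r \<Longrightarrow> B @ C = [] \<or> F @ P @ A = []"
  shows "\<exists>p1 p2. is_path p1 (hd Q1) (last Q1) (H \<union> bd S) \<and> is_path p2 (hd Q2) (last Q2) (H \<union> bd S) \<and>
        set p1 \<inter> set p2 = {} \<and> set p1 \<union> set p2 = \<Union>S"
proof (cases "P = []")
  case True
  obtain p1 p2 where "is_path p1 (hd Q1) (last Q1) (H \<union> bd S)" "is_path p2 (hd Q2) (last Q2) (H \<union> bd S)"
    "set p1 \<inter> set p2 = {}" "set p1 \<union> set p2 = \<Union>S" "last (Q2 @ P) \<in> set p2"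
  proof (rule core_paths[OF IH st S cS bdS dist Qne Q2 lQ lQ2])
    show "link_free D S (last Q2 # P)" using True by (intro link_free_short) simp
    fix r q assume r: "r \<in> set (butlast (tl (Q2 @ P)))" "q \<in> set Q1"
    show "\<not> linked D S r q"
    proof
      assume l: "linked D S r q"
      obtain A B where A: "Q1 = A @ q # B" using r(2) by (meson split_list)
      obtain c G l' where G: "Q2 = c # G @ [l']" "r \<in> set G"
      proof -
        have ne: "Q2 \<noteq> []" "tl Q2 \<noteq> []" using Q2 by (cases Q2; auto)+
        then have "Q2 = hd Q2 # butlast (tl Q2) @ [last Q2]" by (metis append_butlast_last_id last_tl list.collapse)
        then show thesis using that r(1) True by simp
      qed
      obtain C F where "G = C @ r # F" using G(2) by (meson split_list)
      then have "Q2 = (c # C) @ r # (F @ [l'])" using G by simp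
      from nl[OF A this] l show False unfolding linked_commute[of D S r q] by auto
    qed
  qed auto
  then show ?thesis by blast
next
  case Pne: False
  have bdE: "bd S = cycle_edges ((Q2 @ P) @ Q1)" unfolding bdS by (rule cycle_edges_commute)
  \<comment> \<open>The boundary edge from \<open>last P\<close> to \<open>hd Q1\<close> shows that
    some link exists.\<close>
  have "\<exists>x\<in>set P. \<exists>q\<in>set Q1. linked D S q x"
  proof -
    have "{last P, hd Q1} \<in> bd S" unfolding bdE using cycle_edges_append[of "Q2 @ P" Q1] Pne Qne by simp
    then obtain f where f: "f \<in> S" "{last P, hd Q1} \<subseteq> f" by (rule boundary_edge_face)
    have "last P \<in> set P" "hd Q1 \<in> set Q1" using Pne Qne by auto
    moreover from this have "last P \<noteq> hd Q1" using dist by auto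
    ultimately show ?thesis using f by (intro bexI[of _ "last P"] bexI[of _ "hd Q1"]) (auto intro: linked_face)
  qed
  from split_list_first_prop[OF this] obtain P1 x P2 where P: "P = P1 @ x # P2" and ex: "\<exists>q\<in>set Q1. linked D S q x"
    and P1: "\<And>z q. z \<in> set P1 \<Longrightarrow> q \<in> set Q1 \<Longrightarrow> \<not> linked D S q z" by blast
  from split_list_first_prop[OF ex] obtain A y B where Q1: "Q1 = A @ y # B" and yx: "linked D S y x"
    and A: "\<And>q. q \<in> set A \<Longrightarrow> \<not> linked D S q x" by blast
  have nlc: "\<not> linked D S r q" if r: "r \<in> set (butlast (tl (Q2 @ P1 @ [x])))" "q \<in> set Q1" for r q
  proof
    assume "linked D S r q"
    then have l: "linked D S q r" using linked_commute by metis
    have "tl (Q2 @ P1 @ [x]) = tl Q2 @ P1 @ [x]" using Q2 by (cases Q2) auto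
    then have "r \<in> set (tl Q2) \<union> set P1" using r(1) by (simp add: butlast_append)
    then consider "r \<in> set P1" | "r \<in> set (tl Q2)" by blast
    then show False
    proof cases
      case 1
      then show ?thesis using P1 l r(2) by blast
    next
      case 2
      then obtain C F where CF: "tl Q2 = C @ r # F" by (meson split_list)
      then have "Q2 = (hd Q2 # C) @ r # F" using Q2 by (cases Q2) auto
      moreover obtain A' B' where "Q1 = A' @ q # B'" using r(2) by (meson split_list)
      ultimately show ?thesis using nl l Pne by blast
    qed
  qed
  have lP1: "link_free D S (last Q2 # P1 @ [x])"
    using lP link_free_prefix[of D S "last Q2 # P1 @ [x]" "P2 @ [hd Q1]"] P by simp
  show ?thesis
  proof (cases "P2 @ A = []")
    case True
    then have Px: "P = P1 @ [x]" using P by simp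
    obtain p1 p2 where "is_path p1 (hd Q1) (last Q1) (H \<union> bd S)" "is_path p2 (hd Q2) (last Q2) (H \<union> bd S)"
      "set p1 \<inter> set p2 = {}" "set p1 \<union> set p2 = \<Union>S" "last (Q2 @ P1 @ [x]) \<in> set p2"
      by (rule core_paths[OF IH st S cS bdS[unfolded Px] dist[unfolded Px] Qne Q2 lQ lQ2 lP1 nlc]) auto
    then show ?thesis by blast
  next
    case False
    obtain T' D' S' where eq: "flip_equiv T D S T' D' S'" and yxe: "{y, x} \<in> edges_of S'"
      by (rule linked_make_edge[OF st S yx]) blast
    note e = flip_equivD[OF eq]
    interpret tri_sphere T' by (rule sphere[OF e(1)])
    have bd': "bd S' = cycle_edges (y # (B @ Q2 @ P1) @ x # (P2 @ A))"
      unfolding e(5) bdS Q1 P using cycle_edges_commute[of A "y # B @ Q2 @ P1 @ x # P2"] by simp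
    have d': "distinct (y # (B @ Q2 @ P1) @ x # (P2 @ A))" using dist unfolding Q1 P by auto
    have ne1: "B @ Q2 @ P1 \<noteq> []" using Q2 by auto
    obtain S1 S2 where sp: "S' = S1 \<union> S2" "S1 \<inter> S2 = {}" "bd S1 = cycle_edges (y # (B @ Q2 @ P1) @ [x])"
      "bd S2 = cycle_edges (y # x # (P2 @ A))" "S1 \<noteq> {}" "S2 \<noteq> {}"
      by (rule chord_split[OF e(2) bd' d' yxe ne1 False])
    have b1: "bd S1 = cycle_edges ((y # B) @ Q2 @ P1 @ [x])" using sp(3) by simp
    have b2: "bd S2 = cycle_edges ((A @ [y]) @ x # P2)"
      using sp(4) cycle_edges_commute[of A "y # x # P2"] by simp
    have s12: "S1 \<subseteq> S'" "S2 \<subseteq> S'" "S1 \<subseteq> T'" "S2 \<subseteq> T'" using sp(1) e(2) by auto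
    have fin: "finite S'" using e(2) by blast
    have "S1 \<subset> S'" "S2 \<subset> S'" using sp by auto
    then have c12: "card S1 < card S" "card S2 < card S" using psubset_card_mono[OF fin] e(4) by auto
    have lf1: "link_free D' S1 X" if "link_free D S X" for X
      using link_free_mono[OF _ s12(1)] link_free_equiv[OF eq] that by blast
    have lf2: "link_free D' S2 X" if "link_free D S X" for X
      using link_free_mono[OF _ s12(2)] link_free_equiv[OF eq] that by blast
    have lk1: "linked D S u v" if "linked D' S1 u v" for u v using linked_mono[OF that s12(1)] e(7) by simp
    have lk2: "linked D S u v" if "linked D' S2 u v" for u v using linked_mono[OF that s12(2)] e(7) by simp
    obtain p1 p2 where p: "is_path p1 (hd (y # B)) (last (y # B)) (H \<union> bd S1)" "is_path p2 (hd Q2) (last Q2) (H \<union> bd S1)"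
      "set p1 \<inter> set p2 = {}" "set p1 \<union> set p2 = \<Union>S1" "last (Q2 @ P1 @ [x]) \<in> set p2"
    proof (rule core_paths[OF _ e(1) s12(3) _ b1 _ _ Q2 _ lf1[OF lQ2] lf1[OF lP1]])
      show "two_paths m" if "m < card S1" for m using IH that c12 by simp
      show "Suc (card S1) < card T'" using c12 cS e(3) by simp
      show "distinct ((y # B) @ Q2 @ P1 @ [x])" using d' by auto
      show "link_free D' S1 (y # B)" using lf1 lQ link_free_suffix[of D S A "y # B"] Q1 by simp
      show "\<not> linked D' S1 r q" if "r \<in> set (butlast (tl (Q2 @ P1 @ [x])))" "q \<in> set (y # B)" for r q
        using nlc[OF that(1), of q] that(2) lk1 Q1 by auto
    qed auto
    obtain p3 where p3: "is_path p3 (hd (A @ [y])) (last (A @ [y])) (H \<union> bd S2)" "set p3 = \<Union>S2 - {x}"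
    proof (rule cone_path[OF _ e(1) s12(4) _ b2])
      show "two_paths m" if "m < card S2" for m using IH that c12 by simp
      show "Suc (card S2) < card T'" using c12 cS e(3) by simp
      show "distinct ((A @ [y]) @ x # P2)" using d' by auto
      show "3 \<le> length ((A @ [y]) @ x # P2)" using False by (cases A; cases P2; simp)
      show "link_free D' S2 (A @ [y])" using lf2 lQ link_free_prefix[of D S "A @ [y]" B] Q1 by simp
      have "hd (A @ [y]) = hd Q1" using Q1 by (cases A) auto
      then show "link_free D' S2 (x # P2 @ [hd (A @ [y])])"
        using lf2 lP link_free_suffix[of D S "last Q2 # P1" "x # P2 @ [hd Q1]"] P by simp
      show "\<not> linked D' S2 x r" if "A @ [y] = A' @ r # B'" "A' \<noteq> []" "B' \<noteq> []" for A' r B'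
      proof -
        have "r \<in> set A" using that by (cases B' rule: rev_cases) auto
        then show ?thesis using A lk2 linked_commute by metis
      qed
    qed auto
    have V1: "\<Union>(bd S1) = set (y # B @ Q2 @ P1 @ [x])" unfolding b1 Union_cycle_edges by simp
    have V2: "\<Union>(bd S2) = set (A @ y # x # P2)" unfolding b2 Union_cycle_edges by simp
    have common: "\<Union>S1 \<inter> \<Union>S2 \<subseteq> {y, x}"
    proof -
      have "set (y # B @ Q2 @ P1 @ [x]) \<inter> set (A @ y # x # P2) \<subseteq> {y, x}" using d' by auto
      then show ?thesis using common_vertices[OF s12(3,4) sp(2)] V1 V2 by blast
    qed
    have xp2: "x \<in> set p2" using p(5) by simp
    have yp1: "y \<in> set p1" using is_path_ends[OF p(1)] by simp
    have yp3: "y \<in> set p3" using is_path_ends[OF p3(1)] by simp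
    have bds: "bd S1 \<subseteq> insert {y, x} (bd S)" "bd S2 \<subseteq> insert {y, x} (bd S)"
      unfolding sp(3,4) e(5)[symmetric] bd' cycle_edges_chord by auto
    \<comment> \<open>None of the paths uses the chord \<open>{y, x}\<close>: \<open>p1\<close>
      misses \<open>x\<close>, \<open>p2\<close> misses \<open>y\<close>, and \<open>p3\<close>
      leaves out \<open>x\<close>.\<close>
    have r1: "is_path p1 y (last (y # B)) (H \<union> bd S)"
      by (rule is_path_restrict[of _ _ _ _ "bd S1"]) (use p bds xp2 in auto)
    have r2: "is_path p2 (hd Q2) (last Q2) (H \<union> bd S)"
      by (rule is_path_restrict[OF p(2)]) (use p bds yp1 in auto)
    have r3: "is_path p3 (hd (A @ [y])) y (H \<union> bd S)"
      by (rule is_path_restrict[of _ _ _ _ "bd S2"]) (use p3 bds in auto)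
    have "set p3 \<inter> set p1 = {y}" using common p(4) p3(2) yp1 yp3 by blast
    note g = is_path_glue[OF r3 r1 this]
    have "hd (A @ [y]) = hd Q1" "last (y # B) = last Q1" using Q1 by (cases A; simp)+
    then have "is_path (p3 @ tl p1) (hd Q1) (last Q1) (H \<union> bd S)" using g(1) by simp
    moreover have "set (p3 @ tl p1) \<inter> set p2 = {}"
    proof -
      have "set p3 \<inter> set p2 \<subseteq> {y}" using common p(4) p3(2) by blast
      then have "set p3 \<inter> set p2 = {}" using p(3) yp1 by blast
      then show ?thesis using g(2) p(3) by blast
    qed
    moreover have "set (p3 @ tl p1) \<union> set p2 = \<Union>S"
    proof -
      have "set (p3 @ tl p1) \<union> set p2 = (\<Union>S2 - {x}) \<union> \<Union>S1" using g(2) p(4) p3(2) by blast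
      also have "\<dots> = \<Union>S2 \<union> \<Union>S1" using xp2 p(4) by blast
      also have "\<dots> = \<Union>S" using sp(1) e(6) by auto
      finally show ?thesis .
    qed
    ultimately show ?thesis using r2 by blast
  qed
qed

text \<open>A link between the two arcs that leaves vertices on both sides becomes a chord; both
  halves are solved and the paths are glued at its ends. Without such a link
  \<open>unlinked_arcs_paths\<close> applies, after reversal of the boundary if the second arc is a
  single vertex.\<close>

lemma two_paths_step:
  assumes IH: "\<And>m. m < n \<Longrightarrow> two_paths m"
  shows "two_paths n"
  unfolding two_paths_def
proof (intro allI impI)
  fix T D S Q1 Q2 P
  assume st: "(T, D) \<in> St" and S: "S \<subseteq> T" and cn: "card S = n" and cS: "Suc n < card T"
    and dist: "distinct (Q1 @ Q2 @ P)" and len: "3 \<le> length (Q1 @ Q2 @ P)" and bdS: "bd S = cycle_edges (Q1 @ Q2 @ P)"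
    and ne: "Q1 \<noteq> []" "Q2 \<noteq> []" and l1: "link_free D S Q1" and l2: "link_free D S Q2" and l3: "link_free D S (last Q2 # P @ [hd Q1])"
    and nb: "\<not> (length Q1 = 1 \<and> length Q2 = 1)"
  have IHc: "two_paths m" if "m < card S" for m using IH that cn by simp
  have cS': "Suc (card S) < card T" using cS cn by simp
  show "\<exists>p1 p2. is_path p1 (hd Q1) (last Q1) (H \<union> bd S) \<and> is_path p2 (hd Q2) (last Q2) (H \<union> bd S) \<and>
        set p1 \<inter> set p2 = {} \<and> set p1 \<union> set p2 = \<Union>S"
  proof (cases "\<exists>A q B C r F. Q1 = A @ q # B \<and> Q2 = C @ r # F \<and> linked D S q r \<and> B @ C \<noteq> [] \<and> F @ P @ A \<noteq> []")
    case False
    then have nl: "B @ C = [] \<or> F @ P @ A = []" if "Q1 = A @ q # B" "Q2 = C @ r # F" "linked D S q r" for A q B C r F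
      using that by blast
    show ?thesis
    proof (cases "2 \<le> length Q2")
      case True
      show ?thesis by (rule unlinked_arcs_paths[OF IHc st S cS' bdS dist ne(1) True l1 l2 l3 nl])
    next
      case F2: False
      have "length Q1 \<noteq> 0" "length Q2 \<noteq> 0" using ne by auto
      then have q1: "2 \<le> length (rev Q1)" using nb F2 unfolding length_rev by linarith
      have b': "bd S = cycle_edges (rev Q2 @ rev Q1 @ rev P)"
      proof -
        have "bd S = cycle_edges (rev (Q1 @ Q2 @ P))" unfolding bdS by (simp only: cycle_edges_rev)
        also have "\<dots> = cycle_edges (rev P @ (rev Q2 @ rev Q1))" by simp
        also have "\<dots> = cycle_edges ((rev Q2 @ rev Q1) @ rev P)" by (rule cycle_edges_commute)
        finally show ?thesis by simp
      qed
      have l3': "link_free D S (last (rev Q1) # rev P @ [hd (rev Q2)])"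
      proof -
        have "link_free D S (rev (last Q2 # P @ [hd Q1]))" using l3 by (simp only: link_free_rev)
        then show ?thesis using ne by (simp add: hd_rev last_rev)
      qed
      have "\<exists>p1 p2. is_path p1 (hd (rev Q2)) (last (rev Q2)) (H \<union> bd S) \<and> is_path p2 (hd (rev Q1)) (last (rev Q1)) (H \<union> bd S) \<and>
        set p1 \<inter> set p2 = {} \<and> set p1 \<union> set p2 = \<Union>S"
      proof (rule unlinked_arcs_paths[OF IHc st S cS' b' _ _ q1 _ _ l3'])
        show "distinct (rev Q2 @ rev Q1 @ rev P)" using dist by auto
        fix A q B C r F assume a: "rev Q2 = A @ q # B" "rev Q1 = C @ r # F" "linked D S q r"
        have "Q2 = rev B @ q # rev A" "Q1 = rev F @ r # rev C" using a(1,2) by (simp_all add: rev_swap)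
        moreover have "linked D S r q" using a(3) linked_commute by metis
        ultimately have "rev C @ rev B = [] \<or> rev A @ P @ rev F = []" using nl by blast
        then show "B @ C = [] \<or> F @ rev P @ A = []" by auto
      qed (use ne l1 l2 in auto)
      then obtain p1 p2 where p: "is_path p1 (last Q2) (hd Q2) (H \<union> bd S)" "is_path p2 (last Q1) (hd Q1) (H \<union> bd S)"
        "set p1 \<inter> set p2 = {}" "set p1 \<union> set p2 = \<Union>S" using ne by (auto simp: hd_rev last_rev)
      show ?thesis
        by (rule exI[of _ "rev p2"], rule exI[of _ "rev p1"]) (use is_path_rev[OF p(1)] is_path_rev[OF p(2)] p(3,4) in auto)
    qed
  next
    case True
    then obtain A q B C r F where Q1: "Q1 = A @ q # B" and Q2: "Q2 = C @ r # F" and qr: "linked D S q r"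
      and ne1: "B @ C \<noteq> []" and ne2: "F @ P @ A \<noteq> []" by blast
    obtain T' D' S' where eq: "flip_equiv T D S T' D' S'" and qre: "{q, r} \<in> edges_of S'"
      by (rule linked_make_edge[OF st S qr]) blast
    note e = flip_equivD[OF eq]
    interpret tri_sphere T' by (rule sphere[OF e(1)])
    have bd': "bd S' = cycle_edges (q # (B @ C) @ r # (F @ P @ A))"
      unfolding e(5) bdS Q1 Q2 using cycle_edges_commute[of A "q # B @ C @ r # F @ P"] by simp
    have d': "distinct (q # (B @ C) @ r # (F @ P @ A))" using dist unfolding Q1 Q2 by auto
    obtain S1 S2 where sp: "S' = S1 \<union> S2" "S1 \<inter> S2 = {}" "bd S1 = cycle_edges (q # (B @ C) @ [r])"
      "bd S2 = cycle_edges (q # r # (F @ P @ A))" "S1 \<noteq> {}" "S2 \<noteq> {}"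
      by (rule chord_split[OF e(2) bd' d' qre ne1 ne2])
    have b1: "bd S1 = cycle_edges ((q # B) @ (C @ [r]) @ [])" using sp(3) by simp
    have b2: "bd S2 = cycle_edges ((A @ [q]) @ (r # F) @ P)"
      using sp(4) cycle_edges_commute[of A "q # r # F @ P"] by simp
    have s12: "S1 \<subseteq> S'" "S2 \<subseteq> S'" "S1 \<subseteq> T'" "S2 \<subseteq> T'" using sp(1) e(2) by auto
    have fin: "finite S'" using e(2) by blast
    have "S1 \<subset> S'" "S2 \<subset> S'" using sp by auto
    then have c12: "card S1 < card S" "card S2 < card S" using psubset_card_mono[OF fin] e(4) by auto
    have lf1: "link_free D' S1 X" if "link_free D S X" for X
      using link_free_mono[OF _ s12(1)] link_free_equiv[OF eq] that by blast
    have lf2: "link_free D' S2 X" if "link_free D S X" for X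
      using link_free_mono[OF _ s12(2)] link_free_equiv[OF eq] that by blast
    obtain a1 a2 where a: "is_path a1 (hd (q # B)) (last (q # B)) (H \<union> bd S1)" "is_path a2 (hd (C @ [r])) (last (C @ [r])) (H \<union> bd S1)"
      "set a1 \<inter> set a2 = {}" "set a1 \<union> set a2 = \<Union>S1"
    proof (rule two_pathsD[OF IHc[OF c12(1)] e(1) s12(3) _ _ _ b1])
      show "Suc (card S1) < card T'" using c12 cS' e(3) by simp
      show "distinct ((q # B) @ (C @ [r]) @ [])" using d' by auto
      show "3 \<le> length ((q # B) @ (C @ [r]) @ [])" using ne1 by (cases B; cases C; simp)
      show "link_free D' S1 (q # B)" using lf1 l1 link_free_suffix[of D S A "q # B"] Q1 by simp
      show "link_free D' S1 (C @ [r])" using lf1 l2 link_free_prefix[of D S "C @ [r]" F] Q2 by simp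
      show "link_free D' S1 (last (C @ [r]) # [] @ [hd (q # B)])" by (rule link_free_short) simp
      show "\<not> (length (q # B) = 1 \<and> length (C @ [r]) = 1)" using ne1 by auto
    qed auto
    have hl: "hd (A @ [q]) = hd Q1" "last (r # F) = last Q2" "last (q # B) = last Q1" "hd (C @ [r]) = hd Q2"
      unfolding Q1 Q2 by (cases A; cases C; simp)+
    obtain b1' b2' where b: "is_path b1' (hd (A @ [q])) (last (A @ [q])) (H \<union> bd S2)" "is_path b2' (hd (r # F)) (last (r # F)) (H \<union> bd S2)"
      "set b1' \<inter> set b2' = {}" "set b1' \<union> set b2' = \<Union>S2"
    proof (rule two_pathsD[OF IHc[OF c12(2)] e(1) s12(4) _ _ _ b2])
      show "Suc (card S2) < card T'" using c12 cS' e(3) by simp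
      show "distinct ((A @ [q]) @ (r # F) @ P)" using d' by auto
      show "3 \<le> length ((A @ [q]) @ (r # F) @ P)" using ne2 by (cases A; cases F; cases P; simp)
      show "link_free D' S2 (A @ [q])" using lf2 l1 link_free_prefix[of D S "A @ [q]" B] Q1 by simp
      show "link_free D' S2 (r # F)" using lf2 l2 link_free_suffix[of D S C "r # F"] Q2 by simp
      show "link_free D' S2 (last (r # F) # P @ [hd (A @ [q])])" unfolding hl using lf2[OF l3] .
      \<comment> \<open>If both arcs were single vertices, the link would join the ends of the third
        arc, which is free of links.\<close>
      show "\<not> (length (A @ [q]) = 1 \<and> length (r # F) = 1)"
      proof
        assume "length (A @ [q]) = 1 \<and> length (r # F) = 1"
        then have "A = []" "F = []" by auto
        then have "last Q2 # P @ [hd Q1] = [] @ r # P @ q # []" "P \<noteq> []" using ne2 Q1 Q2 by auto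
        then have "\<not> linked D S r q" using link_freeD l3 by metis
        then show False using qr linked_commute by metis
      qed
    qed auto
    have V1: "\<Union>(bd S1) = set (q # B @ C @ [r])" unfolding b1 Union_cycle_edges by simp
    have V2: "\<Union>(bd S2) = set (A @ q # r # F @ P)" unfolding b2 Union_cycle_edges by simp
    have common: "\<Union>S1 \<inter> \<Union>S2 \<subseteq> {q, r}"
    proof -
      have "set (q # B @ C @ [r]) \<inter> set (A @ q # r # F @ P) \<subseteq> {q, r}" using d' by auto
      then show ?thesis using common_vertices[OF s12(3,4) sp(2)] V1 V2 by blast
    qed
    have qs: "q \<in> set a1" "q \<in> set b1'" "r \<in> set a2" "r \<in> set b2'"
      using is_path_ends[OF a(1)] is_path_ends[OF a(2)] is_path_ends[OF b(1)] is_path_ends[OF b(2)] by auto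
    have bds: "bd S1 \<subseteq> insert {q, r} (bd S)" "bd S2 \<subseteq> insert {q, r} (bd S)"
      unfolding sp(3,4) e(5)[symmetric] bd' cycle_edges_chord by auto
    have r1: "is_path a1 q (last Q1) (H \<union> bd S)"
      by (rule is_path_restrict[of _ _ _ _ "bd S1"]) (use a bds qs hl in auto)
    have r2: "is_path a2 (hd Q2) r (H \<union> bd S)"
      by (rule is_path_restrict[of _ _ _ _ "bd S1"]) (use a bds qs hl in auto)
    have r3: "is_path b1' (hd Q1) q (H \<union> bd S)"
      by (rule is_path_restrict[of _ _ _ _ "bd S2"]) (use b bds qs hl in auto)
    have r4: "is_path b2' r (last Q2) (H \<union> bd S)"
      by (rule is_path_restrict[of _ _ _ _ "bd S2"]) (use b bds qs hl in auto)
    have sub: "set a1 \<subseteq> \<Union>S1" "set a2 \<subseteq> \<Union>S1" "set b1' \<subseteq> \<Union>S2" "set b2' \<subseteq> \<Union>S2" using a(4) b(4) by blast+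
    have nin: "r \<notin> set a1" "q \<notin> set a2" "r \<notin> set b1'" "q \<notin> set b2'" using a(3) b(3) qs by blast+
    have "set b1' \<inter> set a1 \<subseteq> {q, r}" "set a2 \<inter> set b2' \<subseteq> {q, r}" using common sub by blast+
    then have i1: "set b1' \<inter> set a1 = {q}" and i2: "set a2 \<inter> set b2' = {r}" using qs nin by blast+
    have i3: "set a1 \<inter> set b2' = {}" using common sub nin by blast
    have i4: "set b1' \<inter> set a2 = {}" using common sub nin by blast
    note g1 = is_path_glue[OF r3 r1 i1] and g2 = is_path_glue[OF r2 r4 i2]
    have "set (b1' @ tl a1) \<inter> set (a2 @ tl b2') = {}" unfolding g1(2) g2(2) using i3 i4 a(3) b(3) by blast
    moreover have "set (b1' @ tl a1) \<union> set (a2 @ tl b2') = \<Union>S"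
    proof -
      have "set (b1' @ tl a1) \<union> set (a2 @ tl b2') = \<Union>S2 \<union> \<Union>S1" unfolding g1(2) g2(2) using a(4) b(4) by blast
      then show ?thesis using sp(1) e(6) by auto
    qed
    ultimately show ?thesis using g1(1) g2(1) by blast
  qed
qed

section \<open>The Hamiltonian cycle of a state\<close>

lemma two_paths_all: "two_paths n"
  by (induction n rule: less_induct) (rule two_paths_step)

text \<open>The disc is everything outside the quadrilateral around an edge \<open>d\<close>. Two
  opposite sides of the quadrilateral provide the ends of the two paths, the other two sides close
  them up.\<close>

lemma hamilton_cycle:
  assumes st: "(T, D) \<in> St" and ne: "T \<noteq> {}" and big: "4 < card T"
  obtains c where "distinct c" "3 \<le> length c" "set c = \<Union>T" "cycle_edges c \<subseteq> H"
proof -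
  interpret tri_sphere T by (rule sphere[OF st])
  \<comment> \<open>If there are optional diagonals, one of them is taken, so that none of the four
    sides of its quadrilateral is optional.\<close>
  have "\<exists>d\<in>edges_of T. D = {} \<or> d \<in> D"
  proof (cases "D = {}")
    case True
    obtain f where f: "f \<in> T" using ne by blast
    obtain a b c where abc: "f = {a, b, c}" "a \<noteq> b" using face_sets[OF f] by metis
    then have "{a, b} \<in> edges_of T" using f by (auto intro: edges_ofI)
    then show ?thesis using True by blast
  qed (use diagonals[OF st] in blast)
  then obtain d where d: "d \<in> edges_of T" "D = {} \<or> d \<in> D" by blast
  obtain a b where ab: "d = {a, b}" "a \<noteq> b" using edge_doubleton[OF d(1)] by blast
  obtain f g where fg: "f \<in> T" "g \<in> T" "f \<noteq> g" "{h \<in> T. d \<subseteq> h} = {f, g}" by (rule edge_faces[OF d(1)])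
  have df: "{a, b} \<subseteq> f" "{a, b} \<subseteq> g" using fg(4) ab by blast+
  obtain u where u: "f = {a, b, u}" "u \<noteq> a" "u \<noteq> b" by (rule face_third[OF fg(1) df(1) ab(2)])
  obtain v where v: "g = {a, b, v}" "v \<noteq> a" "v \<noteq> b" by (rule face_third[OF fg(2) df(2) ab(2)])
  have uv: "u \<noteq> v" using fg(3) u v by auto
  let ?S = "T - {f, g}"
  let ?c = "[a, u] @ [b, v] @ []"
  have dc: "distinct ?c" using u v uv ab by auto
  have cyc: "cycle_edges ?c = {{a, u}, {b, u}, {a, v}, {b, v}}" by (auto simp: cycle_edges_def insert_commute)
  have bdS: "bd ?S = cycle_edges ?c"
  proof -
    have "bd ?S = bd {f, g}" by (rule bd_compl) (use fg in auto)
    also have "bd {f, g} = bd ({f} \<union> {g})" by (simp add: insert_commute)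
    also have "\<dots> = sym_diff (bd {f}) (bd {g})" by (rule bd_disjoint_Un) (use fg in auto)
    also have "\<dots> = cycle_edges ?c"
      unfolding cyc u v bd_face[OF fg(1)[unfolded u(1)]] bd_face[OF fg(2)[unfolded v(1)]]
      using u v uv ab by (auto simp: doubleton_eq_iff)
    finally show ?thesis .
  qed
  have cHd: "bd ?S \<subseteq> H"
  proof
    fix e assume e: "e \<in> bd ?S"
    then have eT: "e \<in> edges_of T" using bd_sub_edges[of ?S] by auto
    have es: "e \<in> {{a, u}, {b, u}, {a, v}, {b, v}}" using e unfolding bdS cyc .
    have sub: "e \<subseteq> f \<or> e \<subseteq> g" using es u(1) v(1) by auto
    have "u \<in> e \<or> v \<in> e" using es by auto
    then have nd: "e \<noteq> d" using u v ab by auto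
    have "e \<notin> D"
    proof
      assume "e \<in> D"
      then have "d \<in> D" using d(2) by blast
      then have "e = d" using one_diagonal[OF st \<open>e \<in> D\<close>] sub fg(1,2) df ab by blast
      then show False using nd by simp
    qed
    then show "e \<in> H" using non_diagonals[OF st] eT by blast
  qed
  have cS: "card ?S = card T - 2" using fg card_Diff_subset[of "{f, g}" T] by simp
  have ll: "3 \<le> length ?c" by simp
  obtain p1 p2 where p: "is_path p1 (hd [a, u]) (last [a, u]) (H \<union> bd ?S)" "is_path p2 (hd [b, v]) (last [b, v]) (H \<union> bd ?S)"
    "set p1 \<inter> set p2 = {}" "set p1 \<union> set p2 = \<Union>?S"
    by (rule two_pathsD[OF two_paths_all st _ _ dc ll bdS _ _ link_free_short link_free_short link_free_short])
       (use cS big in auto)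
  have p': "is_path p1 a u H" "is_path p2 b v H" using p cHd by (auto intro: is_path_mono)
  have cH: "{u, b} \<in> H" "{v, a} \<in> H" using cHd unfolding bdS cyc by (auto simp: insert_commute)
  have i: "is_path (p1 @ p2) a v H" by (rule is_path_append[OF p' cH(1) p(3)])
  have U: "\<Union>?S = \<Union>T"
  proof -
    have "{a, u, b, v} \<subseteq> \<Union>?S" using Union_bd_subset[of ?S] unfolding bdS Union_cycle_edges by auto
    moreover have "\<Union>T = \<Union>?S \<union> {a, u, b, v}" using fg(1,2) u v by auto
    ultimately show ?thesis by blast
  qed
  have s: "set (p1 @ p2) = \<Union>T" using p(4) U by simp
  have "cycle_edges (p1 @ p2) \<subseteq> H" using i cH(2) by (auto simp: is_path_def cycle_edges_eq)
  moreover have "distinct (p1 @ p2)" using i by (simp add: is_path_def)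
  moreover have "3 \<le> length (p1 @ p2)"
  proof -
    have "{a, u, b} \<subseteq> set (p1 @ p2)" using s fg(1) u by auto
    then have "card {a, u, b} \<le> card (set (p1 @ p2))" by (intro card_mono) auto
    then show ?thesis using card_length[of "p1 @ p2"] u ab by simp
  qed
  ultimately show thesis using that s by blast
qed

end

section \<open>Flips preserve triangulated spheres\<close>

text \<open>The old and the new pair of faces have the same boundary, so a set of faces containing
  both or none of a pair can be carried over with its boundary unchanged. Both homological axioms
  are reduced to such sets.\<close>

lemma (in tri_sphere) tri_sphere_flip:
  assumes f: "{a, b, u} \<in> T" "{a, b, v} \<in> T" "u \<noteq> v" and ne: "{u, v} \<notin> edges_of T"
  shows "tri_sphere (flip T a b u v)"
proof -
  let ?O1 = "{a, b, u}" and ?O2 = "{a, b, v}" and ?N1 = "{u, v, a}" and ?N2 = "{u, v, b}"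
  let ?T = "flip T a b u v"
  have d: "a \<noteq> b" "a \<noteq> u" "b \<noteq> u" "a \<noteq> v" "b \<noteq> v" using face_distinct[OF f(1)] face_distinct[OF f(2)] by auto
  have noN: "\<not> {u, v} \<subseteq> h" if "h \<in> T" for h using ne that f(3) by (auto intro: edges_ofI)
  have N: "?N1 \<notin> T" "?N2 \<notin> T" using noN by blast+
  have One: "?O1 \<noteq> ?O2" "?N1 \<noteq> ?N2" using d f(3) by auto
  have ab: "h = ?O1 \<or> h = ?O2" if "h \<in> T" "{a, b} \<subseteq> h" for h
  proof -
    have "{a, b} \<in> edges_of T" using f(1) d by (auto intro: edges_ofI)
    then have "{h \<in> T. {a, b} \<subseteq> h} = {?O1, ?O2}" using faces_of_edge[OF _ f(1,2) _ _ One(1)] by auto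
    then show ?thesis using that by blast
  qed
  have T': "?T = (T - {?O1, ?O2}) \<union> {?N1, ?N2}" by (simp add: flip_def)
  \<comment> \<open>At a side of the quadrilateral, one new face takes the place of one old
    face.\<close>
  have swap: "\<exists>g. g \<noteq> N \<and> {h \<in> ?T. e \<subseteq> h} = {N, g}"
    if e: "card e = 2" "e \<subseteq> K" "e \<subseteq> N" "{K, K'} = {?O1, ?O2}" "{N, N'} = {?N1, ?N2}" "\<not> e \<subseteq> K'" "\<not> e \<subseteq> N'" for e K K' N N'
  proof -
    have "K \<in> {K, K'}" "N \<in> {N, N'}" by simp_all
    then have "K \<in> {?O1, ?O2}" "N \<in> {?N1, ?N2}" unfolding e(4,5) .
    then have KT: "K \<in> T" "N \<notin> T" using f N by auto
    obtain g where g: "g \<noteq> K" "{h \<in> T. e \<subseteq> h} = {K, g}" using two_faces[OF KT(1) e(2,1)] by blast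
    have "g \<in> T" using g(2) by blast
    then have "g \<noteq> N" using KT by blast
    moreover have "{h \<in> ?T. e \<subseteq> h} = insert N ({h \<in> T. e \<subseteq> h} - {K})"
      unfolding T' e(4)[symmetric] e(5)[symmetric] using e(3,6,7) by blast
    ultimately show ?thesis using g by auto
  qed
  have quadedges: "\<exists>N g. g \<noteq> N \<and> {h \<in> ?T. e \<subseteq> h} = {N, g}" if e: "e \<in> {{a, u}, {b, u}, {a, v}, {b, v}}" for e
  proof -
    have *: "{?O2, ?O1} = {?O1, ?O2}" "{?N2, ?N1} = {?N1, ?N2}" by auto
    consider "e = {a, u}" | "e = {b, u}" | "e = {a, v}" | "e = {b, v}" using e by blast
    then show ?thesis
    proof cases
      case 1
      have "\<exists>g. g \<noteq> ?N1 \<and> {h \<in> ?T. e \<subseteq> h} = {?N1, g}"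
        by (rule swap[of e ?O1 _ ?O2 ?N2]) (use 1 d f(3) * in simp_all)
      then show ?thesis by (rule exI)
    next
      case 2
      have "\<exists>g. g \<noteq> ?N2 \<and> {h \<in> ?T. e \<subseteq> h} = {?N2, g}"
        by (rule swap[of e ?O1 _ ?O2 ?N1]) (use 2 d f(3) * in simp_all)
      then show ?thesis by (rule exI)
    next
      case 3
      have "\<exists>g. g \<noteq> ?N1 \<and> {h \<in> ?T. e \<subseteq> h} = {?N1, g}"
        by (rule swap[of e ?O2 _ ?O1 ?N2]) (use 3 d f(3) * in simp_all)
      then show ?thesis by (rule exI)
    next
      case 4
      have "\<exists>g. g \<noteq> ?N2 \<and> {h \<in> ?T. e \<subseteq> h} = {?N2, g}"
        by (rule swap[of e ?O2 _ ?O1 ?N1]) (use 4 d f(3) * in simp_all)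
      then show ?thesis by (rule exI)
    qed
  qed
  have "surface ?T"
  proof
    show "finite ?T" by (simp add: flip_def)
    show "card h = 3" if "h \<in> ?T" for h using that card_face d f(3) by (auto simp: flip_def)
    fix h e assume h: "h \<in> ?T" "e \<subseteq> h" "card e = 2"
    have "\<exists>N g. g \<noteq> N \<and> {h \<in> ?T. e \<subseteq> h} = {N, g}"
    proof (cases "e = {u, v} \<or> e \<in> {{a, u}, {b, u}, {a, v}, {b, v}}")
      case True
      then show ?thesis
      proof
        assume "e = {u, v}"
        then have "{h \<in> ?T. e \<subseteq> h} = {?N1, ?N2}" unfolding T' using noN by auto
        then show ?thesis using One by metis
      qed (rule quadedges)
    next
      case False
      then have nf: "e \<noteq> {u, v}" "e \<noteq> {u, a}" "e \<noteq> {v, a}" "e \<noteq> {u, b}" "e \<noteq> {v, b}"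
        "e \<noteq> {a, u}" "e \<noteq> {a, v}" "e \<noteq> {b, u}" "e \<noteq> {b, v}" by (simp_all add: insert_commute)
      have "\<not> e \<subseteq> ?N1" "\<not> e \<subseteq> ?N2"
        using doubletons_in_triple[OF h(3), of u v a] doubletons_in_triple[OF h(3), of u v b] nf by blast+
      then have hT: "h \<in> T" "h \<notin> {?O1, ?O2}" using h unfolding T' by auto
      then have nab: "e \<noteq> {a, b}" using ab h(2) by blast
      have "\<not> e \<subseteq> ?O1" using doubletons_in_triple[OF h(3), of a b u] nf nab by metis
      moreover have "\<not> e \<subseteq> ?O2" using doubletons_in_triple[OF h(3), of a b v] nf nab by metis
      ultimately have no: "\<not> e \<subseteq> k" if "k \<in> {?O1, ?O2, ?N1, ?N2}" for k
      proof -
        have "k = ?O1 \<or> k = ?O2 \<or> k = ?N1 \<or> k = ?N2" using that by (simp only: insert_iff empty_iff simp_thms)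
        then show ?thesis using \<open>\<not> e \<subseteq> ?O1\<close> \<open>\<not> e \<subseteq> ?O2\<close> \<open>\<not> e \<subseteq> ?N1\<close> \<open>\<not> e \<subseteq> ?N2\<close>
          by (elim disjE) (simp_all only: not_False_eq_True)
      qed
      have "{h \<in> ?T. e \<subseteq> h} = {h \<in> T. e \<subseteq> h}"
      proof (rule set_eqI)
        fix k
        show "k \<in> {h \<in> ?T. e \<subseteq> h} \<longleftrightarrow> k \<in> {h \<in> T. e \<subseteq> h}"
        proof (cases "k \<in> {?O1, ?O2, ?N1, ?N2}")
          case True
          then show ?thesis using no[OF True] by simp
        next
          case False
          then have "k \<in> ?T \<longleftrightarrow> k \<in> T" unfolding T' by blast
          then show ?thesis by simp
        qed
      qed
      moreover obtain g where "g \<noteq> h" "{h \<in> T. e \<subseteq> h} = {h, g}" using two_faces[OF hT(1) h(2,3)] by blast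
      ultimately show ?thesis by (intro exI[of _ h] exI[of _ g]) simp
    qed
    then obtain N g where g: "g \<noteq> N" "{h \<in> ?T. e \<subseteq> h} = {N, g}" by blast
    have "h \<in> {N, g}" using g(2) h by blast
    then show "\<exists>g. g \<noteq> h \<and> {h \<in> ?T. e \<subseteq> h} = {h, g}" using g by (metis insert_commute insertE singletonD)
  qed
  then interpret F: surface ?T .
  have bO: "bd {?O1, ?O2} = {{a, u}, {b, u}, {a, v}, {b, v}}" by (rule bd_two_faces[OF f])
  have "bd {?N1, ?N2} = {{u, a}, {v, a}, {u, b}, {v, b}}" by (rule F.bd_two_faces) (use d T' in auto)
  then have bON: "bd {?N1, ?N2} = bd {?O1, ?O2}" unfolding bO by (auto simp: insert_commute)
  have move: "bd (R \<union> {?N1, ?N2}) = bd (R \<union> {?O1, ?O2})" if R: "R \<subseteq> T - {?O1, ?O2}" for R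
  proof -
    have "bd (R \<union> {?N1, ?N2}) = sym_diff (bd R) (bd {?N1, ?N2})"
      by (rule F.bd_disjoint_Un) (use R T' N in auto)
    moreover have "bd (R \<union> {?O1, ?O2}) = sym_diff (bd R) (bd {?O1, ?O2})"
      by (rule bd_disjoint_Un) (use R f in auto)
    ultimately show ?thesis using bON by simp
  qed
  have eab: "{a, b} \<in> edges_of T" "{h \<in> T. {a, b} \<subseteq> h} = {?O1, ?O2}" using f d ab by (auto intro: edges_ofI)
  have euv: "{u, v} \<in> edges_of ?T" "{h \<in> ?T. {u, v} \<subseteq> h} = {?N1, ?N2}"
    unfolding T' using noN f(3) by (auto intro!: edges_ofI[of ?N1])
  have bN1: "bd {?N1} = {{u, v}, {u, a}, {v, a}}" by (rule F.bd_face) (simp add: T')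
  show ?thesis
  proof
    fix Z assume Z: "Z \<subseteq> edges_of ?T" "even_set Z"
    have finZ: "finite Z" using Z(1) F.finite_edges finite_subset by blast
    \<comment> \<open>Adding the boundary of one new face removes the diagonal
      \<open>{u, v}\<close>; what remains consists of edges of \<open>T\<close>.\<close>
    define Z0 where "Z0 = (if {u, v} \<in> Z then sym_diff Z (bd {?N1}) else Z)"
    have evN: "even_set (bd {?N1})" by (rule F.even_set_bd) (simp add: T')
    have "finite (bd {?N1})" unfolding bN1 by simp
    from even_set_sym_diff[OF finZ this Z(2) evN] Z(2) have "even_set Z0" unfolding Z0_def by presburger
    have uvZ0: "{u, v} \<notin> Z0" unfolding Z0_def bN1 by auto
    have Z0s: "Z0 \<subseteq> edges_of ?T"
      unfolding Z0_def using Z(1) F.bd_sub_edges[of "{?N1}"] T' by auto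
    have fl: "flip ?T u v a b = T"
    proof -
      have "?O1 \<notin> {?N1, ?N2}" "?O2 \<notin> {?N1, ?N2}" using N f by auto
      moreover have "{a, b, u} \<in> T" "{a, b, v} \<in> T" using f by auto
      ultimately show ?thesis using N unfolding flip_def by blast
    qed
    have "edges_of ?T - {{u, v}} \<subseteq> edges_of T" using edges_of_flip[of ?T u v a b] unfolding fl .
    then have Z0T: "Z0 \<subseteq> edges_of T" using uvZ0 Z0s by blast
    then obtain X where X: "X \<subseteq> T" "bd X = Z0" using even_set_bounds \<open>even_set Z0\<close> by blast
    have "{a, b} \<notin> edges_of ?T"
    proof
      assume "{a, b} \<in> edges_of ?T"
      then obtain h where h: "h \<in> ?T" "{a, b} \<subseteq> h" by (auto simp: edges_of_def)
      then have "h \<in> {?N1, ?N2}" using ab unfolding T' by blast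
      then show False using h(2) d by auto
    qed
    then have "{a, b} \<notin> Z0" using \<open>Z0 \<subseteq> edges_of ?T\<close> by blast
    \<comment> \<open>As \<open>{a, b}\<close> is not in the boundary of \<open>X\<close>, the set
      \<open>X\<close> contains both old faces or none.\<close>
    then have XO: "?O1 \<in> X \<longleftrightarrow> ?O2 \<in> X" using in_bd_iff[OF eab One(1) X(1)] X(2) by simp
    obtain Y where Y: "Y \<subseteq> ?T" "bd Y = Z0"
    proof (cases "?O1 \<in> X")
      case True
      then have XR: "(X - {?O1, ?O2}) \<union> {?O1, ?O2} = X" using XO by blast
      have R: "X - {?O1, ?O2} \<subseteq> T - {?O1, ?O2}" using X(1) by blast
      have "bd ((X - {?O1, ?O2}) \<union> {?N1, ?N2}) = Z0" unfolding move[OF R] XR by (rule X(2))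
      moreover have "(X - {?O1, ?O2}) \<union> {?N1, ?N2} \<subseteq> ?T" unfolding T' using X(1) by blast
      ultimately show thesis using that by blast
    next
      case False
      then have "X \<subseteq> ?T" unfolding T' using X XO by auto
      then show thesis using that X by blast
    qed
    show "\<exists>X\<subseteq>?T. bd X = Z"
    proof (cases "{u, v} \<in> Z")
      case True
      have "sym_diff Y {?N1} \<subseteq> ?T" using Y T' by auto
      moreover have "bd (sym_diff Y {?N1}) = sym_diff Z0 (bd {?N1})"
        using F.bd_sym_diff[OF Y(1), of "{?N1}"] Y(2) T' by auto
      moreover have "sym_diff Z0 (bd {?N1}) = Z" unfolding Z0_def using True by auto
      ultimately show ?thesis by metis
    next
      case False
      then show ?thesis using Y unfolding Z0_def by auto
    qed
  next
    fix X assume X: "X \<subseteq> ?T" "bd X = {}"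
    have XN: "?N1 \<in> X \<longleftrightarrow> ?N2 \<in> X" using F.in_bd_iff[OF euv One(2) X(1)] X(2) by simp
    show "X = {} \<or> X = ?T"
    proof (cases "?N1 \<in> X")
      case True
      let ?R = "X - {?N1, ?N2}"
      have R: "?R \<subseteq> T - {?O1, ?O2}" using X(1) unfolding T' by auto
      have XR: "X = ?R \<union> {?N1, ?N2}" using True XN by blast
      then have "bd (?R \<union> {?O1, ?O2}) = {}" using move[OF R] X(2) by metis
      moreover have "?R \<union> {?O1, ?O2} \<subseteq> T" using R f by auto
      ultimately have "?R \<union> {?O1, ?O2} = {} \<or> ?R \<union> {?O1, ?O2} = T" using bd_eq_empty[of "?R \<union> {?O1, ?O2}"] by simp
      then have "?R \<union> {?O1, ?O2} = T" by simp
      then have "?R = T - {?O1, ?O2}" using R by blast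
      then show ?thesis using XR T' by metis
    next
      case False
      then have "X \<subseteq> T - {?O1, ?O2}" using X(1) XN unfolding T' by auto
      then have "X = {} \<or> X = T" using bd_eq_empty[of X] X(2) by blast
      moreover have "X \<noteq> T" using \<open>X \<subseteq> T - {?O1, ?O2}\<close> f(1) by blast
      ultimately show ?thesis by blast
    qed
  qed
qed

section \<open>The number of edges of a triangulated sphere\<close>

text \<open>Choosing for every vertex set \<open>p\<close> one edge set with odd-degree set \<open>p\<close>, every edge set is the
  symmetric difference of the chosen one and a boundary, so \<open>2 ^ E \<le> 2 ^ V * 2 ^ F\<close>.\<close>

lemma (in tri_sphere) card_edges_le: "card (edges_of T) \<le> 3 * card (\<Union>T)"
proof -
  define odds where "odds = (\<lambda>Z :: 'a set set. {v. odd (degree_in Z v)})"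
  define pick where "pick = (\<lambda>p. SOME Z. Z \<subseteq> edges_of T \<and> odds Z = p)"
  have pick: "pick (odds Z) \<subseteq> edges_of T \<and> odds (pick (odds Z)) = odds Z" if "Z \<subseteq> edges_of T" for Z
    unfolding pick_def by (rule someI[of "\<lambda>Y. Y \<subseteq> edges_of T \<and> odds Y = odds Z" Z]) (use that in simp)
  have oddsV: "odds Z \<subseteq> \<Union>T" if "Z \<subseteq> edges_of T" for Z
  proof
    fix v assume "v \<in> odds Z"
    then have "odd (degree_in Z v)" by (simp add: odds_def)
    then have "degree_in Z v \<noteq> 0" by (metis even_zero)
    then have "{e \<in> Z. v \<in> e} \<noteq> {}" unfolding degree_in_def by (metis card.empty)
    then obtain e where "e \<in> Z" "v \<in> e" by blast
    then show "v \<in> \<Union>T" using that edge_subset_Union[of e T] by blast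
  qed
  let ?g = "\<lambda>(p, X). sym_diff (pick p) (bd X)"
  have "Pow (edges_of T) \<subseteq> ?g ` (Pow (\<Union>T) \<times> Pow T)"
  proof
    fix Z assume "Z \<in> Pow (edges_of T)"
    then have Z: "Z \<subseteq> edges_of T" by simp
    let ?p = "pick (odds Z)"
    have p: "?p \<subseteq> edges_of T" "odds ?p = odds Z" using pick[OF Z] by auto
    have fin: "finite Z" "finite ?p" using Z p(1) finite_edges finite_subset by blast+
    have "even_set (sym_diff Z ?p)" unfolding even_set_def even_degree_sym_diff[OF fin]
      using p(2) unfolding odds_def by auto
    then obtain X where X: "X \<subseteq> T" "bd X = sym_diff Z ?p" using even_set_bounds[of "sym_diff Z ?p"] Z p(1) by auto
    have "Z = ?g (odds Z, X)" using X(2) by auto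
    then show "Z \<in> ?g ` (Pow (\<Union>T) \<times> Pow T)" using X(1) oddsV[OF Z] by blast
  qed
  moreover have finP: "finite (Pow (\<Union>T) \<times> Pow T)" by auto
  ultimately have "card (Pow (edges_of T)) \<le> card (?g ` (Pow (\<Union>T) \<times> Pow T))" by (intro card_mono finite_imageI)
  also have "\<dots> \<le> card (Pow (\<Union>T) \<times> Pow T)" by (rule card_image_le[OF finP])
  finally have "2 ^ card (edges_of T) \<le> (2::nat) ^ (card (\<Union>T) + card T)"
    by (simp add: card_Pow card_cartesian_product power_add finite_Union)
  then have le: "card (edges_of T) \<le> card (\<Union>T) + card T" by simp
  \<comment> \<open>Double counting gives \<open>3 F = 2 E\<close>; together with
    \<open>E <= V + F\<close> this leaves \<open>E <= 3 V\<close>.\<close>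
  have "(\<Sum>f\<in>T. card {e \<in> edges_of T. e \<subseteq> f}) = (\<Sum>e\<in>edges_of T. card {f \<in> T. e \<subseteq> f})"
    using sum.swap_restrict[of T "edges_of T" "\<lambda>_ _. 1 :: nat" "\<lambda>f e. e \<subseteq> f"] by simp
  moreover have "card {e \<in> edges_of T. e \<subseteq> f} = 3" if fT: "f \<in> T" for f
  proof -
    obtain a b c where f: "f = {a, b, c}" "a \<noteq> b" "a \<noteq> c" "b \<noteq> c" using face_sets[OF fT] by metis
    have "{e \<in> edges_of T. e \<subseteq> f} = {{a, b}, {a, c}, {b, c}}"
      using doubletons_in_triple[of _ a b c] edges_face[of a b c] fT f by (auto simp: edges_of_def)
    then show ?thesis using f by (auto simp: doubleton_eq_iff card_insert_if)
  qed
  moreover have "card {f \<in> T. e \<subseteq> f} = 2" if e: "e \<in> edges_of T" for e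
    using edge_faces[OF e] by (metis card_2_iff)
  ultimately have "3 * card T = 2 * card (edges_of T)" by simp
  then show ?thesis using le by simp
qed

section \<open>Cycles of graphs as lists of vertices\<close>

lemma cas_with_proj:
  "pre_digraph.cas (with_proj G) u p w \<Longrightarrow>
     pre_digraph.awalk_verts (with_proj G) u p = map fst p @ [w] \<and>
     (\<lambda>(u, v). {u, v}) ` set p = path_edges (map fst p @ [w]) \<and> (p \<noteq> [] \<longrightarrow> fst (hd p) = u)"
proof (induction p arbitrary: u)
  case (Cons e p)
  obtain x y where e: "e = (x, y)" by fastforce
  have "x = u" "pre_digraph.cas (with_proj G) y p w" using Cons(2) e by (simp_all add: pre_digraph.cas.simps)
  with Cons(1)[OF this(2)] show ?case using e
    by (cases p) (auto simp: pre_digraph.awalk_verts.simps pre_digraph.cas.simps)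
qed (simp add: pre_digraph.awalk_verts.simps pre_digraph.cas.simps)

lemma cas_zip:
  "q \<noteq> [] \<Longrightarrow> pre_digraph.cas (with_proj G) (hd q) (zip (butlast q) (tl q)) (last q)"
proof (induction q rule: path_edges.induct)
  case (1 x y r)
  then show ?case by (simp add: pre_digraph.cas.simps)
qed (auto simp: pre_digraph.cas.simps)

lemma set_zip_path: "set (zip (butlast q) (tl q)) = {(q ! i, q ! Suc i) | i. Suc i < length q}"
proof -
  have "{(butlast q ! i, tl q ! i) | i. i < length q - 1} = {(q ! i, q ! Suc i) | i. Suc i < length q}"
    by (intro Collect_cong ex_cong1) (auto simp: nth_butlast nth_tl)
  then show ?thesis by (simp add: set_zip)
qed

text \<open>The vertex list consists of the tails of the arcs; conversely, the arcs are the
  consecutive pairs of the list closed up by its head.\<close>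

theorem cycles_iff:
  assumes arcs: "parcs G = {(u, v). {u, v} \<in> A}" and verts: "\<Union>A \<subseteq> pverts G"
  shows "C \<in> cycles G \<longleftrightarrow> (\<exists>c. distinct c \<and> 3 \<le> length c \<and> cycle_edges c \<subseteq> A \<and> C = cycle_edges c)"
proof
  assume "C \<in> cycles G"
  then obtain p u where p: "C = (\<lambda>(u, v). {u, v}) ` set p" "3 \<le> length p" "pre_digraph.awalk (with_proj G) u p u"
    "distinct (tl (pre_digraph.awalk_verts (with_proj G) u p))" "p \<noteq> []"
    unfolding cycles_def pre_digraph.cycle_def by blast
  have c: "pre_digraph.cas (with_proj G) u p u" "set p \<subseteq> parcs G"
    using p(3) by (auto simp: pre_digraph.awalk_def)
  note * = cas_with_proj[OF c(1)]
  let ?c = "map fst p"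
  have h: "hd ?c = u" using * p(5) by (simp add: hd_map)
  have "C = cycle_edges ?c" using * p(1) h by (simp add: cycle_edges_def)
  moreover have "distinct ?c"
  proof -
    have "distinct (tl ?c @ [u])" using p(4,5) * by simp
    then have "distinct (u # tl ?c)" by auto
    moreover have "u # tl ?c = ?c" using h p(5) by (metis list.collapse list.map_disc_iff)
    ultimately show ?thesis by simp
  qed
  moreover have "C \<subseteq> A" using p(1) c(2) arcs by auto
  ultimately show "\<exists>c. distinct c \<and> 3 \<le> length c \<and> cycle_edges c \<subseteq> A \<and> C = cycle_edges c"
    using p(2) by (intro exI[of _ ?c]) auto
next
  assume "\<exists>c. distinct c \<and> 3 \<le> length c \<and> cycle_edges c \<subseteq> A \<and> C = cycle_edges c"
  then obtain c where c: "distinct c" "3 \<le> length c" "cycle_edges c \<subseteq> A" "C = cycle_edges c" by blast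
  have ne: "c \<noteq> []" using c(2) by auto
  let ?q = "c @ [hd c]"
  let ?p = "zip (butlast ?q) (tl ?q)"
  have mf: "map fst ?p = c" using ne by (simp add: map_fst_zip)
  have cs: "pre_digraph.cas (with_proj G) (hd c) ?p (hd c)" using cas_zip[of ?q G] ne by simp
  note * = cas_with_proj[OF cs, unfolded mf]
  have lp: "length ?p = length c" using ne by simp
  have "set ?p \<subseteq> parcs G"
  proof -
    have "{?q ! i, ?q ! Suc i} \<in> A" if "Suc i < length ?q" for i
      using that c(3) unfolding cycle_edges_def path_edges_nth by blast
    then show ?thesis unfolding set_zip_path arcs by auto
  qed
  moreover have "hd c \<in> pverts G"
  proof -
    have "hd c \<in> \<Union>(cycle_edges c)" unfolding Union_cycle_edges using ne by simp
    then show ?thesis using c(3) verts by blast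
  qed
  ultimately have "pre_digraph.awalk (with_proj G) (hd c) ?p (hd c)" using cs by (simp add: pre_digraph.awalk_def)
  moreover have "distinct (tl (pre_digraph.awalk_verts (with_proj G) (hd c) ?p))"
    using * c(1) ne by (cases c) auto
  moreover have "?p \<noteq> []" using lp ne by (metis length_0_conv)
  ultimately have "pre_digraph.cycle (with_proj G) ?p" unfolding pre_digraph.cycle_def by blast
  moreover have "C = (\<lambda>(u, v). {u, v}) ` set ?p" using * c(4) by (simp add: cycle_edges_def)
  ultimately show "C \<in> cycles G" unfolding cycles_def mem_Collect_eq using lp c(2) by (intro exI[of _ ?p]) simp
qed

lemma card_path_edges_eq: "distinct p \<Longrightarrow> card (path_edges p) = length p - 1"
proof (induction p rule: path_edges.induct)
  case (1 x y r)
  then have "{x, y} \<notin> path_edges (y # r)" by (auto dest!: path_edges_subset)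
  then show ?case using 1 by simp
qed auto

lemma card_cycle_edges: "distinct c \<Longrightarrow> 3 \<le> length c \<Longrightarrow> card (cycle_edges c) = length c"
  using closing_edge_notin[of c] card_path_edges_eq[of c] by (cases "c = []") (auto simp: cycle_edges_eq)

lemma list_length_3: "length c = 3 \<Longrightarrow> \<exists>x y z. c = [x, y, z]"
  by (auto simp: numeral_3_eq_3 length_Suc_conv)

section \<open>Drawings of cycles\<close>

hide_const (open) Digraph_Component.connected

definition closed_curve :: "complex set \<Rightarrow> bool" where
  "closed_curve J \<longleftrightarrow> (\<exists>g. simple_path g \<and> pathfinish g = pathstart g \<and> path_image g = J)"

text \<open>Inside and outside are made interchangeable, since a face may be either side of its
  boundary curve.\<close>

lemma closed_curve_sides:
  assumes "closed_curve J"
  obtains A B where "open A" "open B" "connected A" "connected B" "A \<noteq> {}" "B \<noteq> {}" "A \<inter> B = {}" "A \<union> B = - J"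
    "frontier A = J" "frontier B = J"
proof -
  obtain g where g: "simple_path g" "pathfinish g = pathstart g" "path_image g = J"
    using assms unfolding closed_curve_def by blast
  show thesis using that[of "inside J" "outside J"] Jordan_inside_outside[OF g(1,2)] g(3) by simp
qed

lemma closed_curve_compact: "closed_curve J \<Longrightarrow> compact J"
  unfolding closed_curve_def using compact_simple_path_image by blast

text \<open>Otherwise the inverse of the arc would embed a nonempty open subset of the plane in the
  real line.\<close>

lemma interior_arc_image:
  fixes g :: "real \<Rightarrow> complex"
  assumes "arc g"
  shows "interior (path_image g) = {}"
proof (rule ccontr)
  assume ne: "interior (path_image g) \<noteq> {}"
  obtain h where h: "homeomorphism {0..1} (path_image g) g h" using homeomorphism_arc[OF assms] by blast
  have "continuous_on (interior (path_image g)) h"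
    using homeomorphism_cont2[OF h] interior_subset continuous_on_subset by blast
  moreover have "inj_on h (interior (path_image g))"
    by (rule inj_on_subset[OF inj_on_inverseI[of "path_image g" g h] interior_subset]) (rule homeomorphism_apply2[OF h])
  ultimately have "DIM(complex) \<le> DIM(real)" using invariance_of_dimension ne by blast
  then show False by simp
qed

section \<open>Edges and cycles of a plane graph as point sets\<close>

locale plane =
  fixes V :: "complex set" and E :: "complex set set"
  assumes plane_graph: "plane_graph V E"
begin

text \<open>Edges are passed on to the combinatorial part as pairs of end points;
  \<open>ends_inj\<close> shows that nothing is lost.\<close>

definition ends :: "complex set \<Rightarrow> complex set" where "ends e = e \<inter> V"

lemma finite_VE [simp]: "finite V" "finite E"
  using plane_graph by (auto simp: plane_graph_def)

lemma edge_arc: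
  assumes "e \<in> E"
  obtains g u v where "arc g" "path_image g = e" "pathstart g = u" "pathfinish g = v" "ends e = {u, v}" "u \<noteq> v"
proof -
  obtain u v where "joins e u v" "e \<inter> V = {u, v}" using assms plane_graph by (auto simp: plane_graph_def)
  then show thesis using that joins_neq[of e u v] unfolding joins_def ends_def by blast
qed

lemma edge_arc_from:
  assumes "e \<in> E" "ends e = {u, v}"
  obtains g where "arc g" "path_image g = e" "pathstart g = u" "pathfinish g = v"
proof -
  obtain g a b where g: "arc g" "path_image g = e" "pathstart g = a" "pathfinish g = b" "ends e = {a, b}" "a \<noteq> b"
    by (rule edge_arc[OF assms(1)])
  then consider "a = u \<and> b = v" | "a = v \<and> b = u" using assms(2) by (auto simp: doubleton_eq_iff)
  then show thesis
  proof cases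
    case 1 then show ?thesis using that g by blast
  next
    case 2 then show ?thesis using that[of "reversepath g"] g by (simp add: arc_reversepath)
  qed
qed

lemma card_ends: "e \<in> E \<Longrightarrow> card (ends e) = 2"
  using edge_arc by (metis card_2_iff)

lemma ends_inj: "e \<in> E \<Longrightarrow> e' \<in> E \<Longrightarrow> ends e = ends e' \<Longrightarrow> e = e'"
proof -
  assume e: "e \<in> E" "e' \<in> E" "ends e = ends e'"
  obtain g u v where g: "arc g" "path_image g = e" "pathstart g = u" "pathfinish g = v" "ends e = {u, v}" "u \<noteq> v"
    by (rule edge_arc[OF e(1)])
  obtain g' where g': "arc g'" "path_image g' = e'" "pathstart g' = u" "pathfinish g' = v"
    using edge_arc_from[OF e(2), of u v] g(5) e(3) by metis
  have "joins e u v" "joins e' u v" unfolding joins_def using g g' by blast+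
  moreover have "\<forall>e\<in>E. \<forall>e'\<in>E. \<forall>u v. joins e u v \<and> joins e' u v \<longrightarrow> e = e'" using plane_graph by (simp add: plane_graph_def)
  ultimately show "e = e'" using e by blast
qed

lemma edges_meet: "e \<in> E \<Longrightarrow> e' \<in> E \<Longrightarrow> e \<noteq> e' \<Longrightarrow> e \<inter> e' = ends e \<inter> ends e'"
  using plane_graph unfolding plane_graph_def ends_def by blast

lemma joins_iff: "e \<in> E \<Longrightarrow> u \<in> V \<Longrightarrow> v \<in> V \<Longrightarrow> joins e u v \<longleftrightarrow> ends e = {u, v}"
proof
  assume a: "e \<in> E" "u \<in> V" "v \<in> V" "joins e u v"
  have "{u, v} \<subseteq> ends e" using a unfolding joins_def ends_def by (metis IntI empty_subsetI insert_subset pathfinish_in_path_image pathstart_in_path_image)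
  moreover have "card {u, v} = 2" using joins_neq[OF a(4)] by simp
  moreover have "finite (ends e)" by (simp add: ends_def)
  ultimately show "ends e = {u, v}" using card_ends[OF a(1)] card_subset_eq by metis
next
  assume a: "e \<in> E" "ends e = {u, v}"
  show "joins e u v" using edge_arc_from[OF a] unfolding joins_def by blast
qed

lemma parcs_underlying: "parcs (underlying_graph V E) = {(u, v). {u, v} \<in> ends ` E}"
proof -
  have "u \<in> V \<and> v \<in> V \<and> (\<exists>e\<in>E. joins e u v) \<longleftrightarrow> {u, v} \<in> ends ` E" for u v
  proof
    assume "{u, v} \<in> ends ` E"
    then obtain e where e: "e \<in> E" "ends e = {u, v}" by auto
    then have "u \<in> V" "v \<in> V" by (auto simp: ends_def)
    then show "u \<in> V \<and> v \<in> V \<and> (\<exists>e\<in>E. joins e u v)" using e joins_iff by blast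
  qed (use joins_iff in \<open>metis imageI\<close>)
  then show ?thesis by (simp add: underlying_graph_def)
qed

lemma Union_ends: "\<Union>(ends ` E) \<subseteq> V"
  by (auto simp: ends_def)

definition drawing :: "complex set set \<Rightarrow> complex set" where
  "drawing A = \<Union>{e \<in> E. ends e \<in> A}"

lemma drawn_eq: "\<Union>C \<subseteq> V \<Longrightarrow> (\<And>d. d \<in> C \<Longrightarrow> card d = 2) \<Longrightarrow> drawn E C = drawing C"
proof -
  assume C: "\<Union>C \<subseteq> V" "\<And>d. d \<in> C \<Longrightarrow> card d = 2"
  have "(\<exists>u v. {u, v} \<in> C \<and> joins e u v) \<longleftrightarrow> ends e \<in> C" if e: "e \<in> E" for e
  proof
    assume "\<exists>u v. {u, v} \<in> C \<and> joins e u v"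
    then obtain u v where uv: "{u, v} \<in> C" "joins e u v" by blast
    then have "u \<in> V" "v \<in> V" using C(1) by auto
    then show "ends e \<in> C" using uv joins_iff[OF e] by simp
  next
    assume a: "ends e \<in> C"
    then obtain u v where uv: "ends e = {u, v}" using C(2) by (metis card_2_iff)
    then have "u \<in> V" "v \<in> V" by (auto simp: ends_def)
    then show "\<exists>u v. {u, v} \<in> C \<and> joins e u v" using uv a joins_iff[OF e] by metis
  qed
  then show "drawn E C = drawing C" unfolding drawn_def drawing_def by blast
qed

lemma drawing_Un: "drawing (A \<union> B) = drawing A \<union> drawing B"
  by (auto simp: drawing_def)

lemma drawing_insert_edge: "e \<in> E \<Longrightarrow> drawing (insert (ends e) A) = e \<union> drawing A"
  unfolding drawing_def using ends_inj by blast

lemma drawing_Int_V: "A \<subseteq> ends ` E \<Longrightarrow> drawing A \<inter> V = \<Union>A"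
  by (auto simp: drawing_def ends_def)

lemma in_drawing_iff:
  assumes "e \<in> E" "p \<in> e" "p \<notin> V"
  shows "p \<in> drawing A \<longleftrightarrow> ends e \<in> A"
proof
  assume "p \<in> drawing A"
  then obtain e' where e': "e' \<in> E" "ends e' \<in> A" "p \<in> e'" by (auto simp: drawing_def)
  have "e' = e" using edges_meet[of e' e] assms e' by (auto simp: ends_def)
  then show "ends e \<in> A" using e' by simp
qed (use assms in \<open>auto simp: drawing_def\<close>)

lemma arc_of_path:
  "distinct q \<Longrightarrow> 2 \<le> length q \<Longrightarrow> path_edges q \<subseteq> ends ` E \<Longrightarrow>
     \<exists>g. arc g \<and> pathstart g = hd q \<and> pathfinish g = last q \<and> path_image g = drawing (path_edges q)"
proof (induction q rule: path_edges.induct)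
  case (1 x y r)
  obtain e where e: "e \<in> E" "ends e = {x, y}" using 1(4) by auto
  obtain g where g: "arc g" "path_image g = e" "pathstart g = x" "pathfinish g = y" by (rule edge_arc_from[OF e])
  show ?case
  proof (cases "r = []")
    case True
    have "drawing {{x, y}} = e" using drawing_insert_edge[OF e(1), of "{}"] e(2) by (simp add: drawing_def)
    then show ?thesis using g True by auto
  next
    case False
    then obtain g' where g': "arc g'" "pathstart g' = y" "pathfinish g' = last (y # r)" "path_image g' = drawing (path_edges (y # r))"
      using 1 by (cases r) auto
    have int: "e \<inter> drawing (path_edges (y # r)) \<subseteq> {y}"
    proof
      fix p assume p: "p \<in> e \<inter> drawing (path_edges (y # r))"
      then obtain e' where e': "e' \<in> E" "ends e' \<in> path_edges (y # r)" "p \<in> e'" by (auto simp: drawing_def)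
      have s: "ends e' \<subseteq> set (y # r)" by (rule path_edges_subset[OF e'(2)])
      have "e' \<noteq> e" using s e(2) 1(2) by auto
      then have "p \<in> ends e' \<inter> ends e" using edges_meet[OF e'(1) e(1)] e' p by auto
      then show "p \<in> {y}" using s e(2) 1(2) by auto
    qed
    have "arc (g +++ g')" by (rule arc_join[OF g(1) g'(1)]) (use g g' int in auto)
    moreover have "path_image (g +++ g') = drawing (path_edges (x # y # r))"
      using path_image_join[of g g'] g g' drawing_insert_edge[OF e(1), of "path_edges (y # r)"] e(2) by simp
    ultimately show ?thesis using g g' by (intro exI[of _ "g +++ g'"]) auto
  qed
qed auto

lemma closed_curve_cycle:
  assumes "distinct c" "3 \<le> length c" "cycle_edges c \<subseteq> ends ` E"
  shows "closed_curve (drawing (cycle_edges c))"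
proof -
  have ne: "c \<noteq> []" using assms by auto
  have ce: "cycle_edges c = insert {last c, hd c} (path_edges c)" using ne by (simp add: cycle_edges_eq)
  obtain g where g: "arc g" "pathstart g = hd c" "pathfinish g = last c" "path_image g = drawing (path_edges c)"
    using arc_of_path[of c] assms ce by auto
  obtain e where e: "e \<in> E" "ends e = {last c, hd c}" using assms(3) ce by auto
  obtain g' where g': "arc g'" "path_image g' = e" "pathstart g' = last c" "pathfinish g' = hd c" by (rule edge_arc_from[OF e])
  have int: "drawing (path_edges c) \<inter> e \<subseteq> {hd c, last c}"
  proof
    fix p assume p: "p \<in> drawing (path_edges c) \<inter> e"
    then obtain e' where e': "e' \<in> E" "ends e' \<in> path_edges c" "p \<in> e'" by (auto simp: drawing_def)
    have "e' \<noteq> e" using e'(2) e(2) closing_edge_notin[OF assms(1,2)] by auto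
    then show "p \<in> {hd c, last c}" using edges_meet[OF e'(1) e(1)] e' p e(2) by auto
  qed
  have "simple_path (g +++ g')" by (rule simple_path_join_loop[OF g(1) g'(1)]) (use g g' int in auto)
  moreover have "path_image (g +++ g') = drawing (cycle_edges c)"
    using path_image_join[of g g'] g g' drawing_insert_edge[OF e(1), of "path_edges c"] e(2) ce by auto
  ultimately show ?thesis unfolding closed_curve_def using g g' by (intro exI[of _ "g +++ g'"]) auto
qed

definition "graph_points = V \<union> \<Union>E"

lemma closed_edge: "e \<in> E \<Longrightarrow> closed e"
  using edge_arc by (metis closed_arc_image)

lemma closed_graph_points: "closed graph_points"
  unfolding graph_points_def using closed_edge by (intro closed_Un closed_Union finite_imp_closed) auto

lemma drawing_subset: "drawing A \<subseteq> graph_points"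
  by (auto simp: drawing_def graph_points_def)

lemma interior_graph_points: "interior graph_points = {}"
proof -
  have "interior (V \<union> \<Union>F) = {} \<and> closed (V \<union> \<Union>F)" if "finite F" "F \<subseteq> E" for F
    using that
  proof (induction F rule: finite_induct)
    case empty
    show ?case by (simp add: empty_interior_finite finite_imp_closed)
  next
    case (insert e F)
    then have IH: "interior (V \<union> \<Union>F) = {}" "closed (V \<union> \<Union>F)" by auto
    obtain g where "arc g" "path_image g = e" using edge_arc[of e] insert by (metis insert_subset)
    then have "interior e = {}" "closed e" using interior_arc_image closed_arc_image by auto
    moreover have "V \<union> \<Union>(insert e F) = (V \<union> \<Union>F) \<union> e" by auto
    ultimately show ?case using interior_closed_Un_empty_interior[of "V \<union> \<Union>F" e] IH by (auto intro: closed_Un)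
  qed
  from this[of E] show ?thesis by (simp add: graph_points_def)
qed

lemma connected_edge_interior: "e \<in> E \<Longrightarrow> connected (e - V) \<and> e - V \<noteq> {}"
proof -
  assume e: "e \<in> E"
  obtain g u v where g: "arc g" "path_image g = e" "pathstart g = u" "pathfinish g = v" "ends e = {u, v}" "u \<noteq> v"
    by (rule edge_arc[OF e])
  have "e - V = path_image g - {pathstart g, pathfinish g}" using g by (auto simp: ends_def)
  then show ?thesis
    using connected_simple_path_endless[of g] nonempty_simple_path_endless[of g] arc_imp_simple_path[OF g(1)] by simp
qed

end

section \<open>Plane triangulations are triangulated spheres\<close>

text \<open>At the first vertex of a longest path in \<open>Z\<close>, parity supplies a second edge
  of \<open>Z\<close>, and it leads back to the path.\<close>

lemma even_set_contains_cycle: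
  assumes fin: "finite Z" and Z: "Z \<noteq> {}" "even_set Z" and card2: "\<And>e. e \<in> Z \<Longrightarrow> card e = 2"
  obtains c where "distinct c" "3 \<le> length c" "cycle_edges c \<subseteq> Z"
proof -
  define P where "P = (\<lambda>p. distinct p \<and> 2 \<le> length p \<and> path_edges p \<subseteq> Z)"
  have finU: "finite (\<Union>Z)" using fin card2 by (metis card.infinite finite_Union zero_neq_numeral)
  have "length p < Suc (card (\<Union>Z))" if "P p" for p
  proof -
    have "set p \<subseteq> \<Union>Z"
    proof
      fix v assume "v \<in> set p"
      then obtain a b where p: "p = a @ v # b" by (meson split_list)
      show "v \<in> \<Union>Z"
      proof (cases b)
        case Nil
        then have "a \<noteq> []" using that p by (auto simp: P_def)
        then have "{last a, v} \<in> path_edges p" using p Nil by (simp add: path_edges_append)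
        then show ?thesis using that by (auto simp: P_def)
      next
        case (Cons w b')
        then have "{v, w} \<in> path_edges p" using path_edges_mem[of v w a b'] p by simp
        then show ?thesis using that by (auto simp: P_def)
      qed
    qed
    then have "card (set p) \<le> card (\<Union>Z)" using finU card_mono by blast
    then show ?thesis using that distinct_card[of p] by (simp add: P_def)
  qed
  note bound = this
  obtain e where "e \<in> Z" using Z by blast
  then obtain a b where ab: "{a, b} \<in> Z" "a \<noteq> b" using card2[of e] by (auto simp: card_2_iff)
  then have "P [a, b]" by (simp add: P_def)
  then obtain p where p: "P p" "\<And>q. P q \<Longrightarrow> length q \<le> length p"
    using ex_has_greatest_nat[of P "[a, b]" length "Suc (card (\<Union>Z))"] bound by metis
  obtain h k r where hk: "p = h # k # r" using p(1) by (cases p rule: path_edges.cases) (auto simp: P_def)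
  have hkZ: "{h, k} \<in> Z" using p(1) hk by (simp add: P_def)
  have "even (card {e \<in> Z. h \<in> e})" using Z(2) by (simp add: even_set_def degree_in_def)
  have "\<exists>e. e \<in> Z \<and> h \<in> e \<and> e \<noteq> {h, k}"
  proof (rule ccontr)
    assume "\<not> ?thesis"
    then have "{e \<in> Z. h \<in> e} = {{h, k}}" using hkZ by blast
    then show False using \<open>even (card {e \<in> Z. h \<in> e})\<close> by simp
  qed
  then obtain e where e: "e \<in> Z" "h \<in> e" "e \<noteq> {h, k}" by blast
  then obtain z where z: "e = {h, z}" "z \<noteq> h" using card2[OF e(1)] by (auto simp: card_2_iff)
  have zk: "z \<noteq> k" using e(3) z by auto
  have "z \<in> set p"
  proof (rule ccontr)
    assume "z \<notin> set p"
    then have "P (z # p)" using p(1) e(1) z hk unfolding P_def by (auto simp: insert_commute)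
    from p(2)[OF this] show False by simp
  qed
  then have "z \<in> set r" using hk z zk by auto
  then obtain r1 r2 where r: "r = r1 @ z # r2" by (meson split_list)
  let ?c = "h # k # r1 @ [z]"
  have "cycle_edges ?c \<subseteq> Z"
  proof -
    have "p = [] @ ?c @ r2" using hk r by simp
    then have "path_edges ?c \<subseteq> Z" using path_edges_infix[of ?c "[]" r2] p(1) unfolding P_def by auto
    moreover have "cycle_edges ?c = path_edges ?c \<union> {{z, h}}" by (simp add: cycle_edges_eq)
    ultimately show ?thesis using e(1) z by (auto simp: insert_commute)
  qed
  moreover have "distinct ?c" using p(1) hk r by (auto simp: P_def)
  ultimately show thesis using that[of ?c] by simp
qed

section \<open>Faces of a plane triangulation and their corners\<close>

locale plane_triangulation = plane +
  assumes triangular: "F \<in> faces V E \<Longrightarrow> \<exists>C\<in>k_cycles 3 (underlying_graph V E). frontier F = drawn E C"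
    and four_vertices: "4 \<le> card V"
begin

definition corners :: "complex set \<Rightarrow> complex set" where "corners F = frontier F \<inter> V"

lemma faces_eq: "faces V E = components (- graph_points)"
  by (simp add: faces_def graph_points_def)

lemma face_props:
  assumes "F \<in> faces V E"
  shows "open F" "connected F" "F \<noteq> {}" "F \<inter> graph_points = {}"
proof -
  have F: "F \<in> components (- graph_points)" using assms by (simp add: faces_eq)
  show "open F" using open_components[OF open_Compl[OF closed_graph_points] F] .
  show "connected F" "F \<noteq> {}" by (rule in_components_connected[OF F], rule in_components_nonempty[OF F])
  show "F \<inter> graph_points = {}" using in_components_subset[OF F] by blast
qed

lemma faces_disjoint: "F \<in> faces V E \<Longrightarrow> F' \<in> faces V E \<Longrightarrow> F \<noteq> F' \<Longrightarrow> F \<inter> F' = {}"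
  unfolding faces_eq using components_nonoverlap by blast

lemma Union_faces: "\<Union>(faces V E) = - graph_points"
  unfolding faces_eq by (rule Union_components)

lemma face_triangle:
  assumes "F \<in> faces V E"
  obtains a b c where "a \<noteq> b" "a \<noteq> c" "b \<noteq> c" "{{a, b}, {a, c}, {b, c}} \<subseteq> ends ` E"
    "frontier F = drawing {{a, b}, {a, c}, {b, c}}" "corners F = {a, b, c}"
proof -
  obtain C where C: "C \<in> k_cycles 3 (underlying_graph V E)" "frontier F = drawn E C" using triangular[OF assms] by blast
  have "\<Union>(ends ` E) \<subseteq> pverts (underlying_graph V E)" using Union_ends by (simp add: underlying_graph_def)
  from cycles_iff[OF parcs_underlying this] obtain c where
    c: "distinct c" "3 \<le> length c" "cycle_edges c \<subseteq> ends ` E" "C = cycle_edges c"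
    using C(1) by (auto simp: k_cycles_def)
  have "length c = 3" using C(1) card_cycle_edges[OF c(1,2)] c(4) by (simp add: k_cycles_def)
  then obtain x y z where xyz: "c = [x, y, z]" using list_length_3 by blast
  then have Ceq: "C = {{x, y}, {x, z}, {y, z}}" using c(4) by (auto simp: cycle_edges_def insert_commute)
  have d: "x \<noteq> y" "x \<noteq> z" "y \<noteq> z" using c(1) xyz by auto
  have CE: "{{x, y}, {x, z}, {y, z}} \<subseteq> ends ` E" using c(3,4) Ceq by simp
  have "C \<subseteq> ends ` E" using c(3,4) by simp
  then have "\<Union>C \<subseteq> V" using Union_ends by (meson Union_mono order_trans)
  moreover have "card s = 2" if "s \<in> C" for s using card_cycle_edge[OF c(1), of s] c(2,4) that by simp
  ultimately have fr: "frontier F = drawing C" using C(2) drawn_eq[of C] by simp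
  have "corners F = {x, y, z}" unfolding corners_def fr using drawing_Int_V[of C] CE Ceq by auto
  then show thesis using that[OF d CE] fr Ceq by simp
qed

definition sides :: "complex set \<Rightarrow> complex set set" where "sides f = {d. card d = 2 \<and> d \<subseteq> f}"

lemma sides_triple: "a \<noteq> b \<Longrightarrow> a \<noteq> c \<Longrightarrow> b \<noteq> c \<Longrightarrow> sides {a, b, c} = {{a, b}, {a, c}, {b, c}}"
  unfolding sides_def using doubletons_in_triple[of _ a b c] by auto

lemma frontier_face: "F \<in> faces V E \<Longrightarrow> frontier F = drawing (sides (corners F))"
  by (rule face_triangle[of F]) (use sides_triple in auto)

lemma sides_corners: "F \<in> faces V E \<Longrightarrow> sides (corners F) \<subseteq> ends ` E"
  by (rule face_triangle[of F]) (use sides_triple in auto)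

lemma card_corners: "F \<in> faces V E \<Longrightarrow> card (corners F) = 3"
  by (rule face_triangle[of F]) auto

lemma closed_curve_frontier:
  assumes "F \<in> faces V E" shows "closed_curve (frontier F)"
proof -
  obtain a b c where abc: "a \<noteq> b" "a \<noteq> c" "b \<noteq> c" "{{a, b}, {a, c}, {b, c}} \<subseteq> ends ` E"
    "frontier F = drawing {{a, b}, {a, c}, {b, c}}" by (rule face_triangle[OF assms])
  have "cycle_edges [a, b, c] = {{a, b}, {a, c}, {b, c}}" by (auto simp: cycle_edges_def insert_commute)
  then show ?thesis using closed_curve_cycle[of "[a, b, c]"] abc by simp
qed

lemma connected_in_side:
  assumes "open A" "open B" "A \<inter> B = {}" "A \<union> B = - J" "connected C" "C \<inter> J = {}"
  shows "C \<subseteq> A \<or> C \<subseteq> B"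
proof (rule ccontr)
  assume "\<not> ?thesis"
  then have "A \<inter> C \<noteq> {}" "B \<inter> C \<noteq> {}" "C \<subseteq> A \<union> B" using assms by blast+
  then show False using connectedD[OF assms(5,1,2)] assms(3) by blast
qed

text \<open>A connected set that contains a face and misses its frontier is contained in the
  face.\<close>

lemma face_is_side:
  assumes F: "F \<in> faces V E" and s: "open A" "open B" "connected A" "connected B" "A \<inter> B = {}" "A \<union> B = - frontier F"
  shows "F = A \<or> F = B"
proof -
  have int: "F \<inter> frontier F = {}" using face_props(1)[OF F] frontier_disjoint_eq[of F] by blast
  have "X \<subseteq> F" if "connected X" "X \<inter> frontier F = {}" "F \<subseteq> X" for X
  proof (rule ccontr)
    assume "\<not> X \<subseteq> F"
    then have "X \<inter> F \<noteq> {}" "X - F \<noteq> {}" using that face_props(3)[OF F] by blast+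
    then show False using connected_Int_frontier[OF that(1)] that(2) by blast
  qed
  moreover have "F \<subseteq> A \<or> F \<subseteq> B" by (rule connected_in_side[OF s(1,2,5,6) face_props(2)[OF F] int])
  ultimately show ?thesis using s by blast
qed

text \<open>Two faces with the same frontier would be its two sides, and all vertices would lie on
  one 3-cycle; four vertices exclude this. So faces may be replaced by their triples of
  corners.\<close>

lemma faces_same_corners:
  assumes "F \<in> faces V E" "F' \<in> faces V E" "corners F = corners F'"
  shows "F = F'"
proof (rule ccontr)
  assume ne: "F \<noteq> F'"
  have eq: "frontier F = frontier F'" using frontier_face assms by metis
  obtain A B where s: "open A" "open B" "connected A" "connected B" "A \<inter> B = {}" "A \<union> B = - frontier F"
    by (rule closed_curve_sides[OF closed_curve_frontier[OF assms(1)]])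
  have "F = A \<or> F = B" "F' = A \<or> F' = B"
    using face_is_side[OF assms(1) s] face_is_side[OF assms(2), of A B] s eq by auto
  then have "F \<union> F' = - frontier F" using ne s(6) by blast
  moreover have "F \<inter> V = {}" "F' \<inter> V = {}"
    using face_props(4)[OF assms(1)] face_props(4)[OF assms(2)] by (auto simp: graph_points_def)
  ultimately have "V \<subseteq> corners F" by (auto simp: corners_def)
  moreover have "finite (corners F)" by (simp add: corners_def)
  ultimately have "card V \<le> 3" using card_corners[OF assms(1)] card_mono by metis
  then show False using four_vertices by simp
qed

lemma finite_faces: "finite (faces V E)"
proof (rule finite_imageD)
  show "finite (corners ` faces V E)" by (rule finite_subset[of _ "Pow V"]) (auto simp: corners_def)
  show "inj_on corners (faces V E)" by (intro inj_onI) (rule faces_same_corners)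
qed

text \<open>The graph has empty interior, so the faces are dense, and there are only finitely many
  of them.\<close>

lemma face_accumulates:
  assumes "open W" "p \<in> closure W"
  obtains F where "F \<in> faces V E" "p \<in> closure (W \<inter> F)"
proof -
  have "closure (- graph_points) = UNIV" by (simp add: closure_complement interior_graph_points)
  then have "W \<subseteq> closure (W \<inter> - graph_points)" using open_Int_closure_subset[OF assms(1), of "- graph_points"] by simp
  then have "p \<in> closure (W \<inter> - graph_points)" using assms(2) closure_minimal[of W] by blast
  moreover have "closure (W \<inter> - graph_points) \<subseteq> (\<Union>F\<in>faces V E. closure (W \<inter> F))"
  proof (rule closure_minimal)
    show "W \<inter> - graph_points \<subseteq> (\<Union>F\<in>faces V E. closure (W \<inter> F))"
    proof
      fix q assume q: "q \<in> W \<inter> - graph_points"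
      then obtain F where F: "F \<in> faces V E" "q \<in> F" using Union_faces by blast
      then have "q \<in> closure (W \<inter> F)" using q closure_subset[of "W \<inter> F"] by blast
      then show "q \<in> (\<Union>F\<in>faces V E. closure (W \<inter> F))" using F(1) by blast
    qed
    show "closed (\<Union>F\<in>faces V E. closure (W \<inter> F))" using finite_faces by (intro closed_UN) auto
  qed
  ultimately show thesis using that by blast
qed

lemma frontier_edge_point:
  assumes "e \<in> E" "p \<in> e" "p \<notin> V" "F \<in> faces V E"
  shows "p \<in> closure F \<longleftrightarrow> ends e \<subseteq> corners F"
proof -
  have "p \<notin> F" using face_props(4)[OF assms(4)] assms by (auto simp: graph_points_def)
  then have "p \<in> closure F \<longleftrightarrow> p \<in> frontier F"
    using face_props(1)[OF assms(4)] by (simp add: frontier_def interior_open)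
  also have "\<dots> \<longleftrightarrow> ends e \<in> sides (corners F)" unfolding frontier_face[OF assms(4)] by (rule in_drawing_iff[OF assms(1-3)])
  also have "\<dots> \<longleftrightarrow> ends e \<subseteq> corners F" using card_ends[OF assms(1)] by (simp add: sides_def)
  finally show ?thesis .
qed

text \<open>One face accumulates at an inner point of the edge. It is one side of its frontier, and
  the open other side yields a second face.\<close>

lemma edge_two_faces:
  assumes "e \<in> E"
  obtains F F' where "F \<in> faces V E" "F' \<in> faces V E" "F \<noteq> F'" "ends e \<subseteq> corners F" "ends e \<subseteq> corners F'"
proof -
  obtain p where p: "p \<in> e" "p \<notin> V" using connected_edge_interior[OF assms] by blast
  obtain F where F: "F \<in> faces V E" "p \<in> closure (UNIV \<inter> F)" by (rule face_accumulates[of UNIV p]) auto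
  then have eF: "ends e \<subseteq> corners F" using frontier_edge_point[OF assms p] by simp
  obtain A B where s: "open A" "open B" "connected A" "connected B" "A \<inter> B = {}" "A \<union> B = - frontier F"
    "frontier A = frontier F" "frontier B = frontier F"
    by (rule closed_curve_sides[OF closed_curve_frontier[OF F(1)]])
  have pf: "p \<in> frontier F" unfolding frontier_face[OF F(1)] in_drawing_iff[OF assms p]
    using eF card_ends[OF assms] by (simp add: sides_def)
  have "\<exists>W. open W \<and> p \<in> closure W \<and> W \<inter> F = {}"
  proof (cases "F = A")
    case True
    then show ?thesis using s pf by (intro exI[of _ B]) (auto simp: frontier_def)
  next
    case False
    then have "F = B" using face_is_side[OF F(1) s(1-6)] by simp
    then show ?thesis using s pf by (intro exI[of _ A]) (auto simp: frontier_def)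
  qed
  then obtain W where W: "open W" "p \<in> closure W" "W \<inter> F = {}" by blast
  obtain F' where F': "F' \<in> faces V E" "p \<in> closure (W \<inter> F')" by (rule face_accumulates[OF W(1,2)])
  have "F \<noteq> F'" using W(3) F'(2) by (metis closure_empty empty_iff)
  moreover have "p \<in> closure F'" using F'(2) closure_mono[of "W \<inter> F'" F'] by auto
  then have "ends e \<subseteq> corners F'" using frontier_edge_point[OF assms p F'(1)] by simp
  ultimately show thesis using that F(1) F'(1) eF by blast
qed

text \<open>Two faces at an edge fill, together with the edge, one side of the quadrilateral around them:
  by Janiszewski's theorem, a further point on that side could be joined to the other side.\<close>

lemma edge_neighbourhood:
  assumes e: "e \<in> E" and F: "F1 \<in> faces V E" "F2 \<in> faces V E" "F1 \<noteq> F2" "ends e \<subseteq> corners F1" "ends e \<subseteq> corners F2"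
  shows "open (F1 \<union> F2 \<union> (e - V))" "connected (F1 \<union> F2 \<union> (e - V))"
proof -
  let ?X = "F1 \<union> F2 \<union> (e - V)"
  obtain u v where uv: "ends e = {u, v}" "u \<noteq> v" using card_ends[OF e] by (auto simp: card_2_iff)
  have third: "\<exists>a. corners F = {u, v, a} \<and> a \<noteq> u \<and> a \<noteq> v" if FF: "F \<in> faces V E" "ends e \<subseteq> corners F" for F
  proof -
    obtain x y z where "corners F = {x, y, z}" "x \<noteq> y" "x \<noteq> z" "y \<noteq> z" by (rule face_triangle[OF FF(1)])
    then consider "corners F = {u, v, x}" "x \<noteq> u" "x \<noteq> v" | "corners F = {u, v, y}" "y \<noteq> u" "y \<noteq> v" | "corners F = {u, v, z}" "z \<noteq> u" "z \<noteq> v"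
      using FF(2) uv by auto
    then show ?thesis by cases blast+
  qed
  obtain a where a: "corners F1 = {u, v, a}" "a \<noteq> u" "a \<noteq> v" using third F by blast
  obtain b where b: "corners F2 = {u, v, b}" "b \<noteq> u" "b \<noteq> v" using third F by blast
  have ab: "a \<noteq> b" using faces_same_corners[OF F(1,2)] F(3) a b by auto
  let ?P1 = "drawing {{u, a}, {v, a}}" and ?P2 = "drawing {{u, b}, {v, b}}"
  have s1: "sides (corners F1) = insert (ends e) {{u, a}, {v, a}}" "sides (corners F2) = insert (ends e) {{u, b}, {v, b}}"
    using sides_triple a b uv by auto
  have J1: "frontier F1 = e \<union> ?P1" "frontier F2 = e \<union> ?P2"
    unfolding frontier_face[OF F(1)] frontier_face[OF F(2)] s1 by (rule drawing_insert_edge[OF e])+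
  have sE: "{{u, a}, {v, a}, {u, b}, {v, b}} \<subseteq> ends ` E"
    using sides_corners[OF F(1)] sides_corners[OF F(2)] s1 by auto
  let ?J = "?P1 \<union> ?P2"
  have cyc: "cycle_edges [u, a, v, b] = {{u, a}, {v, a}} \<union> {{u, b}, {v, b}}" by (auto simp: cycle_edges_def insert_commute)
  have J: "?J = drawing (cycle_edges [u, a, v, b])" unfolding cyc by (simp only: drawing_Un)
  have cJ: "closed_curve ?J" unfolding J by (rule closed_curve_cycle) (use a b ab uv cyc sE in auto)
  have eP: "e \<inter> V \<subseteq> ?P1" "e \<inter> V \<subseteq> ?P2"
  proof -
    have "\<Union>{{u, a}, {v, a}} \<subseteq> ?P1" "\<Union>{{u, b}, {v, b}} \<subseteq> ?P2"
      using drawing_Int_V[of "{{u, a}, {v, a}}"] drawing_Int_V[of "{{u, b}, {v, b}}"] sE by auto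
    then show "e \<inter> V \<subseteq> ?P1" "e \<inter> V \<subseteq> ?P2" using uv by (auto simp: ends_def)
  qed
  have eJ: "(e - V) \<inter> ?J = {}"
  proof -
    have "p \<notin> ?J" if "p \<in> e - V" for p
    proof -
      have "ends e \<notin> cycle_edges [u, a, v, b]" unfolding cyc uv(1) using a b uv by (auto simp: doubleton_eq_iff)
      then show ?thesis unfolding J using in_drawing_iff[OF e, of p] that by blast
    qed
    then show ?thesis by blast
  qed
  have FJ: "F1 \<inter> ?J = {}" "F2 \<inter> ?J = {}" using face_props(4)[OF F(1)] face_props(4)[OF F(2)] drawing_subset J by blast+
  have XJ: "?X \<inter> ?J = {}" using eJ FJ by blast
  note ce = connected_edge_interior[OF e]
  have half: "connected (Fi \<union> (e - V))" if "Fi \<in> faces V E" "ends e \<subseteq> corners Fi" for Fi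
  proof (rule connected_intermediate_closure[OF face_props(2)[OF that(1)]])
    show "Fi \<union> (e - V) \<subseteq> closure Fi" using frontier_edge_point[OF e _ _ that(1)] that(2) closure_subset by blast
  qed auto
  have "connected ((F1 \<union> (e - V)) \<union> (F2 \<union> (e - V)))"
    by (rule connected_Un[OF half[OF F(1,4)] half[OF F(2,5)]]) (use ce in blast)
  moreover have "(F1 \<union> (e - V)) \<union> (F2 \<union> (e - V)) = ?X" by blast
  ultimately show cX: "connected ?X" by simp
  obtain A B where s: "open A" "open B" "connected A" "connected B" "A \<noteq> {}" "B \<noteq> {}" "A \<inter> B = {}" "A \<union> B = - ?J"
    by (rule closed_curve_sides[OF cJ])
  \<comment> \<open>The two frontiers share only \<open>e\<close>, and connectedness of this
    intersection is the condition in Janiszewski's theorem.\<close>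
  have int: "frontier F1 \<inter> frontier F2 = e"
  proof -
    have "?P1 \<inter> ?P2 \<subseteq> e"
    proof
      fix p assume p: "p \<in> ?P1 \<inter> ?P2"
      then obtain e1 e2 where e12: "e1 \<in> E" "ends e1 \<in> {{u, a}, {v, a}}" "p \<in> e1" "e2 \<in> E" "ends e2 \<in> {{u, b}, {v, b}}" "p \<in> e2"
        by (auto simp: drawing_def)
      have "ends e1 \<noteq> ends e2" using e12(2,5) a b ab uv(2) by (auto simp: doubleton_eq_iff)
      then have "p \<in> ends e1 \<inter> ends e2" using edges_meet[of e1 e2] e12 by auto
      then have "p \<in> {u, v}" using e12(2,5) ab a b by auto
      then show "p \<in> e" using uv by (auto simp: ends_def)
    qed
    then show ?thesis unfolding J1 by blast
  qed
  have cone: "connected e"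
  proof -
    obtain g where "arc g" "path_image g = e" using edge_arc[OF e] by metis
    then show ?thesis using connected_arc_image by blast
  qed
  have main: "?X = K" if K: "open K" "open K'" "K' \<noteq> {}" "K \<inter> K' = {}" "K \<union> K' = - ?J" "?X \<subseteq> K" for K K'
  proof (rule ccontr)
    assume "?X \<noteq> K"
    then obtain z where z: "z \<in> K" "z \<notin> ?X" using K by blast
    obtain w where w: "w \<in> K'" using K by blast
    have zw: "z \<notin> ?J" "w \<notin> ?J" "w \<notin> ?X" using z w K by blast+
    \<comment> \<open>Neither point lies in the face, which is one side of its frontier, so both lie
      on the other side.\<close>
    have cc: "connected_component (- frontier Fi) z w" if Fi: "Fi \<in> faces V E" "Fi \<subseteq> ?X" "frontier Fi = e \<union> Pi" "Pi \<subseteq> ?J" "e \<inter> V \<subseteq> Pi" for Fi Pi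
    proof -
      obtain A B where s: "open A" "open B" "connected A" "connected B" "A \<inter> B = {}" "A \<union> B = - frontier Fi"
        by (rule closed_curve_sides[OF closed_curve_frontier[OF Fi(1)]])
      have "z \<notin> frontier Fi" "w \<notin> frontier Fi" using Fi z zw by blast+
      moreover have "z \<notin> Fi" "w \<notin> Fi" using Fi(2) z zw by blast+
      moreover have "Fi = A \<or> Fi = B" by (rule face_is_side[OF Fi(1) s])
      ultimately have "(z \<in> A \<and> w \<in> A) \<or> (z \<in> B \<and> w \<in> B)" using s(6) by blast
      then show ?thesis unfolding connected_component_def using s(3,4,6) by blast
    qed
    have cf: "compact (frontier F1)" "closed (frontier F2)" using closed_curve_compact[OF closed_curve_frontier[OF F(1)]] by auto
    have "connected_component (- (frontier F1 \<union> frontier F2)) z w"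
    proof (rule Janiszewski[OF cf])
      show "connected (frontier F1 \<inter> frontier F2)" unfolding int by (rule cone)
      show "connected_component (- frontier F1) z w" by (rule cc[OF F(1) _ J1(1)]) (use eP in auto)
      show "connected_component (- frontier F2) z w" by (rule cc[OF F(2) _ J1(2)]) (use eP in auto)
    qed
    then obtain t where t: "connected t" "t \<subseteq> - (frontier F1 \<union> frontier F2)" "z \<in> t" "w \<in> t"
      unfolding connected_component_def by blast
    have "t \<inter> ?J = {}" using t(2) J1 by blast
    then have "t \<subseteq> K \<or> t \<subseteq> K'" by (rule connected_in_side[OF K(1,2,4,5) t(1)])
    then show False using t z w K(4) by blast
  qed
  have "?X \<subseteq> A \<or> ?X \<subseteq> B" by (rule connected_in_side[OF s(1,2,7,8) cX XJ])
  then show "open ?X"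
  proof
    assume "?X \<subseteq> A"
    then have "?X = A" using main[of A B] s by blast
    then show ?thesis using s(1) by simp
  next
    assume "?X \<subseteq> B"
    then have "?X = B" using main[of B A] s by (simp add: Int_commute Un_commute)
    then show ?thesis using s(2) by simp
  qed
qed

text \<open>A third face accumulating at the edge would meet the open set formed by the first two
  faces and the edge.\<close>

lemma edge_faces_exactly:
  assumes e: "e \<in> E" and F: "F1 \<in> faces V E" "F2 \<in> faces V E" "F1 \<noteq> F2" "ends e \<subseteq> corners F1" "ends e \<subseteq> corners F2"
    and F3: "F3 \<in> faces V E" "ends e \<subseteq> corners F3"
  shows "F3 = F1 \<or> F3 = F2"
proof (rule ccontr)
  assume n: "\<not> ?thesis"
  obtain p where p: "p \<in> e" "p \<notin> V" using connected_edge_interior[OF e] by blast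
  have "p \<in> closure F3" using frontier_edge_point[OF e p F3(1)] F3(2) by simp
  then have "(F1 \<union> F2 \<union> (e - V)) \<inter> F3 \<noteq> {}"
    using edge_neighbourhood(1)[OF e F] p by (metis DiffI UnI2 disjoint_iff open_Int_closure_eq_empty IntI empty_iff)
  moreover have "F1 \<inter> F3 = {}" "F2 \<inter> F3 = {}" using faces_disjoint F F3 n by auto
  moreover have "e \<inter> F3 = {}" using face_props(4)[OF F3(1)] e by (auto simp: graph_points_def)
  ultimately show False by blast
qed

section \<open>The sphere of corner triples\<close>

definition tri :: "complex set set" where "tri = corners ` faces V E"

lemma tri_edge:
  assumes "f \<in> tri" "d \<subseteq> f" "card d = 2"
  obtains e where "e \<in> E" "d = ends e"
proof -
  obtain F where F: "F \<in> faces V E" "f = corners F" using assms by (auto simp: tri_def)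
  have "d \<in> sides (corners F)" using assms F by (simp add: sides_def)
  then show thesis using sides_corners[OF F(1)] that by blast
qed

lemma tri_at_edge:
  assumes e: "e \<in> E" and F: "F1 \<in> faces V E" "F2 \<in> faces V E" "F1 \<noteq> F2" "ends e \<subseteq> corners F1" "ends e \<subseteq> corners F2"
  shows "{h \<in> tri. ends e \<subseteq> h} = {corners F1, corners F2}"
  using edge_faces_exactly[OF e F] F by (auto simp: tri_def)

sublocale surface tri
proof
  show "finite tri" by (simp add: tri_def finite_faces)
  show "card f = 3" if "f \<in> tri" for f using that card_corners by (auto simp: tri_def)
  fix f d assume f: "f \<in> tri" "d \<subseteq> f" "card d = 2"
  obtain e where e: "e \<in> E" "d = ends e" by (rule tri_edge[OF f])
  obtain F1 F2 where F: "F1 \<in> faces V E" "F2 \<in> faces V E" "F1 \<noteq> F2" "ends e \<subseteq> corners F1" "ends e \<subseteq> corners F2"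
    by (rule edge_two_faces[OF e(1)])
  have ne: "corners F1 \<noteq> corners F2" using faces_same_corners F by blast
  have eq: "{h \<in> tri. d \<subseteq> h} = {corners F1, corners F2}" unfolding e(2) by (rule tri_at_edge[OF e(1) F])
  have "f \<in> {h \<in> tri. d \<subseteq> h}" using f by simp
  then have "f = corners F1 \<or> f = corners F2" unfolding eq by simp
  then show "\<exists>g. g \<noteq> f \<and> {h \<in> tri. d \<subseteq> h} = {f, g}"
  proof
    assume "f = corners F1"
    then show ?thesis using eq ne by (intro exI[of _ "corners F2"]) auto
  next
    assume "f = corners F2"
    then show ?thesis using eq ne by (intro exI[of _ "corners F1"]) auto
  qed
qed

lemma edges_tri: "edges_of tri = ends ` E"
proof
  show "edges_of tri \<subseteq> ends ` E"
  proof
    fix d assume "d \<in> edges_of tri"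
    then obtain f where "f \<in> tri" "d \<subseteq> f" "card d = 2" by (auto simp: edges_of_def)
    then show "d \<in> ends ` E" using tri_edge by (metis imageI)
  qed
  show "ends ` E \<subseteq> edges_of tri"
  proof
    fix d assume "d \<in> ends ` E"
    then obtain e where e: "e \<in> E" "d = ends e" by blast
    obtain F F' where "F \<in> faces V E" "ends e \<subseteq> corners F" using edge_two_faces[OF e(1)] by metis
    then show "d \<in> edges_of tri" using e card_ends by (auto simp: edges_of_def tri_def)
  qed
qed

lemma in_bd_tri_iff:
  assumes e: "e \<in> E" and F: "F1 \<in> faces V E" "F2 \<in> faces V E" "F1 \<noteq> F2" "ends e \<subseteq> corners F1" "ends e \<subseteq> corners F2"
    and X: "X \<subseteq> tri"
  shows "ends e \<in> bd X \<longleftrightarrow> (corners F1 \<in> X) \<noteq> (corners F2 \<in> X)"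
proof (rule in_bd_iff[OF _ tri_at_edge[OF e F] _ X])
  show "ends e \<in> edges_of tri" using edges_tri e by simp
  show "corners F1 \<noteq> corners F2" using faces_same_corners F by blast
qed

text \<open>\<open>X\<close> collects the faces on one side of the Jordan curve. The open edge and
  its two faces form an open connected set. Off the curve it stays on one side; for an edge on the
  curve it meets both sides, and the edge itself meets neither, so the two faces are
  separated.\<close>

lemma cycle_bounds:
  assumes c: "distinct c" "3 \<le> length c" "cycle_edges c \<subseteq> ends ` E"
  obtains X where "X \<subseteq> tri" "bd X = cycle_edges c"
proof -
  let ?J = "drawing (cycle_edges c)"
  obtain A B where s: "open A" "open B" "connected A" "connected B" "A \<noteq> {}" "B \<noteq> {}" "A \<inter> B = {}" "A \<union> B = - ?J"
    "frontier A = ?J" "frontier B = ?J"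
    by (rule closed_curve_sides[OF closed_curve_cycle[OF c]])
  define X where "X = corners ` {F \<in> faces V E. F \<subseteq> A}"
  have XT: "X \<subseteq> tri" by (auto simp: X_def tri_def)
  have X: "corners F \<in> X \<longleftrightarrow> F \<subseteq> A" if "F \<in> faces V E" for F
    using that faces_same_corners unfolding X_def by blast
  have side: "F \<subseteq> A \<or> F \<subseteq> B" "\<not> (F \<subseteq> A \<and> F \<subseteq> B)" if F: "F \<in> faces V E" for F
  proof -
    have "F \<inter> ?J = {}" using face_props(4)[OF F] drawing_subset by blast
    then show "F \<subseteq> A \<or> F \<subseteq> B" by (rule connected_in_side[OF s(1,2,7,8) face_props(2)[OF F]])
    show "\<not> (F \<subseteq> A \<and> F \<subseteq> B)" using face_props(3)[OF F] s(7) by blast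
  qed
  have "ends e \<in> bd X \<longleftrightarrow> ends e \<in> cycle_edges c" if e: "e \<in> E" for e
  proof -
    obtain F1 F2 where F: "F1 \<in> faces V E" "F2 \<in> faces V E" "F1 \<noteq> F2" "ends e \<subseteq> corners F1" "ends e \<subseteq> corners F2"
      by (rule edge_two_faces[OF e])
    let ?N = "F1 \<union> F2 \<union> (e - V)"
    note nb = edge_neighbourhood[OF e F]
    obtain p where p: "p \<in> e" "p \<notin> V" using connected_edge_interior[OF e] by blast
    have bdX: "ends e \<in> bd X \<longleftrightarrow> (F1 \<subseteq> A) \<noteq> (F2 \<subseteq> A)"
      using in_bd_tri_iff[OF e F XT] X F by simp
    show ?thesis
    proof (cases "ends e \<in> cycle_edges c")
      case True
      have eJ: "e \<subseteq> ?J" using True e by (auto simp: drawing_def)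
      have "p \<in> closure A" "p \<in> closure B" using s(9,10) eJ p by (auto simp: frontier_def)
      then have "?N \<inter> A \<noteq> {}" "?N \<inter> B \<noteq> {}" using nb(1) p by (meson DiffI UnI2 disjoint_iff open_Int_closure_eq_empty)+
      moreover have "e \<inter> A = {}" "e \<inter> B = {}" using eJ s(8) by blast+
      ultimately have "F1 \<inter> A \<noteq> {} \<or> F2 \<inter> A \<noteq> {}" "F1 \<inter> B \<noteq> {} \<or> F2 \<inter> B \<noteq> {}" by blast+
      then show ?thesis using bdX True side[OF F(1)] side[OF F(2)] s(7) by blast
    next
      case False
      have "?N \<inter> ?J = {}"
      proof -
        have "F1 \<inter> ?J = {}" "F2 \<inter> ?J = {}" using face_props(4)[OF F(1)] face_props(4)[OF F(2)] drawing_subset by blast+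
        moreover have "(e - V) \<inter> ?J = {}" using in_drawing_iff[OF e] False by blast
        ultimately show ?thesis by blast
      qed
      then have "?N \<subseteq> A \<or> ?N \<subseteq> B" by (rule connected_in_side[OF s(1,2,7,8) nb(2)])
      then show ?thesis using bdX False side[OF F(1)] side[OF F(2)] by blast
    qed
  qed
  moreover have "bd X \<subseteq> ends ` E" using bd_sub_edges[OF XT] edges_tri by simp
  ultimately have "bd X = cycle_edges c" using c(3) by blast
  then show thesis using that XT by blast
qed

text \<open>An even set is exhausted by cycles, each of which bounds. If \<open>X\<close> has empty
  boundary, the faces in \<open>X\<close> with the edges between them form an open set, and so do
  the remaining ones. Together they cover the plane without finitely many vertices, which is
  connected, so one of the two sets is empty.\<close>

sublocale tri_sphere tri
proof
  fix Z assume Z: "Z \<subseteq> edges_of tri" "even_set Z"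
  have "finite Z" using Z(1) finite_edges finite_subset by blast
  then show "\<exists>X\<subseteq>tri. bd X = Z" using Z
  proof (induction "card Z" arbitrary: Z rule: less_induct)
    case less
    show ?case
    proof (cases "Z = {}")
      case True
      then show ?thesis by (intro exI[of _ "{}"]) simp
    next
      case False
      have "card d = 2" if "d \<in> Z" for d using that less(3) by (auto simp: edges_of_def)
      then obtain c where c: "distinct c" "3 \<le> length c" "cycle_edges c \<subseteq> Z"
        by (rule even_set_contains_cycle[OF less(2) False less(4)])
      obtain X where X: "X \<subseteq> tri" "bd X = cycle_edges c" by (rule cycle_bounds[OF c(1,2)]) (use c(3) less(3) edges_tri in auto)
      let ?Y = "sym_diff Z (cycle_edges c)"
      have Y: "?Y = Z - cycle_edges c" using c(3) by blast
      have "c \<noteq> []" using c by auto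
      then have "cycle_edges c \<noteq> {}" by (simp add: cycle_edges_eq)
      then have "?Y \<subset> Z" unfolding Y using c(3) by blast
      then have lt: "card ?Y < card Z" using psubset_card_mono[OF less(2)] by blast
      have fY: "finite ?Y" "?Y \<subseteq> edges_of tri" unfolding Y using less(2,3) by auto
      have eY: "even_set ?Y" by (rule even_set_sym_diff[OF less(2) _ less(4) even_set_cycle[OF c(1,2)]]) simp
      obtain W where W: "W \<subseteq> tri" "bd W = ?Y" using less(1)[OF lt fY eY] by blast
      have "sym_diff W X \<subseteq> tri" using W X by blast
      moreover have "bd (sym_diff W X) = Z" unfolding bd_sym_diff[OF W(1) X(1)] W(2) X(2) using c(3) by blast
      ultimately show ?thesis by blast
    qed
  qed
next
  fix X assume X: "X \<subseteq> tri" "bd X = {}"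
  define N where "N = (\<lambda>e. (e - V) \<union> \<Union>{F \<in> faces V E. ends e \<subseteq> corners F})"
  define P where "P = (\<lambda>X. \<Union>{F \<in> faces V E. corners F \<in> X} \<union> \<Union>(N ` {e \<in> E. \<forall>F\<in>faces V E. ends e \<subseteq> corners F \<longrightarrow> corners F \<in> X}))"
  have N: "\<exists>F1 F2. F1 \<in> faces V E \<and> F2 \<in> faces V E \<and> {F \<in> faces V E. ends e \<subseteq> corners F} = {F1, F2} \<and> (corners F1 \<in> X \<longleftrightarrow> corners F2 \<in> X) \<and> open (N e)"
    if e: "e \<in> E" for e
  proof -
    obtain F1 F2 where F: "F1 \<in> faces V E" "F2 \<in> faces V E" "F1 \<noteq> F2" "ends e \<subseteq> corners F1" "ends e \<subseteq> corners F2"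
      by (rule edge_two_faces[OF e])
    have eq: "{F \<in> faces V E. ends e \<subseteq> corners F} = {F1, F2}" using edge_faces_exactly[OF e F] F by blast
    have "N e = F1 \<union> F2 \<union> (e - V)" unfolding N_def eq by auto
    then have "open (N e)" using edge_neighbourhood(1)[OF e F] by simp
    moreover have "corners F1 \<in> X \<longleftrightarrow> corners F2 \<in> X" using in_bd_tri_iff[OF e F X(1)] X(2) by simp
    ultimately show ?thesis using eq F by blast
  qed
  have op: "open (P Y)" for Y
    unfolding P_def using N face_props(1) by (intro open_Un open_Union) auto
  let ?Q = "P (tri - X)"
  have cover: "- V \<subseteq> P X \<union> ?Q"
  proof
    fix p assume p: "p \<in> - V"
    show "p \<in> P X \<union> ?Q"
    proof (cases "p \<in> graph_points")
      case False
      then obtain F where "F \<in> faces V E" "p \<in> F" using Union_faces by blast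
      then show ?thesis by (auto simp: P_def tri_def)
    next
      case True
      then obtain e where e: "e \<in> E" "p \<in> e" using p by (auto simp: graph_points_def)
      have pN: "p \<in> N e" using e p by (simp add: N_def)
      obtain F1 F2 where F: "F1 \<in> faces V E" "F2 \<in> faces V E" "{F \<in> faces V E. ends e \<subseteq> corners F} = {F1, F2}" "corners F1 \<in> X \<longleftrightarrow> corners F2 \<in> X"
        using N[OF e(1)] by blast
      have st: "(\<forall>F\<in>faces V E. ends e \<subseteq> corners F \<longrightarrow> corners F \<in> Y) \<longleftrightarrow> corners F1 \<in> Y \<and> corners F2 \<in> Y" for Y
      proof -
        have "(\<forall>F\<in>faces V E. ends e \<subseteq> corners F \<longrightarrow> corners F \<in> Y) \<longleftrightarrow> (\<forall>F\<in>{F \<in> faces V E. ends e \<subseteq> corners F}. corners F \<in> Y)"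
          by blast
        then show ?thesis unfolding F(3) by simp
      qed
      have "corners F1 \<in> tri" "corners F2 \<in> tri" using F by (auto simp: tri_def)
      then show ?thesis unfolding P_def st[of X] using e(1) pN F(4) st[of X] st[of "tri - X"] by blast
    qed
  qed
  have disj: "P X \<inter> ?Q = {}"
  proof (rule ccontr)
    assume "P X \<inter> ?Q \<noteq> {}"
    then obtain p where p: "p \<in> P X" "p \<in> ?Q" by blast
    have face: "corners F \<in> Y" if "p \<in> P Y" "F \<in> faces V E" "p \<in> F" for F Y
    proof -
      have *: "p \<notin> graph_points" using face_props(4) that by blast
      from that(1) obtain F' where F': "F' \<in> faces V E" "p \<in> F'" "corners F' \<in> Y"
        unfolding P_def N_def using * by (auto simp: graph_points_def)
      then show ?thesis using faces_disjoint[OF F'(1) that(2)] that(3) by blast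
    qed
    have edge: "\<exists>F\<in>faces V E. corners F \<in> Y \<and> ends e \<subseteq> corners F \<and> (\<forall>F\<in>faces V E. ends e \<subseteq> corners F \<longrightarrow> corners F \<in> Y)"
      if pe: "p \<in> P Y" "e \<in> E" "p \<in> e" "p \<notin> V" for e Y
    proof -
      have "p \<notin> F" if "F \<in> faces V E" for F using face_props(4)[OF that] \<open>e \<in> E\<close> \<open>p \<in> e\<close> by (auto simp: graph_points_def)
      then obtain e' where e': "e' \<in> E" "p \<in> e'" "\<forall>F\<in>faces V E. ends e' \<subseteq> corners F \<longrightarrow> corners F \<in> Y"
        using pe(1) unfolding P_def N_def by blast
      have "e' = e" using edges_meet[OF e'(1) pe(2)] e'(2) pe by (auto simp: ends_def)
      moreover obtain F1 where "F1 \<in> faces V E" "ends e \<subseteq> corners F1" using edge_two_faces[OF pe(2)] by metis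
      ultimately show ?thesis using e'(3) by blast
    qed
    have pV: "p \<notin> V"
    proof
      assume "p \<in> V"
      then have "p \<notin> F" if "F \<in> faces V E" for F using face_props(4)[OF that] by (auto simp: graph_points_def)
      then show False using p(1) \<open>p \<in> V\<close> unfolding P_def N_def by blast
    qed
    show False
    proof (cases "p \<in> graph_points")
      case True
      then obtain e where "e \<in> E" "p \<in> e" using pV by (auto simp: graph_points_def)
      then show False using edge[OF p(1) _ _ pV] edge[OF p(2) _ _ pV] by blast
    next
      case False
      then obtain F where F: "F \<in> faces V E" "p \<in> F" using Union_faces by blast
      show False using face[OF p(1) F] face[OF p(2) F] by blast
    qed
  qed
  have "path_connected (- V)" by (rule path_connected_complement_countable) (simp_all add: countable_finite)
  then have "connected (- V)" by (rule path_connected_imp_connected)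
  then have "P X \<inter> - V = {} \<or> ?Q \<inter> - V = {}"
    using connectedD[of "- V" "P X" ?Q] op cover disj by blast
  moreover have "Y = {}" if Y: "P Y \<inter> - V = {}" "Y \<subseteq> tri" for Y
  proof (rule ccontr)
    assume "Y \<noteq> {}"
    then obtain F where F: "F \<in> faces V E" "corners F \<in> Y" using Y(2) by (auto simp: tri_def)
    then have "F \<subseteq> P Y" by (auto simp: P_def)
    moreover have "F \<inter> V = {}" "F \<noteq> {}" using face_props[OF F(1)] by (auto simp: graph_points_def)
    ultimately show False using Y(1) by blast
  qed
  ultimately show "X = {} \<or> X = tri" using X(1) by blast
qed

lemma Union_tri: "\<Union>tri = V"
proof
  show "\<Union>tri \<subseteq> V" by (auto simp: tri_def corners_def)
  show "V \<subseteq> \<Union>tri"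
  proof
    fix v assume v: "v \<in> V"
    obtain F where F: "F \<in> faces V E" "v \<in> closure (UNIV \<inter> F)" by (rule face_accumulates[of UNIV v]) auto
    have "v \<notin> F" using face_props(4)[OF F(1)] v by (auto simp: graph_points_def)
    then have "v \<in> corners F" using F v face_props(1)[OF F(1)] by (simp add: corners_def frontier_def interior_open)
    then show "v \<in> \<Union>tri" using F by (auto simp: tri_def)
  qed
qed

end

section \<open>Hamiltonian cycles avoiding prescribed edges\<close>

text \<open>The edges \<open>{s, \<phi> s}\<close> are to be avoided. Flipping one of them creates the edge \<open>{p s, q s}\<close>; the last three
  assumptions exclude separating triangles with one, two or three such new edges.\<close>

locale avoidable_edges = tri_sphere +
  fixes S :: "'a set" and \<phi> p q :: "'a \<Rightarrow> 'a"
  assumes faces_chosen: "s \<in> S \<Longrightarrow> {s, \<phi> s, p s} \<in> T" "s \<in> S \<Longrightarrow> {s, \<phi> s, q s} \<in> T" "s \<in> S \<Longrightarrow> p s \<noteq> q s"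
    and independent: "s \<in> S \<Longrightarrow> s' \<in> S \<Longrightarrow> {s, s'} \<notin> edges_of T"
    and opp_nonedge: "s \<in> S \<Longrightarrow> {p s, q s} \<notin> edges_of T"
    and opp_inj: "s \<in> S \<Longrightarrow> s' \<in> S \<Longrightarrow> {p s, q s} = {p s', q s'} \<Longrightarrow> s = s'"
    and triangles: "{a, b} \<in> edges_of T \<Longrightarrow> {b, c} \<in> edges_of T \<Longrightarrow> {a, c} \<in> edges_of T \<Longrightarrow> {a, b, c} \<in> T"
    and one_new: "s \<in> S \<Longrightarrow> {c, p s} \<in> edges_of T \<Longrightarrow> {c, q s} \<in> edges_of T \<Longrightarrow> c = s \<or> c = \<phi> s"
    and two_new: "s \<in> S \<Longrightarrow> s' \<in> S \<Longrightarrow> s \<noteq> s' \<Longrightarrow> {a, b} = {p s, q s} \<Longrightarrow> {b, c} = {p s', q s'} \<Longrightarrow> {a, c} \<notin> edges_of T"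
    and three_new: "s \<in> S \<Longrightarrow> s' \<in> S \<Longrightarrow> s'' \<in> S \<Longrightarrow> s \<noteq> s' \<Longrightarrow> {a, b} = {p s, q s} \<Longrightarrow> {b, c} = {p s', q s'} \<Longrightarrow> {a, c} \<noteq> {p s'', q s''}"
begin

text \<open>The closed form shows that the order of the flips does not matter.\<close>

definition flipped :: "'a set \<Rightarrow> 'a set set" where
  "flipped X = {f \<in> T. \<forall>s\<in>X. \<not> {s, \<phi> s} \<subseteq> f} \<union> (\<Union>s\<in>X. {{p s, q s, s}, {p s, q s, \<phi> s}})"

definition diags :: "'a set \<Rightarrow> 'a set set" where
  "diags X = (\<lambda>s. {s, \<phi> s}) ` (S - X) \<union> (\<lambda>s. {p s, q s}) ` X"

lemma chosen_distinct:
  assumes "s \<in> S"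
  shows "s \<noteq> \<phi> s" "s \<noteq> p s" "s \<noteq> q s" "\<phi> s \<noteq> p s" "\<phi> s \<noteq> q s" "p s \<noteq> q s"
  using face_distinct[OF faces_chosen(1)[OF assms]] face_distinct[OF faces_chosen(2)[OF assms]] faces_chosen(3)[OF assms] by auto

lemma chosen_edges:
  assumes "s \<in> S"
  shows "{s, \<phi> s} \<in> edges_of T" "{s, p s} \<in> edges_of T" "{s, q s} \<in> edges_of T" "{\<phi> s, p s} \<in> edges_of T" "{\<phi> s, q s} \<in> edges_of T"
  using edges_face[OF faces_chosen(1)[OF assms]] edges_face[OF faces_chosen(2)[OF assms]] by auto

lemma faces_at_chosen:
  assumes "s \<in> S" "f \<in> T" "{s, \<phi> s} \<subseteq> f"
  shows "f = {s, \<phi> s, p s} \<or> f = {s, \<phi> s, q s}"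
proof -
  have "p s \<notin> {s, \<phi> s, q s}" using chosen_distinct[OF assms(1)] by auto
  then have "{s, \<phi> s, p s} \<noteq> {s, \<phi> s, q s}" by blast
  then have "{h \<in> T. {s, \<phi> s} \<subseteq> h} = {{s, \<phi> s, p s}, {s, \<phi> s, q s}}"
    using faces_of_edge[OF chosen_edges(1)[OF assms(1)] faces_chosen(1,2)[OF assms(1)]] by auto
  then show ?thesis using assms(2,3) by blast
qed

lemma not_nbr: "s \<in> S \<Longrightarrow> s' \<in> S \<Longrightarrow> s' \<noteq> \<phi> s \<and> s' \<noteq> p s \<and> s' \<noteq> q s"
  using independent chosen_edges by metis

lemma sphere_has_no_opp: "f \<in> T \<Longrightarrow> s \<in> S \<Longrightarrow> \<not> {p s, q s} \<subseteq> f"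
  using opp_nonedge chosen_distinct(6) edges_ofI by metis

lemma chosen_face_in: "s \<in> S \<Longrightarrow> X \<subseteq> S \<Longrightarrow> s \<notin> X \<Longrightarrow> {s, \<phi> s, p s} \<in> flipped X \<and> {s, \<phi> s, q s} \<in> flipped X"
proof -
  assume s: "s \<in> S" "X \<subseteq> S" "s \<notin> X"
  have "\<not> {t, \<phi> t} \<subseteq> {s, \<phi> s, r}" if "t \<in> X" "r = p s \<or> r = q s" for t r
  proof -
    have "t \<in> S" "t \<noteq> s" using that s by auto
    then show ?thesis using not_nbr[OF s(1), of t] that(2) by auto
  qed
  then show ?thesis using faces_chosen[OF s(1)] unfolding flipped_def by blast
qed

lemma old_edge_cases:
  assumes X: "X \<subseteq> S" and e: "e \<in> edges_of (flipped X)"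
  shows "(e \<in> edges_of T \<and> (\<forall>s\<in>X. e \<noteq> {s, \<phi> s})) \<or> (\<exists>s\<in>X. e = {p s, q s})"
proof -
  obtain f where f: "f \<in> flipped X" "e \<subseteq> f" "card e = 2" using e by (auto simp: edges_of_def)
  then consider "f \<in> T" "\<forall>s\<in>X. \<not> {s, \<phi> s} \<subseteq> f" | s r where "s \<in> X" "f = {p s, q s, r}" "r = s \<or> r = \<phi> s"
    unfolding flipped_def by blast
  then show ?thesis
  proof cases
    case 1
    then show ?thesis using f by (auto simp: edges_of_def)
  next
    case (2 s r)
    have s: "s \<in> S" using 2 X by auto
    have "e = {p s, q s} \<or> e = {p s, r} \<or> e = {q s, r}" using f 2 doubletons_in_triple by metis
    moreover have "{p s, r} \<in> edges_of T" "{q s, r} \<in> edges_of T"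
      using chosen_edges[OF s] 2(3) by (auto simp: insert_commute)
    moreover have "{x, r} \<noteq> {t, \<phi> t}" if t: "t \<in> X" "x = p s \<or> x = q s" for t x
    proof
      assume "{x, r} = {t, \<phi> t}"
      then have *: "t \<in> {x, r}" "\<phi> t \<in> {x, r}" by auto
      have "t \<in> S" using t X by auto
      then have "t = s" using * t(2) 2(3) not_nbr[OF s, of t] by auto
      then show False using * t(2) 2(3) chosen_distinct[OF s] by auto
    qed
    ultimately show ?thesis using 2(1) by blast
  qed
qed

lemma opp_faces:
  assumes X: "X \<subseteq> S" and s: "s \<in> X" and f: "f \<in> flipped X" "{p s, q s} \<subseteq> f"
  shows "f = {p s, q s, s} \<or> f = {p s, q s, \<phi> s}"
proof -
  have sS: "s \<in> S" using X s by auto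
  have "f \<notin> T" using sphere_has_no_opp[of f s] f sS by blast
  then obtain t r where t: "t \<in> X" "f = {p t, q t, r}" "r = t \<or> r = \<phi> t" using f unfolding flipped_def by blast
  have tS: "t \<in> S" using X t by auto
  have c2: "card {p s, q s} = 2" using chosen_distinct[OF sS] by simp
  have "{p s, q s} \<subseteq> {p t, q t, r}" using f(2) t(2) by simp
  from doubletons_in_triple[OF c2 this]
  have "{p s, q s} = {p t, q t} \<or> {p s, q s} = {p t, r} \<or> {p s, q s} = {q t, r}" .
  moreover have "{p t, r} \<in> edges_of T" "{q t, r} \<in> edges_of T" using chosen_edges[OF tS] t(3) by (auto simp: insert_commute)
  ultimately have "s = t" using opp_nonedge[OF sS] opp_inj[OF sS tS] by auto
  then show ?thesis using t by auto
qed

lemma opp_notin_flipped: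
  assumes X: "X \<subseteq> S" and s: "s \<in> S" "s \<notin> X"
  shows "{p s, q s} \<notin> edges_of (flipped X)"
proof
  assume "{p s, q s} \<in> edges_of (flipped X)"
  then obtain t where "t \<in> X" "{p s, q s} = {p t, q t}" using old_edge_cases[OF X] opp_nonedge[OF s(1)] by blast
  then show False using opp_inj[OF s(1), of t] s X by auto
qed

lemma chosen_notin_flipped:
  assumes X: "X \<subseteq> S" and s: "s \<in> X"
  shows "{s, \<phi> s} \<notin> edges_of (flipped X)"
proof
  assume "{s, \<phi> s} \<in> edges_of (flipped X)"
  then obtain t where t: "t \<in> X" "{s, \<phi> s} = {p t, q t}" using old_edge_cases[OF X] s by blast
  have "s \<in> S" "t \<in> S" using t s X by auto
  then show False using t opp_nonedge[of t] chosen_edges(1)[of s] by auto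
qed

lemma flip_insert:
  assumes X: "X \<subseteq> S" and s: "s \<in> S" "s \<notin> X"
  shows "flip (flipped X) s (\<phi> s) (p s) (q s) = flipped (insert s X)"
proof -
  define K where "K = {{s, \<phi> s, p s}, {s, \<phi> s, q s}}"
  define N where "N = (\<Union>t\<in>X. {{p t, q t, t}, {p t, q t, \<phi> t}})"
  define A where "A = {f \<in> T. \<forall>t\<in>X. \<not> {t, \<phi> t} \<subseteq> f}"
  have sub: "{f \<in> T. {s, \<phi> s} \<subseteq> f} = K" unfolding K_def using faces_at_chosen[OF s(1)] faces_chosen[OF s(1)] by auto
  have NT: "N \<inter> T = {}"
  proof -
    have "{p t, q t, r} \<notin> T" if "t \<in> X" for t r using sphere_has_no_opp[of "{p t, q t, r}" t] that X by auto
    then show ?thesis by (auto simp: N_def)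
  qed
  have "flipped X = A \<union> N" by (simp add: flipped_def A_def N_def)
  then have "flipped X - K = (A - K) \<union> N" using NT sub by blast
  also have "A - K = {f \<in> T. \<forall>t\<in>insert s X. \<not> {t, \<phi> t} \<subseteq> f}"
    unfolding sub[symmetric] A_def by blast
  finally have "flipped X - K \<union> {{p s, q s, s}, {p s, q s, \<phi> s}} = flipped (insert s X)"
    unfolding flipped_def[of "insert s X"] N_def by auto
  then show ?thesis unfolding flip_def K_def .
qed

lemma flip_remove:
  assumes X: "X \<subseteq> S" and s: "s \<in> X"
  shows "flip (flipped X) (p s) (q s) s (\<phi> s) = flipped (X - {s})"
proof -
  have sS: "s \<in> S" using X s by auto
  have X': "X - {s} \<subseteq> S" "s \<notin> X - {s}" using X by auto
  let ?T = "flipped (X - {s})"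
  have ins: "flipped X = flip ?T s (\<phi> s) (p s) (q s)" using flip_insert[OF X'(1) sS X'(2)] s by (simp add: insert_absorb)
  have c: "{s, \<phi> s, p s} \<in> ?T" "{s, \<phi> s, q s} \<in> ?T" using chosen_face_in[OF sS X'] by auto
  have no: "{p s, q s, r} \<notin> ?T" for r
  proof
    assume "{p s, q s, r} \<in> ?T"
    then have "{p s, q s} \<in> edges_of ?T" using chosen_distinct(6)[OF sS] by (auto intro: edges_ofI)
    then show False using opp_notin_flipped[OF X'(1) sS X'(2)] by simp
  qed
  have n: "{p s, q s, s} \<notin> ?T" "{p s, q s, \<phi> s} \<notin> ?T" by (rule no)+
  have "{s, \<phi> s, p s} \<noteq> {p s, q s, r} \<and> {s, \<phi> s, q s} \<noteq> {p s, q s, r}" for r using no[of r] c by auto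
  then show ?thesis using c n unfolding ins flip_def by blast
qed

lemma tri_sphere_flipped:
  assumes "finite X" "X \<subseteq> S" shows "tri_sphere (flipped X)"
  using assms
proof (induction X rule: finite_induct)
  case empty
  have "flipped {} = T" by (simp add: flipped_def)
  then show ?case using tri_sphere_axioms by simp
next
  case (insert s X)
  then have s: "X \<subseteq> S" "s \<in> S" "s \<notin> X" by auto
  interpret F: tri_sphere "flipped X" using insert by auto
  show ?case unfolding flip_insert[OF s, symmetric]
    by (rule F.tri_sphere_flip) (use chosen_face_in[OF s(2,1,3)] opp_notin_flipped[OF s] chosen_distinct(6)[OF s(2)] in auto)
qed

lemma triangle_with_new_edge:
  assumes X: "X \<subseteq> S" and s: "s \<in> X" and ab: "{a, b} = {p s, q s}"
    and e: "{b, c} \<in> edges_of (flipped X)" "{a, c} \<in> edges_of (flipped X)"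
  shows "{a, b, c} \<in> flipped X"
proof -
  have sS: "s \<in> S" using X s by auto
  have ne: "b \<noteq> c" "a \<noteq> c" using e by (auto simp: edges_of_def)
  have same: "t \<noteq> s" if "{x, c} = {p t, q t}" "x = a \<or> x = b" for t x
  proof
    assume "t = s"
    then have "{x, c} = {a, b}" using that ab by simp
    then have "c \<in> {a, b}" by blast
    then show False using ne by auto
  qed
  consider (old) "{b, c} \<in> edges_of T" "{a, c} \<in> edges_of T"
    | (b) t where "t \<in> X" "{b, c} = {p t, q t}" "{a, c} \<in> edges_of T"
    | (a) t where "t \<in> X" "{a, c} = {p t, q t}" "{b, c} \<in> edges_of T"
    | (ab) t r where "t \<in> X" "{b, c} = {p t, q t}" "r \<in> X" "{a, c} = {p r, q r}"
    using old_edge_cases[OF X e(1)] old_edge_cases[OF X e(2)] by blast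
  then show ?thesis
  proof cases
    case old
    have "(a = p s \<and> b = q s) \<or> (a = q s \<and> b = p s)" using ab by (auto simp: doubleton_eq_iff)
    then have "{c, p s} \<in> edges_of T \<and> {c, q s} \<in> edges_of T" using old by (auto simp: insert_commute)
    then have "c = s \<or> c = \<phi> s" using one_new[OF sS] by blast
    moreover have "{a, b, c} = {p s, q s, c}" using ab by auto
    ultimately have "{a, b, c} = {p s, q s, s} \<or> {a, b, c} = {p s, q s, \<phi> s}" by metis
    then show ?thesis using s unfolding flipped_def by blast
  next
    case (b t)
    then show ?thesis using two_new[OF sS, of t a b c] same[of b t] ab X by auto
  next
    case (a t)
    have "{b, a} = {p s, q s}" using ab by auto
    then show ?thesis using two_new[OF sS, of t b a c] same[of a t] a X by auto
  next
    case (ab t r)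
    then show ?thesis using three_new[OF sS, of t r a b c] same[of b t] assms(3) X by auto
  qed
qed

lemma triangles_flipped:
  assumes X: "X \<subseteq> S" and e: "{a, b} \<in> edges_of (flipped X)" "{b, c} \<in> edges_of (flipped X)" "{a, c} \<in> edges_of (flipped X)"
  shows "{a, b, c} \<in> flipped X"
proof -
  have c: "{b, a} = {a, b}" "{c, b} = {b, c}" "{c, a} = {a, c}" by auto
  consider (ab) s where "s \<in> X" "{a, b} = {p s, q s}" | (bc) s where "s \<in> X" "{b, c} = {p s, q s}"
    | (ac) s where "s \<in> X" "{a, c} = {p s, q s}"
    | (old) "\<forall>s\<in>X. {a, b} \<noteq> {p s, q s}" "\<forall>s\<in>X. {b, c} \<noteq> {p s, q s}" "\<forall>s\<in>X. {a, c} \<noteq> {p s, q s}" by blast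
  then show ?thesis
  proof cases
    case ab
    then show ?thesis using triangle_with_new_edge[OF X _ _ e(2,3)] by blast
  next
    case bc
    then have "{b, c, a} \<in> flipped X" using triangle_with_new_edge[OF X, of _ b c a] e c by simp
    then show ?thesis by (simp add: insert_commute)
  next
    case ac
    then have "{a, c, b} \<in> flipped X" using triangle_with_new_edge[OF X, of _ a c b] e c by simp
    then show ?thesis by (simp add: insert_commute)
  next
    case none: old
    have o1: "{a, b} \<in> edges_of T \<and> (\<forall>s\<in>X. {a, b} \<noteq> {s, \<phi> s})" using old_edge_cases[OF X e(1)] none(1) by blast
    have o2: "{b, c} \<in> edges_of T \<and> (\<forall>s\<in>X. {b, c} \<noteq> {s, \<phi> s})" using old_edge_cases[OF X e(2)] none(2) by blast
    have o3: "{a, c} \<in> edges_of T \<and> (\<forall>s\<in>X. {a, c} \<noteq> {s, \<phi> s})" using old_edge_cases[OF X e(3)] none(3) by blast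
    have f: "{a, b, c} \<in> T" using triangles o1 o2 o3 by blast
    have "\<not> {s, \<phi> s} \<subseteq> {a, b, c}" if s: "s \<in> X" for s
    proof
      assume sub: "{s, \<phi> s} \<subseteq> {a, b, c}"
      have "card {s, \<phi> s} = 2" using chosen_distinct(1)[of s] s X by auto
      from doubletons_in_triple[OF this sub] show False using o1 o2 o3 s by metis
    qed
    then show ?thesis using f unfolding flipped_def by blast
  qed
qed

text \<open>The order within the pairs \<open>a\<close>, \<open>b\<close> and \<open>u\<close>,
  \<open>v\<close> of a quadrilateral is open, so only unordered pairs can be identified;
  \<open>flip_cong\<close> says that a flip depends on nothing more.\<close>

lemma diags_cases:
  assumes X: "X \<subseteq> S" and q: "quad (flipped X) (diags X) a b u v"
  obtains s where "s \<in> S" "s \<notin> X" "{a, b} = {s, \<phi> s}" "{u, v} = {p s, q s}" 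
    | s where "s \<in> X" "{a, b} = {p s, q s}" "{u, v} = {s, \<phi> s}"
proof -
  have q': "{a, b} \<in> diags X" "{a, b, u} \<in> flipped X" "{a, b, v} \<in> flipped X" "u \<noteq> v" using q by (auto simp: quad_def)
  have opp: "{u, v} = {x, y}" if "insert u {a, b} = insert x {a, b} \<or> insert u {a, b} = insert y {a, b}"
    "insert v {a, b} = insert x {a, b} \<or> insert v {a, b} = insert y {a, b}" "u \<notin> {a, b}" "v \<notin> {a, b}" for x y
  proof -
    have "u = x \<or> u = y" "v = x \<or> v = y" using that by (metis insertI1 insertE)+
    then show ?thesis using q'(4) by auto
  qed
  have absorb: "x \<notin> {a, b}" if "insert x {a, b} = insert y {a, b}" "y \<notin> {a, b}" for x y
    using that by (metis insert_absorb insertI1)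
  have reord: "{a, b, x} = insert x {a, b}" for x by auto
  from q'(1) consider s where "s \<in> S" "s \<notin> X" "{a, b} = {s, \<phi> s}" | s where "s \<in> X" "{a, b} = {p s, q s}"
    unfolding diags_def by blast
  then show thesis
  proof cases
    case (1 s)
    have fT: "f \<in> T" if f: "f \<in> flipped X" "{s, \<phi> s} \<subseteq> f" for f
    proof (rule ccontr)
      assume "f \<notin> T"
      then obtain t r where t: "t \<in> X" "f = {p t, q t, r}" "r = t \<or> r = \<phi> t" using f(1) unfolding flipped_def by blast
      then have "s \<in> {p t, q t, r}" using f(2) by auto
      then show False using not_nbr[of t s] t 1 X by auto
    qed
    have k: "insert x {a, b} = insert (p s) {a, b} \<or> insert x {a, b} = insert (q s) {a, b}" if "{a, b, x} \<in> flipped X" for x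
    proof -
      have "{a, b, x} \<in> T" by (rule fT[OF that]) (use 1(3) in auto)
      then have "{a, b, x} = {s, \<phi> s, p s} \<or> {a, b, x} = {s, \<phi> s, q s}" by (rule faces_at_chosen[OF 1(1)]) (use 1(3) in auto)
      moreover have "{s, \<phi> s, r} = insert r {a, b}" for r using 1(3) by auto
      ultimately show ?thesis by (simp add: reord)
    qed
    have "u \<notin> {a, b}" "v \<notin> {a, b}"
    proof -
      have "p s \<notin> {a, b}" "q s \<notin> {a, b}" using 1(3) chosen_distinct[OF 1(1)] by auto
      then show "u \<notin> {a, b}" "v \<notin> {a, b}" using k[OF q'(2)] k[OF q'(3)] absorb by metis+
    qed
    then have "{u, v} = {p s, q s}" using opp[of "p s" "q s"] k[OF q'(2)] k[OF q'(3)] by blast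
    then show ?thesis using that(1) 1 by blast
  next
    case (2 s)
    have sS: "s \<in> S" using 2 X by auto
    have k: "insert x {a, b} = insert s {a, b} \<or> insert x {a, b} = insert (\<phi> s) {a, b}" if "{a, b, x} \<in> flipped X" for x
    proof -
      have "{a, b, x} = {p s, q s, s} \<or> {a, b, x} = {p s, q s, \<phi> s}" by (rule opp_faces[OF X 2(1) that]) (use 2(2) in auto)
      moreover have "{p s, q s, r} = insert r {a, b}" for r using 2(2) by auto
      ultimately show ?thesis by (simp add: reord)
    qed
    have "u \<notin> {a, b}" "v \<notin> {a, b}"
    proof -
      have "s \<notin> {a, b}" "\<phi> s \<notin> {a, b}" using 2(2) chosen_distinct[OF sS] by auto
      then show "u \<notin> {a, b}" "v \<notin> {a, b}" using k[OF q'(2)] k[OF q'(3)] absorb by metis+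
    qed
    then have "{u, v} = {s, \<phi> s}" using opp[of s "\<phi> s"] k[OF q'(2)] k[OF q'(3)] by blast
    then show ?thesis using that(2) 2 by blast
  qed
qed

lemma flip_cong:
  assumes "{a, b} = {a', b'}" "{u, v} = {u', v'}" shows "flip R a b u v = flip R a' b' u' v'"
proof -
  have "{{a, b, u}, {a, b, v}} = (\<lambda>x. insert x {a, b}) ` {u, v}" "{{u, v, a}, {u, v, b}} = (\<lambda>x. insert x {u, v}) ` {a, b}" for a b u v :: 'b
    by auto
  then show ?thesis unfolding flip_def using assms by metis
qed

lemma flip_family_flipped:
  assumes finS: "finite S"
  shows "flip_family {(flipped X, diags X) | X. X \<subseteq> S} (edges_of T - (\<lambda>s. {s, \<phi> s}) ` S)"
proof (rule flip_family.intro)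
  fix T' D assume "(T', D) \<in> {(flipped X, diags X) | X. X \<subseteq> S}"
  then obtain X where X: "T' = flipped X" "D = diags X" "X \<subseteq> S" by blast
  have finX: "finite X" using X(3) finS finite_subset by blast
  show "tri_sphere T'" unfolding X(1) by (rule tri_sphere_flipped[OF finX X(3)])
  show "{a, b, c} \<in> T'" if "{a, b} \<in> edges_of T'" "{b, c} \<in> edges_of T'" "{a, c} \<in> edges_of T'" for a b c
    using triangles_flipped[OF X(3)] that unfolding X(1) by blast
  show "D \<subseteq> edges_of T'"
  proof
    fix d assume "d \<in> D"
    then consider s where "s \<in> S" "s \<notin> X" "d = {s, \<phi> s}" | s where "s \<in> X" "d = {p s, q s}" unfolding X(2) diags_def by blast
    then show "d \<in> edges_of T'"
    proof cases
      case (1 s)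
      then show ?thesis using chosen_face_in[OF 1(1) X(3) 1(2)] chosen_distinct(1)[OF 1(1)] unfolding X(1)
        by (auto intro: edges_ofI)
    next
      case (2 s)
      then have "{p s, q s, s} \<in> flipped X" unfolding flipped_def by blast
      then show ?thesis using 2 chosen_distinct(6)[of s] X(3) unfolding X(1) by (auto intro: edges_ofI)
    qed
  qed
  show "edges_of T' - D \<subseteq> edges_of T - (\<lambda>s. {s, \<phi> s}) ` S"
    using old_edge_cases[OF X(3)] unfolding X(1,2) diags_def by blast
  show "d = d'" if d: "d \<in> D" "d' \<in> D" "f \<in> T'" "d \<subseteq> f" "d' \<subseteq> f" for d d' f
  proof -
    \<comment> \<open>Two chosen edges in a common old face would make two chosen vertices
      adjacent.\<close>
    have inT: "e = {s, \<phi> s}" if e: "e \<in> D" "f \<in> T" "e \<subseteq> f" "s \<in> S" "{s, \<phi> s} \<subseteq> f" for e s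
    proof -
      consider t where "t \<in> S" "e = {t, \<phi> t}" | t where "t \<in> S" "e = {p t, q t}"
        using e(1) X(3) unfolding X(2) diags_def by blast
      then show ?thesis
      proof cases
        case (1 t)
        have "s = t"
        proof (rule ccontr)
          assume "s \<noteq> t"
          then have "{s, t} \<in> edges_of T" using e 1 by (auto intro: edges_ofI)
          then show False using independent e(4) 1(1) by blast
        qed
        then show ?thesis using 1 by simp
      next
        case (2 t)
        then show ?thesis using sphere_has_no_opp[OF e(2)] e(3) by blast
      qed
    qed
    have inN: "e = {p t, q t}" if e: "e \<in> D" "t \<in> X" "f = {p t, q t, r}" "r = t \<or> r = \<phi> t" "e \<subseteq> f" for e t r
    proof -
      have tS: "t \<in> S" using e X by auto
      consider s where "s \<in> S" "s \<notin> X" "e = {s, \<phi> s}" | s where "s \<in> S" "e = {p s, q s}"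
        using e(1) X(3) unfolding X(2) diags_def by blast
      then show ?thesis
      proof cases
        case (1 s)
        then have "s \<in> {p t, q t, r}" "s \<noteq> t" using e by auto
        then show ?thesis using not_nbr[OF tS 1(1)] e(4) by auto
      next
        case (2 s)
        have "card e = 2" using 2 chosen_distinct(6) by simp
        then have "e = {p t, q t} \<or> e = {p t, r} \<or> e = {q t, r}" using doubletons_in_triple[OF _ e(5)[unfolded e(3)]] by blast
        moreover have "{p t, r} \<in> edges_of T" "{q t, r} \<in> edges_of T" using chosen_edges[OF tS] e(4) by (auto simp: insert_commute)
        moreover have "e \<notin> edges_of T" using opp_nonedge[OF 2(1)] 2(2) by simp
        ultimately show ?thesis by metis
      qed
    qed
    show ?thesis
    proof (cases "f \<in> T")
      case False
      then obtain t r where "t \<in> X" "f = {p t, q t, r}" "r = t \<or> r = \<phi> t" using d(3) unfolding X(1) flipped_def by blast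
      then show ?thesis using inN[OF d(1)] inN[OF d(2)] d(4,5) by metis
    next
      case True
      consider s where "s \<in> S" "d = {s, \<phi> s}" | s where "s \<in> S" "d = {p s, q s}"
        using d(1) X(3) unfolding X(2) diags_def by blast
      then show ?thesis
      proof cases
        case (1 s)
        then show ?thesis using inT[OF d(2) True d(5) 1(1)] d(4) by simp
      next
        case (2 s)
        then show ?thesis using sphere_has_no_opp[OF True] d(4) by blast
      qed
    qed
  qed
  fix a b u v assume q: "quad T' D a b u v"
  show "{u, v} \<notin> edges_of T'"
    by (rule diags_cases[OF X(3) q[unfolded X(1,2)]])
       (use opp_notin_flipped[OF X(3)] chosen_notin_flipped[OF X(3)] in \<open>auto simp: X(1)\<close>)
  show "(flip T' a b u v, insert {u, v} (D - {{a, b}})) \<in> {(flipped X, diags X) | X. X \<subseteq> S}"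
  proof (rule diags_cases[OF X(3) q[unfolded X(1,2)]])
    fix s assume s: "s \<in> S" "s \<notin> X" "{a, b} = {s, \<phi> s}" "{u, v} = {p s, q s}"
    have "flip T' a b u v = flipped (insert s X)" unfolding X(1) flip_cong[OF s(3,4)] by (rule flip_insert[OF X(3) s(1,2)])
    moreover have "insert {u, v} (D - {{a, b}}) = diags (insert s X)"
    proof -
      have "{t, \<phi> t} \<noteq> {s, \<phi> s}" if "t \<in> S" "t \<noteq> s" for t using not_nbr[OF s(1) that(1)] that by (auto simp: doubleton_eq_iff)
      moreover have "{p t, q t} \<noteq> {s, \<phi> s}" if "t \<in> X" for t using opp_nonedge[of t] chosen_edges(1)[OF s(1)] that X(3) by auto
      ultimately have "D - {{a, b}} = (\<lambda>t. {t, \<phi> t}) ` (S - insert s X) \<union> (\<lambda>t. {p t, q t}) ` X"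
        unfolding X(2) diags_def s(3) by auto
      then show ?thesis unfolding diags_def s(4) by auto
    qed
    ultimately show ?thesis using s(1) X(3) by blast
  next
    fix s assume s: "s \<in> X" "{a, b} = {p s, q s}" "{u, v} = {s, \<phi> s}"
    have sS: "s \<in> S" using s X by auto
    have "flip T' a b u v = flipped (X - {s})" unfolding X(1) flip_cong[OF s(2,3)] by (rule flip_remove[OF X(3) s(1)])
    moreover have "insert {u, v} (D - {{a, b}}) = diags (X - {s})"
    proof -
      have "{p t, q t} \<noteq> {p s, q s}" if "t \<in> X - {s}" for t using opp_inj[of t s] that X(3) sS by auto
      moreover have "{t, \<phi> t} \<noteq> {p s, q s}" if "t \<in> S" for t using opp_nonedge[OF sS] chosen_edges(1)[OF that] by auto
      ultimately have "D - {{a, b}} = (\<lambda>t. {t, \<phi> t}) ` (S - X) \<union> (\<lambda>t. {p t, q t}) ` (X - {s})"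
        unfolding X(2) diags_def s(2) by auto
      moreover have "S - (X - {s}) = insert s (S - X)" using sS s(1) by auto
      ultimately show ?thesis unfolding diags_def s(3) by auto
    qed
    ultimately show ?thesis using X(3) by blast
  qed
qed

theorem avoiding_hamilton_cycle:
  assumes "finite S" "4 < card T"
  obtains c where "distinct c" "3 \<le> length c" "set c = \<Union>T" "cycle_edges c \<subseteq> edges_of T" "\<And>s. s \<in> S \<Longrightarrow> {s, \<phi> s} \<notin> cycle_edges c"
proof -
  interpret F: flip_family "{(flipped X, diags X) | X. X \<subseteq> S}" "edges_of T - (\<lambda>s. {s, \<phi> s}) ` S"
    by (rule flip_family_flipped[OF assms(1)])
  have "flipped {} = T" by (simp add: flipped_def)
  then have st: "(T, diags {}) \<in> {(flipped X, diags X) | X. X \<subseteq> S}" by blast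
  have "T \<noteq> {}" using assms(2) by auto
  obtain c where c: "distinct c" "3 \<le> length c" "set c = \<Union>T" "cycle_edges c \<subseteq> edges_of T - (\<lambda>s. {s, \<phi> s}) ` S"
    by (rule F.hamilton_cycle[OF st \<open>T \<noteq> {}\<close> assms(2)])
  have "cycle_edges c \<subseteq> edges_of T" "\<And>s. s \<in> S \<Longrightarrow> {s, \<phi> s} \<notin> cycle_edges c" using c(4) by blast+
  then show thesis by (rule that[OF c(1-3)])
qed

end

section \<open>Four-connected triangulations\<close>

context tri_sphere
begin

definition nb :: "'a \<Rightarrow> 'a set" where
  "nb v = {w. {v, w} \<in> edges_of T}"

text \<open>Deleting \<open>A\<close> leaves a connected graph or no vertex at all.\<close>

definition conn_off :: "'a set \<Rightarrow> bool" where
  "conn_off A \<longleftrightarrow> (\<forall>U \<subseteq> \<Union>T - A. U \<noteq> {} \<longrightarrow> (\<forall>x\<in>U. nb x \<subseteq> U \<union> A) \<longrightarrow> U = \<Union>T - A)"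

definition sep4 :: "'a set set set" where
  "sep4 = {cycle_edges [a, b, c, d] | a b c d. distinct [a, b, c, d] \<and> cycle_edges [a, b, c, d] \<subseteq> edges_of T \<and> \<not> conn_off {a, b, c, d}}"

lemma nb_sym: "w \<in> nb v \<longleftrightarrow> v \<in> nb w"
  by (simp add: nb_def insert_commute)

lemma nb_edge: "{v, w} \<in> edges_of T \<longleftrightarrow> w \<in> nb v"
  by (simp add: nb_def)

lemma not_in_nb: "v \<notin> nb v"
  by (auto simp: nb_def edges_of_def)

lemma nb_subset: "nb v \<subseteq> \<Union>T"
  using edge_subset_Union by (fastforce simp: nb_def)

lemma finite_nb [simp, intro]: "finite (nb v)"
  by (rule finite_subset[OF nb_subset]) (rule finite_Union[OF subset_refl])

lemma nb_face: "{a, b, c} \<in> T \<Longrightarrow> b \<in> nb a \<and> c \<in> nb a \<and> c \<in> nb b"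
  using edges_face by (auto simp: nb_def)

lemma edge_two_thirds:
  assumes "w \<in> nb v"
  obtains x z where "{v, w, x} \<in> T" "{v, w, z} \<in> T" "x \<noteq> z"
proof -
  have e: "{v, w} \<in> edges_of T" "v \<noteq> w" using assms not_in_nb by (auto simp: nb_def)
  obtain f g where fg: "f \<in> T" "g \<in> T" "f \<noteq> g" "{h \<in> T. {v, w} \<subseteq> h} = {f, g}" using edge_faces[OF e(1)] .
  then have s: "{v, w} \<subseteq> f" "{v, w} \<subseteq> g" by blast+
  obtain x where x: "f = {v, w, x}" using face_third[OF fg(1) s(1) e(2)] .
  obtain z where z: "g = {v, w, z}" using face_third[OF fg(2) s(2) e(2)] .
  show thesis using that[of x z] fg x z by auto
qed

lemma third_vertex:
  assumes "{v, w, x} \<in> T" "{v, w, z} \<in> T" "x \<noteq> z" "{v, w, y} \<in> T"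
  shows "y = x \<or> y = z"
proof (rule ccontr)
  assume n: "\<not> (y = x \<or> y = z)"
  have d: "v \<noteq> w" "x \<notin> {v, w, y}" "x \<notin> {v, w, z}" "y \<notin> {v, w, z}"
    using n assms face_distinct by auto
  have ne: "{v, w, x} \<noteq> {v, w, y}" "{v, w, x} \<noteq> {v, w, z}" "{v, w, z} \<noteq> {v, w, y}" using d by blast+
  have e: "{v, w} \<in> edges_of T" using edges_face assms by blast
  show False
    using third_face_eq[OF e assms(1) assms(2) assms(4)] ne by auto
qed

text \<open>No edge leads from an interior vertex of \<open>X\<close> to a vertex outside
  \<open>X\<close>, so vertices off the boundary on both sides would be separated by it.\<close>

lemma conn_off_bd:
  assumes X: "X \<subseteq> T" and c: "conn_off (\<Union>(bd X))"
  shows "\<Union>X \<subseteq> \<Union>(bd X) \<or> \<Union>(T - X) \<subseteq> \<Union>(bd X)"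
proof (rule ccontr)
  assume "\<not> ?thesis"
  then obtain u v where u: "u \<in> \<Union>X - \<Union>(bd X)" and v: "v \<in> \<Union>(T - X)" "v \<notin> \<Union>(bd X)" by blast
  define U where "U = \<Union>X - \<Union>(bd X)"
  have "U \<subseteq> \<Union>T - \<Union>(bd X)" "U \<noteq> {}" using X u by (auto simp: U_def)
  moreover have "nb x \<subseteq> U \<union> \<Union>(bd X)" if x: "x \<in> U" for x
  proof
    fix y assume "y \<in> nb x"
    then obtain f where f: "f \<in> T" "x \<in> f" "y \<in> f" by (auto simp: nb_def edges_of_def)
    obtain g where "g \<in> X" "x \<in> g" using x by (auto simp: U_def)
    then have "f \<in> X" using faces_at_interior_vertex[OF X _ _ _ f(1,2)] x by (auto simp: U_def)
    then show "y \<in> U \<union> \<Union>(bd X)" using f by (auto simp: U_def)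
  qed
  ultimately have "U = \<Union>T - \<Union>(bd X)" using c[unfolded conn_off_def, rule_format, of U] by blast
  then have "v \<in> \<Union>X" using v by (auto simp: U_def)
  then obtain g where g: "g \<in> X" "v \<in> g" by blast
  obtain f where f: "f \<in> T" "f \<notin> X" "v \<in> f" using v by blast
  show False using faces_at_interior_vertex[OF X v(2) g f(1,3)] f(2) by simp
qed

text \<open>If deleting the cycle does not disconnect, one of its two sides has no further vertices,
  and each face there is spanned by vertices of the cycle.\<close>

lemma cycle_side:
  assumes d: "distinct c" "3 \<le> length c" and ce: "cycle_edges c \<subseteq> edges_of T" and co: "conn_off (set c)"
  obtains f where "f \<in> T" "f \<subseteq> set c"
proof -
  obtain X where X: "X \<subseteq> T" "bd X = cycle_edges c" using even_set_bounds[OF ce even_set_cycle[OF d]] by blast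
  have s: "\<Union>(bd X) = set c" using X Union_cycle_edges by simp
  have "c \<noteq> []" using d by auto
  then have ne: "bd X \<noteq> {}" using s by auto
  then have "X \<noteq> {}" "X \<noteq> T" by auto
  then obtain f g where fg: "f \<in> X" "g \<in> T - X" using X(1) by blast
  have "\<Union>X \<subseteq> set c \<or> \<Union>(T - X) \<subseteq> set c" using conn_off_bd[OF X(1)] co unfolding s by blast
  then have "f \<subseteq> set c \<or> g \<subseteq> set c" using fg by blast
  then show thesis using that fg X(1) by blast
qed

text \<open>The three faces close up around \<open>s\<close>, so by connectedness of the link they
  are all faces at \<open>s\<close>.\<close>

lemma three_faces_star:
  assumes "{s, a, b} \<in> T" "{s, b, c} \<in> T" "{s, a, c} \<in> T"
  shows "nb s \<subseteq> {a, b, c}"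
proof -
  define A where "A = {{s, a, b}, {s, b, c}, {s, a, c}}"
  have d: "s \<noteq> a" "s \<noteq> b" "s \<noteq> c" "a \<noteq> b" "b \<noteq> c" "a \<noteq> c" using face_distinct assms by auto
  have "A = {f \<in> T. s \<in> f}"
  proof (rule link_connected)
    show "A \<subseteq> {f \<in> T. s \<in> f}" "A \<noteq> {}" using assms by (auto simp: A_def)
    fix f g w assume f: "f \<in> A" and g: "g \<in> T" "{s, w} \<subseteq> g" "{s, w} \<subseteq> f" "w \<noteq> s"
    have w: "w = a \<or> w = b \<or> w = c" using f g by (auto simp: A_def)
    obtain y where y: "g = {s, w, y}" using face_third[OF g(1,2)] g(4) by metis
    have p: "{s, b, a} \<in> T" "{s, c, b} \<in> T" "{s, c, a} \<in> T" using assms by (simp_all add: insert_commute)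
    have "(w = a \<and> (y = b \<or> y = c)) \<or> (w = b \<and> (y = a \<or> y = c)) \<or> (w = c \<and> (y = a \<or> y = b))"
      using w third_vertex[OF assms(1,3), of y] third_vertex[OF p(1) assms(2), of y] third_vertex[OF p(3,2), of y] d g(1) y by auto
    then show "g \<in> A" using y by (auto simp: A_def insert_commute)
  qed
  moreover have "\<exists>f. f \<in> {f \<in> T. s \<in> f} \<and> y \<in> f" if "y \<in> nb s" for y using that by (auto simp: nb_def edges_of_def)
  ultimately have "y \<in> \<Union>A" if "y \<in> nb s" for y using that by auto
  then show ?thesis using not_in_nb[of s] by (auto simp: A_def)
qed

lemma four_faces_star:
  assumes "{s, a, b} \<in> T" "{s, b, c} \<in> T" "{s, c, d} \<in> T" "{s, a, d} \<in> T" "a \<noteq> c" "b \<noteq> d"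
  shows "nb s \<subseteq> {a, b, c, d}"
proof -
  define A where "A = {{s, a, b}, {s, b, c}, {s, c, d}, {s, a, d}}"
  have "A = {f \<in> T. s \<in> f}"
  proof (rule link_connected)
    show "A \<subseteq> {f \<in> T. s \<in> f}" "A \<noteq> {}" using assms by (auto simp: A_def)
    fix f g w assume f: "f \<in> A" and g: "g \<in> T" "{s, w} \<subseteq> g" "{s, w} \<subseteq> f" "w \<noteq> s"
    have w: "w = a \<or> w = b \<or> w = c \<or> w = d" using f g by (auto simp: A_def)
    obtain y where y: "g = {s, w, y}" using face_third[OF g(1,2)] g(4) by metis
    have p: "{s, b, a} \<in> T" "{s, c, b} \<in> T" "{s, d, a} \<in> T" "{s, d, c} \<in> T" using assms by (simp_all add: insert_commute)
    have "(w = a \<and> (y = b \<or> y = d)) \<or> (w = b \<and> (y = a \<or> y = c)) \<or> (w = c \<and> (y = b \<or> y = d)) \<or> (w = d \<and> (y = a \<or> y = c))"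
      using w third_vertex[OF assms(1,4), of y] third_vertex[OF p(1) assms(2), of y] third_vertex[OF p(2) assms(3), of y]
        third_vertex[OF p(3,4), of y] assms(5,6) g(1) y by auto
    then show "g \<in> A" using y by (auto simp: A_def insert_commute)
  qed
  moreover have "\<exists>f. f \<in> {f \<in> T. s \<in> f} \<and> y \<in> f" if "y \<in> nb s" for y using that by (auto simp: nb_def edges_of_def)
  ultimately have "y \<in> \<Union>A" if "y \<in> nb s" for y using that by auto
  then show ?thesis using not_in_nb[of s] by (auto simp: A_def)
qed

end

locale four_connected_sphere = tri_sphere +
  assumes many_vertices: "4 < card (\<Union>T)"
    and nonseparating: "A \<subseteq> \<Union>T \<Longrightarrow> card A \<le> 3 \<Longrightarrow> conn_off A"
begin

lemma triangle_face:
  assumes "b \<in> nb a" "c \<in> nb b" "c \<in> nb a"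
  shows "{a, b, c} \<in> T"
proof -
  have d: "distinct [a, b, c]" using assms not_in_nb by auto
  have ce: "cycle_edges [a, b, c] \<subseteq> edges_of T" using assms by (auto simp: cycle_edges_def nb_def insert_commute)
  have "a \<in> nb b" using assms(1) nb_sym by blast
  then have "{a, b, c} \<subseteq> \<Union>T" using assms nb_subset[of a] nb_subset[of b] by auto
  then have "conn_off (set [a, b, c])" using nonseparating[of "{a, b, c}"] d by simp
  then obtain f where f: "f \<in> T" "f \<subseteq> {a, b, c}" using cycle_side[OF d _ ce] by auto
  have "card f = card {a, b, c}" using card_face[OF f(1)] d by simp
  then have "f = {a, b, c}" using card_subset_eq[of "{a, b, c}" f] f by auto
  then show ?thesis using f by simp
qed

text \<open>Some face has its three corners on the cycle, and three of four vertices include an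
  opposite pair.\<close>

lemma four_cycle_chord:
  assumes e: "b \<in> nb a" "c \<in> nb b" "d \<in> nb c" "d \<in> nb a" and ne: "a \<noteq> c" "b \<noteq> d" and co: "cycle_edges [a, b, c, d] \<notin> sep4"
  shows "c \<in> nb a \<or> d \<in> nb b"
proof -
  have d: "distinct [a, b, c, d]" using assms not_in_nb by auto
  have ce: "cycle_edges [a, b, c, d] \<subseteq> edges_of T" using e by (auto simp: cycle_edges_def nb_def insert_commute)
  have "conn_off (set [a, b, c, d])" using co ce d unfolding sep4_def by auto
  then obtain f where f: "f \<in> T" "f \<subseteq> {a, b, c, d}" using cycle_side[OF d _ ce] by auto
  have "{a, c} \<subseteq> f \<or> {b, d} \<subseteq> f"
  proof (rule ccontr)
    assume "\<not> ?thesis"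
    then have "f \<subseteq> {a, b} \<or> f \<subseteq> {a, d} \<or> f \<subseteq> {c, b} \<or> f \<subseteq> {c, d}" using f(2) by blast
    then obtain x y where "f \<subseteq> {x, y}" by metis
    then have "card f \<le> card {x, y}" by (rule card_mono[rotated]) simp
    also have "\<dots> \<le> 2" by (simp add: card_insert_if)
    finally show False using card_face[OF f(1)] by simp
  qed
  then show ?thesis using edges_ofI[OF f(1)] ne nb_def by auto
qed

lemma degree_ge_4:
  assumes "v \<in> \<Union>T" shows "4 \<le> card (nb v)"
proof (rule ccontr)
  assume l: "\<not> ?thesis"
  then have "conn_off (nb v)" using nonseparating[OF nb_subset] by simp
  moreover have "{v} \<subseteq> \<Union>T - nb v" using assms not_in_nb by auto
  ultimately have "{v} = \<Union>T - nb v" unfolding conn_off_def by blast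
  then have "\<Union>T \<subseteq> insert v (nb v)" by blast
  then have "card (\<Union>T) \<le> card (insert v (nb v))" by (rule card_mono[rotated]) simp
  also have "\<dots> \<le> Suc (card (nb v))" by (rule card_insert_le_m1) simp_all
  finally show False using many_vertices l by simp
qed

text \<open>If \<open>x\<close> and \<open>z\<close> were adjacent, a third face on
  \<open>s\<close>, \<open>x\<close>, \<open>z\<close> would close up the star of \<open>s\<close>
  at degree 3.\<close>

lemma opposite_nonadjacent:
  assumes "{s, f, x} \<in> T" "{s, f, z} \<in> T" "x \<noteq> z"
  shows "z \<notin> nb x"
proof
  assume z: "z \<in> nb x"
  have n: "x \<in> nb s" "z \<in> nb s" using nb_face assms by auto
  have "{s, x, z} \<in> T" by (rule triangle_face) (use n z in auto)
  then have "nb s \<subseteq> {x, f, z}" using three_faces_star[of s x f z] assms by (simp add: insert_commute)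
  then have "card (nb s) \<le> 3" using card_mono[of "{x, f, z}" "nb s"] card_length[of "[x, f, z]"] by simp
  moreover have "s \<in> \<Union>T" using assms by auto
  ultimately show False using degree_ge_4[of s] by simp
qed

text \<open>Another common neighbour \<open>w\<close> gives a 4-cycle through \<open>s\<close>,
  which is not separating. Its chord can only be \<open>{s, w}\<close>, and then four faces close up
  around \<open>s\<close>, against degree at least 5.\<close>

lemma common_neighbour_of_opposites:
  assumes f: "{s, f, x} \<in> T" "{s, f, z} \<in> T" "x \<noteq> z" and s: "s \<notin> \<Union>(\<Union>sep4)" "5 \<le> card (nb s)"
    and w: "x \<in> nb w" "z \<in> nb w"
  shows "w = s \<or> w = f"
proof (rule ccontr)
  assume "\<not> ?thesis"
  then have ne: "w \<noteq> s" "w \<noteq> f" by auto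
  have n: "x \<in> nb s" "z \<in> nb s" "w \<in> nb x" "w \<in> nb z" using nb_face[OF f(1)] nb_face[OF f(2)] w nb_sym by auto
  have "s \<in> \<Union>(cycle_edges [s, x, w, z])" using Union_cycle_edges[of "[s, x, w, z]"] by simp
  then have "cycle_edges [s, x, w, z] \<notin> sep4" using s(1) by blast
  then have "w \<in> nb s \<or> z \<in> nb x" using four_cycle_chord[of x s w z] n w ne f(3) by auto
  then have ws: "w \<in> nb s" using opposite_nonadjacent[OF f] by blast
  have "{s, x, w} \<in> T" "{s, w, z} \<in> T" by (rule triangle_face; use n ws w in auto)+
  then have "nb s \<subseteq> {f, x, w, z}" using four_faces_star[of s f x w z] f ne by auto
  then have "card (nb s) \<le> 4" using card_mono[of "{f, x, w, z}" "nb s"] card_length[of "[f, x, w, z]"] by simp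
  then show False using s(2) by simp
qed

text \<open>Let three such common neighbours exist. If \<open>y\<close> and \<open>z\<close> are
  adjacent, their edge lies in three faces. Otherwise each 4-cycle through \<open>y\<close>,
  \<open>z\<close> and two of the three has its chord between these two, and \<open>y\<close> gets
  degree 3.\<close>

lemma two_common_neighbours:
  assumes yz: "y \<noteq> z" and A: "A \<subseteq> nb y \<inter> nb z" "A \<inter> \<Union>(\<Union>sep4) = {}"
  shows "card A \<le> 2"
proof (rule ccontr)
  assume "\<not> ?thesis"
  then have "3 \<le> card A" by simp
  then obtain B where "B \<subseteq> A" "card B = 3" using obtain_subset_with_card_n[of 3 A] by metis
  then obtain a b c where abc: "{a, b, c} \<subseteq> A" "a \<noteq> b" "a \<noteq> c" "b \<noteq> c" using card_3_iff by metis
  have n: "y \<in> nb t" "z \<in> nb t" "t \<in> nb y" "t \<in> nb z" if "t \<in> A" for t using that A(1) nb_sym by auto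
  show False
  proof (cases "z \<in> nb y")
    case True
    have "{y, z, t} \<in> T" if "t \<in> A" for t using triangle_face[of z y t] True n[OF that] by simp
    then have "{y, z, a} \<in> T" "{y, z, b} \<in> T" "{y, z, c} \<in> T" using abc by auto
    then show False using third_vertex[of y z a b c] abc by auto
  next
    case False
    have adj: "t' \<in> nb t" if "t \<in> A" "t' \<in> A" "t \<noteq> t'" for t t'
    proof -
      have "t \<in> \<Union>(cycle_edges [t, y, t', z])" using Union_cycle_edges[of "[t, y, t', z]"] by simp
      then have "cycle_edges [t, y, t', z] \<notin> sep4" using that A(2) by blast
      then show ?thesis using four_cycle_chord[of y t t' z] n[OF that(1)] n[OF that(2)] that False yz by auto
    qed
    have "{y, t, t'} \<in> T" if "t \<in> A" "t' \<in> A" "t \<noteq> t'" for t t'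
      using triangle_face[of t y t'] adj[OF that] n[OF that(1)] n[OF that(2)] by simp
    then have "nb y \<subseteq> {a, b, c}" using three_faces_star[of y a b c] abc by auto
    then have "card (nb y) \<le> 3" using card_mono[of "{a, b, c}" "nb y"] card_length[of "[a, b, c]"] by simp
    moreover have "y \<in> \<Union>T" using n(1)[of a] abc nb_subset[of a] by auto
    ultimately show False using degree_ge_4[of y] by simp
  qed
qed

end

section \<open>Many candidates with few conflicts\<close>

lemma card_UN_bound:
  assumes "finite I" "card I \<le> m" "\<And>i. i \<in> I \<Longrightarrow> card (A i) \<le> k"
  shows "card (\<Union>i\<in>I. A i) \<le> m * k"
proof -
  have "card (\<Union>i\<in>I. A i) \<le> (\<Sum>i\<in>I. card (A i))" by (rule card_UN_le[OF assms(1)])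
  also have "\<dots> \<le> (\<Sum>i\<in>I. k)" by (rule sum_mono) (rule assms(3))
  also have "\<dots> \<le> m * k" using assms(2) by simp
  finally show ?thesis .
qed

text \<open>A largest conflict-free set \<open>S\<close> is dominating: every element of
  \<open>A\<close> lies in \<open>S\<close> or is in conflict with an element of
  \<open>S\<close>.\<close>

lemma large_independent_set:
  assumes "finite A" and sym: "\<And>s t. R s t \<Longrightarrow> R t s" and d: "\<And>s. s \<in> A \<Longrightarrow> card {t \<in> A. R s t} \<le> d"
  obtains S where "S \<subseteq> A" "pairwise (\<lambda>s t. \<not> R s t) S" "card A \<le> card S * (d + 1)"
proof -
  define P where "P S \<longleftrightarrow> S \<subseteq> A \<and> pairwise (\<lambda>s t. \<not> R s t) S" for S
  have "P {}" by (simp add: P_def)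
  moreover have "card S < Suc (card A)" if "P S" for S
    using that card_mono[OF assms(1)] by (simp add: P_def le_imp_less_Suc)
  ultimately obtain S where S: "P S" and max: "\<And>S'. P S' \<Longrightarrow> card S' \<le> card S"
    using ex_has_greatest_nat[of P "{}" card "Suc (card A)"] by blast
  have SA: "S \<subseteq> A" and fS: "finite S" using S finite_subset[OF _ assms(1)] by (auto simp: P_def)
  have "A \<subseteq> (\<Union>s\<in>S. insert s {t \<in> A. R s t})"
  proof (rule subsetI, rule ccontr)
    fix a assume a: "a \<in> A" "a \<notin> (\<Union>s\<in>S. insert s {t \<in> A. R s t})"
    then have "a \<notin> S" "\<And>s. s \<in> S \<Longrightarrow> \<not> R s a \<and> \<not> R a s" using sym by blast+
    then have "P (insert a S)" using S a(1) by (auto simp: P_def pairwise_insert)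
    then show False using max[of "insert a S"] \<open>a \<notin> S\<close> fS by simp
  qed
  then have "card A \<le> card (\<Union>s\<in>S. insert s {t \<in> A. R s t})"
    by (rule card_mono[rotated]) (use fS assms(1) in auto)
  also have "\<dots> \<le> card S * (d + 1)"
  proof (rule card_UN_bound[OF fS order_refl])
    fix s assume "s \<in> S"
    then have "card {t \<in> A. R s t} \<le> d" using d SA by blast
    then show "card (insert s {t \<in> A. R s t}) \<le> d + 1" using card_insert_le_m1[of "d + 1" "{t \<in> A. R s t}" s] by simp
  qed
  finally show thesis using that S unfolding P_def by blast
qed

context tri_sphere
begin

lemma finite_vertices [simp, intro]: "finite (\<Union>T)"
  by (rule finite_Union[OF subset_refl])

lemma card_third_vertices:
  assumes "w \<in> nb v" shows "card {x. {v, w, x} \<in> T} \<le> 2"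
proof -
  obtain x z where xz: "{v, w, x} \<in> T" "{v, w, z} \<in> T" "x \<noteq> z" using edge_two_thirds[OF assms] .
  have "{y. {v, w, y} \<in> T} \<subseteq> {x, z}" using third_vertex[OF xz] by blast
  then have "card {y. {v, w, y} \<in> T} \<le> card {x, z}" by (rule card_mono[rotated]) simp
  then show ?thesis using xz(3) by simp
qed

lemma sum_degrees: "(\<Sum>v\<in>\<Union>T. card (nb v)) = 2 * card (edges_of T)"
proof -
  have "card (nb v) = card {e \<in> edges_of T. v \<in> e}" for v
  proof (rule bij_betw_same_card[of "\<lambda>w. {v, w}"])
    show "bij_betw (\<lambda>w. {v, w}) (nb v) {e \<in> edges_of T. v \<in> e}"
    proof (rule bij_betw_imageI)
      show "inj_on (\<lambda>w. {v, w}) (nb v)" by (auto simp: inj_on_def doubleton_eq_iff)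
      show "(\<lambda>w. {v, w}) ` nb v = {e \<in> edges_of T. v \<in> e}"
      proof
        show "(\<lambda>w. {v, w}) ` nb v \<subseteq> {e \<in> edges_of T. v \<in> e}" by (auto simp: nb_def)
        show "{e \<in> edges_of T. v \<in> e} \<subseteq> (\<lambda>w. {v, w}) ` nb v"
        proof
          fix e assume e: "e \<in> {e \<in> edges_of T. v \<in> e}"
          then obtain w where "e = {v, w}" using edge_doubleton[of e T] by blast
          then show "e \<in> (\<lambda>w. {v, w}) ` nb v" using e by (simp add: nb_def)
        qed
      qed
    qed
  qed
  moreover have "(\<Sum>v\<in>\<Union>T. card {e \<in> edges_of T. v \<in> e}) = 2 * card (edges_of T)"
  proof (rule sum_multicount)
    show "\<forall>e\<in>edges_of T. card {v \<in> \<Union>T. v \<in> e} = 2"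
    proof
      fix e assume e: "e \<in> edges_of T"
      have "{v \<in> \<Union>T. v \<in> e} = e" using edge_subset_Union[OF e] by blast
      then show "card {v \<in> \<Union>T. v \<in> e} = 2" using e by (simp add: edges_of_def)
    qed
  qed simp_all
  ultimately show ?thesis by simp
qed

lemma sum_degrees_le: "(\<Sum>v\<in>\<Union>T. card (nb v)) \<le> 6 * card (\<Union>T)"
  using sum_degrees card_edges_le by simp

lemma finite_sep4 [simp, intro]: "finite sep4"
  by (rule finite_subset[of _ "Pow (edges_of T)"]) (auto simp: sep4_def)

lemma card_sep4_vertices: "card (\<Union>(\<Union>sep4)) \<le> 4 * card sep4"
proof -
  have "card (\<Union>C\<in>sep4. \<Union>C) \<le> card sep4 * 4"
  proof (rule card_UN_bound[OF finite_sep4 order_refl])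
    fix C assume "C \<in> sep4"
    then obtain a b c d where "C = cycle_edges [a, b, c, d]" unfolding sep4_def by blast
    then have "\<Union>C = set [a, b, c, d]" using Union_cycle_edges by metis
    then show "card (\<Union>C) \<le> 4" using card_length[of "[a, b, c, d]"] by simp
  qed
  moreover have "(\<Union>C\<in>sep4. \<Union>C) = \<Union>(\<Union>sep4)" by blast
  ultimately show ?thesis by simp
qed

definition high :: "nat \<Rightarrow> 'a set" where
  "high D = {v \<in> \<Union>T. D < card (nb v)}"

text \<open>Degree at least 5 makes flips safe, see \<open>common_neighbour_of_opposites\<close>;
  degree at most 12 bounds both the conflicts and the share of choices that a cycle avoids. With at
  most one high neighbour, a vertex cannot share both ends of its new edge with another chosen
  one.\<close>

definition candidates :: "nat \<Rightarrow> 'a set" where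
  "candidates D = {s \<in> \<Union>T. 5 \<le> card (nb s) \<and> card (nb s) \<le> 12 \<and> s \<notin> \<Union>(\<Union>sep4) \<and> card (nb s \<inter> high D) \<le> 1}"

text \<open>If no two vertices of \<open>S\<close> are in conflict, then new edges at distinct vertices of \<open>S\<close> can only share a vertex
  of high degree, and two of them never lie in a triangle with an old edge.\<close>

definition conflict :: "nat \<Rightarrow> 'a \<Rightarrow> 'a \<Rightarrow> bool" where
  "conflict D s t \<longleftrightarrow> t \<in> nb s \<or> (\<exists>y\<in>nb s \<inter> nb t. y \<notin> high D) \<or>
     (\<exists>y\<in>nb s \<inter> nb t \<inter> high D. \<exists>x\<in>nb s - {y}. \<exists>z\<in>nb t - {y}. z \<in> nb x)"

lemma finite_vertices_where [simp, intro]: "finite {v \<in> \<Union>T. P v}"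
  by (rule finite_subset[OF _ finite_vertices]) blast

lemma finite_high [simp, intro]: "finite (high D)"
  unfolding high_def by (rule finite_vertices_where)

lemma finite_candidates [simp, intro]: "finite (candidates D)"
  unfolding candidates_def by (rule finite_vertices_where)

lemma card_high: "card (high D) * D \<le> 6 * card (\<Union>T)"
proof -
  have "card (high D) * D = (\<Sum>v\<in>high D. D)" by simp
  also have "\<dots> \<le> (\<Sum>v\<in>high D. card (nb v))" by (rule sum_mono) (simp add: high_def)
  also have "\<dots> \<le> (\<Sum>v\<in>\<Union>T. card (nb v))" by (rule sum_mono2) (auto simp: high_def)
  finally show ?thesis using sum_degrees_le by simp
qed

lemma conflict_sym: "conflict D s t \<Longrightarrow> conflict D t s"
  unfolding conflict_def using nb_sym by blast

end

context four_connected_sphere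
begin

text \<open>The link of a vertex of degree 4 is a 4-cycle, and it separates that vertex from any
  sixth vertex.\<close>

lemma degree_4_cycle:
  assumes v: "card (nb v) = 4" and n: "5 < card (\<Union>T)"
  obtains C where "C \<in> sep4" "\<And>e. e \<in> C \<Longrightarrow> insert v e \<in> T"
proof -
  have "nb v \<noteq> {}" using v by auto
  then obtain a where a: "a \<in> nb v" by blast
  obtain b d where bd: "{v, a, b} \<in> T" "{v, a, d} \<in> T" "b \<noteq> d" using edge_two_thirds[OF a] .
  have n3: "\<not> nb v \<subseteq> {x, y, z}" for x y z
  proof
    assume "nb v \<subseteq> {x, y, z}"
    then have "card (nb v) \<le> card {x, y, z}" by (rule card_mono[rotated]) simp
    then show False using v card_length[of "[x, y, z]"] by simp
  qed
  have bn: "b \<in> nb v" "d \<in> nb v" using bd nb_face by blast+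
  have other: "\<exists>x. {v, w, x} \<in> T \<and> x \<noteq> a" if "w \<in> nb v" for w
    using edge_two_thirds[OF that] by metis
  obtain c where c: "{v, b, c} \<in> T" "c \<noteq> a" using other[OF bn(1)] by blast
  obtain c' where c': "{v, d, c'} \<in> T" "c' \<noteq> a" using other[OF bn(2)] by blast
  have cn: "c \<in> nb v" "c' \<in> nb v" using c c' nb_face by blast+
  have cd: "c \<noteq> d"
  proof
    assume "c = d"
    then show False using three_faces_star[of v a b d] bd c n3 by blast
  qed
  have cb: "c' \<noteq> b"
  proof
    assume "c' = b"
    then have "{v, b, d} \<in> T" using c' by (simp add: insert_commute)
    then show False using three_faces_star[of v a b d] bd n3 by blast
  qed
  have ds: "a \<noteq> b" "a \<noteq> d" "c \<noteq> b" "c' \<noteq> d" using face_distinct bd c c' by auto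
  have "card {a, b, c, d} = 4" using ds bd(3) c(2) cd by simp
  moreover have "{a, b, c, d} \<subseteq> nb v" using a bn cn by blast
  ultimately have eq: "nb v = {a, b, c, d}" using v card_subset_eq[of "nb v" "{a, b, c, d}"] by auto
  then have "c' = c" using cn(2) c'(2) cb ds(4) by blast
  then have c'': "{v, d, c} \<in> T" using c' by simp
  define C where "C = cycle_edges [a, b, c, d]"
  have C: "C = {{a, b}, {b, c}, {c, d}, {d, a}}" by (auto simp: C_def cycle_edges_def)
  have f: "insert v e \<in> T" if "e \<in> C" for e using that bd c(1) c'' unfolding C by (auto simp: insert_commute)
  have "C \<subseteq> edges_of T" using bd c(1) c'' edges_face unfolding C by (auto simp: insert_commute)
  moreover have "\<not> conn_off {a, b, c, d}"
  proof
    assume co: "conn_off {a, b, c, d}"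
    have "{v} \<subseteq> \<Union>T - {a, b, c, d}" using bd(1) not_in_nb[of v] eq by auto
    then have "{v} = \<Union>T - {a, b, c, d}" using co eq unfolding conn_off_def by blast
    then have "\<Union>T \<subseteq> {v, a, b, c, d}" by blast
    then have "card (\<Union>T) \<le> card {v, a, b, c, d}" by (rule card_mono[rotated]) simp
    then show False using n card_length[of "[v, a, b, c, d]"] by simp
  qed
  ultimately have "C \<in> sep4" using ds bd(3) c(2) cd unfolding sep4_def C_def by fastforce
  then show thesis using that f by blast
qed

text \<open>Each separating 4-cycle is the link of at most two vertices, because each of them spans
  a face with a fixed edge of the cycle.\<close>

lemma card_degree_4:
  assumes n: "5 < card (\<Union>T)"
  shows "card {v \<in> \<Union>T. card (nb v) = 4} \<le> 2 * card sep4"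
proof -
  have "{v \<in> \<Union>T. card (nb v) = 4} \<subseteq> (\<Union>C\<in>sep4. {v \<in> \<Union>T. \<forall>e\<in>C. insert v e \<in> T})"
  proof
    fix v assume "v \<in> {v \<in> \<Union>T. card (nb v) = 4}"
    then have v: "v \<in> \<Union>T" "card (nb v) = 4" by blast+
    obtain C where "C \<in> sep4" "\<And>e. e \<in> C \<Longrightarrow> insert v e \<in> T" using degree_4_cycle[OF v(2) n] by metis
    then show "v \<in> (\<Union>C\<in>sep4. {v \<in> \<Union>T. \<forall>e\<in>C. insert v e \<in> T})" using v(1) by blast
  qed
  then have "card {v \<in> \<Union>T. card (nb v) = 4} \<le> card (\<Union>C\<in>sep4. {v \<in> \<Union>T. \<forall>e\<in>C. insert v e \<in> T})"
    by (rule card_mono[rotated]) (intro finite_UN_I finite_sep4 finite_vertices_where)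
  also have "\<dots> \<le> card sep4 * 2"
  proof (rule card_UN_bound[OF finite_sep4 order_refl])
    fix C assume "C \<in> sep4"
    then obtain a b c d where C: "C = cycle_edges [a, b, c, d]" "C \<subseteq> edges_of T" unfolding sep4_def by blast
    then have ab: "{a, b} \<in> C" "b \<in> nb a" by (auto simp: cycle_edges_def nb_def)
    have fin: "finite {x. {a, b, x} \<in> T}" by (rule finite_subset[of _ "\<Union>T"]) auto
    have "{v \<in> \<Union>T. \<forall>e\<in>C. insert v e \<in> T} \<subseteq> {x. {a, b, x} \<in> T}" using ab(1) by (auto simp: insert_commute)
    from card_mono[OF fin this] show "card {v \<in> \<Union>T. \<forall>e\<in>C. insert v e \<in> T} \<le> 2" using card_third_vertices[OF ab(2)] by simp
  qed
  finally show ?thesis by simp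
qed

text \<open>Every vertex contributes at least 4 to the degree sum, those of degree at least 13
  another 9, and the sum is at most \<open>6 n\<close>.\<close>

lemma card_degree_13: "9 * card {v \<in> \<Union>T. 13 \<le> card (nb v)} \<le> 2 * card (\<Union>T)"
proof -
  have "4 * card (\<Union>T) + 9 * card {v \<in> \<Union>T. 13 \<le> card (nb v)} = (\<Sum>v\<in>\<Union>T. 4 + 9 * of_bool (13 \<le> card (nb v)))"
    by (simp add: sum.distrib sum_distrib_left[symmetric] Int_def)
  also have "\<dots> \<le> (\<Sum>v\<in>\<Union>T. card (nb v))" by (rule sum_mono) (use degree_ge_4 in auto)
  also have "\<dots> \<le> 6 * card (\<Union>T)" by (rule sum_degrees_le)
  finally show ?thesis by simp
qed

lemma card_two_high:
  "card {s \<in> \<Union>T. s \<notin> \<Union>(\<Union>sep4) \<and> 2 \<le> card (nb s \<inter> high D)} \<le> card (high D) * card (high D) * 2"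
proof -
  define I where "I = {(y, z). y \<in> high D \<and> z \<in> high D \<and> y \<noteq> z}"
  define A where "A = (\<lambda>(y, z). {s \<in> \<Union>T. s \<notin> \<Union>(\<Union>sep4) \<and> s \<in> nb y \<inter> nb z})"
  have I: "I \<subseteq> high D \<times> high D" by (auto simp: I_def)
  have cI: "card I \<le> card (high D) * card (high D)" using card_mono[OF _ I] by (simp add: card_cartesian_product)
  have fI: "finite I" using finite_subset[OF I] by simp
  have "{s \<in> \<Union>T. s \<notin> \<Union>(\<Union>sep4) \<and> 2 \<le> card (nb s \<inter> high D)} \<subseteq> (\<Union>i\<in>I. A i)"
  proof
    fix s assume s: "s \<in> {s \<in> \<Union>T. s \<notin> \<Union>(\<Union>sep4) \<and> 2 \<le> card (nb s \<inter> high D)}"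
    then have "2 \<le> card (nb s \<inter> high D)" by simp
    then obtain B where "B \<subseteq> nb s \<inter> high D" "card B = 2" using obtain_subset_with_card_n by metis
    then obtain y z where yz: "{y, z} \<subseteq> nb s \<inter> high D" "y \<noteq> z" by (metis card_2_iff)
    then have "(y, z) \<in> I" "s \<in> nb y" "s \<in> nb z" using nb_sym by (auto simp: I_def)
    then show "s \<in> (\<Union>i\<in>I. A i)" using s unfolding A_def by blast
  qed
  then have "card {s \<in> \<Union>T. s \<notin> \<Union>(\<Union>sep4) \<and> 2 \<le> card (nb s \<inter> high D)} \<le> card (\<Union>i\<in>I. A i)"
    by (rule card_mono[rotated]) (auto simp: fI A_def)
  also have "\<dots> \<le> card (high D) * card (high D) * 2"
  proof (rule card_UN_bound[OF fI cI])
    fix i assume "i \<in> I"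
    then obtain y z where "i = (y, z)" "y \<noteq> z" by (auto simp: I_def)
    then show "card (A i) \<le> 2" using two_common_neighbours[of y z "A i"] by (auto simp: A_def)
  qed
  finally show ?thesis .
qed

text \<open>Discarded vertices have degree 4, have degree at least 13, lie on a separating 4-cycle,
  or have two high neighbours. The factor 9 clears the fraction in
  \<open>card_degree_13\<close>.\<close>

lemma card_candidates:
  assumes "5 < card (\<Union>T)"
  shows "7 * card (\<Union>T) \<le> 9 * card (candidates D) + 54 * card sep4 + 18 * (card (high D) * card (high D))"
proof -
  define A4 A13 A2 where "A4 = {v \<in> \<Union>T. card (nb v) = 4}" and "A13 = {v \<in> \<Union>T. 13 \<le> card (nb v)}"
    and "A2 = {s \<in> \<Union>T. s \<notin> \<Union>(\<Union>sep4) \<and> 2 \<le> card (nb s \<inter> high D)}"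
  have "\<Union>T \<subseteq> candidates D \<union> A4 \<union> A13 \<union> \<Union>(\<Union>sep4) \<union> A2"
  proof
    fix v assume v: "v \<in> \<Union>T"
    then have "4 \<le> card (nb v)" by (rule degree_ge_4)
    then have "card (nb v) = 4 \<or> 13 \<le> card (nb v) \<or> 5 \<le> card (nb v) \<and> card (nb v) \<le> 12" by linarith
    moreover have "card (nb v \<inter> high D) \<le> 1 \<or> 2 \<le> card (nb v \<inter> high D)" by linarith
    ultimately show "v \<in> candidates D \<union> A4 \<union> A13 \<union> \<Union>(\<Union>sep4) \<union> A2"
      using v unfolding candidates_def A4_def A13_def A2_def by blast
  qed
  moreover have "finite (\<Union>(\<Union>sep4))"
  proof (rule finite_subset)
    show "\<Union>(\<Union>sep4) \<subseteq> \<Union>T" using edge_subset_Union unfolding sep4_def by blast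
  qed simp
  moreover have "finite (candidates D)" "finite A4" "finite A13" "finite A2" unfolding A4_def A13_def A2_def by (rule finite_candidates finite_vertices_where)+
  ultimately have "card (\<Union>T) \<le> card (candidates D \<union> A4 \<union> A13 \<union> \<Union>(\<Union>sep4) \<union> A2)" by (intro card_mono) auto
  also have "\<dots> \<le> card (candidates D) + card A4 + card A13 + card (\<Union>(\<Union>sep4)) + card A2"
    by (meson card_Un_le add_le_mono1 order_trans)
  finally show ?thesis
    using card_degree_4[OF assms] card_degree_13 card_sep4_vertices card_two_high[of D]
    unfolding A4_def A13_def A2_def by linarith
qed

text \<open>There are at most 12 neighbours and \<open>12 D\<close> vertices with a common low
  neighbour. The third kind of conflict adds \<open>24 D\<close>: at most 12 choices of
  \<open>x\<close>, \<open>D\<close> of \<open>z\<close>, one of the high \<open>y\<close>, and two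
  common neighbours \<open>t\<close> of \<open>y\<close> and \<open>z\<close>. Both \<open>x\<close>
  and \<open>z\<close> are low, as \<open>y\<close> already is the only high neighbour of
  \<open>s\<close> and of \<open>t\<close>.\<close>

lemma card_conflicts:
  assumes s: "s \<in> candidates D"
  shows "card {t \<in> candidates D. conflict D s t} \<le> 12 + 36 * D"
proof -
  have d12: "card (nb s) \<le> 12" and h1: "card (nb s \<inter> high D) \<le> 1" using s by (auto simp: candidates_def)
  have low: "card (nb x) \<le> D" if "x \<in> nb y - high D" for x y
    using that nb_subset[of y] by (auto simp: high_def)
  have le: "card (nb s - high D) \<le> 12" using card_mono[of "nb s" "nb s - high D"] d12 by simp
  define A where "A = (\<Union>y\<in>nb s - high D. nb y)"
  define B where "B = (\<Union>x\<in>nb s - high D. \<Union>z\<in>nb x - high D. \<Union>y\<in>nb s \<inter> high D. candidates D \<inter> nb z \<inter> nb y)"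
  have cA: "card A \<le> 12 * D" unfolding A_def by (rule card_UN_bound[OF _ le]) (auto intro: low)
  have cB: "card B \<le> 12 * (D * (1 * 2))" unfolding B_def
  proof (intro card_UN_bound)
    fix x assume "x \<in> nb s - high D"
    then show "card (nb x - high D) \<le> D" using low[of x s] card_mono[of "nb x" "nb x - high D"] by simp
  next
    fix x z y assume "z \<in> nb x - high D" "y \<in> nb s \<inter> high D"
    then show "card (candidates D \<inter> nb z \<inter> nb y) \<le> 2"
      by (intro two_common_neighbours[of z y]) (auto simp: candidates_def)
  qed (use le h1 in auto)
  have "{t \<in> candidates D. conflict D s t} \<subseteq> nb s \<union> A \<union> B"
  proof
    fix t assume "t \<in> {t \<in> candidates D. conflict D s t}"
    then have t: "t \<in> candidates D" "conflict D s t" by auto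
    consider "t \<in> nb s" | y where "y \<in> nb s \<inter> nb t" "y \<notin> high D"
      | y x z where "y \<in> nb s \<inter> nb t \<inter> high D" "x \<in> nb s - {y}" "z \<in> nb t - {y}" "z \<in> nb x"
      using t(2) unfolding conflict_def by blast
    then show "t \<in> nb s \<union> A \<union> B"
    proof cases
      case (2 y)
      then show ?thesis using nb_sym by (auto simp: A_def)
    next
      case (3 y x z)
      have u: "w \<notin> high D" if c: "card (nb r \<inter> high D) \<le> 1" and w: "w \<in> nb r - {y}" "y \<in> nb r" for r w
      proof
        assume "w \<in> high D"
        then have "{w, y} \<subseteq> nb r \<inter> high D" using w 3 by blast
        then have "card {w, y} \<le> card (nb r \<inter> high D)" by (rule card_mono[rotated]) simp
        then show False using c w by simp
      qed
      have "x \<notin> high D" using u[OF h1 3(2)] 3(1) by blast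
      moreover have "z \<notin> high D" using u[OF _ 3(3)] t(1) 3(1) by (auto simp: candidates_def)
      moreover have "t \<in> nb z" "t \<in> nb y" using 3 nb_sym by auto
      ultimately have "t \<in> B" unfolding B_def using 3 t(1) by blast
      then show ?thesis by blast
    qed simp
  qed
  then have "card {t \<in> candidates D. conflict D s t} \<le> card (nb s \<union> A \<union> B)"
    by (rule card_mono[rotated]) (auto simp: A_def B_def)
  also have "\<dots> \<le> card (nb s) + card A + card B" by (meson card_Un_le add_le_mono1 order_trans)
  finally show ?thesis using d12 cA cB by simp
qed

lemma conflict_free_set:
  obtains S where "S \<subseteq> candidates D" "pairwise (\<lambda>s t. \<not> conflict D s t) S" "card (candidates D) \<le> card S * (13 + 36 * D)"
proof -
  obtain S where "S \<subseteq> candidates D" "pairwise (\<lambda>s t. \<not> conflict D s t) S" "card (candidates D) \<le> card S * (12 + 36 * D + 1)"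
    by (rule large_independent_set[OF finite_candidates conflict_sym card_conflicts]) assumption+
  then show thesis using that by simp
qed

end

section \<open>Hamiltonian cycles counted by the choices that they avoid\<close>

context tri_sphere
begin

definition hamiltonian_edge_sets :: "'a set set set" where
  "hamiltonian_edge_sets = {cycle_edges c | c. distinct c \<and> 3 \<le> length c \<and> set c = \<Union>T \<and> cycle_edges c \<subseteq> edges_of T}"

lemma finite_hamiltonian_edge_sets [simp, intro]: "finite hamiltonian_edge_sets"
  by (rule finite_subset[of _ "Pow (edges_of T)"]) (auto simp: hamiltonian_edge_sets_def)

text \<open>The degree of \<open>s\<close> in the cycle is even and not zero.\<close>

lemma card_nb_hamiltonian:
  assumes h: "h \<in> hamiltonian_edge_sets" and s: "s \<in> \<Union>T"
  shows "2 \<le> card {w \<in> nb s. {s, w} \<in> h}"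
proof -
  obtain c where c: "distinct c" "3 \<le> length c" "set c = \<Union>T" "cycle_edges c \<subseteq> edges_of T" and hc: "h = cycle_edges c"
    using h unfolding hamiltonian_edge_sets_def by blast
  have "even (degree_in h s)" using even_set_cycle[OF c(1,2)] hc by (simp add: even_set_def)
  moreover have "degree_in h s \<noteq> 0"
  proof -
    obtain e where "e \<in> h" "s \<in> e" using cycle_vertex_edge[of s c] s c(3) hc by blast
    then have "{e \<in> h. s \<in> e} \<noteq> {}" by blast
    moreover have "finite h" using hc by simp
    ultimately show ?thesis by (simp add: degree_in_def)
  qed
  ultimately have "2 \<le> degree_in h s" by presburger
  also have "degree_in h s = card ((\<lambda>w. {s, w}) ` {w \<in> nb s. {s, w} \<in> h})"
  proof -
    have "{e \<in> h. s \<in> e} = (\<lambda>w. {s, w}) ` {w \<in> nb s. {s, w} \<in> h}"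
    proof
      show "(\<lambda>w. {s, w}) ` {w \<in> nb s. {s, w} \<in> h} \<subseteq> {e \<in> h. s \<in> e}" by auto
      show "{e \<in> h. s \<in> e} \<subseteq> (\<lambda>w. {s, w}) ` {w \<in> nb s. {s, w} \<in> h}"
      proof
        fix e assume e: "e \<in> {e \<in> h. s \<in> e}"
        then have "e \<in> edges_of T" using c(4) hc by blast
        moreover from this obtain w where "e = {s, w}" using edge_doubleton[of e T] e by blast
        ultimately show "e \<in> (\<lambda>w. {s, w}) ` {w \<in> nb s. {s, w} \<in> h}" using e by (simp add: nb_def)
      qed
    qed
    then show ?thesis by (simp add: degree_in_def)
  qed
  also have "\<dots> = card {w \<in> nb s. {s, w} \<in> h}"
    by (rule card_image) (auto simp: inj_on_def doubleton_eq_iff)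
  finally show ?thesis .
qed

end

context four_connected_sphere
begin

lemma five_faces: "4 < card T"
proof -
  have "(\<Sum>f\<in>T. card {e \<in> edges_of T. e \<subseteq> f}) = 2 * card (edges_of T)"
  proof (rule sum_multicount)
    show "\<forall>e\<in>edges_of T. card {f \<in> T. e \<subseteq> f} = 2"
    proof
      fix e assume e: "e \<in> edges_of T"
      obtain f g where "f \<noteq> g" "{h \<in> T. e \<subseteq> h} = {f, g}" by (rule edge_faces[OF e])
      then show "card {f \<in> T. e \<subseteq> f} = 2" by simp
    qed
  qed simp_all
  moreover have "card {e \<in> edges_of T. e \<subseteq> f} \<le> 3" if f: "f \<in> T" for f
  proof -
    obtain a b c where abc: "f = {a, b, c}" using face_sets[OF f] .
    have "{e \<in> edges_of T. e \<subseteq> f} \<subseteq> set [{a, b}, {a, c}, {b, c}]"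
    proof
      fix e assume "e \<in> {e \<in> edges_of T. e \<subseteq> f}"
      then have "card e = 2" "e \<subseteq> {a, b, c}" using abc by (auto simp: edges_of_def)
      from doubletons_in_triple[OF this] show "e \<in> set [{a, b}, {a, c}, {b, c}]" by simp
    qed
    from card_mono[OF _ this] show ?thesis using card_length[of "[{a, b}, {a, c}, {b, c}]"] by simp
  qed
  ultimately have "2 * card (edges_of T) \<le> (\<Sum>f\<in>T. 3)" using sum_mono[of T "\<lambda>f. card {e \<in> edges_of T. e \<subseteq> f}" "\<lambda>_. 3"] by simp
  moreover have "(\<Sum>v\<in>\<Union>T. 4) \<le> (\<Sum>v\<in>\<Union>T. card (nb v))" by (rule sum_mono) (rule degree_ge_4)
  ultimately show ?thesis using sum_degrees many_vertices by simp
qed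

text \<open>Verifies \<open>avoidable_edges\<close> for an arbitrary choice of neighbours.
  Throughout, new edges at different vertices can only meet in a high vertex, and each chosen vertex
  has at most one of these.\<close>

lemma choice_avoided:
  assumes S: "S \<subseteq> candidates D" and free: "pairwise (\<lambda>s t. \<not> conflict D s t) S" and \<phi>: "\<And>s. s \<in> S \<Longrightarrow> \<phi> s \<in> nb s"
  obtains h where "h \<in> hamiltonian_edge_sets" "\<And>s. s \<in> S \<Longrightarrow> {s, \<phi> s} \<notin> h"
proof -
  have "\<exists>x z. {s, \<phi> s, x} \<in> T \<and> {s, \<phi> s, z} \<in> T \<and> x \<noteq> z" if "s \<in> S" for s
    using edge_two_thirds[OF \<phi>[OF that]] by metis
  then obtain p q where pq: "\<And>s. s \<in> S \<Longrightarrow> {s, \<phi> s, p s} \<in> T" "\<And>s. s \<in> S \<Longrightarrow> {s, \<phi> s, q s} \<in> T" "\<And>s. s \<in> S \<Longrightarrow> p s \<noteq> q s"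
    by metis
  have n: "p s \<in> nb s" "q s \<in> nb s" if "s \<in> S" for s
    using nb_face[OF pq(1)[OF that]] nb_face[OF pq(2)[OF that]] by auto
  have cand: "5 \<le> card (nb s)" "s \<notin> \<Union>(\<Union>sep4)" "card (nb s \<inter> high D) \<le> 1" if "s \<in> S" for s
    using S that by (auto simp: candidates_def)
  have nc: "\<not> conflict D s t" if "s \<in> S" "t \<in> S" "s \<noteq> t" for s t using free that by (auto simp: pairwise_def)
  have common: "y \<in> high D" if "s \<in> S" "t \<in> S" "s \<noteq> t" "y \<in> nb s" "y \<in> nb t" for s t y
    using nc[OF that(1-3)] that(4,5) unfolding conflict_def by blast
  have one: "x = y" if "s \<in> S" "x \<in> nb s" "x \<in> high D" "y \<in> nb s" "y \<in> high D" for s x y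
  proof (rule ccontr)
    assume "x \<noteq> y"
    have "{x, y} \<subseteq> nb s \<inter> high D" using that by blast
    then have "card {x, y} \<le> card (nb s \<inter> high D)" by (rule card_mono[rotated]) simp
    then show False using cand(3)[OF that(1)] \<open>x \<noteq> y\<close> by simp
  qed
  have opp: "x \<in> nb s \<and> y \<in> nb s \<and> x \<noteq> y" if "s \<in> S" "{x, y} = {p s, q s}" for s x y
    using n[OF that(1)] pq(3)[OF that(1)] that(2) by (auto simp: doubleton_eq_iff)
  interpret avoidable_edges T S \<phi> p q
  proof
    fix s t assume st: "s \<in> S" "t \<in> S"
    show "{s, t} \<notin> edges_of T"
    proof (cases "s = t")
      case False
      then show ?thesis using nc[OF st] by (auto simp: conflict_def nb_def)
    qed (auto simp: edges_of_def)
  next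
    fix s assume s: "s \<in> S"
    show "{p s, q s} \<notin> edges_of T"
      using opposite_nonadjacent[OF pq(1,2,3)[OF s]] by (simp add: nb_def)
  next
    fix s t assume st: "s \<in> S" "t \<in> S" "{p s, q s} = {p t, q t}"
    show "s = t"
    proof (rule ccontr)
      assume ne: "s \<noteq> t"
      have "p s \<in> nb t" "q s \<in> nb t" using opp[OF st(2,3)] by auto
      then have "p s \<in> high D" "q s \<in> high D" using common[OF st(1,2) ne] n[OF st(1)] by auto
      then show False using one[OF st(1)] n[OF st(1)] pq(3)[OF st(1)] by blast
    qed
  next
    fix a b c assume "{a, b} \<in> edges_of T" "{b, c} \<in> edges_of T" "{a, c} \<in> edges_of T"
    then show "{a, b, c} \<in> T" by (intro triangle_face) (auto simp: nb_def)
  next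
    fix s c assume s: "s \<in> S" and c: "{c, p s} \<in> edges_of T" "{c, q s} \<in> edges_of T"
    show "c = s \<or> c = \<phi> s"
      by (rule common_neighbour_of_opposites[OF pq(1,2,3)[OF s] cand(2,1)[OF s]]) (use c in \<open>simp_all add: nb_def\<close>)
  next
    fix s t a b c assume st: "s \<in> S" "t \<in> S" "s \<noteq> t" and e: "{a, b} = {p s, q s}" "{b, c} = {p t, q t}"
    have b: "b \<in> nb s" "b \<in> nb t" "a \<in> nb s - {b}" "c \<in> nb t - {b}" using opp[OF st(1) e(1)] opp[OF st(2) e(2)] by auto
    \<comment> \<open>Adjacency of \<open>a\<close> and \<open>c\<close> would now be a conflict of
      the third kind. A new edge between them would make \<open>a\<close> a second high neighbour of
      \<open>s\<close>.\<close>
    then have "b \<in> high D" using common[OF st] by blast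
    then show "{a, c} \<notin> edges_of T" using nc[OF st] b unfolding conflict_def nb_edge by blast
    fix r assume r: "r \<in> S"
    show "{a, c} \<noteq> {p r, q r}"
    proof
      assume ac: "{a, c} = {p r, q r}"
      have ar: "a \<in> nb r" using opp[OF r ac] by blast
      show False
      proof (cases "r = s")
        case True
        then have "{a, c} = {a, b}" using ac e(1) by simp
        then show False using b(3,4) by (auto simp: doubleton_eq_iff)
      next
        case False
        then have "a \<in> high D" using common[OF r st(1) False ar] b(3) by blast
        then show False using one[OF st(1)] b \<open>b \<in> high D\<close> by blast
      qed
    qed
  qed (use pq in auto)
  have fS: "finite S" by (rule finite_subset[OF S finite_candidates])
  obtain c where c: "distinct c" "3 \<le> length c" "set c = \<Union>T" "cycle_edges c \<subseteq> edges_of T" "\<And>s. s \<in> S \<Longrightarrow> {s, \<phi> s} \<notin> cycle_edges c"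
    using avoiding_hamilton_cycle[OF fS five_faces] by metis
  then have "cycle_edges c \<in> hamiltonian_edge_sets" unfolding hamiltonian_edge_sets_def by blast
  then show thesis using that c(5) by blast
qed

lemma card_hamiltonian_exponential:
  assumes S: "S \<subseteq> candidates D" and free: "pairwise (\<lambda>s t. \<not> conflict D s t) S"
  shows "(6 / 5 :: real) ^ card S \<le> card hamiltonian_edge_sets"
proof -
  have fS: "finite S" by (rule finite_subset[OF S finite_candidates])
  define H where "H = hamiltonian_edge_sets"
  define W where "W h s = {w \<in> nb s. {s, w} \<notin> h}" for h s
  have fW: "finite (W h s)" for h s by (simp add: W_def)
  \<comment> \<open>A cycle uses two of at most 12 edges at \<open>s\<close>, and
    \<open>(d - 2) / d <= 5 / 6\<close> for \<open>d <= 12\<close>.\<close>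
  have cW: "real (card (W h s)) \<le> 5 / 6 * card (nb s)" if h: "h \<in> H" and s: "s \<in> S" for h s
  proof -
    have s': "s \<in> \<Union>T" "card (nb s) \<le> 12" using S s by (auto simp: candidates_def)
    have "W h s = nb s - {w \<in> nb s. {s, w} \<in> h}" by (auto simp: W_def)
    then have "card (W h s) = card (nb s) - card {w \<in> nb s. {s, w} \<in> h}" by (simp add: card_Diff_subset)
    moreover have "card {w \<in> nb s. {s, w} \<in> h} \<le> card (nb s)" by (rule card_mono) auto
    ultimately show ?thesis using card_nb_hamiltonian[of h s] h s' by (simp add: H_def)
  qed
  have "PiE S nb \<subseteq> (\<Union>h\<in>H. PiE S (W h))"
  proof
    fix \<phi> assume \<phi>: "\<phi> \<in> PiE S nb"
    obtain h where "h \<in> H" "\<And>s. s \<in> S \<Longrightarrow> {s, \<phi> s} \<notin> h"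
      using choice_avoided[OF S free, of \<phi>] \<phi> unfolding H_def by blast
    then show "\<phi> \<in> (\<Union>h\<in>H. PiE S (W h))" using \<phi> by (auto simp: W_def PiE_iff)
  qed
  then have "card (PiE S nb) \<le> card (\<Union>h\<in>H. PiE S (W h))"
    by (rule card_mono[rotated]) (auto simp: H_def intro!: finite_PiE fS fW)
  also have "\<dots> \<le> (\<Sum>h\<in>H. card (PiE S (W h)))" by (rule card_UN_le) (simp add: H_def)
  finally have "real (card (PiE S nb)) \<le> real (\<Sum>h\<in>H. card (PiE S (W h)))" by (simp only: of_nat_le_iff)
  also have "\<dots> = (\<Sum>h\<in>H. \<Prod>s\<in>S. real (card (W h s)))" by (simp add: card_PiE[OF fS])
  also have "\<dots> \<le> (\<Sum>h\<in>H. \<Prod>s\<in>S. 5 / 6 * real (card (nb s)))" by (intro sum_mono prod_mono) (use cW in auto)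
  also have "\<dots> = card H * ((5 / 6) ^ card S * (\<Prod>s\<in>S. real (card (nb s))))" by (simp only: prod.distrib prod_constant sum_constant)
  finally have "1 * (\<Prod>s\<in>S. real (card (nb s))) \<le> (card H * (5 / 6) ^ card S) * (\<Prod>s\<in>S. real (card (nb s)))"
    by (simp add: card_PiE[OF fS] mult.assoc)
  moreover have "0 < (\<Prod>s\<in>S. real (card (nb s)))"
  proof (rule prod_pos)
    fix s assume "s \<in> S"
    then have "5 \<le> card (nb s)" using S by (auto simp: candidates_def)
    then show "0 < real (card (nb s))" by linarith
  qed
  ultimately have "1 \<le> card H * (5 / 6 :: real) ^ card S" by (simp only: mult_le_cancel_right_pos)
  then have "1 * (6 / 5 :: real) ^ card S \<le> (card H * (5 / 6 :: real) ^ card S) * (6 / 5) ^ card S"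
    by (rule mult_right_mono) simp
  also have "\<dots> = card H" by (simp add: mult.assoc power_mult_distrib[symmetric])
  finally show ?thesis by (simp add: H_def)
qed

lemma card_hamiltonian_quadratic:
  assumes \<beta>: "0 < \<beta>" "\<beta> \<le> 1 / 25" and pow: "\<And>k :: nat. \<beta> * (2978 * real k) ^ 4 \<le> (6 / 5) ^ k"
    and few: "40 * card sep4 \<le> card (\<Union>T)"
  shows "\<beta> * (real (card (\<Union>T)))\<^sup>2 \<le> card hamiltonian_edge_sets"
proof (cases "5 < card (\<Union>T)")
  case False
  then have n: "card (\<Union>T) = 5" using many_vertices by simp
  \<comment> \<open>With five vertices one Hamiltonian cycle is enough, as \<beta> \<le> 1/25; the
    empty set of chosen vertices supplies it.\<close>
  have "\<beta> * (real (card (\<Union>T)))\<^sup>2 \<le> 1" using \<beta> by (simp add: n)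
  also have "1 \<le> real (card hamiltonian_edge_sets)" using card_hamiltonian_exponential[of "{}" 0] by simp
  finally show ?thesis .
next
  case True
  define n where "n = card (\<Union>T)"
  define r where "r = sqrt (real n)"
  \<comment> \<open>The degree sum \<open>6 n\<close> allows at most
    \<open>6 n / (40 r) = 3/20 r\<close> high vertices, so at most \<open>2 * 9/400 n\<close>
    vertices off separating 4-cycles have two high neighbours.\<close>
  define D where "D = nat \<lceil>40 * r\<rceil>"
  define h where "h = card (high D)"
  have r: "1 \<le> r" "r * r = real n" using True by (simp_all add: r_def n_def)
  have D: "40 * r \<le> real D" "real D \<le> 40 * r + 1" using r(1) of_nat_ceiling[of "40 * r"] unfolding D_def by linarith+
  have "real h * (40 * r) \<le> real h * real D" using D(1) by (intro mult_left_mono) auto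
  also have "\<dots> \<le> 6 * real n" using card_high[of D] by (simp add: h_def n_def flip: of_nat_mult)
  also have "\<dots> = 6 * r * r" using r(2) by simp
  finally have "real h * 40 \<le> 6 * r" using r(1) by (simp add: mult.assoc[symmetric])
  then have h: "real h \<le> 3 / 20 * r" by simp
  have "real h * real h \<le> (3 / 20 * r) * (3 / 20 * r)" using h by (intro mult_mono) (use r(1) in auto)
  also have "\<dots> = 9 / 400 * n" using r(2) by simp
  finally have hh: "real h * real h \<le> 9 / 400 * n" .
  have "real (7 * n) \<le> real (9 * card (candidates D) + 54 * card sep4 + 18 * (h * h))"
    using card_candidates[OF True, of D] unfolding n_def h_def by (simp only: of_nat_le_iff)
  then have "7 * real n \<le> 9 * real (card (candidates D)) + 54 * real (card sep4) + 18 * (real h * real h)" by simp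
  \<comment> \<open>\<open>card_candidates\<close> leaves
    \<open>9 * card (candidates D) >= (7 - 54/40 - 18 * 9/400) n\<close>, and the factor on the
    right exceeds \<open>9/2\<close>.\<close>
  then have c: "real n \<le> 2 * real (card (candidates D))" using hh few by (simp add: n_def)
  obtain S where S: "S \<subseteq> candidates D" "pairwise (\<lambda>s t. \<not> conflict D s t) S" "card (candidates D) \<le> card S * (13 + 36 * D)"
    using conflict_free_set .
  define k where "k = card S"
  have "real (card (candidates D)) \<le> real (k * (13 + 36 * D))" using S(3) unfolding k_def by (simp only: of_nat_le_iff)
  then have "r * r \<le> 2 * (real k * (13 + 36 * real D))" using c r(2) by simp
  \<comment> \<open>\<open>13 + 36 D <= 49 + 1440 r <= 1489 r\<close>, because
    \<open>r >= 1\<close>; doubling gives the constant 2978.\<close>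
  also have "\<dots> \<le> 2 * (real k * (1489 * r))" using D(2) r(1) by (intro mult_left_mono) auto
  also have "\<dots> = 2978 * real k * r" by simp
  finally have "r \<le> 2978 * real k" using r(1) by simp
  then have "r ^ 4 \<le> (2978 * real k) ^ 4" using r(1) by (intro power_mono) auto
  moreover have "r ^ 4 = (real n)\<^sup>2" using r(2) by (simp add: power2_eq_square power4_eq_xxxx flip: r(2))
  ultimately have "\<beta> * (real n)\<^sup>2 \<le> \<beta> * (2978 * real k) ^ 4" using \<beta>(1) by simp
  also have "\<dots> \<le> (6 / 5) ^ k" by (rule pow)
  also have "\<dots> \<le> card hamiltonian_edge_sets" unfolding k_def by (rule card_hamiltonian_exponential[OF S(1,2)])
  finally show ?thesis by (simp add: n_def)
qed

end

text \<open>The exponent is 4 because \<open>n\<close> is at most the square of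
  \<open>2978 k\<close> and its own square is wanted. The base \<open>25/24\<close> is chosen such
  that its fourth power is at most \<open>6/5\<close>; the bound 1/25 serves the case of five
  vertices.\<close>

lemma fourth_power_le_exponential:
  obtains \<beta> :: real where "0 < \<beta>" "\<beta> \<le> 1 / 25" "\<And>k :: nat. \<beta> * (2978 * real k) ^ 4 \<le> (6 / 5) ^ k"
proof -
  have "(\<lambda>k. of_nat k * (24 / 25 :: real) ^ k) \<longlonglongrightarrow> 0" by (rule powser_times_n_limit_0) simp
  then have "Bseq (\<lambda>k. of_nat k * (24 / 25 :: real) ^ k)" by (rule convergent_imp_Bseq[OF convergentI])
  then obtain M where M: "0 < M" "\<And>k. norm (of_nat k * (24 / 25 :: real) ^ k) \<le> M" unfolding Bseq_def by blast
  define \<beta> where "\<beta> = min (1 / 25) (1 / (M * 2978) ^ 4)"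
  have "\<beta> * (2978 * real k) ^ 4 \<le> (6 / 5) ^ k" for k :: nat
  proof -
    have "real k = (real k * (24 / 25) ^ k) * (25 / 24) ^ k" by (simp add: mult.assoc flip: power_mult_distrib)
    also have "\<dots> \<le> M * (25 / 24) ^ k" using M(2)[of k] by (intro mult_right_mono) simp_all
    finally have "(2978 * real k) ^ 4 \<le> (2978 * (M * (25 / 24) ^ k)) ^ 4" by (intro power_mono mult_left_mono) simp_all
    also have "\<dots> = (M * 2978) ^ 4 * ((25 / 24) ^ 4) ^ k"
      by (simp only: power_mult_distrib mult_ac flip: power_mult)
    also have "\<dots> \<le> (M * 2978) ^ 4 * (6 / 5) ^ k" by (intro mult_left_mono power_mono) (simp_all add: power_divide)
    finally have k: "(2978 * real k) ^ 4 \<le> (M * 2978) ^ 4 * (6 / 5) ^ k" .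
    have "\<beta> * (2978 * real k) ^ 4 \<le> 1 / (M * 2978) ^ 4 * ((M * 2978) ^ 4 * (6 / 5) ^ k)"
      using k M(1) by (intro mult_mono) (auto simp: \<beta>_def)
    also have "\<dots> = (6 / 5) ^ k" using M(1) by simp
    finally show ?thesis .
  qed
  moreover have "0 < \<beta>" "\<beta> \<le> 1 / 25" using M(1) by (auto simp: \<beta>_def)
  ultimately show thesis using that by blast
qed

section \<open>From plane triangulations to triangulated spheres\<close>

context plane_triangulation
begin

abbreviation "G \<equiv> underlying_graph V E"

lemma conn_off_connected:
  assumes con: "Digraph_Component.connected (delete_vertices G A)"
  shows "conn_off A"
  unfolding conn_off_def
proof (intro allI impI)
  fix U assume U: "U \<subseteq> \<Union>tri - A" "U \<noteq> {}" and cl: "\<forall>x\<in>U. nb x \<subseteq> U \<union> A"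
  define M where "M = with_proj (mk_symmetric (delete_vertices G A))"
  have vM: "verts M = V - A"
    by (simp add: M_def mk_symmetric_def delete_vertices_def induce_subgraph_verts underlying_graph_def)
  have arc: "y \<in> nb x \<and> y \<notin> A" if "(x, y) \<in> arcs_ends M" for x y
  proof -
    have "arcs (delete_vertices G A) = {(u, v). {u, v} \<in> ends ` E \<and> u \<in> V - A \<and> v \<in> V - A}"
      by (auto simp: delete_vertices_def induce_subgraph_def parcs_underlying) (auto simp: underlying_graph_def)
    moreover have "tail (delete_vertices G A) = fst" "head (delete_vertices G A) = snd" by (simp_all add: delete_vertices_def)
    ultimately show ?thesis using that
      by (auto simp: M_def arcs_ends_conv mk_symmetric_def nb_def edges_tri insert_commute)
  qed
  obtain u where u: "u \<in> U" using U(2) by blast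
  have "v \<in> U" if v: "v \<in> \<Union>tri - A" for v
  proof -
    have uv: "u \<in> verts M" "v \<in> verts M" using u v U(1) unfolding vM Union_tri by auto
    have "(u, v) \<in> rtrancl_on (verts M) (arcs_ends M)"
      using con uv unfolding Digraph_Component.connected_def strongly_connected_def M_def reachable_def by blast
    then show ?thesis using u
    proof (induction rule: rtrancl_on.induct)
      case (rtrancl_on_into_rtrancl_on a x y)
      then show ?case using arc[of x y] cl by blast
    qed
  qed
  then show "U = \<Union>tri - A" using U(1) by blast
qed

lemma in_cycles_iff: "C \<in> cycles G \<longleftrightarrow> (\<exists>c. distinct c \<and> 3 \<le> length c \<and> cycle_edges c \<subseteq> ends ` E \<and> C = cycle_edges c)"
  by (rule cycles_iff[OF parcs_underlying]) (simp add: Union_ends underlying_graph_def)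

lemma finite_cycles: "finite (cycles G)"
  by (rule finite_subset[of _ "Pow (ends ` E)"]) (auto simp: in_cycles_iff)

lemma card_sep4_le: "card sep4 \<le> card {C \<in> k_cycles 4 G. separating G C}"
proof (rule card_mono)
  show "finite {C \<in> k_cycles 4 G. separating G C}"
    by (rule finite_subset[OF _ finite_cycles]) (auto simp: k_cycles_def)
  show "sep4 \<subseteq> {C \<in> k_cycles 4 G. separating G C}"
  proof
    fix C assume "C \<in> sep4"
    then obtain a b c d where d: "distinct [a, b, c, d]" and ce: "cycle_edges [a, b, c, d] \<subseteq> ends ` E"
      and C: "C = cycle_edges [a, b, c, d]" and n: "\<not> conn_off {a, b, c, d}"
      unfolding sep4_def edges_tri by blast
    have U: "\<Union>C = {a, b, c, d}" unfolding C Union_cycle_edges by simp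
    have "C \<in> cycles G" unfolding in_cycles_iff using d ce C by (intro exI[of _ "[a, b, c, d]"]) simp
    moreover have "card C = 4" using card_cycle_edges[OF d] C by simp
    \<comment> \<open>With no vertex left, \<open>conn_off\<close> would hold vacuously.\<close>
    moreover have "pverts G - \<Union>C \<noteq> {}"
    proof
      assume "pverts G - \<Union>C = {}"
      then have "\<Union>tri - {a, b, c, d} = {}" unfolding U Union_tri by (simp add: underlying_graph_def)
      then show False using n unfolding conn_off_def by blast
    qed
    moreover have "\<not> Digraph_Component.connected (delete_vertices G (\<Union>C))" using n conn_off_connected U by metis
    ultimately show "C \<in> {C \<in> k_cycles 4 G. separating G C}" by (simp add: k_cycles_def separating_def)
  qed
qed

lemma card_hamiltonian_edge_sets_le: "card hamiltonian_edge_sets \<le> card (hamiltonian_cycles G)"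
proof (rule card_mono)
  show "finite (hamiltonian_cycles G)"
    by (rule finite_subset[OF _ finite_cycles]) (auto simp: hamiltonian_cycles_def)
  show "hamiltonian_edge_sets \<subseteq> hamiltonian_cycles G"
  proof
    fix h assume "h \<in> hamiltonian_edge_sets"
    then obtain c where c: "distinct c" "3 \<le> length c" "set c = V" "cycle_edges c \<subseteq> ends ` E" "h = cycle_edges c"
      unfolding hamiltonian_edge_sets_def edges_tri Union_tri by blast
    then have "h \<in> cycles G" unfolding in_cycles_iff by blast
    moreover have "\<Union>h = pverts G" using c(3,5) by (simp add: Union_cycle_edges underlying_graph_def)
    ultimately show "h \<in> hamiltonian_cycles G" by (simp add: hamiltonian_cycles_def)
  qed
qed

lemma four_connected_sphere_tri:
  assumes "k_connected 4 G"
  shows "four_connected_sphere tri"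
proof
  show "4 < card (\<Union>tri)" using assms unfolding Union_tri by (simp add: k_connected_def underlying_graph_def)
  fix A assume "A \<subseteq> \<Union>tri" "card A \<le> 3"
  then have "Digraph_Component.connected (delete_vertices G A)"
    using assms unfolding Union_tri by (auto simp: k_connected_def underlying_graph_def)
  then show "conn_off A" by (rule conn_off_connected)
qed

end

theorem theorem1p2:
  shows "\<exists>\<alpha>>0. \<exists>\<beta>>0. \<forall>(V :: complex set) (E :: complex set set).
    let G = underlying_graph V E; n = card V in
      planar_triangulation V E \<longrightarrow> k_connected 4 G \<longrightarrow> n \<ge> 2 \<longrightarrow>
      real (card {C \<in> k_cycles 4 G. separating G C}) \<le> (\<alpha>::real) * real n / log 2 (real n) \<longrightarrow>
      real (card (hamiltonian_cycles G)) \<ge> (\<beta>::real) * (real n)\<^sup>2"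
proof -
  obtain \<beta> :: real where \<beta>: "0 < \<beta>" "\<beta> \<le> 1 / 25" "\<And>k :: nat. \<beta> * (2978 * real k) ^ 4 \<le> (6 / 5) ^ k"
    using fourth_power_le_exponential by blast
  have main: "\<beta> * (real (card V))\<^sup>2 \<le> real (card (hamiltonian_cycles (underlying_graph V E)))"
    if pt: "planar_triangulation V E" and k: "k_connected 4 (underlying_graph V E)" and n: "2 \<le> card V"
      and few: "real (card {C \<in> k_cycles 4 (underlying_graph V E). separating (underlying_graph V E) C}) \<le> 1 / 40 * real (card V) / log 2 (real (card V))"
    for V :: "complex set" and E :: "complex set set"
  proof -
    interpret plane_triangulation V E
    proof
      show "plane_graph V E" using pt by (simp add: planar_triangulation_def)
      show "4 \<le> card V" using k by (simp add: k_connected_def underlying_graph_def)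
      show "\<exists>C\<in>k_cycles 3 (underlying_graph V E). frontier F = drawn E C" if "F \<in> faces V E" for F
        using pt that unfolding planar_triangulation_def by blast
    qed
    interpret F: four_connected_sphere tri by (rule four_connected_sphere_tri[OF k])
    \<comment> \<open>With a logarithm of at least 1, the hypothesis gives at most
      \<open>n / 40\<close> separating 4-cycles, the bound used to count candidates.\<close>
    have "1 \<le> log 2 (real (card V))" using n by (simp add: le_log_iff)
    then have "1 / 40 * real (card V) / log 2 (real (card V)) \<le> 1 / 40 * real (card V) / 1"
      by (intro divide_left_mono) auto
    then have "40 * real (card sep4) \<le> real (card (\<Union>tri))" using few card_sep4_le unfolding Union_tri by linarith
    then have "40 * card sep4 \<le> card (\<Union>tri)" by linarith
    from F.card_hamiltonian_quadratic[OF \<beta> this] show ?thesis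
      using card_hamiltonian_edge_sets_le unfolding Union_tri by linarith
  qed
  show ?thesis
    unfolding Let_def
    by (intro exI[of _ "1 / 40"] conjI exI[of _ \<beta>] \<beta>(1) allI impI main) simp_all
qed

end
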